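(* Let $H$ be a graph, let $n\ge 1$, and let $k:=og(H)$. There exists an $n$-ary relation $R\neq\emptyset$ over $V_H$ with $\mathrm{pPol}(E_H)\subsetneq \mathrm{pPol}(R)$ such that $\textsc{Csp}(R)$ is NP-complete if and only if $k\le n$. Moreover, if $k>n$, then every $n$-ary relation $R\neq\emptyset$ over $V_H$ with $\mathrm{pPol}(E_H)\subsetneq \mathrm{pPol}(R)$ is such that $\textsc{Csp}(R)$ is trivial.
   Context: Graphs are finite, simple, undirected, loopless; $E_H$ is the (symmetric, irreflexive) edge relation of $H$ on $V_H$. The odd-girth $og(H)$ of a non-bipartite graph $H$ is the size of a smallest induced odd cycle of $H$; for bipartite $H$ it is $\infty$. For a relation $R\subseteq V^n$, a partial function $f:\mathrm{dom}(f)\to V$ with $\mathrm{dom}(f)\subseteq V^m$ is a partial polymorphism of $R$ if for every $n\times m$ matrix over $V$ whose columns all lie in $R$ and whose rows all lie in $\mathrm{dom}(f)$, applying $f$ to each row gives a column in $R$; $\mathrm{pPol}(R)$ is the set of partial polymorphisms. For a relation $R$ over a finite domain $V$, $\textsc{Csp}(R)$ is the decision problem: given a finite set of variables $X$ and a set of constraints $R(\mathbf{x})$ with $\mathbf{x}$ a tuple of variables from $X$ of length the arity of $R$, decide whether there is an assignment $X\to V$ satisfying all constraints. $\textsc{Csp}(R)$ is called trivial if every instance is satisfiable. *)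

theory Defs
  imports
    "Graph_Theory.Pair_Digraph"
    "HOL-Library.Extended_Nat"
    "HOL-Library.NList"
    "HOL-Computational_Algebra.Polynomial"
begin

section \<open>Graphs and odd-girth\<close>

text \<open>
  A finite simple undirected loopless graph is a \<open>pair_graph\<close>: its arc set \<open>parcs H\<close> is the
  symmetric irreflexive edge relation. An \<open>n\<close>-ary relation over \<open>V\<close> is a subset of
  \<open>nlists n V\<close>, the lists of length \<open>n\<close> over \<open>V\<close>.
\<close>

definition edge_relation :: "'v pair_pre_digraph \<Rightarrow> 'v list set" where
  "edge_relation H = {[u, v] | u v. (u, v) \<in> parcs H}"

definition bipartite :: "'v pair_pre_digraph \<Rightarrow> bool" where
  "bipartite H \<longleftrightarrow> (\<exists>A. \<forall>(u, v) \<in> parcs H. u \<in> A \<longleftrightarrow> v \<notin> A)"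

definition induced_cycle :: "'v pair_pre_digraph \<Rightarrow> 'v list \<Rightarrow> bool" where
  "induced_cycle H c \<longleftrightarrow>
     3 \<le> length c \<and> distinct c \<and> set c \<subseteq> pverts H \<and>
     (\<forall>i < length c. \<forall>j < length c.
        (c ! i, c ! j) \<in> parcs H \<longleftrightarrow>
          j = Suc i mod length c \<or> i = Suc j mod length c)"

definition odd_girth :: "'v pair_pre_digraph \<Rightarrow> enat" where
  "odd_girth H =
     (if bipartite H then \<infinity>
      else enat (LEAST k. odd k \<and> (\<exists>c. induced_cycle H c \<and> length c = k)))"

section \<open>Partial polymorphisms\<close>

text \<open>
  An \<open>m\<close>-ary partial function on \<open>V\<close> is a map from lists of length \<open>m\<close>. The arity is recorded
  explicitly, as the nowhere defined function does not determine it. An \<open>n \<times> m\<close> matrix is a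
  function \<open>M\<close> of the row index \<open>i < n\<close> and the column index \<open>j < m\<close>.
\<close>

definition partial_polymorphism ::
  "'v set \<Rightarrow> nat \<Rightarrow> 'v list set \<Rightarrow> nat \<Rightarrow> ('v list \<rightharpoonup> 'v) \<Rightarrow> bool" where
  "partial_polymorphism V n R m f \<longleftrightarrow>
     dom f \<subseteq> nlists m V \<and> ran f \<subseteq> V \<and>
     (\<forall>M :: nat \<Rightarrow> nat \<Rightarrow> 'v.
        (\<forall>j < m. map (\<lambda>i. M i j) [0..<n] \<in> R) \<longrightarrow>
        (\<forall>i < n. map (M i) [0..<m] \<in> dom f) \<longrightarrow>
        map (\<lambda>i. the (f (map (M i) [0..<m]))) [0..<n] \<in> R)"

definition pPol :: "'v set \<Rightarrow> nat \<Rightarrow> 'v list set \<Rightarrow> (nat \<times> ('v list \<rightharpoonup> 'v)) set" where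
  "pPol V n R = {(m, f). 1 \<le> m \<and> partial_polymorphism V n R m f}"

section \<open>Constraint satisfaction problems\<close>

text \<open>
  An instance of CSP(\<open>R\<close>), for an \<open>n\<close>-ary \<open>R\<close>, is a finite set \<open>X\<close> of variables (named by natural
  numbers) with a finite set \<open>C\<close> of \<open>n\<close>-tuples over \<open>X\<close>; a tuple \<open>x \<in> C\<close> is the constraint \<open>R(x)\<close>.
\<close>

type_synonym csp_instance = "nat set \<times> nat list set"

definition csp_instances :: "nat \<Rightarrow> csp_instance set" where
  "csp_instances n = {(X, C). finite X \<and> finite C \<and> C \<subseteq> nlists n X}"

definition csp_satisfiable :: "'v set \<Rightarrow> 'v list set \<Rightarrow> csp_instance \<Rightarrow> bool" where
  "csp_satisfiable V R = (\<lambda>(X, C). \<exists>a. a ` X \<subseteq> V \<and> (\<forall>x \<in> C. map a x \<in> R))"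

definition csp_trivial :: "'v set \<Rightarrow> nat \<Rightarrow> 'v list set \<Rightarrow> bool" where
  "csp_trivial V n R \<longleftrightarrow> (\<forall>I \<in> csp_instances n. csp_satisfiable V R I)"

section \<open>Turing machines and polynomial time\<close>

text \<open>
  Deterministic machines with \<open>tapes M\<close> two-way infinite tapes. States are \<open>0, \<dots>, states M - 1\<close>,
  the initial state is \<open>0\<close>, and the number \<open>states M\<close> is the halting state. Tape symbols are
  \<open>0, \<dots>, symbols M - 1\<close>, where \<open>0\<close> is the blank and \<open>1\<close>, \<open>2\<close> are the bits. The transition function
  maps the state and the list of scanned symbols to the next state and, for each tape, the symbol
  to be written and the head movement. Only its finitely many values on proper states and symbols
  matter.
\<close>

record turing_machine =
  tapes :: nat
  states :: nat
  symbols :: nat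
  transition :: "nat \<Rightarrow> nat list \<Rightarrow> nat \<times> (nat \<times> int) list"

definition turing_machine :: "turing_machine \<Rightarrow> bool" where
  "turing_machine M \<longleftrightarrow>
     1 \<le> tapes M \<and> 3 \<le> symbols M \<and>
     (\<forall>q < states M. \<forall>s \<in> nlists (tapes M) {..<symbols M}.
        fst (transition M q s) \<le> states M \<and>
        snd (transition M q s) \<in> nlists (tapes M) ({..<symbols M} \<times> {-1, 0, 1}))"

text \<open>State, contents of each cell of each tape, and head position on each tape.\<close>

type_synonym configuration = "nat \<times> (nat \<Rightarrow> int \<Rightarrow> nat) \<times> (nat \<Rightarrow> int)"

definition step :: "turing_machine \<Rightarrow> configuration \<Rightarrow> configuration" where
  "step M = (\<lambda>(q, t, h).
     if q = states M then (q, t, h)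
     else
       let (q', acts) = transition M q (map (\<lambda>j. t j (h j)) [0..<tapes M])
       in (q',
           \<lambda>j. if j < tapes M then (t j)(h j := fst (acts ! j)) else t j,
           \<lambda>j. if j < tapes M then h j + snd (acts ! j) else h j))"

definition bit_symbol :: "bool \<Rightarrow> nat" where
  "bit_symbol b = (if b then 2 else 1)"

definition initial :: "bool list \<Rightarrow> configuration" where
  "initial w =
     (0,
      \<lambda>j p. if j = 0 \<and> 0 \<le> p \<and> p < int (length w) then bit_symbol (w ! nat p) else 0,
      \<lambda>j. 0)"

text \<open>The output is read off the last tape, from cell \<open>0\<close> up to the first blank.\<close>

definition halts_with :: "turing_machine \<Rightarrow> configuration \<Rightarrow> bool list \<Rightarrow> bool" where
  "halts_with M = (\<lambda>(q, t, h) y.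
     q = states M \<and>
     (\<forall>i < length y. t (tapes M - 1) (int i) = bit_symbol (y ! i)) \<and>
     t (tapes M - 1) (int (length y)) = 0)"

definition polytime :: "(bool list \<Rightarrow> bool list) \<Rightarrow> bool" where
  "polytime f \<longleftrightarrow>
     (\<exists>M (p :: nat poly). turing_machine M \<and>
        (\<forall>w. \<exists>k \<le> poly p (length w). halts_with M ((step M ^^ k) (initial w)) (f w)))"

section \<open>NP-completeness\<close>

text \<open>Self-delimiting pairing: every bit of \<open>x\<close> is preceded by \<open>True\<close>, and \<open>False\<close> ends \<open>x\<close>.\<close>

definition pair_string :: "bool list \<Rightarrow> bool list \<Rightarrow> bool list" where
  "pair_string x y = concat (map (\<lambda>b. [True, b]) x) @ False # y"

definition NP :: "bool list set set" where
  "NP = {L. \<exists>f (p :: nat poly). polytime f \<and>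
     (\<forall>x. x \<in> L \<longleftrightarrow> (\<exists>y. length y \<le> poly p (length x) \<and> f (pair_string x y) = [True]))}"

text \<open>
  A decision problem is given by the encodings \<open>Y\<close> of its yes-instances and \<open>N\<close> of its
  no-instances. A many-one reduction produces instances; strings which encode no instance do not
  count as no-instances. In particular, nothing but the full language reduces to a problem all of
  whose instances are yes-instances.
\<close>

type_synonym decision_problem = "bool list set \<times> bool list set"

definition polytime_reducible :: "bool list set \<Rightarrow> decision_problem \<Rightarrow> bool" where
  "polytime_reducible L = (\<lambda>(Y, N). \<exists>f. polytime f \<and>
     (\<forall>w. (w \<in> L \<longrightarrow> f w \<in> Y) \<and> (w \<notin> L \<longrightarrow> f w \<in> N)))"

definition NP_complete :: "decision_problem \<Rightarrow> bool" where
  "NP_complete P \<longleftrightarrow> fst P \<in> NP \<and> (\<forall>L \<in> NP. polytime_reducible L P)"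

text \<open>
  Encoding of CSP instances: variables are written in binary (least significant bit first), and
  lists are self-delimiting. The two finite sets of an instance are listed in any order, possibly
  with repetitions.
\<close>

fun binary :: "nat \<Rightarrow> bool list" where
  "binary n = (if n = 0 then [] else odd n # binary (n div 2))"

declare binary.simps [simp del]

definition encode_list :: "('a \<Rightarrow> bool list) \<Rightarrow> 'a list \<Rightarrow> bool list" where
  "encode_list e xs = concat (map (\<lambda>x. True # e x) xs) @ [False]"

definition encode_var :: "nat \<Rightarrow> bool list" where
  "encode_var v = encode_list (\<lambda>b. [b]) (binary v)"

definition csp_encodings :: "csp_instance \<Rightarrow> bool list set" where
  "csp_encodings = (\<lambda>(X, C).
     {encode_list encode_var xs @ encode_list (encode_list encode_var) cs | xs cs.
        set xs = X \<and> set cs = C})"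

definition CSP :: "'v set \<Rightarrow> nat \<Rightarrow> 'v list set \<Rightarrow> decision_problem" where
  "CSP V n R =
     (\<Union>I \<in> {I \<in> csp_instances n. csp_satisfiable V R I}. csp_encodings I,
      \<Union>I \<in> {I \<in> csp_instances n. \<not> csp_satisfiable V R I}. csp_encodings I)"

end

(*
  If pPol(E_H) is contained in pPol(R) and R is nonempty, then R consists of all tuples that satisfy
  the equalities and edges holding between the coordinates of R. If one of the conditions is an edge
  and n < k, then the graph of these edges on the coordinates has no odd cycle, so E_H is obtained
  from R by identifying the coordinates of each colour class and pPol(R) = pPol(E_H). Hence only
  equalities are left when the inclusion is strict, and constant assignments satisfy every instance.
  If k <= n, the tuples whose first k entries form a closed walk give the required relation R:
  its projection to two coordinates is again the edge relation of a non-bipartite graph.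

  Such a CSP is hard by the theorem of Hell and Nesetril, proved here for R directly. The core is
  that for a non-bipartite graph one can choose a coordinate for every polymorphism, compatibly with
  minors and with adjacency of polymorphisms. In a counterexample E with the least number of vertices
  and then the largest number of edges, E^3 has a loop, E is a core, two vertices that share both ends
  of an edge as neighbours are equal, and a homomorphism of a power of K_3 to E with the largest image
  shows that E is K_3, where polymorphisms depend on a single coordinate up to a permutation. As
  a consequence, a tiling problem for a fixed finite set of tiles is encoded in CSP(R): a tile is
  represented by a polymorphism, whose values are the variables, and the chosen coordinate recovers
  the tile. The computations of a machine verifying certificates are such tilings.

  Polynomial time is handled through a small language of programs on stacks, and membership in NP
  through nondeterministic rewriting of stacks.
*)

theory Submission
  imports Defs "HOL-Library.Countable" "HOL-Library.List_Lexorder"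
begin

section \<open>Polymorphisms of non-bipartite graphs\<close>

text \<open>Invariance of the choice under adjacency is an extra demand, and it shapes the core
  argument. It comes from the constraints: they speak only of edges, through two coordinates of
  \<open>R\<close>, so an identity between a polymorphism and a minor of another one can be imposed
  only in the weaker form of adjacency, and adjacency must already force the same coordinate. Hence
  every passage to another graph in the induction has to preserve \<open>padj\<close> and not only
  the set of polymorphisms; this is where idempotence needs care. A single arity \<open>K\<close> is
  enough, since tiles and blocks form finite sets that are known in advance and arities can be
  padded.

  There is one reduction, from machines straight to CSP(R), so only one output format has to be
  programmed: finitely many templates repeated over a grid. Positions are written in unary inside
  the variable names, and the printing program needs nothing but nested loops over unary counters.
  Likewise only one verifier is programmed, an interpreter for rewriting rules that are selected by
  the certificate. It must stop on every certificate, which is why each round consumes a part of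
  it.\<close>

text \<open>A \<open>K\<close>-ary operation takes an infinite sequence and depends only on its first \<open>K\<close> entries. Thus
  minors are compositions with maps of the natural numbers.\<close>

definition dep :: "nat \<Rightarrow> ((nat \<Rightarrow> 'a) \<Rightarrow> 'b) \<Rightarrow> bool" where
  "dep K f \<longleftrightarrow> (\<forall>x y. (\<forall>i<K. x i = y i) \<longrightarrow> f x = f y)"

definition padj :: "('v \<times> 'v) set \<Rightarrow> ((nat \<Rightarrow> 'v) \<Rightarrow> 'v) \<Rightarrow> ((nat \<Rightarrow> 'v) \<Rightarrow> 'v) \<Rightarrow> bool" where
  "padj E f g \<longleftrightarrow> (\<forall>x y. (\<forall>i. (x i, y i) \<in> E) \<longrightarrow> (f x, g y) \<in> E)"

definition pols :: "nat \<Rightarrow> ('v \<times> 'v) set \<Rightarrow> ((nat \<Rightarrow> 'v) \<Rightarrow> 'v) set" where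
  "pols K E = {f. dep K f \<and> padj E f f}"

definition ipols :: "nat \<Rightarrow> ('v \<times> 'v) set \<Rightarrow> ((nat \<Rightarrow> 'v) \<Rightarrow> 'v) set" where
  "ipols K E = {f \<in> pols K E. \<forall>v \<in> Field E. f (\<lambda>_. v) = v}"

text \<open>In algebraic terms this is a minion homomorphism to the projections, restricted to one
  arity, which moreover is constant along the edges of the exponential graph,
  \<open>padj\<close>.\<close>

definition chooses ::
  "nat \<Rightarrow> ((nat \<Rightarrow> 'v) \<Rightarrow> 'v) set \<Rightarrow> ('v \<times> 'v) set \<Rightarrow> (((nat \<Rightarrow> 'v) \<Rightarrow> 'v) \<Rightarrow> nat) \<Rightarrow> bool" where
  "chooses K F E \<xi> \<longleftrightarrow>
     (\<forall>f \<in> F. \<xi> f < K \<and> (\<forall>\<pi>. (\<forall>i<K. \<pi> i < K) \<longrightarrow> \<xi> (\<lambda>x. f (x \<circ> \<pi>)) = \<pi> (\<xi> f))) \<and>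
     (\<forall>f \<in> F. \<forall>g \<in> F. padj E f g \<longrightarrow> \<xi> f = \<xi> g)"

definition odd_closed_walk :: "('v \<times> 'v) set \<Rightarrow> bool" where
  "odd_closed_walk E \<longleftrightarrow> (\<exists>x m. (x, x) \<in> E ^^ (2 * m + 1))"

definition nonbipartite_graph :: "('v \<times> 'v) set \<Rightarrow> bool" where
  "nonbipartite_graph E \<longleftrightarrow> finite E \<and> sym E \<and> irrefl E \<and> odd_closed_walk E"

definition core_graph :: "('v \<times> 'v) set \<Rightarrow> bool" where
  "core_graph E \<longleftrightarrow> (\<forall>e. (\<forall>(x, y) \<in> E. (e x, e y) \<in> E) \<longrightarrow> inj_on e (Field E))"

lemma dep_minor: "dep K f \<Longrightarrow> \<forall>i<K. \<pi> i < K \<Longrightarrow> dep K (\<lambda>x. f (x \<circ> \<pi>))"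
  unfolding dep_def by (simp add: comp_def)

lemma dep_comp: "dep K f \<Longrightarrow> dep K (\<lambda>x. e (f x))"
  unfolding dep_def by metis

lemma pols_minor: "f \<in> pols K E \<Longrightarrow> \<forall>i<K. \<pi> i < K \<Longrightarrow> (\<lambda>x. f (x \<circ> \<pi>)) \<in> pols K E"
  unfolding pols_def by (auto simp: dep_minor padj_def)

lemma ipols_minor: "f \<in> ipols K E \<Longrightarrow> \<forall>i<K. \<pi> i < K \<Longrightarrow> (\<lambda>x. f (x \<circ> \<pi>)) \<in> ipols K E"
  unfolding ipols_def by (auto simp: pols_minor comp_def dest: pols_minor[unfolded comp_def])

text \<open>A choice is pulled back along \<open>\<Phi>\<close>. In the induction
  \<open>\<Phi>\<close> is the identity or the composition with an endomorphism, with a quotient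
  map, or with inverses of automorphisms.\<close>

lemma chooses_transfer:
  assumes "chooses K F' E' \<xi>"
    and "\<And>f. f \<in> F \<Longrightarrow> \<Phi> f \<in> F'"
    and "\<And>f g. f \<in> F \<Longrightarrow> g \<in> F \<Longrightarrow> padj E f g \<Longrightarrow> padj E' (\<Phi> f) (\<Phi> g)"
    and "\<And>f \<pi>. f \<in> F \<Longrightarrow> \<Phi> (\<lambda>x. f (x \<circ> \<pi>)) = (\<lambda>x. \<Phi> f (x \<circ> \<pi>))"
  shows "chooses K F E (\<xi> \<circ> \<Phi>)"
  using assms unfolding chooses_def by simp

lemma padj_sym: "sym E \<Longrightarrow> padj E f g \<Longrightarrow> padj E g f"
  unfolding padj_def by (meson symD)

lemma triangle_odd_closed_walk:
  "(a, b) \<in> E \<Longrightarrow> (b, c) \<in> E \<Longrightarrow> (c, a) \<in> E \<Longrightarrow> odd_closed_walk E"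
  unfolding odd_closed_walk_def
  by (intro exI[of _ a] exI[of _ 1]) (auto simp: numeral_eq_Suc)

lemma relpow_image:
  "(\<And>x y. (x, y) \<in> E \<Longrightarrow> (e x, e y) \<in> E') \<Longrightarrow> (x, y) \<in> E ^^ n \<Longrightarrow> (e x, e y) \<in> E' ^^ n"
  by (induction n arbitrary: y) auto

lemma odd_closed_walk_image:
  assumes "odd_closed_walk E" and "\<And>x y. (x, y) \<in> E \<Longrightarrow> (e x, e y) \<in> E'"
  shows "odd_closed_walk E'"
proof -
  obtain x m where "(x, x) \<in> E ^^ (2 * m + 1)" using assms(1) by (auto simp: odd_closed_walk_def)
  then have "(e x, e x) \<in> E' ^^ (2 * m + 1)" using relpow_image[of E e E' x x] assms(2) by blast
  then show ?thesis unfolding odd_closed_walk_def by blast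
qed

lemma nonbipartite_graph_image:
  assumes "nonbipartite_graph E" and "\<And>x y. (x, y) \<in> E \<Longrightarrow> e x \<noteq> e y"
  shows "nonbipartite_graph (map_prod e e ` E)"
  unfolding nonbipartite_graph_def
proof (intro conjI)
  show "finite (map_prod e e ` E)" using assms(1) by (simp add: nonbipartite_graph_def)
  show "sym (map_prod e e ` E)"
    using assms(1) unfolding nonbipartite_graph_def sym_def by force
  show "irrefl (map_prod e e ` E)"
    using assms(2) unfolding irrefl_def by fastforce
  show "odd_closed_walk (map_prod e e ` E)"
    using assms(1) by (intro odd_closed_walk_image[of E e]) (auto simp: nonbipartite_graph_def)
qed

lemma Field_image: "Field (map_prod e e ` E) = e ` Field E"
  unfolding Field_def by force

lemma finite_Field_nonbipartite: "nonbipartite_graph E \<Longrightarrow> finite (Field E)"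
  by (simp add: nonbipartite_graph_def finite_Field)

text \<open>In a core, an automorphism can be composed with every polymorphism to make it idempotent.\<close>

lemma chooses_core:
  assumes E: "nonbipartite_graph E" and core: "core_graph E"
    and \<xi>: "chooses K (ipols K E) E \<xi>"
  shows "\<exists>\<xi>. chooses K (pols K E) E \<xi>"
proof -
  have fin: "finite E" "finite (Field E)" and sy: "sym E"
    using E finite_Field_nonbipartite by (auto simp: nonbipartite_graph_def)
  \<comment> \<open>The unary minor is an endomorphism, hence an automorphism because
    \<open>E\<close> is a finite core. Composing \<open>f\<close> with its inverse makes
    \<open>f\<close> idempotent.\<close>
  define hat where "hat f = (\<lambda>v. f (\<lambda>_ :: nat. v))" for f :: "(nat \<Rightarrow> 'a) \<Rightarrow> 'a"
  have hatE: "(hat f x, hat f y) \<in> E" if "f \<in> pols K E" "(x, y) \<in> E" for f x y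
    using that by (auto simp: hat_def pols_def padj_def)
  have inj: "inj_on (hat f) (Field E)" if "f \<in> pols K E" for f
    using core hatE[OF that] unfolding core_graph_def by blast
  have inF: "hat f x \<in> Field E" if "f \<in> pols K E" "x \<in> Field E" for f x
    using that hatE[OF that(1)] unfolding Field_def by blast
  have surjF: "hat f ` Field E = Field E" if "f \<in> pols K E" for f
    by (rule endo_inj_surj[OF fin(2) _ inj[OF that]]) (use inF that in blast)
  have surjE: "map_prod (hat f) (hat f) ` E = E" if f: "f \<in> pols K E" for f
  proof (rule endo_inj_surj[OF fin(1)])
    show "map_prod (hat f) (hat f) ` E \<subseteq> E" using hatE[OF f] by auto
    show "inj_on (map_prod (hat f) (hat f)) E"
      by (rule inj_on_subset[OF map_prod_inj_on[OF inj[OF f] inj[OF f]]]) (auto simp: Field_def)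
  qed
  define iv where "iv f = inv_into (Field E) (hat f)" for f
  have iv1: "iv f (hat f x) = x" if "f \<in> pols K E" "x \<in> Field E" for f x
    unfolding iv_def using inv_into_f_f[OF inj[OF that(1)] that(2)] .
  have ivE: "(iv f x, iv f y) \<in> E" if f: "f \<in> pols K E" and xy: "(x, y) \<in> E" for f x y
  proof -
    obtain x' y' where "(x', y') \<in> E" "x = hat f x'" "y = hat f y'"
      using surjE[OF f] xy by fastforce
    moreover have "x' \<in> Field E" "y' \<in> Field E" using \<open>(x', y') \<in> E\<close> by (auto simp: Field_def)
    ultimately show ?thesis by (simp add: iv1[OF f])
  qed
  \<comment> \<open>Adjacent polymorphisms must be corrected by the same automorphism, or
    \<open>\<Phi>\<close> would destroy adjacency. Every neighbour of \<open>y\<close> is a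
    neighbour of \<open>\<alpha>\<close>, so folding \<open>y\<close> onto \<open>\<alpha>\<close>
    is an endomorphism, and in a core this forces \<open>\<alpha> = y\<close>.\<close>
  have hat_eq: "hat f y = hat g y"
    if f: "f \<in> pols K E" and g: "g \<in> pols K E" and fg: "padj E f g" and y: "y \<in> Field E" for f g y
  proof -
    define \<alpha> where "\<alpha> = iv f (hat g y)"
    have adj: "(x, \<alpha>) \<in> E" if "(x, y) \<in> E" for x
    proof -
      have "(hat f x, hat g y) \<in> E" using fg that by (auto simp: hat_def padj_def)
      then show ?thesis using ivE[OF f] iv1[OF f, of x] that unfolding \<alpha>_def
        by (metis FieldI1)
    qed
    have irr: "\<not> (y, y) \<in> E" using E by (auto simp: nonbipartite_graph_def irrefl_def)
    define e where "e = (\<lambda>z. if z = y then \<alpha> else z)"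
    have "(\<alpha>, x) \<in> E" if "(y, x) \<in> E" for x using adj[of x] that symD[OF sy] by blast
    then have "\<forall>(x, z) \<in> E. (e x, e z) \<in> E" using adj irr unfolding e_def by auto
    then have "inj_on e (Field E)" using core by (simp add: core_graph_def)
    moreover have "\<alpha> \<in> Field E" using adj y sy unfolding Field_def by (auto dest: symD)
    ultimately have "\<alpha> = y" using y unfolding e_def inj_on_def by metis
    moreover have "hat g y \<in> hat f ` Field E" using surjF[OF f] inF[OF g y] by simp
    then have "hat f \<alpha> = hat g y" unfolding \<alpha>_def iv_def by (rule f_inv_into_f)
    ultimately show ?thesis by simp
  qed
  have iv_eq: "iv f w = iv g w"
    if f: "f \<in> pols K E" and g: "g \<in> pols K E" and fg: "padj E f g" and w: "w \<in> Field E" for f g w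
  proof -
    obtain y where "y \<in> Field E" "w = hat f y" using surjF[OF f] w by blast
    then show ?thesis using iv1[OF f] iv1[OF g] hat_eq[OF f g fg] by metis
  qed
  define \<Phi> where "\<Phi> f = (\<lambda>x. iv f (f x))" for f
  have adj: "padj E (\<Phi> f) (\<Phi> g)"
    if f: "f \<in> pols K E" and g: "g \<in> pols K E" and fg: "padj E f g" for f g
    unfolding padj_def \<Phi>_def
  proof (intro allI impI)
    fix x y :: "nat \<Rightarrow> 'a" assume "\<forall>i. (x i, y i) \<in> E"
    then have "(f x, g y) \<in> E" using fg by (auto simp: padj_def)
    then have "(iv f (f x), iv f (g y)) \<in> E" "iv f (g y) = iv g (g y)"
      using ivE[OF f] iv_eq[OF f g fg, OF FieldI2] by blast+
    then show "(iv f (f x), iv g (g y)) \<in> E" by simp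
  qed
  have "chooses K (pols K E) E (\<xi> \<circ> \<Phi>)"
  proof (rule chooses_transfer[OF \<xi>])
    fix f assume f: "f \<in> pols K E"
    have "dep K (\<Phi> f)" using f by (simp add: pols_def \<Phi>_def dep_comp)
    moreover have "padj E (\<Phi> f) (\<Phi> f)" using adj[OF f f] f by (auto simp: pols_def)
    moreover have "\<Phi> f (\<lambda>_. v) = v" if "v \<in> Field E" for v
      using iv1[OF f that] by (simp add: \<Phi>_def hat_def)
    ultimately show "\<Phi> f \<in> ipols K E" by (auto simp: ipols_def pols_def)
  next
    fix f g assume "f \<in> pols K E" "g \<in> pols K E" "padj E f g"
    then show "padj E (\<Phi> f) (\<Phi> g)" by (rule adj)
  next
    fix f and \<pi> :: "nat \<Rightarrow> nat" assume "f \<in> pols K E"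
    show "\<Phi> (\<lambda>x. f (x \<circ> \<pi>)) = (\<lambda>x. \<Phi> f (x \<circ> \<pi>))"
      by (simp add: \<Phi>_def iv_def hat_def comp_def)
  qed
  then show ?thesis by blast
qed

text \<open>An idempotent polymorphism that keeps \<open>S\<close> closed is, unchanged, a
  polymorphism of the graph induced on \<open>S\<close>. A least counterexample therefore has no
  proper closed vertex set that induces a non-bipartite graph.\<close>

lemma chooses_subset:
  assumes \<xi>: "chooses K (pols K (E \<inter> S \<times> S)) (E \<inter> S \<times> S) \<xi>"
    and S: "\<And>f x. f \<in> ipols K E \<Longrightarrow> \<forall>i. x i \<in> S \<Longrightarrow> f x \<in> S"
  shows "chooses K (ipols K E) E \<xi>"
proof -
  have adj: "padj (E \<inter> S \<times> S) f g" if "f \<in> ipols K E" "g \<in> ipols K E" "padj E f g" for f g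
    unfolding padj_def
  proof (intro allI impI)
    fix x y :: "nat \<Rightarrow> 'a" assume "\<forall>i. (x i, y i) \<in> E \<inter> S \<times> S"
    then have "\<forall>i. (x i, y i) \<in> E" "\<forall>i. x i \<in> S" "\<forall>i. y i \<in> S" by auto
    then show "(f x, g y) \<in> E \<inter> S \<times> S"
      using that S unfolding padj_def by blast
  qed
  have "chooses K (ipols K E) E (\<xi> \<circ> (\<lambda>f. f))"
    by (rule chooses_transfer[OF \<xi>]) (use adj in \<open>auto simp: ipols_def pols_def\<close>)
  then show ?thesis by (simp add: comp_def)
qed

section \<open>Homomorphisms from powers of the triangle\<close>

datatype three = Th0 | Th1 | Th2

text \<open>Applied pointwise, it yields a common neighbour of two vertices in a power of K_3. For
  equal arguments two values would do, and one is fixed arbitrarily.\<close>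

fun third :: "three \<Rightarrow> three \<Rightarrow> three" where
  "third Th0 Th1 = Th2" | "third Th1 Th0 = Th2" | "third Th0 Th2 = Th1" | "third Th2 Th0 = Th1"
| "third Th1 Th2 = Th0" | "third Th2 Th1 = Th0" | "third Th0 Th0 = Th1" | "third Th1 Th1 = Th0"
| "third Th2 Th2 = Th0"

lemma third_neq: "third a b \<noteq> a" "third a b \<noteq> b"
  by (cases a; cases b; simp)+

lemma third_eqI: "a \<noteq> b \<Longrightarrow> c \<noteq> a \<Longrightarrow> c \<noteq> b \<Longrightarrow> third a b = c"
  by (cases a; cases b; cases c; simp)

lemma card_three: "card (UNIV :: three set) = 3"
proof -
  have "UNIV = {Th0, Th1, Th2}" using three.exhaust by auto
  then show ?thesis by (metis card_3_iff three.distinct)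
qed

definition hom3 :: "('v \<times> 'v) set \<Rightarrow> ((nat \<Rightarrow> three) \<Rightarrow> 'v) \<Rightarrow> bool" where
  "hom3 E h \<longleftrightarrow> (\<forall>x y. (\<forall>i. x i \<noteq> y i) \<longrightarrow> (h x, h y) \<in> E)"

definition diamond_free :: "('v \<times> 'v) set \<Rightarrow> bool" where
  "diamond_free E \<longleftrightarrow> (\<forall>p q u v. (p, u) \<in> E \<longrightarrow> (p, v) \<in> E \<longrightarrow> (u, v) \<in> E \<longrightarrow>
     (u, q) \<in> E \<longrightarrow> (v, q) \<in> E \<longrightarrow> p = q)"

definition essential :: "((nat \<Rightarrow> three) \<Rightarrow> 'v) \<Rightarrow> nat set" where
  "essential h = {i. \<exists>z c. h z \<noteq> h (z(i := c))}"

text \<open>Both images are adjacent to the two ends of the edge between \<open>h u\<close> and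
  \<open>h x\<close>, so diamond-freeness identifies them. The sequence \<open>s(i := x i)\<close>
  agrees with \<open>x\<close> at \<open>i\<close>; its image is adjacent to \<open>h x\<close> only
  because it differs everywhere from \<open>y\<close> and \<open>h x = h y\<close>.\<close>

lemma hom3_swap:
  assumes h: "hom3 E h" and df: "diamond_free E" and xy: "h x = h y"
    and i: "x i \<noteq> y i" and c: "c \<noteq> x i"
    and s: "\<And>l. l \<noteq> i \<Longrightarrow> s l \<noteq> x l" "\<And>l. l \<noteq> i \<Longrightarrow> s l \<noteq> y l"
  shows "h (s(i := x i)) = h (s(i := c))"
proof -
  define u where "u = (\<lambda>l. if l = i then third (x i) c else third (x l) (s l))"
  define v where "v = s(i := x i)"
  define w where "w = s(i := c)"
  have a1: "(h u, h x) \<in> E" "(h w, h x) \<in> E" "(h w, h u) \<in> E" "(h u, h v) \<in> E"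
    using h unfolding hom3_def
    by (metis c fun_upd_apply s third_neq u_def v_def w_def)+
  have "(h x, h v) \<in> E" unfolding xy using h unfolding hom3_def
    by (metis fun_upd_apply i s(2) v_def)
  then show ?thesis
    using df a1 unfolding diamond_free_def v_def[symmetric] w_def[symmetric]
    by metis
qed

text \<open>One swap produces two sequences with equal image that differ only at \<open>i\<close>.
  From then on the next \<open>s\<close> has to avoid a single sequence off \<open>i\<close>, and
  two more swaps, through an \<open>r\<close> that avoids both \<open>s\<close> and
  \<open>z\<close>, reach an arbitrary \<open>z\<close>.\<close>

lemma hom3_inessential:
  assumes h: "hom3 E h" and df: "diamond_free E" and xy: "h x = h y" and i: "x i \<noteq> y i"
  shows "i \<notin> essential h"
proof -
  define s where "s = (\<lambda>l. third (x l) (y l))"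
  obtain c where c: "c \<noteq> x i" using i by metis
  have 1: "h (s(i := x i)) = h (s(i := c))"
    by (rule hom3_swap[OF h df xy i c]) (auto simp: s_def third_neq)
  have 2: "h (z(i := x i)) = h (z(i := d))" if d: "d \<noteq> x i" for z d
  proof -
    define r where "r = (\<lambda>l. third (s l) (z l))"
    have "h (r(i := (s(i := x i)) i)) = h (r(i := c))"
      by (rule hom3_swap[OF h df 1]) (use c in \<open>auto simp: r_def third_neq\<close>)
    then have 3: "h (r(i := x i)) = h (r(i := c))" by simp
    have "h (z(i := (r(i := x i)) i)) = h (z(i := d))"
      by (rule hom3_swap[OF h df 3]) (use c d in \<open>auto simp: r_def third_neq(2)[symmetric]\<close>)
    then show ?thesis by simp
  qed
  then have "h (z(i := x i)) = h (z(i := d))" for z d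
    by (metis)
  then have "h z = h (z(i := d))" for z d
    by (metis fun_upd_triv)
  then show ?thesis by (simp add: essential_def)
qed

text \<open>Hence the image of \<open>h\<close> is a copy of the vertices of a power of K_3, with
  the essential coordinates as exponent. For the converse direction the inessential coordinates are
  changed one at a time; \<open>dep\<close> leaves only finitely many to change.\<close>

lemma hom3_eq_iff:
  assumes h: "hom3 E h" and df: "diamond_free E" and dep: "dep n h"
  shows "h x = h y \<longleftrightarrow> (\<forall>i \<in> essential h. x i = y i)"
proof
  assume "h x = h y" then show "\<forall>i \<in> essential h. x i = y i"
    using hom3_inessential[OF h df] by blast
next
  assume eq: "\<forall>i \<in> essential h. x i = y i"
  have "h x = h (\<lambda>i. if i < m then y i else x i)" for m
  proof (induction m)
    case (Suc m)
    have "h (\<lambda>i. if i < m then y i else x i) = h ((\<lambda>i. if i < m then y i else x i)(m := y m))"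
    proof (cases "m \<in> essential h")
      case True
      then have "(\<lambda>i. if i < m then y i else x i)(m := y m) = (\<lambda>i. if i < m then y i else x i)"
        using eq by auto
      then show ?thesis by simp
    qed (auto simp: essential_def)
    also have "(\<lambda>i. if i < m then y i else x i)(m := y m) = (\<lambda>i. if i < Suc m then y i else x i)"
      by (auto simp: less_Suc_eq)
    finally show ?case using Suc by simp
  qed simp
  moreover have "h (\<lambda>i. if i < n then y i else x i) = h y"
    by (rule dep[unfolded dep_def, rule_format]) simp
  ultimately show "h x = h y" by simp
qed

lemma hom3_essential_nonempty:
  assumes h: "hom3 E h" and irr: "irrefl E" and df: "diamond_free E" and dep: "dep n h"
  shows "essential h \<noteq> {}"
proof
  assume "essential h = {}"
  then have "h (\<lambda>_. Th0) = h (\<lambda>_. Th1)" using hom3_eq_iff[OF h df dep] by simp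
  moreover have "(h (\<lambda>_. Th0), h (\<lambda>_. Th1)) \<in> E" using h by (simp add: hom3_def)
  ultimately show False using irr by (simp add: irrefl_def)
qed

lemma essential_less:
  assumes "dep n h" "i \<in> essential h" shows "i < n"
proof (rule ccontr)
  assume "\<not> i < n"
  then have "h z = h (z(i := c))" for z c using assms(1) unfolding dep_def by simp
  then show False using assms(2) by (simp add: essential_def)
qed

lemma hom3_range: "hom3 E h \<Longrightarrow> h x \<in> Field E"
proof -
  assume "hom3 E h"
  moreover have "\<forall>i. x i \<noteq> third (x i) (x i)" using third_neq(1) by metis
  ultimately have "(h x, h (\<lambda>i. third (x i) (x i))) \<in> E" unfolding hom3_def by simp
  then show "h x \<in> Field E" by (rule FieldI1)
qed

text \<open>With two essential coordinates, \<open>hom3_eq_iff\<close> would give more than three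
  values: changing \<open>j\<close> alone already exhausts the vertices, so a change at
  \<open>i\<close> would repeat one of them. An idempotent polymorphism is thus a projection, and
  its coordinate is the choice.\<close>

lemma chooses_K3:
  fixes k :: "three \<Rightarrow> 'v"
  assumes k: "bij_betw k UNIV (Field E)" and kE: "\<And>a b. (k a, k b) \<in> E \<longleftrightarrow> a \<noteq> b"
  shows "\<exists>\<xi>. chooses K (ipols K E) E \<xi>"
proof -
  have FE: "Field E = range k" and injk: "inj k" using k by (auto simp: bij_betw_def)
  have Esub: "\<exists>a b. x = k a \<and> y = k b \<and> a \<noteq> b" if "(x, y) \<in> E" for x y
  proof -
    have "x \<in> range k" "y \<in> range k" using that FE by (auto simp: Field_def)
    then obtain a b where "x = k a" "y = k b" by blast
    then show ?thesis using that kE by blast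
  qed
  have irr: "irrefl E" unfolding irrefl_def using Esub injk by (metis injD)
  have df: "diamond_free E" unfolding diamond_free_def
  proof (intro allI impI)
    fix p q u v assume a: "(p, u) \<in> E" "(p, v) \<in> E" "(u, v) \<in> E" "(u, q) \<in> E" "(v, q) \<in> E"
    then have "p \<in> range k" "q \<in> range k" "u \<in> range k" "v \<in> range k"
      unfolding FE[symmetric] by (auto simp: Field_def)
    then obtain a b c d where "p = k a" "q = k b" "u = k c" "v = k d" by blast
    with a have "a \<noteq> c" "a \<noteq> d" "c \<noteq> d" "c \<noteq> b" "d \<noteq> b" by (auto simp: kE)
    then have "third c d = a" "third c d = b" by (auto intro!: third_eqI)
    then show "p = q" using \<open>p = k a\<close> \<open>q = k b\<close> by metis
  qed
  have ex: "\<exists>j<K. \<forall>w. f (\<lambda>r. k (w r)) = k (w j)" if f: "f \<in> ipols K E" for f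
  proof -
    define h where "h w = f (\<lambda>r. k (w r))" for w :: "nat \<Rightarrow> three"
    have h: "hom3 E h" using f kE by (auto simp: hom3_def h_def ipols_def pols_def padj_def)
    have dep: "dep K h" using f by (auto simp: dep_def h_def ipols_def pols_def)
    note iff = hom3_eq_iff[OF h df dep]
    obtain j where j: "j \<in> essential h" using hom3_essential_nonempty[OF h irr df dep] by blast
    have uniq: "i = j" if i: "i \<in> essential h" for i
    proof (rule ccontr)
      assume ij: "i \<noteq> j"
      define x where "x = (\<lambda>_ :: nat. Th0)"
      have "inj (\<lambda>c. h (x(j := c)))"
      proof (rule injI)
        fix c d assume "h (x(j := c)) = h (x(j := d))"
        then have "(x(j := c)) j = (x(j := d)) j" using iff j by blast
        then show "c = d" by simp
      qed
      moreover have "range (\<lambda>c. h (x(j := c))) \<subseteq> Field E" using hom3_range[OF h] by blast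
      moreover have "card (Field E) = 3" using k card_three by (metis bij_betw_same_card)
      ultimately have "range (\<lambda>c. h (x(j := c))) = Field E"
        by (metis card_image card_three card_subset_eq card_gt_0_iff zero_less_numeral)
      then have "h (x(i := Th1)) \<in> range (\<lambda>c. h (x(j := c)))" using hom3_range[OF h] by simp
      then obtain c where "h (x(i := Th1)) = h (x(j := c))" by blast
      then have "(x(i := Th1)) i = (x(j := c)) i" using iff i by blast
      then show False using ij by (simp add: x_def)
    qed
    have "f (\<lambda>r. k (w r)) = k (w j)" for w
    proof -
      have "h w = h (\<lambda>_. w j)" using iff uniq by metis
      also have "\<dots> = k (w j)" using f FE by (simp add: h_def ipols_def)
      finally show ?thesis by (simp add: h_def)
    qed
    then show ?thesis using essential_less[OF dep j] by blast
  qed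
  define \<xi> where "\<xi> f = (SOME j. j < K \<and> (\<forall>w. f (\<lambda>r. k (w r)) = k (w j)))" for f
  have \<xi>: "\<xi> f < K" "f (\<lambda>r. k (w r)) = k (w (\<xi> f))" if "f \<in> ipols K E" for f w
  proof -
    have "\<xi> f < K \<and> (\<forall>w. f (\<lambda>r. k (w r)) = k (w (\<xi> f)))"
      unfolding \<xi>_def by (rule someI_ex) (use ex[OF that] in blast)
    then show "\<xi> f < K" "f (\<lambda>r. k (w r)) = k (w (\<xi> f))" by auto
  qed
  have uniq: "j = \<xi> f" if "f \<in> ipols K E" "\<And>w. f (\<lambda>r. k (w r)) = k (w j)" for f j
  proof -
    have "k (w j) = k (w (\<xi> f))" for w using \<xi>(2)[OF that(1), of w] that(2)[of w] by simp
    then have "w j = w (\<xi> f)" for w :: "nat \<Rightarrow> three" using injk by (metis injD)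
    from this[of "\<lambda>i. if i = j then Th0 else Th1"] show ?thesis by (auto split: if_splits)
  qed
  have "chooses K (ipols K E) E \<xi>"
    unfolding chooses_def
  proof (intro conjI ballI allI impI)
    fix f assume f: "f \<in> ipols K E" then show "\<xi> f < K" by (rule \<xi>)
    fix \<pi> :: "nat \<Rightarrow> nat" assume \<pi>: "\<forall>i<K. \<pi> i < K"
    show "\<xi> (\<lambda>x. f (x \<circ> \<pi>)) = \<pi> (\<xi> f)"
    proof (rule uniq[symmetric, OF ipols_minor[OF f \<pi>]])
      fix w :: "nat \<Rightarrow> three"
      show "f ((\<lambda>r. k (w r)) \<circ> \<pi>) = k (w (\<pi> (\<xi> f)))"
        using \<xi>(2)[OF f, of "w \<circ> \<pi>"] by (simp add: comp_def)
    qed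
  next
    fix f g assume f: "f \<in> ipols K E" and g: "g \<in> ipols K E" and fg: "padj E f g"
    \<comment> \<open>These sequences differ everywhere, and \<open>w\<close> has the value
      \<open>Th1\<close> only at \<open>\<xi> g\<close>. Adjacency of the two projections then pins
      down \<open>\<xi> f\<close>.\<close>
    define w w' where "w = (\<lambda>r. if r = \<xi> g then Th1 else Th0)"
      and "w' = (\<lambda>r. if r = \<xi> g then Th0 else Th1)"
    have "(f (\<lambda>r. k (w r)), g (\<lambda>r. k (w' r))) \<in> E"
      using fg unfolding padj_def by (auto simp: kE w_def w'_def)
    then have "w (\<xi> f) \<noteq> w' (\<xi> g)" using \<xi>(2)[OF f] \<xi>(2)[OF g] by (simp add: kE)
    then show "\<xi> f = \<xi> g" by (auto simp: w_def w'_def split: if_splits)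
  qed
  then show ?thesis by blast
qed

section \<open>Induction on non-bipartite graphs\<close>

lemma ipols_relpow:
  assumes R: "\<And>f x y. f \<in> F \<Longrightarrow> \<forall>i :: nat. (x i, y i) \<in> R \<Longrightarrow> (f x, f y) \<in> R"
    and f: "f \<in> F"
  shows "\<forall>i :: nat. (x i, y i) \<in> R ^^ m \<Longrightarrow> (f x, f y) \<in> R ^^ m"
proof (induction m arbitrary: y)
  case 0
  then have "x = y" by auto
  then show ?case by simp
next
  case (Suc m)
  then have "\<forall>i. \<exists>z. (x i, z) \<in> R ^^ m \<and> (z, y i) \<in> R" by auto
  then obtain z where "\<forall>i. (x i, z i) \<in> R ^^ m" "\<forall>i. (z i, y i) \<in> R" by metis
  then have "(f x, f z) \<in> R ^^ m" "(f z, f y) \<in> R" using Suc.IH R[OF f] by auto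
  then show ?case by auto
qed

lemma relpow_odd_fixed: "E O E O E = E \<Longrightarrow> E ^^ (2 * m + 1) = E"
proof (induction m)
  case (Suc m)
  have "E ^^ (2 * Suc m + 1) = E ^^ (2 * m + 1) O E O E"
    by (simp add: O_assoc relpow_commute)
  then show ?case using Suc by simp
qed simp

text \<open>\<open>diamond_free\<close> says that this relation lies in the identity. Being defined
  from \<open>E\<close> by existential quantifiers and conjunctions, it is preserved by every
  polymorphism.\<close>

definition diamond :: "('v \<times> 'v) set \<Rightarrow> ('v \<times> 'v) set" where
  "diamond E = {(x, y). \<exists>u v. (x, u) \<in> E \<and> (x, v) \<in> E \<and> (u, v) \<in> E \<and> (u, y) \<in> E \<and> (v, y) \<in> E}"

lemma diamondI:
  "(x, u) \<in> E \<Longrightarrow> (x, v) \<in> E \<Longrightarrow> (u, v) \<in> E \<Longrightarrow> (u, y) \<in> E \<Longrightarrow> (v, y) \<in> E \<Longrightarrow> (x, y) \<in> diamond E"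
  unfolding diamond_def by blast

lemma pols_edge: "f \<in> pols K E \<Longrightarrow> \<forall>i. (x i, y i) \<in> E \<Longrightarrow> (f x, f y) \<in> E"
  by (auto simp: pols_def padj_def)

lemma pols_diamond:
  assumes f: "f \<in> pols K E" and "\<forall>i. (x i, y i) \<in> diamond E" shows "(f x, f y) \<in> diamond E"
proof -
  have "\<forall>i. \<exists>u v. (x i, u) \<in> E \<and> (x i, v) \<in> E \<and> (u, v) \<in> E \<and> (u, y i) \<in> E \<and> (v, y i) \<in> E"
    using assms(2) by (simp add: diamond_def)
  then obtain u v where "\<forall>i. (x i, u i) \<in> E \<and> (x i, v i) \<in> E \<and> (u i, v i) \<in> E \<and>
    (u i, y i) \<in> E \<and> (v i, y i) \<in> E" by metis
  then show ?thesis using pols_edge[OF f] unfolding diamond_def by blast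
qed

text \<open>The second measure counts missing pairs: the passage from \<open>E\<close> to
  \<open>E O E O E\<close> keeps the vertices and adds edges. All other reductions lower the number
  of vertices.\<close>

theorem nonbipartite_chooses:
  fixes E :: "('v \<times> 'v) set"
  assumes "nonbipartite_graph E"
  shows "\<exists>\<xi>. chooses K (pols K E) E \<xi>"
  using assms
proof (induction E rule: wf_induct_rule[OF wf_measures[of
      "[\<lambda>E. card (Field E), \<lambda>E. card (Field E \<times> Field E) - card E]"]])
  case (1 E)
  note E = \<open>nonbipartite_graph E\<close>
  have fin: "finite E" "finite (Field E)" and sy: "sym E" and irr: "irrefl E"
    and owalk: "odd_closed_walk E"
    using E finite_Field_nonbipartite by (auto simp: nonbipartite_graph_def)
  have IH1: "\<exists>\<xi>. chooses K (pols K E') E' \<xi>"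
    if "nonbipartite_graph E'" "card (Field E') < card (Field E)" for E' :: "('v \<times> 'v) set"
    using 1(1)[of E'] that by simp
  have irr': "(x, x) \<notin> E" for x using irr by (auto simp: irrefl_def)
  have symE: "(y, x) \<in> E" if "(x, y) \<in> E" for x y using sy that by (auto dest: symD)
  have nonbip_sub: "nonbipartite_graph (E \<inter> S \<times> S)"
    if "(a, b) \<in> E" "(b, c) \<in> E" "(c, a) \<in> E" "a \<in> S" "b \<in> S" "c \<in> S" for a b c S
    unfolding nonbipartite_graph_def
    using fin sy irr triangle_odd_closed_walk[of a b "E \<inter> S \<times> S" c] that
    by (auto simp: sym_def irrefl_def)
  show ?case
  proof (rule ccontr)
    assume neg: "\<not> ?case"
    have E3: "E \<subseteq> E O E O E"
      using relcompI[OF _ relcompI[OF symE]] by (metis subrelI)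
    have "\<not> irrefl (E O E O E)"
    proof
      assume irr3: "irrefl (E O E O E)"
      \<comment> \<open>Otherwise all odd powers would be \<open>E\<close>, and an odd closed walk
        would be a loop.\<close>
      have "E O E O E \<noteq> E"
        using relpow_odd_fixed[of E] owalk irr' unfolding odd_closed_walk_def by metis
      have F3: "Field (E O E O E) = Field E"
        using E3 unfolding Field_def by blast
      have fin3: "finite (E O E O E)" using fin by simp
      have "E \<subset> E O E O E" using E3 \<open>E O E O E \<noteq> E\<close> by blast
      then have "card E < card (E O E O E)" using fin3 by (rule psubset_card_mono[rotated])
      moreover have "card (E O E O E) \<le> card (Field E \<times> Field E)"
        using fin F3 by (intro card_mono) (auto simp: Field_def)
      moreover have "nonbipartite_graph (E O E O E)"
        unfolding nonbipartite_graph_def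
      proof (intro conjI fin3 irr3)
        show "sym (E O E O E)"
          using sy by (simp add: sym_conv_converse_eq converse_relcomp O_assoc)
        show "odd_closed_walk (E O E O E)"
          by (rule odd_closed_walk_image[OF owalk, of "\<lambda>x. x"]) (use E3 in blast)
      qed
      ultimately have "\<exists>\<xi>. chooses K (pols K (E O E O E)) (E O E O E) \<xi>"
        using 1(1)[of "E O E O E"] F3 by simp
      then obtain \<xi> where \<xi>: "chooses K (pols K (E O E O E)) (E O E O E) \<xi>" by blast
      \<comment> \<open>Along a walk of length three, \<open>f\<close> and \<open>g\<close> are
        applied in turn to its successive vertices.\<close>
      have adj: "padj (E O E O E) f g" if "padj E f g" for f g
        unfolding padj_def
      proof (intro allI impI)
        fix x y :: "nat \<Rightarrow> 'v" assume "\<forall>i. (x i, y i) \<in> E O E O E"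
        then have "\<forall>i. \<exists>u v. (x i, u) \<in> E \<and> (u, v) \<in> E \<and> (v, y i) \<in> E" by blast
        then obtain u v where "\<forall>i. (x i, u i) \<in> E" "\<forall>i. (u i, v i) \<in> E" "\<forall>i. (v i, y i) \<in> E"
          by metis
        then have "(f x, g u) \<in> E" "(g u, f v) \<in> E" "(f v, g y) \<in> E"
          using that padj_sym[OF sy that] by (auto simp: padj_def)
        then show "(f x, g y) \<in> E O E O E" by blast
      qed
      have "chooses K (pols K E) E (\<xi> \<circ> (\<lambda>f. f))"
        by (rule chooses_transfer[OF \<xi>]) (use adj in \<open>auto simp: pols_def\<close>)
      then show False using neg by blast
    qed
    then obtain a b c where tri: "(a, b) \<in> E" "(b, c) \<in> E" "(c, a) \<in> E"
      unfolding irrefl_def by blast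
    have core: "core_graph E"
      unfolding core_graph_def
    proof (intro allI impI)
      fix e assume e: "\<forall>(x, y) \<in> E. (e x, e y) \<in> E"
      show "inj_on e (Field E)"
      proof (rule ccontr)
        assume ninj: "\<not> inj_on e (Field E)"
        let ?E = "map_prod e e ` E"
        have "nonbipartite_graph ?E"
          by (rule nonbipartite_graph_image[OF E]) (use e irr' in fastforce)
        moreover have "card (Field ?E) < card (Field E)"
          unfolding Field_image using ninj fin(2)
          by (metis card_image_le eq_card_imp_inj_on le_neq_implies_less)
        ultimately obtain \<xi> where \<xi>: "chooses K (pols K ?E) ?E \<xi>" using IH1 by blast
        have adj: "padj ?E (\<lambda>x. e (f x)) (\<lambda>x. e (g x))" if "padj E f g" for f g
          unfolding padj_def
        proof (intro allI impI)
          fix x y :: "nat \<Rightarrow> 'v" assume "\<forall>i. (x i, y i) \<in> ?E"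
          moreover have "?E \<subseteq> E" using e by auto
          ultimately have "\<forall>i. (x i, y i) \<in> E" by (meson subsetD)
          then have "(f x, g y) \<in> E" using that by (simp add: padj_def)
          then have "map_prod e e (f x, g y) \<in> ?E" by (rule imageI)
          then show "(e (f x), e (g y)) \<in> ?E" by simp
        qed
        have "chooses K (pols K E) E (\<xi> \<circ> (\<lambda>f x. e (f x)))"
          by (rule chooses_transfer[OF \<xi>]) (use adj in \<open>auto simp: pols_def dep_comp\<close>)
        then show False using neg by blast
      qed
    qed
    have no_i: "\<not> chooses K (ipols K E) E \<xi>" for \<xi>
      using chooses_core[OF E core] neg by blast
    \<comment> \<open>This is the tool for all that follows. A vertex set that is defined from
      \<open>E\<close> by a primitive positive formula is closed under idempotent polymorphisms,
      even if fixed vertices occur in the formula. As soon as it contains a triangle, it is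
      everything.\<close>
    have sub: "S = Field E"
      if S: "\<And>f x. f \<in> ipols K E \<Longrightarrow> \<forall>i. x i \<in> S \<Longrightarrow> f x \<in> S" and "S \<subseteq> Field E"
        and t: "(x, y) \<in> E" "(y, z) \<in> E" "(z, x) \<in> E" "x \<in> S" "y \<in> S" "z \<in> S" for S x y z
    proof (rule ccontr)
      assume "S \<noteq> Field E"
      have "Field (E \<inter> S \<times> S) \<subseteq> S" by (auto simp: Field_def)
      then have "Field (E \<inter> S \<times> S) \<subset> Field E" using \<open>S \<noteq> Field E\<close> \<open>S \<subseteq> Field E\<close> by blast
      then have "card (Field (E \<inter> S \<times> S)) < card (Field E)" using fin psubset_card_mono by blast
      then obtain \<xi> where "chooses K (pols K (E \<inter> S \<times> S)) (E \<inter> S \<times> S) \<xi>"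
        using IH1[OF nonbip_sub[OF t]] by blast
      then have "chooses K (ipols K E) E \<xi>" by (rule chooses_subset) (use S in blast)
      then show False using no_i by blast
    qed
    have ipol: "(f x, f y) \<in> E" if "f \<in> ipols K E" "\<forall>i. (x i, y i) \<in> E" for f x y
      using that pols_edge by (auto simp: ipols_def)
    have idem: "f (\<lambda>_. v) = v" if "f \<in> ipols K E" "v \<in> Field E" for f v
      using that by (simp add: ipols_def)
    let ?T = "{x. \<exists>u v. (x, u) \<in> E \<and> (u, v) \<in> E \<and> (v, x) \<in> E}"
    have T: "?T = Field E"
    proof (rule sub[OF _ _ tri])
      fix f and x :: "nat \<Rightarrow> 'v" assume f: "f \<in> ipols K E" "\<forall>i. x i \<in> ?T"
      then have "\<forall>i. \<exists>u v. (x i, u) \<in> E \<and> (u, v) \<in> E \<and> (v, x i) \<in> E" by blast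
      then obtain u v where "\<forall>i. (x i, u i) \<in> E" "\<forall>i. (u i, v i) \<in> E" "\<forall>i. (v i, x i) \<in> E" by metis
      then show "f x \<in> ?T" using ipol[OF f(1)] by blast
    qed (use tri in \<open>auto simp: Field_def\<close>)
    let ?R = "diamond E"
    have Rsub: "?R \<subseteq> Field E \<times> Field E" by (auto simp: diamond_def Field_def)
    have finR: "finite ?R" using finite_subset[OF Rsub] fin by simp
    have Rrefl: "(x, x) \<in> ?R" if "x \<in> Field E" for x
    proof -
      have "x \<in> ?T" using that unfolding T .
      then obtain u v where uv: "(x, u) \<in> E" "(u, v) \<in> E" "(v, x) \<in> E" by blast
      show ?thesis by (rule diamondI[OF uv(1) symE[OF uv(3)] uv(2) symE[OF uv(1)] uv(3)])
    qed
    have Rrefln: "(x, x) \<in> ?R ^^ m" if "x \<in> Field E" for x m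
      by (induction m) (use Rrefl[OF that] in auto)
    have Rsym: "sym ?R"
    proof (rule symI)
      fix x y assume "(x, y) \<in> ?R"
      then obtain u v where uv: "(x, u) \<in> E" "(x, v) \<in> E" "(u, v) \<in> E" "(u, y) \<in> E" "(v, y) \<in> E"
        by (auto simp: diamond_def)
      show "(y, x) \<in> ?R"
        by (rule diamondI[OF symE[OF uv(4)] symE[OF uv(5)] uv(3) symE[OF uv(1)] symE[OF uv(2)]])
    qed
    have Rpow: "(f x, f y) \<in> ?R ^^ m" if "f \<in> pols K E" "\<forall>i. (x i, y i) \<in> ?R ^^ m" for f x y m
      by (rule ipols_relpow[of "pols K E"]) (use that pols_diamond in blast)+
    \<comment> \<open>This makes the quotient by \<open>?R\<close> loopless. In a shortest
      violation, let \<open>?S\<close> be the neighbours of the vertices reached from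
      \<open>x\<close> with one step less. It contains the triangle \<open>u\<close>,
      \<open>v\<close>, \<open>y\<close>, hence every vertex; that \<open>x\<close> itself is in it
      is a shorter violation.\<close>
    have ER: "(x, y) \<notin> ?R ^^ n" if "(x, y) \<in> E" for x y n
      using that
    proof (induction n arbitrary: x y rule: less_induct)
      case (less n)
      show ?case
      proof
        assume xy: "(x, y) \<in> ?R ^^ n"
        then obtain m where n: "n = Suc m" using irr' less.prems by (cases n) auto
        then obtain c where c: "(x, c) \<in> ?R ^^ m" "(c, y) \<in> ?R" using xy by auto
        then obtain u v where uv: "(c, u) \<in> E" "(c, v) \<in> E" "(u, v) \<in> E" "(u, y) \<in> E" "(v, y) \<in> E"
          by (auto simp: diamond_def)
        have x: "x \<in> Field E" using less.prems by (auto simp: Field_def)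
        let ?S = "{z. \<exists>w. (x, w) \<in> ?R ^^ m \<and> (w, z) \<in> E}"
        have "?S = Field E"
        proof (rule sub[OF _ _ uv(3) uv(5) symE[OF uv(4)]])
          fix f and z :: "nat \<Rightarrow> 'v" assume f: "f \<in> ipols K E" and "\<forall>i. z i \<in> ?S"
          then have "\<forall>i. \<exists>w. (x, w) \<in> ?R ^^ m \<and> (w, z i) \<in> E" by blast
          then obtain w where "\<forall>i. (x, w i) \<in> ?R ^^ m" "\<forall>i. (w i, z i) \<in> E" by metis
          then have "(f (\<lambda>_. x), f w) \<in> ?R ^^ m" "(f w, f z) \<in> E"
            using f ipol[OF f] Rpow[of f "\<lambda>_. x" w m] by (auto simp: ipols_def)
          then show "f z \<in> ?S" using idem[OF f x] by auto
        next
          show "y \<in> ?S" using Rrefln[OF x] less.prems by blast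
        qed (use uv c(1) in \<open>auto simp: Field_def\<close>)
        then have "x \<in> ?S" using x by (simp only:)
        then obtain w where "(x, w) \<in> ?R ^^ m" "(w, x) \<in> E" by blast
        then show False using less.IH[of m x w] symE[of w x] n by auto
      qed
    qed
    have "?R \<subseteq> Id"
    proof (rule ccontr)
      assume "\<not> ?R \<subseteq> Id"
      then obtain p q where pq: "(p, q) \<in> ?R" "p \<noteq> q" by auto
      \<comment> \<open>A representative in each class of the equivalence relation generated by
        \<open>?R\<close>. Polymorphisms preserve \<open>?R\<close> and so act on the
        quotient.\<close>
      define \<rho> where "\<rho> x = (SOME y. (x, y) \<in> ?R\<^sup>*)" for x
      have \<rho>: "(x, \<rho> x) \<in> ?R\<^sup>*" for x unfolding \<rho>_def by (rule someI[of _ x]) simp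
      have sym_star: "sym (?R\<^sup>*)" using Rsym by (rule sym_rtrancl)
      have \<rho>_eq: "\<rho> x = \<rho> y" if "(x, y) \<in> ?R\<^sup>*" for x y
      proof -
        have "(x, z) \<in> ?R\<^sup>* \<longleftrightarrow> (y, z) \<in> ?R\<^sup>*" for z
          using that sym_star by (meson rtrancl_trans symD)
        then show ?thesis by (simp add: \<rho>_def)
      qed
      have \<rho>_neq: "\<rho> x \<noteq> \<rho> y" if "(x, y) \<in> E" for x y
      proof
        assume "\<rho> x = \<rho> y"
        then have "(x, y) \<in> ?R\<^sup>*" using \<rho>[of x] \<rho>[of y] sym_star by (metis rtrancl_trans symD)
        then show False using ER[OF that] by (auto simp: rtrancl_is_UN_relpow)
      qed
      let ?E = "map_prod \<rho> \<rho> ` E"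
      have nb: "nonbipartite_graph ?E" by (rule nonbipartite_graph_image[OF E \<rho>_neq])
      have "\<not> inj_on \<rho> (Field E)"
        using pq Rsub \<rho>_eq[of p q] unfolding inj_on_def by blast
      then have "card (Field ?E) < card (Field E)"
        unfolding Field_image using fin(2)
        by (metis card_image_le eq_card_imp_inj_on le_neq_implies_less)
      then obtain \<xi> where \<xi>: "chooses K (pols K ?E) ?E \<xi>" using IH1[OF nb] by blast
      \<comment> \<open>Since \<open>?R\<close> is reflexive on the vertices, walks can be padded to
        a common length. Only then are all coordinates related by one and the same power, to which
        \<open>Rpow\<close> applies.\<close>
      have bound: "(x, y) \<in> ?R ^^ card ?R" if "(x, y) \<in> ?R\<^sup>*" "x \<in> Field E" for x y
      proof -
        have "(x, y) \<in> (\<Union>n\<in>{n. n \<le> card ?R}. ?R ^^ n)"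
          using that(1) by (simp only: rtrancl_finite_eq_relpow[OF finR])
        then obtain n where n: "(x, y) \<in> ?R ^^ n" "n \<le> card ?R" by auto
        have "(x, y) \<in> ?R ^^ (card ?R - n) O ?R ^^ n" using n(1) Rrefln[OF that(2)] by blast
        then show ?thesis using n(2) by (simp flip: relpow_add)
      qed
      have adj: "padj ?E (\<lambda>x. \<rho> (f x)) (\<lambda>x. \<rho> (g x))"
        if f: "f \<in> pols K E" and g: "g \<in> pols K E" and fg: "padj E f g" for f g
        unfolding padj_def
      proof (intro allI impI)
        fix x y :: "nat \<Rightarrow> 'v" assume "\<forall>i. (x i, y i) \<in> ?E"
        then have "\<exists>u v. x i = \<rho> u \<and> y i = \<rho> v \<and> (u, v) \<in> E" for i
          by (auto elim!: allE[of _ i])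
        then obtain u v where uv: "\<forall>i. x i = \<rho> (u i)" "\<forall>i. y i = \<rho> (v i)" "\<forall>i. (u i, v i) \<in> E"
          by metis
        then have F: "u i \<in> Field E" "v i \<in> Field E" for i by (auto simp: Field_def)
        have "\<rho> (f u) = \<rho> (f x)"
          by (rule \<rho>_eq, rule relpow_imp_rtrancl[of _ "card ?R"], rule Rpow[OF f])
            (use bound[OF \<rho>] F uv in auto)
        moreover have "\<rho> (g v) = \<rho> (g y)"
          by (rule \<rho>_eq, rule relpow_imp_rtrancl[of _ "card ?R"], rule Rpow[OF g])
            (use bound[OF \<rho>] F uv in auto)
        moreover have "(f u, g v) \<in> E" using fg uv(3) by (simp add: padj_def)
        then have "map_prod \<rho> \<rho> (f u, g v) \<in> ?E" by (rule imageI)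
        ultimately show "(\<rho> (f x), \<rho> (g y)) \<in> ?E" by simp
      qed
      have "chooses K (pols K E) E (\<xi> \<circ> (\<lambda>f x. \<rho> (f x)))"
      proof (rule chooses_transfer[OF \<xi>])
        fix f assume f: "f \<in> pols K E"
        then show "(\<lambda>x. \<rho> (f x)) \<in> pols K ?E"
          using adj[OF f f] by (auto simp: pols_def dep_comp)
      qed (use adj in auto)
      then show False using neg by blast
    qed
    then have df: "diamond_free E" unfolding diamond_free_def diamond_def by blast
    define hs where "hs = {h. hom3 E h \<and> (\<exists>n. dep n h)}"
    define th where "th = (\<lambda>w :: nat \<Rightarrow> three. case w 0 of Th0 \<Rightarrow> a | Th1 \<Rightarrow> b | Th2 \<Rightarrow> c)"
    have "th \<in> hs"
      unfolding hs_def
    proof (intro CollectI conjI exI)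
      show "dep 1 th" by (auto simp: dep_def th_def)
      have "(th x, th y) \<in> E" if "x 0 \<noteq> y 0" for x y
        using that tri tri[THEN symE] unfolding th_def
        by (cases "x 0"; cases "y 0") simp_all
      then show "hom3 E th" by (simp add: hom3_def)
    qed
    have range_h: "range h \<subseteq> Field E" if "h \<in> hs" for h
      using that hom3_range by (auto simp: hs_def)
    then have "\<forall>h. h \<in> hs \<longrightarrow> card (range h) < Suc (card (Field E))"
      using fin by (simp add: card_mono less_Suc_eq_le)
    then obtain h where h: "h \<in> hs" and hmax: "\<And>h'. h' \<in> hs \<Longrightarrow> card (range h') \<le> card (range h)"
      using ex_has_greatest_nat[of "\<lambda>h. h \<in> hs" th "\<lambda>h. card (range h)"] \<open>th \<in> hs\<close> by blast
    then obtain n where hh: "hom3 E h" "dep n h" by (auto simp: hs_def)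
    have S: "range h = Field E"
    proof (rule sub[OF _ range_h[OF h]])
      show "(h (\<lambda>_. Th0), h (\<lambda>_. Th1)) \<in> E" "(h (\<lambda>_. Th1), h (\<lambda>_. Th2)) \<in> E"
        "(h (\<lambda>_. Th2), h (\<lambda>_. Th0)) \<in> E" using hh(1) by (auto simp: hom3_def)
      fix f and x :: "nat \<Rightarrow> 'v" assume f: "f \<in> ipols K E" and x: "\<forall>i. x i \<in> range h"
      \<comment> \<open>\<open>f\<close> applied to copies of \<open>h\<close> on disjoint sets of
        coordinates, numbered by \<open>prod_encode\<close>. If all copies receive the same
        argument, idempotence shows that no value of \<open>h\<close> is lost; by maximality none is
        gained, so the image of \<open>h\<close> is closed under \<open>f\<close>.\<close>
      define h' where "h' w = f (\<lambda>r. h (\<lambda>l. w (prod_encode (r, l))))" for w :: "nat \<Rightarrow> three"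
      define N where "N = Suc (Max (prod_encode ` ({..<K} \<times> {..<n})))"
      have N: "prod_encode (r, l) < N" if "r < K" "l < n" for r l
        unfolding N_def using that by (auto intro!: Max_ge simp: less_Suc_eq_le)
      have "dep N h'"
        unfolding dep_def
      proof (intro allI impI)
        fix w w' :: "nat \<Rightarrow> three" assume w: "\<forall>i<N. w i = w' i"
        have "h (\<lambda>l. w (prod_encode (r, l))) = h (\<lambda>l. w' (prod_encode (r, l)))" if "r < K" for r
          by (rule hh(2)[unfolded dep_def, rule_format]) (use w N that in auto)
        moreover have "dep K f" using f by (simp add: ipols_def pols_def)
        ultimately show "h' w = h' w'" unfolding h'_def dep_def by simp
      qed
      moreover have "hom3 E h'"
        unfolding hom3_def h'_def
        by (intro allI impI ipol[OF f(1)]) (use hh(1) in \<open>auto simp: hom3_def\<close>)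
      ultimately have h': "h' \<in> hs" by (auto simp: hs_def)
      have sub': "range h \<subseteq> range h'"
      proof
        fix v assume "v \<in> range h"
        then obtain z where z: "v = h z" by blast
        have "h' (\<lambda>m. z (snd (prod_decode m))) = f (\<lambda>_. v)" by (simp add: h'_def z)
        also have "\<dots> = v" using idem[OF f(1)] hom3_range[OF hh(1)] z by simp
        finally show "v \<in> range h'" by (metis rangeI)
      qed
      have "finite (range h')" using range_h[OF h'] fin finite_subset by blast
      then have eq: "range h = range h'"
        using card_subset_eq[OF _ sub'] hmax[OF h'] card_mono[OF _ sub'] le_antisym by simp
      have "\<forall>i. \<exists>z. x i = h z" using x by (auto simp: image_iff)
      from choice[OF this] obtain z where z: "\<forall>i. x i = h (z i)" ..
      have "x = (\<lambda>r. h (z r))" using z by auto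
      then have "h' (\<lambda>m. z (fst (prod_decode m)) (snd (prod_decode m))) = f x"
        by (simp add: h'_def)
      then show "f x \<in> range h" unfolding eq by (auto intro: range_eqI[OF HOL.sym])
    qed auto
    note iff = hom3_eq_iff[OF hh(1) df hh(2)]
    \<comment> \<open>If \<open>x\<close> and \<open>y\<close> agree at \<open>i\<close>, a common
      neighbour of them has two possible entries at \<open>i\<close>. Diamond-freeness gives both
      versions the same image, which contradicts that \<open>i\<close> is essential.\<close>
    have edge: "x i \<noteq> y i" if xy: "(h x, h y) \<in> E" and i: "i \<in> essential h" for x y i
    proof
      assume eq: "x i = y i"
      define z where "z = (\<lambda>l. third (x l) (y l))"
      define z' where "z' = z(i := third (x i) (z i))"
      have "(h z, h x) \<in> E" "(h z, h y) \<in> E" "(h x, h z') \<in> E" "(h y, h z') \<in> E"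
        using hh(1) third_neq unfolding hom3_def z_def z'_def
        by (auto simp: eq third_neq third_neq[symmetric])
      then have "h z = h z'" using df xy unfolding diamond_free_def by metis
      then have "z i = z' i" using iff i by blast
      then show False by (simp add: z'_def third_neq(2)[symmetric])
    qed
    obtain j where j: "j \<in> essential h"
      using hom3_essential_nonempty[OF hh(1) irr df hh(2)] by blast
    \<comment> \<open>Projection to the essential coordinate \<open>j\<close>, followed by the
      diagonal. This endomorphism is injective because \<open>E\<close> is a core, so the coordinate
      \<open>j\<close> alone determines the value of \<open>h\<close>.\<close>
    define e where "e v = h (\<lambda>_. (SOME x. h x = v) j)" for v
    have e: "e (h x) = h (\<lambda>_. x j)" for x
    proof -
      have "h (SOME y. h y = h x) = h x" by (rule someI[of _ x]) simp
      then have "(SOME y. h y = h x) j = x j" using iff j by blast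
      then show ?thesis by (simp add: e_def)
    qed
    have "(e v, e w) \<in> E" if vw: "(v, w) \<in> E" for v w
    proof -
      have "v \<in> range h" "w \<in> range h" unfolding S using vw by (auto simp: Field_def)
      then obtain x y where "v = h x" "w = h y" by blast
      then show ?thesis using edge[of x y j] j vw hh(1) by (simp add: e hom3_def)
    qed
    then have "\<forall>(v, w) \<in> E. (e v, e w) \<in> E" by blast
    then have inj_e: "inj_on e (range h)" using core unfolding S core_graph_def by simp
    have only: "h x = h (\<lambda>_. x j)" for x
      by (rule inj_onD[OF inj_e]) (simp_all add: e)
    define k where "k t = h (\<lambda>_. t)" for t
    have "(k s, k t) \<in> E \<longleftrightarrow> s \<noteq> t" for s t
      using edge[OF _ j, of "\<lambda>_. s" "\<lambda>_. t"] hh(1) by (auto simp: k_def hom3_def)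
    moreover have "bij_betw k UNIV (Field E)"
      unfolding bij_betw_def
    proof
      show "inj k"
      proof (rule injI)
        fix s t assume "k s = k t"
        then show "s = t" using iff[of "\<lambda>_. s" "\<lambda>_. t"] j by (auto simp: k_def)
      qed
      have "h x \<in> range k" for x using only[of x] unfolding k_def by (rule range_eqI)
      then show "range k = Field E" unfolding S[symmetric] by (auto simp: k_def)
    qed
    ultimately show False using chooses_K3[of k E K] no_i by blast
  qed
qed

section \<open>Odd girth and partial polymorphisms\<close>

lemma pair_graph_facts:
  assumes "pair_graph H"
  shows "finite (pverts H)" "parcs H \<subseteq> pverts H \<times> pverts H" "sym (parcs H)" "irrefl (parcs H)"
proof -
  interpret pair_graph H by fact
  show "finite (pverts H)" by (rule pair_finite_verts)
  show "parcs H \<subseteq> pverts H \<times> pverts H"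
    using arc_fst_in_verts arc_snd_in_verts by (fastforce simp: subset_iff)
  show "sym (parcs H)" using arcs_symmetric by (auto intro: symI)
  show "irrefl (parcs H)" using pair_no_loops by (force simp: irrefl_def)
qed

section \<open>Odd closed walks, two-colourings and induced odd cycles\<close>

lemma sym_relpow:
  assumes "sym E" shows "(x, y) \<in> E ^^ n \<Longrightarrow> (y, x) \<in> E ^^ n"
proof (induction n arbitrary: x y)
  case (Suc n)
  then obtain z where z: "(x, z) \<in> E ^^ n" "(z, y) \<in> E" by (elim relpow_Suc_E)
  have "(y, z) \<in> E" using z(2) assms by (meson symE)
  then show ?case using Suc.IH[OF z(1)] by (rule relpow_Suc_I2)
qed simp

lemma sym_rtrancl_iff:
  assumes "sym E" "(u, v) \<in> E" shows "(r, u) \<in> E\<^sup>* \<longleftrightarrow> (r, v) \<in> E\<^sup>*"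
proof -
  have "(v, u) \<in> E" using assms by (meson symE)
  then show ?thesis using assms(2) by (meson rtrancl.rtrancl_into_rtrancl)
qed

lemma relpow_append: "(x, y) \<in> E ^^ m \<Longrightarrow> (y, z) \<in> E ^^ n \<Longrightarrow> (x, z) \<in> E ^^ (m + n)"
  by (auto simp: relpow_add)

lemma relpow_Suc_append:
  assumes "(x, y) \<in> E ^^ m" "(y, y') \<in> E" "(y', z) \<in> E ^^ n" shows "(x, z) \<in> E ^^ (m + 1 + n)"
proof -
  have "(y, y') \<in> E ^^ 1" using assms(2) by simp
  from relpow_append[OF relpow_append[OF assms(1) this] assms(3)] show ?thesis .
qed

text \<open>A vertex is coloured by the parity of walks from a root of its component. Walks of even
  length to both ends of an edge would close up to an odd walk.\<close>

lemma two_colouring: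
  assumes E: "sym E" and no: "\<And>m x. odd m \<Longrightarrow> (x, x) \<notin> E ^^ m"
  shows "\<exists>A. \<forall>(u, v) \<in> E. u \<in> A \<longleftrightarrow> v \<notin> A"
proof -
  define root where "root v = (SOME r. (r, v) \<in> E\<^sup>*)" for v
  have root: "(root v, v) \<in> E\<^sup>*" for v unfolding root_def by (rule someI[of _ v]) simp
  define A where "A = {v. \<exists>m. even m \<and> (root v, v) \<in> E ^^ m}"
  have "u \<in> A \<longleftrightarrow> v \<notin> A" if uv: "(u, v) \<in> E" for u v
  proof
    have r: "root v = root u" using sym_rtrancl_iff[OF E uv] by (simp add: root_def)
    show "v \<notin> A" if "u \<in> A"
    proof
      assume "v \<in> A"
      then obtain m m' where m: "even m" "(root u, u) \<in> E ^^ m" "even m'" "(root u, v) \<in> E ^^ m'"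
        using \<open>u \<in> A\<close> by (auto simp: A_def r)
      have "(root u, root u) \<in> E ^^ (m + 1 + m')"
        by (rule relpow_Suc_append[OF m(2) uv sym_relpow[OF E m(4)]])
      moreover have "odd (m + 1 + m')" using m by simp
      ultimately show False using no by blast
    qed
    show "u \<in> A" if "v \<notin> A"
    proof -
      obtain m where m: "(root u, u) \<in> E ^^ m" using root rtrancl_power by blast
      then have "(root v, v) \<in> E ^^ Suc m" using uv by (auto simp: r)
      then have "even m" using \<open>v \<notin> A\<close> unfolding A_def by (metis (mono_tags, lifting) even_Suc mem_Collect_eq)
      then show ?thesis using m by (auto simp: A_def)
    qed
  qed
  then show ?thesis by blast
qed

lemma two_colouring_relpow:
  assumes "\<forall>(u, v) \<in> E. u \<in> A \<longleftrightarrow> v \<notin> A"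
  shows "(x, y) \<in> E ^^ m \<Longrightarrow> (x \<in> A \<longleftrightarrow> y \<in> A) \<longleftrightarrow> even m"
proof (induction m arbitrary: y)
  case (Suc m)
  then obtain z where z: "(x, z) \<in> E ^^ m" "(z, y) \<in> E" by (elim relpow_Suc_E)
  show ?case using Suc.IH[OF z(1)] bspec[OF assms z(2)] by auto
qed simp

lemma walk_segment:
  assumes "\<And>i. i < m \<Longrightarrow> (f i, f (Suc i)) \<in> E"
  shows "i \<le> j \<Longrightarrow> j \<le> m \<Longrightarrow> (f i, f j) \<in> E ^^ (j - i)"
proof (induction j)
  case (Suc j)
  show ?case
  proof (cases "i = Suc j")
    case False
    then have "(f i, f j) \<in> E ^^ (j - i)" "i \<le> j" using Suc by simp_all
    moreover have "(f j, f (Suc j)) \<in> E" using assms Suc.prems(2) by simp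
    ultimately have "(f i, f (Suc j)) \<in> E ^^ Suc (j - i)" by auto
    then show ?thesis using \<open>i \<le> j\<close> by (simp only: Suc_diff_le)
  qed simp
qed simp

text \<open>A repeated vertex or a chord splits the walk into two closed walks, one of which is odd
  and shorter. The statement is about a bare relation because it is used for \<open>H\<close> and
  also for a graph on the coordinates of a relation.\<close>

lemma shortest_odd_walk:
  assumes E: "sym E" "irrefl E" and x: "odd m" "(x, x) \<in> E ^^ m"
    and min: "\<And>y l. odd l \<Longrightarrow> (y, y) \<in> E ^^ l \<Longrightarrow> m \<le> l"
  shows "\<exists>f. 3 \<le> m \<and> inj_on f {..<m} \<and>
     (\<forall>i<m. \<forall>j<m. (f i, f j) \<in> E \<longleftrightarrow> j = Suc i mod m \<or> i = Suc j mod m)"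
proof -
  obtain f where f0: "f 0 = x" "f m = x" and step: "\<And>i. i < m \<Longrightarrow> (f i, f (Suc i)) \<in> E"
    using x(2) by (auto simp: relpow_fun_conv)
  have seg: "(f i, f j) \<in> E ^^ (j - i)" if "i \<le> j" "j \<le> m" for i j
    using walk_segment[of m f E i j] step that by blast
  have m: "0 < m" using x(1) by (cases m) auto
  have "m \<noteq> 1" using step[of 0] f0 E(2) by (auto simp: irrefl_def)
  moreover have "m \<noteq> 2" using x(1) by auto
  ultimately have m3: "3 \<le> m" using m by linarith
  have start: "(x, f i) \<in> E ^^ i" and rest: "(f i, x) \<in> E ^^ (m - i)" if "i \<le> m" for i
    using seg[of 0 i] seg[of i m] that f0 by simp_all
  have ne: "f i \<noteq> f j" if ij: "i < j" "j < m" for i j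
  proof
    assume e: "f i = f j"
    have im: "i \<le> m" "j \<le> m" "i \<le> j" using ij by simp_all
    show False
    proof (cases "odd (j - i)")
      case True
      have "(f i, f i) \<in> E ^^ (j - i)" using seg[OF im(3,2)] e by simp
      from min[OF True this] show False using ij by simp
    next
      case False
      have "(f i, x) \<in> E ^^ (m - j)" using rest[OF im(2)] e by simp
      from relpow_append[OF start[OF im(1)] this] have "(x, x) \<in> E ^^ (i + (m - j))" .
      moreover have "odd (i + (m - j))" using False x(1) ij by auto
      ultimately have "m \<le> i + (m - j)" using min by blast
      then show False using ij by simp
    qed
  qed
  have chord: "j = Suc i \<or> i = 0 \<and> Suc j = m" if ij: "i < j" "j < m" and c: "(f i, f j) \<in> E" for i j
  proof -
    have im: "i \<le> m" "j \<le> m" "i \<le> j" using ij by simp_all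
    show ?thesis
    proof (cases "odd (j - i)")
      case True
      from relpow_Suc_append[OF start[OF im(1)] c rest[OF im(2)]] have "(x, x) \<in> E ^^ (i + 1 + (m - j))" .
      moreover have "odd (i + 1 + (m - j))" using True x(1) ij by auto
      ultimately have "m \<le> i + 1 + (m - j)" using min by blast
      then show ?thesis using ij by arith
    next
      case False
      have "(f j, f i) \<in> E" using c E(1) by (meson symE)
      with seg[OF im(3,2)] have "(f i, f i) \<in> E ^^ Suc (j - i)" by auto
      moreover have "odd (Suc (j - i))" using False by simp
      ultimately have "m \<le> Suc (j - i)" using min by blast
      then show ?thesis using ij by linarith
    qed
  qed
  have inj: "inj_on f {..<m}"
    by (rule inj_onI) (metis lessThan_iff linorder_neqE_nat ne)
  have edge: "(f i, f (Suc i mod m)) \<in> E" if "i < m" for i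
  proof (cases "Suc i = m")
    case True
    then show ?thesis using step[OF that] f0 by simp
  next
    case False
    then have "Suc i mod m = Suc i" using that by simp
    then show ?thesis using step[OF that] by simp
  qed
  have "(f i, f j) \<in> E \<longleftrightarrow> j = Suc i mod m \<or> i = Suc j mod m" if ij: "i < m" "j < m" for i j
  proof
    assume c: "(f i, f j) \<in> E"
    then have c': "(f j, f i) \<in> E" using E(1) by (meson symE)
    have "i \<noteq> j" using c E(2) by (auto simp: irrefl_def)
    then consider "i < j" | "j < i" by linarith
    then show "j = Suc i mod m \<or> i = Suc j mod m"
    proof cases
      case 1
      then show ?thesis using chord[OF 1 ij(2) c] ij by auto
    next
      case 2
      then show ?thesis using chord[OF 2 ij(1) c'] ij by auto
    qed
  next
    assume "j = Suc i mod m \<or> i = Suc j mod m"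
    then show "(f i, f j) \<in> E"
    proof
      assume "j = Suc i mod m"
      then show ?thesis using edge[OF ij(1)] by simp
    next
      assume "i = Suc j mod m"
      then have "(f j, f i) \<in> E" using edge[OF ij(2)] by simp
      then show ?thesis using E(1) by (meson symE)
    qed
  qed
  then show ?thesis using m3 inj by blast
qed

lemma shortest_exists:
  assumes "odd m" "(x, x) \<in> E ^^ m"
  obtains k y where "k \<le> m" "odd k" "(y, y) \<in> E ^^ k" "\<And>z l. odd l \<Longrightarrow> (z, z) \<in> E ^^ l \<Longrightarrow> k \<le> l"
proof -
  let ?P = "\<lambda>k. odd k \<and> (\<exists>y. (y, y) \<in> E ^^ k)"
  define k where "k = (LEAST k. ?P k)"
  have P: "?P m" using assms by blast
  have 1: "?P k" unfolding k_def by (rule LeastI[of ?P, OF P])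
  have 2: "k \<le> l" if "?P l" for l unfolding k_def by (rule Least_le[of ?P, OF that])
  from 1 obtain y where "(y, y) \<in> E ^^ k" by blast
  with 1 show thesis using 2 P by (intro that[of k y]) blast+
qed

lemma odd_walk_not_bipartite:
  assumes "odd m" "(x, x) \<in> parcs H ^^ m" shows "\<not> bipartite H"
proof
  assume "bipartite H"
  then obtain A where "\<forall>(u, v) \<in> parcs H. u \<in> A \<longleftrightarrow> v \<notin> A" unfolding bipartite_def by blast
  from two_colouring_relpow[OF this assms(2)] assms(1) show False by simp
qed

lemma induced_cycle_exists:
  assumes H: "pair_graph H" and m: "odd m" "(x, x) \<in> parcs H ^^ m"
  shows "\<exists>k \<le> m. odd k \<and> (\<exists>c. induced_cycle H c \<and> length c = k)"
proof -
  obtain k y where k: "k \<le> m" "odd k" "(y, y) \<in> parcs H ^^ k"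
    and min: "\<And>z l. odd l \<Longrightarrow> (z, z) \<in> parcs H ^^ l \<Longrightarrow> k \<le> l"
    using shortest_exists[OF m] by blast
  obtain f where f: "3 \<le> k" "inj_on f {..<k}"
      "\<And>i j. i < k \<Longrightarrow> j < k \<Longrightarrow> (f i, f j) \<in> parcs H \<longleftrightarrow> j = Suc i mod k \<or> i = Suc j mod k"
    using shortest_odd_walk[OF pair_graph_facts(3,4)[OF H] k(2,3)] min by blast
  have "induced_cycle H (map f [0..<k])"
    unfolding induced_cycle_def
  proof (intro conjI allI impI)
    show "distinct (map f [0..<k])" using f(2) by (simp add: distinct_map atLeast0LessThan)
    have "f i \<in> pverts H" if "i < k" for i
    proof -
      have "(f i, f (Suc i mod k)) \<in> parcs H" using f(3)[OF that, of "Suc i mod k"] f(1) by simp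
      then show ?thesis using pair_graph_facts(2)[OF H] by blast
    qed
    then show "set (map f [0..<k]) \<subseteq> pverts H" by auto
  qed (use f in simp_all)
  then show ?thesis using k by (intro exI[of _ k]) auto
qed

lemma odd_girth_le:
  assumes H: "pair_graph H" and n: "odd_girth H \<le> enat n"
  shows "\<exists>c. induced_cycle H c \<and> odd (length c) \<and> length c \<le> n"
proof -
  let ?P = "\<lambda>k. odd k \<and> (\<exists>c. induced_cycle H c \<and> length c = k)"
  have nb: "\<not> bipartite H" using n by (auto simp: odd_girth_def)
  then have "\<exists>m x. odd m \<and> (x, x) \<in> parcs H ^^ m"
    using two_colouring[OF pair_graph_facts(3)[OF H]] unfolding bipartite_def by blast
  then have "\<exists>k. ?P k" using induced_cycle_exists[OF H] by blast
  then have "?P (LEAST k. ?P k)" by (rule LeastI_ex)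
  moreover have "(LEAST k. ?P k) \<le> n" using n nb by (simp add: odd_girth_def)
  ultimately show ?thesis by metis
qed

lemma odd_girth_gt:
  assumes H: "pair_graph H" and n: "odd_girth H > enat n" and m: "odd m" "(x, x) \<in> parcs H ^^ m"
  shows "n < m"
proof (rule ccontr)
  assume "\<not> n < m"
  let ?P = "\<lambda>k. odd k \<and> (\<exists>c. induced_cycle H c \<and> length c = k)"
  obtain k where k: "k \<le> m" "?P k" using induced_cycle_exists[OF H m] by blast
  then have "(LEAST k. ?P k) \<le> k" by (intro Least_le) auto
  then show False using n k \<open>\<not> n < m\<close> odd_walk_not_bipartite[OF m] by (simp add: odd_girth_def)
qed

section \<open>Relations preserved by the partial polymorphisms of the edge relation\<close>

lemma edge_relation_iff [simp]: "[u, v] \<in> edge_relation H \<longleftrightarrow> (u, v) \<in> parcs H"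
  by (auto simp: edge_relation_def)

lemma upt_two: "[0..<2] = [0, Suc 0]"
  by (simp add: upt_rec)

text \<open>An \<open>n\<close>-ary relation preserved by all partial polymorphisms of the edge relation is defined by the
  equalities and edges that hold between its coordinates: a tuple \<open>s\<close> satisfying these is the
  value of the partial function that maps the rows of the matrix of all tuples to the entries of \<open>s\<close>.\<close>

lemma qfpp_definable:
  assumes V: "finite V" "parcs H \<subseteq> V \<times> V" and R: "R \<subseteq> nlists n V" "R \<noteq> {}"
    and pol: "pPol V 2 (edge_relation H) \<subseteq> pPol V n R"
    and s: "s \<in> nlists n V"
    and eqs: "\<And>i j. i < n \<Longrightarrow> j < n \<Longrightarrow> \<forall>r \<in> R. r ! i = r ! j \<Longrightarrow> s ! i = s ! j"
    and edges: "\<And>i j. i < n \<Longrightarrow> j < n \<Longrightarrow> \<forall>r \<in> R. (r ! i, r ! j) \<in> parcs H \<Longrightarrow> (s ! i, s ! j) \<in> parcs H"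
  shows "s \<in> R"
proof -
  have "finite (nlists n V)" unfolding nlists_def using finite_lists_length_eq[OF V(1), of n] by (simp only: conj_commute)
  then have "finite R" using R(1) finite_subset by blast
  then obtain rs where rs: "set rs = R" using finite_list by blast
  define m where "m = length rs"
  have m: "1 \<le> m" using rs R(2) unfolding m_def by (cases rs) auto
  define row where "row i = map (\<lambda>r. r ! i) rs" for i
  \<comment> \<open>Equal rows mean that two coordinates agree in all tuples of \<open>R\<close>. By
    \<open>eqs\<close> the partial function \<open>f\<close> is therefore well defined.\<close>
  have row_eq: "s ! i = s ! j" if "i < n" "j < n" "row i = row j" for i j
    using that by (intro eqs) (auto simp: row_def rs)
  define f where "f x = (if \<exists>i<n. x = row i then Some (s ! (SOME i. i < n \<and> x = row i)) else None)" for x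
  have f: "f (row i) = Some (s ! i)" if "i < n" for i
  proof -
    have "(SOME j. j < n \<and> row i = row j) < n \<and> row i = row (SOME j. j < n \<and> row i = row j)"
      by (rule someI[of _ i]) (use that in simp)
    then show ?thesis using row_eq that unfolding f_def by (metis (no_types, lifting))
  qed
  have domf: "dom f = row ` {..<n}"
    by (auto simp: f_def dom_def split: if_splits)
  have rowV: "row i \<in> nlists m V" if "i < n" for i
  proof (rule nlistsI)
    show "set (row i) \<subseteq> V" using R(1) that by (auto simp: row_def rs intro!: nlistsE_nth_in)
  qed (simp add: row_def m_def)
  have rs_nth: "rs ! j \<in> R" if "j < m" for j using that rs by (auto simp: m_def)
  have "ran f \<subseteq> V"
  proof
    fix y assume "y \<in> ran f"
    then obtain x where x: "f x = Some y" by (auto simp: ran_def)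
    then have "x \<in> row ` {..<n}" using domf by blast
    then obtain i where i: "i < n" "x = row i" by blast
    then have "y = s ! i" using x f by simp
    then show "y \<in> V" using nlistsE_nth_in[OF s i(1)] by simp
  qed
  moreover have "dom f \<subseteq> nlists m V" using rowV by (auto simp: domf)
  \<comment> \<open>Two rows that form an edge in every column are two coordinates that form an edge
    in every tuple of \<open>R\<close>, so \<open>edges\<close> applies to their images under
    \<open>f\<close>.\<close>
  moreover have "map (\<lambda>i. the (f (map (M i) [0..<m]))) [0..<2] \<in> edge_relation H"
    if M: "\<forall>j < m. map (\<lambda>i. M i j) [0..<2] \<in> edge_relation H" "\<forall>i < 2. map (M i) [0..<m] \<in> dom f"
    for M :: "nat \<Rightarrow> nat \<Rightarrow> 'a"
  proof -
    have "map (M 0) [0..<m] \<in> row ` {..<n}" "map (M (Suc 0)) [0..<m] \<in> row ` {..<n}"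
      using M(2) unfolding domf by simp_all
    then obtain i i' where i: "i < n" "i' < n" "map (M 0) [0..<m] = row i" "map (M (Suc 0)) [0..<m] = row i'"
      by blast
    have "(r ! i, r ! i') \<in> parcs H" if rR: "r \<in> R" for r
    proof -
      have "r \<in> set rs" using rR rs by simp
      then obtain j where j: "j < m" "r = rs ! j" unfolding m_def in_set_conv_nth by blast
      have "map (M 0) [0..<m] ! j = row i ! j" "map (M (Suc 0)) [0..<m] ! j = row i' ! j" using i by simp_all
      then have "M 0 j = r ! i" "M (Suc 0) j = r ! i'" using j by (simp_all add: row_def m_def)
      moreover have "(M 0 j, M (Suc 0) j) \<in> parcs H" using M(1) j by (simp add: upt_two)
      ultimately show ?thesis by simp
    qed
    then have "(s ! i, s ! i') \<in> parcs H" using edges[OF i(1,2)] by blast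
    then show ?thesis by (simp add: upt_two i(3,4) f i(1,2))
  qed
  ultimately have "(m, f) \<in> pPol V 2 (edge_relation H)"
    using m unfolding pPol_def partial_polymorphism_def by blast
  then have "partial_polymorphism V n R m f" using pol unfolding pPol_def by blast
  have rowm: "map (\<lambda>j. rs ! j ! i) [0..<m] = row i" for i
    unfolding row_def m_def by (rule nth_equalityI) auto
  from \<open>partial_polymorphism V n R m f\<close> have "map (\<lambda>i. the (f (map (\<lambda>j. rs ! j ! i) [0..<m]))) [0..<n] \<in> R"
    unfolding partial_polymorphism_def
  proof (elim conjE allE[of _ "\<lambda>i j. rs ! j ! i"] impE)
    have "map (\<lambda>i. rs ! j ! i) [0..<n] = rs ! j" if "j < m" for j
    proof -
      have "length (rs ! j) = n" using rs_nth[OF that] R(1) by auto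
      then show ?thesis using map_nth[of "rs ! j"] by simp
    qed
    then show "\<forall>j<m. map (\<lambda>i. rs ! j ! i) [0..<n] \<in> R" using rs_nth by simp
    show "\<forall>i<n. map (\<lambda>j. rs ! j ! i) [0..<m] \<in> dom f"
      unfolding rowm domf by auto
  qed
  moreover have "map (\<lambda>i. the (f (row i))) [0..<n] = s"
    by (rule nth_equalityI) (use f s in auto)
  ultimately show ?thesis by (simp only: rowm)
qed

text \<open>Identifying the coordinates in \<open>A\<close> and those outside \<open>A\<close> turns
  \<open>R\<close> into the edge relation. For matrices: the two rows of a matrix over the edges are
  copied according to \<open>A\<close>, and the result is read off at \<open>i\<close> and
  \<open>j\<close>.\<close>

lemma edge_coordinates_imp_pPol_subset:
  assumes V: "parcs H \<subseteq> V \<times> V"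
    and A: "i < n" "j < n" "i \<in> A" "j \<notin> A"
    and R: "\<forall>r \<in> R. (r ! i, r ! j) \<in> parcs H"
    and two: "\<And>u v. (u, v) \<in> parcs H \<Longrightarrow> map (\<lambda>i. if i \<in> A then u else v) [0..<n] \<in> R"
  shows "pPol V n R \<subseteq> pPol V 2 (edge_relation H)"
proof
  fix p assume p: "p \<in> pPol V n R"
  obtain m f where mf: "p = (m, f)" by fastforce
  have m: "1 \<le> m" and f: "dom f \<subseteq> nlists m V" "ran f \<subseteq> V"
    and pol: "\<And>M :: nat \<Rightarrow> nat \<Rightarrow> 'a. \<forall>j < m. map (\<lambda>i. M i j) [0..<n] \<in> R \<Longrightarrow> \<forall>i < n. map (M i) [0..<m] \<in> dom f \<Longrightarrow>
        map (\<lambda>i. the (f (map (M i) [0..<m]))) [0..<n] \<in> R"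
    using p unfolding mf pPol_def partial_polymorphism_def by blast+
  have "map (\<lambda>i. the (f (map (M i) [0..<m]))) [0..<2] \<in> edge_relation H"
    if M: "\<forall>j < m. map (\<lambda>i. M i j) [0..<2] \<in> edge_relation H" "\<forall>i < 2. map (M i) [0..<m] \<in> dom f"
    for M :: "nat \<Rightarrow> nat \<Rightarrow> 'a"
  proof -
    define M' where "M' i = M (if i \<in> A then 0 else Suc 0)" for i
    have "map (\<lambda>i. M' i j) [0..<n] \<in> R" if "j < m" for j
    proof -
      have "(M 0 j, M (Suc 0) j) \<in> parcs H" using M(1) that by (simp add: upt_two)
      from two[OF this] show ?thesis by (simp add: M'_def if_distrib[of "\<lambda>i. M i j"])
    qed
    moreover have "map (M' i) [0..<m] \<in> dom f" for i using M(2) by (simp add: M'_def)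
    ultimately have "map (\<lambda>i. the (f (map (M' i) [0..<m]))) [0..<n] \<in> R" by (intro pol) blast+
    from bspec[OF R this] show ?thesis using A by (simp add: upt_two M'_def)
  qed
  then show "p \<in> pPol V 2 (edge_relation H)"
    using m f unfolding mf pPol_def partial_polymorphism_def by blast
qed

theorem large_odd_girth_trivial:
  assumes H: "pair_graph H" and n: "1 \<le> n" and og: "odd_girth H > enat n"
    and R: "R \<subseteq> nlists n (pverts H)" "R \<noteq> {}"
    and pol: "pPol (pverts H) 2 (edge_relation H) \<subset> pPol (pverts H) n R"
  shows "csp_trivial (pverts H) n R"
proof -
  note V = pair_graph_facts[OF H]
  note def = qfpp_definable[OF V(1,2) R psubset_imp_subset[OF pol]]
  \<comment> \<open>Every tuple of \<open>R\<close> is a homomorphism from this graph to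
    \<open>H\<close>, so an odd cycle of \<open>D\<close> is at least as long as the odd girth; but
    \<open>D\<close> has only \<open>n\<close> vertices.\<close>
  define D where "D = {(i, j). i < n \<and> j < n \<and> (\<forall>r \<in> R. (r ! i, r ! j) \<in> parcs H)}"
  obtain r0 where r0: "r0 \<in> R" using R(2) by blast
  have symD: "sym D" using V(3) unfolding D_def sym_def by blast
  have irrD: "irrefl D" using V(4) r0 unfolding D_def irrefl_def by blast
  have D: "(i, i) \<notin> D ^^ m" if "odd m" for i m
  proof
    assume "(i, i) \<in> D ^^ m"
    from shortest_exists[OF that this] obtain k y where k: "odd k" "(y, y) \<in> D ^^ k"
      and min: "\<And>z l. odd l \<Longrightarrow> (z, z) \<in> D ^^ l \<Longrightarrow> k \<le> l" by metis
    obtain f where f: "inj_on f {..<k}" "\<And>i j. i < k \<Longrightarrow> j < k \<Longrightarrow> (f i, f j) \<in> D \<longleftrightarrow> j = Suc i mod k \<or> i = Suc j mod k"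
      using shortest_odd_walk[OF symD irrD k] min by blast
    have "f ` {..<k} \<subseteq> {..<n}"
    proof
      fix y assume "y \<in> f ` {..<k}"
      then obtain i where i: "i < k" "y = f i" by blast
      then have "(f i, f (Suc i mod k)) \<in> D" using f(2)[of i "Suc i mod k"] by simp
      then show "y \<in> {..<n}" using i by (simp add: D_def)
    qed
    then have "card (f ` {..<k}) \<le> card {..<n}" by (intro card_mono) simp_all
    then have "k \<le> n" by (simp add: card_image[OF f(1)])
    have "(x, y) \<in> D ^^ l \<Longrightarrow> (r0 ! x, r0 ! y) \<in> parcs H ^^ l" for x y l
    proof (induction l arbitrary: y)
      case (Suc l)
      then obtain z where z: "(x, z) \<in> D ^^ l" "(z, y) \<in> D" by (elim relpow_Suc_E)
      have "(r0 ! z, r0 ! y) \<in> parcs H" using z(2) r0 unfolding D_def by blast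
      with Suc.IH[OF z(1)] show ?case by (rule relpow_Suc_I)
    qed simp
    from odd_girth_gt[OF H og k(1) this[OF k(2)]] \<open>k \<le> n\<close> show False by simp
  qed
  have "D = {}"
  proof (rule ccontr)
    assume "D \<noteq> {}"
    then obtain i0 j0 where ij0: "(i0, j0) \<in> D" by auto
    obtain A where A: "\<forall>(u, v) \<in> D. u \<in> A \<longleftrightarrow> v \<notin> A" using two_colouring[OF symD D] by blast
    have A: "u \<in> A \<longleftrightarrow> v \<notin> A" if "(u, v) \<in> D" for u v using bspec[OF A that] by simp
    have main: "pPol (pverts H) n R \<subseteq> pPol (pverts H) 2 (edge_relation H)"
      if i: "(i, j) \<in> D" "i \<in> A" for i j
    proof (rule edge_coordinates_imp_pPol_subset[OF V(2)])
      \<comment> \<open>All coordinates that are isolated in \<open>D\<close> go to the same side.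
        Coordinates that are equal throughout \<open>R\<close> have the same neighbours in
        \<open>D\<close>, so they are never separated; with \<open>A\<close> itself two equal
        isolated coordinates might be.\<close>
      define A' where "A' = A \<inter> Domain D"
      show "i < n" "j < n" "\<forall>r \<in> R. (r ! i, r ! j) \<in> parcs H" using i(1) by (auto simp: D_def)
      show "i \<in> A'" "j \<notin> A'" using i A[OF i(1)] by (auto simp: A'_def)
      fix u v assume uv: "(u, v) \<in> parcs H"
      have vu: "(v, u) \<in> parcs H" using uv V(3) by (meson symE)
      show "map (\<lambda>i. if i \<in> A' then u else v) [0..<n] \<in> R"
      proof (rule def)
        have "u \<in> pverts H" "v \<in> pverts H" using uv V(2) by blast+
        then show "map (\<lambda>i. if i \<in> A' then u else v) [0..<n] \<in> nlists n (pverts H)" by (intro nlistsI) auto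
      next
        fix i j assume ij: "i < n" "j < n" "\<forall>r\<in>R. r ! i = r ! j"
        have nb: "(i, l) \<in> D \<longleftrightarrow> (j, l) \<in> D" for l using ij by (auto simp: D_def)
        have "i \<in> A' \<longleftrightarrow> j \<in> A'"
        proof (cases "i \<in> Domain D")
          case True
          then obtain l where "(i, l) \<in> D" by blast
          then show ?thesis using nb A[of i l] A[of j l] by (auto simp: A'_def)
        next
          case False
          then show ?thesis using nb by (auto simp: A'_def)
        qed
        then show "map (\<lambda>i. if i \<in> A' then u else v) [0..<n] ! i = map (\<lambda>i. if i \<in> A' then u else v) [0..<n] ! j"
          using ij by simp
      next
        fix i j assume ij: "i < n" "j < n" "\<forall>r\<in>R. (r ! i, r ! j) \<in> parcs H"
        then have "(i, j) \<in> D" by (simp add: D_def)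
        moreover have "(j, i) \<in> D" using calculation symD by (meson symE)
        ultimately have "i \<in> A' \<longleftrightarrow> j \<notin> A'" using A[of i j] by (auto simp: A'_def)
        then show "(map (\<lambda>i. if i \<in> A' then u else v) [0..<n] ! i, map (\<lambda>i. if i \<in> A' then u else v) [0..<n] ! j) \<in> parcs H"
          using ij uv vu by auto
      qed
    qed
    have "(j0, i0) \<in> D" using ij0 symD by (meson symE)
    then have "pPol (pverts H) n R \<subseteq> pPol (pverts H) 2 (edge_relation H)"
      using main ij0 A[OF ij0] by blast
    then show False using pol by blast
  qed
  have "r0 ! 0 \<in> pverts H" using r0 R(1) n by (intro nlistsE_nth_in[of r0 n]) auto
  then obtain v where v: "v \<in> pverts H" by blast
  have const: "replicate n v \<in> R"
  proof (rule def)
    show "replicate n v \<in> nlists n (pverts H)" using v by (intro nlistsI) auto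
    show "(replicate n v ! i, replicate n v ! j) \<in> parcs H"
      if "i < n" "j < n" "\<forall>r\<in>R. (r ! i, r ! j) \<in> parcs H" for i j
    proof -
      have "(i, j) \<in> D" using that by (simp add: D_def)
      then show ?thesis using \<open>D = {}\<close> by simp
    qed
  qed simp
  have "map (\<lambda>_. v) c \<in> R" if "c \<in> nlists n X" for c and X :: "nat set"
    using const that by (simp add: map_replicate_const)
  then show ?thesis
    unfolding csp_trivial_def csp_instances_def csp_satisfiable_def using v
    by (auto intro!: exI[of _ "\<lambda>_. v"])
qed

text \<open>A machine without proper states starts in its halting state and computes the identity,
  and no pair is the string \<open>[True]\<close>.\<close>

lemma empty_in_NP: "{} \<in> NP"
proof -
  define M where "M = \<lparr>tapes = 1, states = 0, symbols = 3, transition = (\<lambda>_ _. (0, []))\<rparr>"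
  have "turing_machine M" by (simp add: turing_machine_def M_def)
  moreover have "halts_with M ((step M ^^ 0) (initial w)) w" for w
    by (simp add: halts_with_def initial_def M_def)
  ultimately have "polytime (\<lambda>w. w)"
    unfolding polytime_def by (intro exI[of _ M] exI[of _ 0] conjI allI exI[of _ "0 :: nat"]) auto
  moreover have "pair_string x y \<noteq> [True]" for x y
    by (cases x) (auto simp: pair_string_def)
  ultimately show ?thesis unfolding NP_def by (auto intro!: exI[of _ "\<lambda>w. w"])
qed

text \<open>A reduction from the empty language must produce no-instances, and there are
  none.\<close>

lemma trivial_not_NP_complete:
  assumes "csp_trivial V n R" shows "\<not> NP_complete (CSP V n R)"
proof
  assume "NP_complete (CSP V n R)"
  then have "polytime_reducible {} (CSP V n R)" using empty_in_NP by (simp add: NP_complete_def)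
  then obtain f :: "bool list \<Rightarrow> bool list" where "f [] \<in> snd (CSP V n R)"
    unfolding polytime_reducible_def split_beta by blast
  then show False using assms by (auto simp: CSP_def csp_trivial_def)
qed

section \<open>The relation of closed walks of odd length\<close>

definition closed_walks :: "'v pair_pre_digraph \<Rightarrow> nat \<Rightarrow> nat \<Rightarrow> 'v list set" where
  "closed_walks H n k = {r \<in> nlists n (pverts H). \<forall>i<k. (r ! i, r ! (Suc i mod k)) \<in> parcs H}"

lemma closed_walks_nonempty:
  assumes c: "induced_cycle H c" "length c \<le> n"
  shows "c @ replicate (n - length c) (c ! 0) \<in> closed_walks H n (length c)"
proof -
  have k: "3 \<le> length c" and cV: "set c \<subseteq> pverts H" using c(1) by (auto simp: induced_cycle_def)
  have e: "(c ! i, c ! (Suc i mod length c)) \<in> parcs H" if "i < length c" for i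
  proof -
    have "0 < length c" using k by linarith
    then have "Suc i mod length c < length c" by (rule mod_less_divisor)
    then show ?thesis using c(1) that unfolding induced_cycle_def by blast
  qed
  have "c ! 0 \<in> pverts H" using cV k by (auto intro!: subsetD[OF cV] nth_mem)
  then have "c @ replicate (n - length c) (c ! 0) \<in> nlists n (pverts H)"
    using cV c(2) by (intro nlistsI) auto
  moreover have "Suc i mod length c < length c" for i by (rule mod_less_divisor) (use k in linarith)
  ultimately show ?thesis using e by (simp add: closed_walks_def nth_append)
qed

text \<open>Membership is a conjunction of edge conditions, and each of them concerns a submatrix
  with two rows.\<close>

lemma closed_walks_pPol:
  assumes k: "0 < k" "k \<le> n"
  shows "pPol (pverts H) 2 (edge_relation H) \<subseteq> pPol (pverts H) n (closed_walks H n k)"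
proof
  fix p assume p: "p \<in> pPol (pverts H) 2 (edge_relation H)"
  obtain m f where mf: "p = (m, f)" by fastforce
  have m: "1 \<le> m" and f: "dom f \<subseteq> nlists m (pverts H)" "ran f \<subseteq> pverts H"
    and pol: "\<And>M :: nat \<Rightarrow> nat \<Rightarrow> 'a. \<forall>j < m. map (\<lambda>i. M i j) [0..<2] \<in> edge_relation H \<Longrightarrow>
        \<forall>i < 2. map (M i) [0..<m] \<in> dom f \<Longrightarrow> map (\<lambda>i. the (f (map (M i) [0..<m]))) [0..<2] \<in> edge_relation H"
    using p unfolding mf pPol_def partial_polymorphism_def by blast+
  have "map (\<lambda>i. the (f (map (M i) [0..<m]))) [0..<n] \<in> closed_walks H n k"
    if M: "\<forall>j < m. map (\<lambda>i. M i j) [0..<n] \<in> closed_walks H n k" "\<forall>i < n. map (M i) [0..<m] \<in> dom f"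
    for M :: "nat \<Rightarrow> nat \<Rightarrow> 'a"
  proof -
    have "the (f (map (M i) [0..<m])) \<in> pverts H" if i: "i < n" for i
    proof -
      obtain y where "f (map (M i) [0..<m]) = Some y" using M(2) i by blast
      then show ?thesis using f(2) by (auto simp: ran_def)
    qed
    then have "map (\<lambda>i. the (f (map (M i) [0..<m]))) [0..<n] \<in> nlists n (pverts H)" by (intro nlistsI) auto
    moreover have "(the (f (map (M i) [0..<m])), the (f (map (M (Suc i mod k)) [0..<m]))) \<in> parcs H" if i: "i < k" for i
    proof -
      define M' where "M' a = M (if a = 0 then i else Suc i mod k)" for a :: nat
      have lt: "Suc i mod k < n" using k by (meson less_le_trans mod_less_divisor)
      have "map (\<lambda>i. M' i j) [0..<2] \<in> edge_relation H" if "j < m" for j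
      proof -
        have "map (\<lambda>i. M i j) [0..<n] \<in> closed_walks H n k" using M(1) that by blast
        then have "(map (\<lambda>i. M i j) [0..<n] ! i, map (\<lambda>i. M i j) [0..<n] ! (Suc i mod k)) \<in> parcs H"
          using i unfolding closed_walks_def by blast
        then show ?thesis using lt i k by (simp add: upt_two M'_def)
      qed
      moreover have "map (M' a) [0..<m] \<in> dom f" for a using M(2) lt i k unfolding M'_def by simp
      ultimately have "map (\<lambda>i. the (f (map (M' i) [0..<m]))) [0..<2] \<in> edge_relation H" by (intro pol) blast+
      then show ?thesis by (simp add: upt_two M'_def)
    qed
    moreover have "Suc i mod k < n" for i using k by (meson less_le_trans mod_less_divisor)
    ultimately show ?thesis using k(2) by (simp add: closed_walks_def)
  qed
  then show "p \<in> pPol (pverts H) n (closed_walks H n k)"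
    using m f unfolding mf pPol_def partial_polymorphism_def by blast
qed

text \<open>The unary partial function that maps both ends of an edge to one of them separates the two
  sets, as an odd closed walk has more than two vertices.\<close>

lemma closed_walks_pPol_strict:
  assumes H: "pair_graph H" and k: "odd k" "k \<le> n" and uv: "(u, v) \<in> parcs H"
  shows "pPol (pverts H) 2 (edge_relation H) \<noteq> pPol (pverts H) n (closed_walks H n k)"
proof -
  have k0: "0 < k" using k(1) by (cases k) auto
  have irr: "(x, x) \<notin> parcs H" for x using pair_graph_facts(4)[OF H] by (auto simp: irrefl_def)
  have V: "u \<in> pverts H" "v \<in> pverts H" using uv pair_graph_facts(2)[OF H] by blast+
  define f where "f = (\<lambda>x. if x = [u] \<or> x = [v] then Some u else None)"
  have domf: "dom f = {[u], [v]}" by (auto simp: f_def dom_def)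
  have "\<not> partial_polymorphism (pverts H) 2 (edge_relation H) 1 f"
  proof
    assume "partial_polymorphism (pverts H) 2 (edge_relation H) 1 f"
    then have "map (\<lambda>i. the (f (map ((\<lambda>i j. if i = 0 then u else v) i) [0..<1]))) [0..<2] \<in> edge_relation H"
      unfolding partial_polymorphism_def
      by (elim conjE allE[of _ "\<lambda>i j. if i = 0 then u else v"] impE) (use uv in \<open>auto simp: upt_two domf\<close>)
    then show False using irr by (simp add: upt_two f_def)
  qed
  moreover have "partial_polymorphism (pverts H) n (closed_walks H n k) 1 f"
    unfolding partial_polymorphism_def
  proof (intro conjI allI impI)
    show "dom f \<subseteq> nlists 1 (pverts H)" using V by (auto simp: domf intro!: nlistsI)
    show "ran f \<subseteq> pverts H" using V by (auto simp: f_def ran_def split: if_splits)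
    fix M :: "nat \<Rightarrow> nat \<Rightarrow> 'a"
    assume M: "\<forall>j<1. map (\<lambda>i. M i j) [0..<n] \<in> closed_walks H n k" "\<forall>i<n. map (M i) [0..<1] \<in> dom f"
    define a where "a i = M i 0" for i
    have e: "(a i, a (Suc i mod k)) \<in> parcs H" if i: "i < k" for i
    proof -
      have "map (\<lambda>i. M i 0) [0..<n] \<in> closed_walks H n k" using M(1) by simp
      then have "(map (\<lambda>i. M i 0) [0..<n] ! i, map (\<lambda>i. M i 0) [0..<n] ! (Suc i mod k)) \<in> parcs H"
        using i unfolding closed_walks_def by blast
      moreover have "Suc i mod k < n" using k0 k(2) by (meson less_le_trans mod_less_divisor)
      ultimately show ?thesis using i k(2) by (simp add: a_def)
    qed
    have ab: "a i = u \<or> a i = v" if "i < k" for i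
      using M(2) that k(2) by (auto simp: domf a_def)
    have flip: "a (Suc i mod k) = u \<longleftrightarrow> a i \<noteq> u" if i: "i < k" for i
      using e[OF i] ab[OF i] ab[of "Suc i mod k"] irr k0 by (metis mod_less_divisor)
    have "a i = u \<longleftrightarrow> (a 0 = u \<longleftrightarrow> even i)" if "i < k" for i
      using that
    proof (induction i)
      case (Suc i)
      then show ?case using flip[of i] by auto
    qed simp
    from this[of "k - 1"] flip[of "k - 1"] k(1) k0 have False by auto
    then show "map (\<lambda>i. the (f (map (M i) [0..<1]))) [0..<n] \<in> closed_walks H n k" ..
  qed
  ultimately have "(1, f) \<in> pPol (pverts H) n (closed_walks H n k) - pPol (pverts H) 2 (edge_relation H)"
    by (simp add: pPol_def)
  then show ?thesis by blast
qed

text \<open>The projection may be a proper subgraph of \<open>H\<close>, as an edge need not lie on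
  a closed walk of length \<open>k\<close>. Reflecting a closed walk gives symmetry, and the
  rotations of the single walk \<open>r0\<close> give an odd closed walk.\<close>

lemma closed_walks_nonbipartite:
  assumes H: "pair_graph H" and k: "odd k" "3 \<le> k" "k \<le> n" and ne: "r0 \<in> closed_walks H n k"
  shows "nonbipartite_graph ((\<lambda>r. (r ! 0, r ! 1)) ` closed_walks H n k)"
proof -
  let ?R = "closed_walks H n k"
  let ?E = "(\<lambda>r. (r ! 0, r ! 1)) ` ?R"
  have irr: "(x, x) \<notin> parcs H" for x using pair_graph_facts(4)[OF H] by (auto simp: irrefl_def)
  have edge: "(r ! i, r ! (Suc i mod k)) \<in> parcs H" if "r \<in> ?R" "i < k" for r i
    using that unfolding closed_walks_def by blast
  have RV: "?R \<subseteq> nlists n (pverts H)" unfolding closed_walks_def by blast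
  have sub: "?E \<subseteq> parcs H"
  proof
    fix p assume "p \<in> ?E"
    then obtain r where r: "r \<in> ?R" "p = (r ! 0, r ! 1)" by blast
    show "p \<in> parcs H" using edge[OF r(1), of 0] r(2) k by simp
  qed
  \<comment> \<open>Reindexing along a map of the cycle that sends neighbours to neighbours yields a
    closed walk again.\<close>
  have re: "map (\<lambda>i. r ! (if i < k then \<rho> i else i)) [0..<n] \<in> ?R"
    if r: "r \<in> ?R" and \<rho>: "\<And>i. i < k \<Longrightarrow> \<rho> i < k"
      and st: "\<And>i. i < k \<Longrightarrow> \<rho> (Suc i mod k) = Suc (\<rho> i) mod k \<or> \<rho> i = Suc (\<rho> (Suc i mod k)) mod k"
    for r and \<rho> :: "nat \<Rightarrow> nat"
  proof -
    have rV: "r \<in> nlists n (pverts H)" using r RV by blast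
    have "r ! (if i < k then \<rho> i else i) \<in> pverts H" if "i < n" for i
      by (rule nlistsE_nth_in[OF rV]) (use \<rho>[of i] that k(3) in auto)
    then have "map (\<lambda>i. r ! (if i < k then \<rho> i else i)) [0..<n] \<in> nlists n (pverts H)" by (intro nlistsI) auto
    moreover have "(r ! \<rho> i, r ! \<rho> (Suc i mod k)) \<in> parcs H" if i: "i < k" for i
      using st[OF i]
    proof
      assume "\<rho> (Suc i mod k) = Suc (\<rho> i) mod k"
      then show ?thesis using edge[OF r \<rho>[OF i]] by simp
    next
      assume a: "\<rho> i = Suc (\<rho> (Suc i mod k)) mod k"
      have "Suc i mod k < k" using k by simp
      from edge[OF r \<rho>[OF this]] a have "(r ! \<rho> (Suc i mod k), r ! \<rho> i) \<in> parcs H" by simp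
      then show ?thesis using pair_graph_facts(3)[OF H] by (meson symE)
    qed
    moreover have "Suc i mod k < k" for i using k by simp
    moreover have "Suc i mod k < n" for i using k by (meson less_le_trans mod_less_divisor order_less_le_trans zero_less_numeral)
    ultimately show ?thesis using k(3) by (simp add: closed_walks_def)
  qed
  have "finite (parcs H)" using finite_subset[OF pair_graph_facts(2)[OF H]] pair_graph_facts(1)[OF H] by simp
  then have "finite ?E" using sub finite_subset by blast
  moreover have "irrefl ?E" using sub irr unfolding irrefl_def by blast
  moreover have "sym ?E"
  proof (rule symI)
    fix x y assume "(x, y) \<in> ?E"
    then obtain r where r: "r \<in> ?R" "x = r ! 0" "y = r ! 1" by blast
    \<comment> \<open>The reflection of the cycle that exchanges the positions 0 and 1.\<close>
    let ?\<rho> = "\<lambda>i. (k + 1 - i) mod k"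
    have "map (\<lambda>i. r ! (if i < k then ?\<rho> i else i)) [0..<n] \<in> ?R"
    proof (rule re[OF r(1)])
      show "?\<rho> (Suc i mod k) = Suc (?\<rho> i) mod k \<or> ?\<rho> i = Suc (?\<rho> (Suc i mod k)) mod k" if "i < k" for i
      proof (cases "Suc i = k")
        case True
        then show ?thesis using k by (auto simp: mod_Suc)
      next
        case False
        then have "Suc i mod k = Suc i" "k + 1 - i = Suc (k + 1 - Suc i)" using that by simp_all
        then show ?thesis by (simp only: mod_Suc_eq simp_thms)
      qed
    qed (use k in simp)
    moreover have "map (\<lambda>i. r ! (if i < k then ?\<rho> i else i)) [0..<n] ! 0 = y"
      "map (\<lambda>i. r ! (if i < k then ?\<rho> i else i)) [0..<n] ! 1 = x" using r k by (simp_all add: mod_Suc)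
    ultimately show "(y, x) \<in> ?E" by (intro image_eqI) auto
  qed
  moreover have "odd_closed_walk ?E"
  proof -
    have step: "(r0 ! (j mod k), r0 ! (Suc j mod k)) \<in> ?E" for j
    proof -
      let ?\<rho> = "\<lambda>i. (i + j) mod k"
      have "map (\<lambda>i. r0 ! (if i < k then ?\<rho> i else i)) [0..<n] \<in> ?R"
      proof (rule re[OF ne])
        show "?\<rho> (Suc i mod k) = Suc (?\<rho> i) mod k \<or> ?\<rho> i = Suc (?\<rho> (Suc i mod k)) mod k" for i
          by (simp add: mod_add_left_eq mod_Suc_eq)
      qed (use k in simp)
      moreover have "map (\<lambda>i. r0 ! (if i < k then ?\<rho> i else i)) [0..<n] ! 0 = r0 ! (j mod k)"
        "map (\<lambda>i. r0 ! (if i < k then ?\<rho> i else i)) [0..<n] ! 1 = r0 ! (Suc j mod k)" using k by simp_all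
      ultimately show ?thesis by (intro image_eqI) auto
    qed
    have "(r0 ! (0 mod k), r0 ! (k mod k)) \<in> ?E ^^ k"
      unfolding relpow_fun_conv by (intro exI[of _ "\<lambda>j. r0 ! (j mod k)"] conjI allI impI refl step)
    moreover obtain m where "k = 2 * m + 1" using k(1) by (elim oddE)
    ultimately show ?thesis unfolding odd_closed_walk_def by auto
  qed
  ultimately show ?thesis by (simp add: nonbipartite_graph_def)
qed

section \<open>A programming language for polynomial time\<close>

text \<open>Registers are stacks of non-blank symbols, so that the blank 0 signals an empty stack:
  \<open>Case r\<close> then branches on 0, and \<open>While r\<close> stops.\<close>

datatype com =
    Skip
  | Emit nat
  | Push nat nat
  | Put nat nat
  | Pop nat
  | Seq com com (infixr \<open>;;\<close> 60)
  | Case nat "nat \<Rightarrow> com"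
  | While nat com

type_synonym store = "(nat \<Rightarrow> nat list) \<times> nat list"

primrec wf_com :: "nat \<Rightarrow> nat \<Rightarrow> com \<Rightarrow> bool" where
  "wf_com k S Skip \<longleftrightarrow> True"
| "wf_com k S (Emit a) \<longleftrightarrow> a < S"
| "wf_com k S (Push r a) \<longleftrightarrow> r < k \<and> a < S"
| "wf_com k S (Put r a) \<longleftrightarrow> r < k \<and> a < S"
| "wf_com k S (Pop r) \<longleftrightarrow> r < k"
| "wf_com k S (Seq c d) \<longleftrightarrow> wf_com k S c \<and> wf_com k S d"
| "wf_com k S (Case r f) \<longleftrightarrow> r < k \<and> (\<forall>a<S. wf_com k S (f a))"
| "wf_com k S (While r c) \<longleftrightarrow> r < k \<and> wf_com k S c"

definition idle :: "nat list \<Rightarrow> (nat \<times> int) list" where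
  "idle s = map (\<lambda>a. (a, 0)) s"

text \<open>The control of the machine is the list of commands still to be executed. Tape \<open>k\<close> is the output
  and the other tapes are stacks with the head on the top. \<open>Put\<close> is the second half of \<open>Push\<close>.\<close>

fun act :: "nat \<Rightarrow> nat \<Rightarrow> com list \<Rightarrow> nat list \<Rightarrow> com list \<times> (nat \<times> int) list" where
  "act k S [] s = ([], idle s)"
| "act k S (Skip # ks) s = (ks, idle s)"
| "act k S (Emit a # ks) s = (ks, (idle s)[k := (a, 1)])"
| "act k S (Push r a # ks) s = (Put r a # ks, (idle s)[r := (s ! r, -1)])"
| "act k S (Put r a # ks) s = (ks, (idle s)[r := (a, 0)])"
| "act k S (Pop r # ks) s = (ks, (idle s)[r := (s ! r, if s ! r = 0 then 0 else 1)])"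
| "act k S (Seq c d # ks) s = (c # d # ks, idle s)"
| "act k S (Case r f # ks) s = (f (if s ! r < S then s ! r else 0) # ks, idle s)"
| "act k S (While r c # ks) s = (if s ! r = 0 then ks else c # While r c # ks, idle s)"

type_synonym cconfig = "com list \<times> (nat \<Rightarrow> int \<Rightarrow> nat) \<times> (nat \<Rightarrow> int)"

definition cstep :: "nat \<Rightarrow> nat \<Rightarrow> cconfig \<Rightarrow> cconfig" where
  "cstep k S = (\<lambda>(ks, t, h).
     let (ks', acts) = act k S ks (map (\<lambda>j. t j (h j)) [0..<Suc k])
     in (ks', \<lambda>j. if j < Suc k then (t j)(h j := fst (acts ! j)) else t j,
         \<lambda>j. if j < Suc k then h j + snd (acts ! j) else h j))"

text \<open>Stacks grow to the left, so that the input as given is already a stack with its first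
  letter on top. Cells to the left of a head may hold remains of popped symbols, whereas the output
  tape must be blank from its head on.\<close>

definition represents :: "nat \<Rightarrow> nat \<Rightarrow> store \<Rightarrow> (nat \<Rightarrow> int \<Rightarrow> nat) \<Rightarrow> (nat \<Rightarrow> int) \<Rightarrow> bool" where
  "represents k S = (\<lambda>(s, out) t h.
     (\<forall>r<k. set (s r) \<subseteq> {0<..<S} \<and> (\<forall>i<length (s r). t r (h r + int i) = s r ! i) \<and>
        t r (h r + int (length (s r))) = 0) \<and>
     h k = int (length out) \<and> (\<forall>i<length out. t k (int i) = out ! i) \<and>
     (\<forall>p\<ge>int (length out). t k p = 0))"

text \<open>Quantifying over the remaining commands \<open>ks\<close> and over all representing
  tapes makes these statements composable. The number of steps is only bounded, so that branches of
  different length can be merged.\<close>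

definition runs :: "nat \<Rightarrow> nat \<Rightarrow> com \<Rightarrow> store \<Rightarrow> store \<Rightarrow> nat \<Rightarrow> bool" where
  "runs k S c st st' n \<longleftrightarrow>
     (\<forall>ks t h. represents k S st t h \<longrightarrow>
        (\<exists>m\<le>n. \<exists>t' h'. (cstep k S ^^ m) (c # ks, t, h) = (ks, t', h') \<and> represents k S st' t' h'))"

definition top :: "nat list \<Rightarrow> nat" where
  "top xs = (case xs of [] \<Rightarrow> 0 | a # _ \<Rightarrow> a)"

lemma top_simps [simp]: "top [] = 0" "top (a # xs) = a"
  by (simp_all add: top_def)

lemma represents_top:
  assumes "represents k S (s, out) t h" "r < k"
  shows "t r (h r) = top (s r)"
  using assms by (cases "s r") (fastforce simp: represents_def)+

lemma represents_nonzero: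
  assumes "represents k S (s, out) t h" "r < k" "s r \<noteq> []"
  shows "0 < top (s r)" "top (s r) < S"
  using assms by (cases "s r"; fastforce simp: represents_def)+

lemma runsI:
  assumes "\<And>ks t h. represents k S st t h \<Longrightarrow>
    \<exists>t' h'. (cstep k S ^^ n) (c # ks, t, h) = (ks, t', h') \<and> represents k S st' t' h'"
  shows "runs k S c st st' n"
  unfolding runs_def using assms by blast

lemma runs_mono: "runs k S c st st' n \<Longrightarrow> n \<le> m \<Longrightarrow> runs k S c st st' m"
  unfolding runs_def by (meson le_trans)

lemma cstep_idle:
  assumes "act k S ks (map (\<lambda>j. t j (h j)) [0..<Suc k]) = (ks', idle (map (\<lambda>j. t j (h j)) [0..<Suc k]))"
  shows "cstep k S (ks, t, h) = (ks', t, h)"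
proof -
  have "idle (map (\<lambda>j. t j (h j)) [0..<Suc k]) ! j = (t j (h j), 0)" if "j < Suc k" for j
    using that by (simp add: idle_def del: upt_Suc)
  then show ?thesis using assms by (auto simp: cstep_def fun_eq_iff simp del: upt_Suc)
qed

lemma cstep_update:
  assumes "act k S ks (map (\<lambda>j. t j (h j)) [0..<Suc k]) =
      (ks', (idle (map (\<lambda>j. t j (h j)) [0..<Suc k]))[r := (a, d)])" and r: "r < Suc k"
  shows "cstep k S (ks, t, h) = (ks', t(r := (t r)(h r := a)), h(r := h r + d))"
proof -
  have "idle (map (\<lambda>j. t j (h j)) [0..<Suc k]) ! j = (t j (h j), 0)"
    "length (idle (map (\<lambda>j. t j (h j)) [0..<Suc k])) = Suc k" if "j < Suc k" for j
    using that by (simp_all add: idle_def del: upt_Suc)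
  then show ?thesis using assms by (auto simp: cstep_def fun_eq_iff simp del: upt_Suc)
qed

lemma runs_Skip: "runs k S Skip st st 1"
  by (rule runsI) (simp add: cstep_idle)

lemma runs_Emit:
  assumes "0 < a" shows "runs k S (Emit a) (s, out) (s, out @ [a]) 1"
proof (rule runsI)
  fix ks t h assume rep: "represents k S (s, out) t h"
  have "cstep k S (Emit a # ks, t, h) = (ks, t(k := (t k)(h k := a)), h(k := h k + 1))"
    by (rule cstep_update) simp_all
  moreover have "represents k S (s, out @ [a]) (t(k := (t k)(h k := a))) (h(k := h k + 1))"
    using rep by (auto simp: represents_def nth_append less_Suc_eq)
  ultimately show "\<exists>t' h'. (cstep k S ^^ 1) (Emit a # ks, t, h) = (ks, t', h') \<and>
    represents k S (s, out @ [a]) t' h'" by auto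
qed

lemma represents_push:
  assumes rep: "represents k S (s, out) t h" and a: "0 < a" "a < S" and r: "r < k"
  shows "represents k S (s(r := a # s r), out) (t(r := (t r)(h r - 1 := a))) (h(r := h r - 1))"
proof -
  have "((t r)(h r - 1 := a)) (h r - 1 + int i) = (a # s r) ! i" if "i < Suc (length (s r))" for i
  proof (cases i)
    case (Suc j)
    then have "t r (h r + int j) = s r ! j" using rep r that by (simp add: represents_def)
    then show ?thesis using Suc by (simp add: algebra_simps)
  qed simp
  then show ?thesis using rep a r by (auto simp: represents_def)
qed

lemma runs_Push:
  assumes "0 < a" "a < S" "r < k" shows "runs k S (Push r a) (s, out) (s(r := a # s r), out) 2"
proof (rule runsI)
  fix ks t h assume rep: "represents k S (s, out) t h"
  have "cstep k S (Push r a # ks, t, h) = (Put r a # ks, t(r := (t r)(h r := t r (h r))), h(r := h r + -1))"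
    by (rule cstep_update) (use assms in \<open>simp_all del: upt_Suc\<close>)
  then have 1: "cstep k S (Push r a # ks, t, h) = (Put r a # ks, t, h(r := h r - 1))" by simp
  have 2: "cstep k S (Put r a # ks, t, h(r := h r - 1)) =
    (ks, t(r := (t r)(h r - 1 := a)), h(r := h r - 1))"
    using cstep_update[of k S "Put r a # ks" t "h(r := h r - 1)" ks r a 0] assms by simp
  have "represents k S (s(r := a # s r), out) (t(r := (t r)(h r - 1 := a))) (h(r := h r - 1))"
    using represents_push[OF rep assms] .
  then show "\<exists>t' h'. (cstep k S ^^ 2) (Push r a # ks, t, h) = (ks, t', h') \<and>
    represents k S (s(r := a # s r), out) t' h'" using 1 2 by (auto simp: numeral_2_eq_2)
qed

lemma runs_Pop:
  assumes r: "r < k" shows "runs k S (Pop r) (s, out) (s(r := tl (s r)), out) 1"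
proof (rule runsI)
  fix ks t h assume rep: "represents k S (s, out) t h"
  let ?d = "if s r = [] then 0 else 1"
  have "(t r (h r) = 0) = (s r = [])"
    using represents_top[OF rep r] represents_nonzero[OF rep r] by fastforce
  then have "cstep k S (Pop r # ks, t, h) = (ks, t(r := (t r)(h r := t r (h r))), h(r := h r + ?d))"
    by (intro cstep_update) (use assms in \<open>simp_all del: upt_Suc\<close>)
  moreover have "represents k S (s(r := tl (s r)), out) t (h(r := h r + ?d))"
  proof (cases "s r")
    case Nil
    then have "s(r := tl (s r)) = s" "h(r := h r + ?d) = h" by auto
    then show ?thesis using rep by simp
  next
    case (Cons a xs)
    then have "t r (h r + int (Suc i)) = xs ! i" if "i < length xs" for i
    proof -
      have "t r (h r + int (Suc i)) = s r ! Suc i"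
        using rep r that Cons unfolding represents_def by (simp del: of_nat_Suc)
      then show ?thesis using Cons by simp
    qed
    moreover have "set (a # xs) \<subseteq> {0<..<S}" "t r (h r + int (length (a # xs))) = 0"
      unfolding Cons[symmetric] using rep r by (simp_all add: represents_def)
    ultimately show ?thesis using rep r Cons by (auto simp: represents_def algebra_simps)
  qed
  ultimately show "\<exists>t' h'. (cstep k S ^^ 1) (Pop r # ks, t, h) = (ks, t', h') \<and>
    represents k S (s(r := tl (s r)), out) t' h'" by auto
qed

lemma runs_step_then:
  assumes "\<And>ks t h. represents k S st t h \<Longrightarrow> cstep k S (c # ks, t, h) = (c' # ks, t, h)"
    and "runs k S c' st st' n"
  shows "runs k S c st st' (n + 1)"
  unfolding runs_def
proof (intro allI impI)
  fix ks t h assume rep: "represents k S st t h"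
  then obtain m t' h' where "m \<le> n" "(cstep k S ^^ m) (c' # ks, t, h) = (ks, t', h')"
    "represents k S st' t' h'" using assms(2) unfolding runs_def by blast
  then show "\<exists>m\<le>n + 1. \<exists>t' h'. (cstep k S ^^ m) (c # ks, t, h) = (ks, t', h') \<and>
    represents k S st' t' h'"
    using assms(1)[OF rep] by (intro exI[of _ "Suc m"]) (auto simp: funpow_swap1)
qed

lemma runs_two:
  assumes 1: "runs k S c st st' n1" and 2: "runs k S d st' st'' n2" and rep: "represents k S st t h"
  shows "\<exists>m\<le>n1 + n2. \<exists>t' h'. (cstep k S ^^ m) (c # d # ks, t, h) = (ks, t', h') \<and>
    represents k S st'' t' h'"
proof -
  obtain m1 t1 h1 where 3: "m1 \<le> n1" "(cstep k S ^^ m1) (c # d # ks, t, h) = (d # ks, t1, h1)"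
    "represents k S st' t1 h1" using 1 rep unfolding runs_def by blast
  obtain m2 t2 h2 where 4: "m2 \<le> n2" "(cstep k S ^^ m2) (d # ks, t1, h1) = (ks, t2, h2)"
    "represents k S st'' t2 h2" using 2 3(3) unfolding runs_def by blast
  have "(cstep k S ^^ (m2 + m1)) (c # d # ks, t, h) = (ks, t2, h2)"
    using 3 4 by (simp add: funpow_add)
  then show ?thesis using 3(1) 4(1,3) by (intro exI[of _ "m2 + m1"]) auto
qed

lemma runs_Seq:
  assumes 1: "runs k S c st st' n1" and 2: "runs k S d st' st'' n2"
  shows "runs k S (c ;; d) st st'' (n1 + n2 + 1)"
  unfolding runs_def
proof (intro allI impI)
  fix ks t h assume "represents k S st t h"
  from runs_two[OF 1 2 this, of ks] obtain m t' h' where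
    "m \<le> n1 + n2" "(cstep k S ^^ m) (c # d # ks, t, h) = (ks, t', h')" "represents k S st'' t' h'"
    by blast
  then show "\<exists>m\<le>n1 + n2 + 1. \<exists>t' h'. (cstep k S ^^ m) ((c ;; d) # ks, t, h) = (ks, t', h') \<and>
    represents k S st'' t' h'"
    by (intro exI[of _ "Suc m"]) (auto simp: funpow_swap1 cstep_idle)
qed

lemma runs_Case:
  assumes r: "r < k" and S: "0 < S" and f: "runs k S (f (top (s r))) (s, out) st' n"
  shows "runs k S (Case r f) (s, out) st' (n + 1)"
proof (rule runs_step_then[OF _ f])
  fix ks t h assume rep: "represents k S (s, out) t h"
  have "top (s r) < S" using represents_nonzero[OF rep r] S by (cases "s r") auto
  then show "cstep k S (Case r f # ks, t, h) = (f (top (s r)) # ks, t, h)"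
    using represents_top[OF rep r] r by (intro cstep_idle) (simp del: upt_Suc)
qed

lemma runs_While_Nil:
  assumes r: "r < k" and "s r = []" shows "runs k S (While r c) (s, out) (s, out) 1"
proof (rule runsI)
  fix ks t h assume rep: "represents k S (s, out) t h"
  have "cstep k S (While r c # ks, t, h) = (ks, t, h)"
    using represents_top[OF rep r] assms by (intro cstep_idle) (simp del: upt_Suc)
  then show "\<exists>t' h'. (cstep k S ^^ 1) (While r c # ks, t, h) = (ks, t', h') \<and>
    represents k S (s, out) t' h'" using rep by simp
qed

lemma runs_While_step:
  assumes r: "r < k" and ne: "s r \<noteq> []" and c: "runs k S c (s, out) st' n1"
    and w: "runs k S (While r c) st' st'' n2"
  shows "runs k S (While r c) (s, out) st'' (n1 + n2 + 1)"
  unfolding runs_def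
proof (intro allI impI)
  fix ks t h assume rep: "represents k S (s, out) t h"
  have "cstep k S (While r c # ks, t, h) = (c # While r c # ks, t, h)"
    using represents_top[OF rep r] represents_nonzero[OF rep r ne] r
    by (intro cstep_idle) (simp del: upt_Suc)
  moreover obtain m t' h' where "m \<le> n1 + n2"
    "(cstep k S ^^ m) (c # While r c # ks, t, h) = (ks, t', h')" "represents k S st'' t' h'"
    using runs_two[OF c w rep, of ks] by blast
  ultimately show "\<exists>m\<le>n1 + n2 + 1. \<exists>t' h'. (cstep k S ^^ m) (While r c # ks, t, h) = (ks, t', h') \<and>
    represents k S st'' t' h'"
    by (intro exI[of _ "Suc m"]) (auto simp: funpow_swap1)
qed

text \<open>The stores between the rounds are given in advance as a sequence \<open>st\<close>; a
  loop is then verified by writing down a formula for its \<open>i\<close>-th store.\<close>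

lemma runs_While:
  assumes r: "r < k"
    and ne: "\<And>i. i < N \<Longrightarrow> fst (st i) r \<noteq> []"
    and body: "\<And>i. i < N \<Longrightarrow> runs k S c (st i) (st (Suc i)) B"
    and last: "fst (st N) r = []"
  shows "runs k S (While r c) (st 0) (st N) (N * (B + 1) + 1)"
proof -
  have "i \<le> N \<Longrightarrow> runs k S (While r c) (st (N - i)) (st N) (i * (B + 1) + 1)" for i
  proof (induction i)
    case 0
    then show ?case using runs_While_Nil[OF r, of "fst (st N)" S c "snd (st N)"] last by simp
  next
    case (Suc i)
    let ?j = "N - Suc i"
    have j: "?j < N" "Suc ?j = N - i" using Suc.prems by auto
    have "runs k S (While r c) (fst (st ?j), snd (st ?j)) (st N) (B + (i * (B + 1) + 1) + 1)"
      by (rule runs_While_step[where s = "fst (st ?j)" and out = "snd (st ?j)" and st' = "st (N - i)"])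
        (use r ne[OF j(1)] Suc body[OF j(1)] j(2) in auto)
    then show ?case by (simp add: algebra_simps)
  qed
  from this[of N] show ?thesis by simp
qed

text \<open>The control lists that occur while \<open>c\<close> runs in front of \<open>ks\<close>.
  The body of a loop is always followed by the same \<open>While\<close>, so recursion does not let
  the lists grow and the set is finite; it supplies the states of the machine.\<close>

primrec conts :: "nat \<Rightarrow> com \<Rightarrow> com list \<Rightarrow> com list set" where
  "conts S Skip ks = {Skip # ks}"
| "conts S (Emit a) ks = {Emit a # ks}"
| "conts S (Push r a) ks = {Push r a # ks, Put r a # ks}"
| "conts S (Put r a) ks = {Put r a # ks}"
| "conts S (Pop r) ks = {Pop r # ks}"
| "conts S (Seq c d) ks = {Seq c d # ks} \<union> conts S c (d # ks) \<union> conts S d ks"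
| "conts S (Case r f) ks = {Case r f # ks} \<union> (\<Union>a<S. conts S (f a) ks)"
| "conts S (While r c) ks = {While r c # ks} \<union> conts S c (While r c # ks)"

lemma finite_conts: "finite (conts S c ks)"
  by (induction c arbitrary: ks) auto

lemma conts_self: "c # ks \<in> conts S c ks"
  by (cases c) auto

lemma conts_nonempty: "[] \<notin> conts S c ks"
  by (induction c arbitrary: ks) auto

text \<open>The scanned symbols are arbitrary here, because \<open>act\<close> replaces a symbol out
  of range by 0 in a \<open>Case\<close>.\<close>

lemma conts_act:
  "0 < S \<Longrightarrow> ks' \<in> conts S c ks \<Longrightarrow> fst (act k S ks' s) \<in> insert ks (conts S c ks)"
proof (induction c arbitrary: ks)
  case (Seq c d)
  from Seq.prems(2) consider "ks' = Seq c d # ks" | "ks' \<in> conts S c (d # ks)" | "ks' \<in> conts S d ks"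
    by auto
  then show ?case
  proof cases
    case 2
    then show ?thesis using Seq.IH(1)[OF Seq.prems(1) 2] conts_self[of d ks S] by auto
  next
    case 3
    then show ?thesis using Seq.IH(2)[OF Seq.prems(1) 3] by auto
  qed (use conts_self in auto)
next
  case (Case r f)
  from Case.prems(2) consider "ks' = Case r f # ks" | a where "a < S" "ks' \<in> conts S (f a) ks"
    by auto
  then show ?case
  proof cases
    case 1
    then show ?thesis using Case.prems(1) conts_self by auto
  next
    case 2
    then show ?thesis using Case.IH[OF _ Case.prems(1) 2(2)] by auto
  qed
next
  case (While r c)
  from While.prems(2) consider "ks' = While r c # ks" | "ks' \<in> conts S c (While r c # ks)"
    by auto
  then show ?case
  proof cases
    case 1
    then show ?thesis using conts_self by auto
  next
    case 2
    then show ?thesis using While.IH[OF While.prems(1) 2] by auto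
  qed
qed auto

lemma wf_conts:
  "wf_com k S c \<Longrightarrow> list_all (wf_com k S) ks \<Longrightarrow> ks' \<in> conts S c ks \<Longrightarrow> list_all (wf_com k S) ks'"
proof (induction c arbitrary: ks)
  case (Seq c d)
  then show ?case by (auto dest: Seq.IH(1)[of "d # ks"])
next
  case (While r c)
  then show ?case using While.IH[of "While r c # ks"] by auto
qed auto

lemma act_valid:
  assumes "list_all (wf_com k S) ks" and "s \<in> nlists (Suc k) {..<S}"
  shows "snd (act k S ks s) \<in> nlists (Suc k) ({..<S} \<times> {-1, 0, 1})"
proof -
  have s: "length s = Suc k" "set s \<subseteq> {..<S}" using assms(2) by (auto simp only: nlists_def mem_Collect_eq)
  define B where "B = {..<S} \<times> {-1, 0, 1 :: int}"
  have 0: "set (idle s) \<subseteq> B" "length (idle s) = Suc k" using s by (auto simp: idle_def B_def)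
  then have 1: "idle s \<in> nlists (Suc k) B" by (intro nlistsI)
  have 2: "(idle s)[r := (a, d)] \<in> nlists (Suc k) B" if "a < S" "d \<in> {-1, 0, 1}" for r a d
    using 0 set_update_subset_insert[of "idle s" r "(a, d)"] that
    by (intro nlistsI) (auto simp: B_def)
  have 3: "s ! r < S" if "r < Suc k" for r
    using s that nth_mem[of r s] by (metis lessThan_iff subsetD)
  have "snd (act k S ks s) \<in> nlists (Suc k) B"
  proof (cases ks)
    case (Cons c ks')
    then show ?thesis using assms(1) by (cases c) (simp_all add: 1 2 3)
  qed (simp add: 1)
  then show ?thesis by (simp only: B_def)
qed

theorem polytimeI:
  assumes wf: "wf_com k S c" and k: "1 \<le> k" and S: "3 \<le> S"
    and run: "\<And>w. \<exists>s'. runs k S c ((\<lambda>_. [])(0 := map bit_symbol w), [])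
                  (s', map bit_symbol (f w)) (poly p (length w))"
  shows "polytime f"
proof -
  define Q where "Q = conts S c []"
  have "finite (Q - {[c]})" by (simp add: Q_def finite_conts)
  from finite_distinct_list[OF this] obtain xs where xs: "set xs = Q - {[c]}" "distinct xs" by auto
  \<comment> \<open>Positions in this list are the numbers of the states: \<open>[c]\<close> gets 0,
    the initial state, and the empty list comes last, as the halting state.\<close>
  define L where "L = [c] # xs @ [[]]"
  define N where "N = Suc (length xs)"
  have lenL: "length L = Suc N" by (simp add: L_def N_def)
  have dL: "distinct L" using xs conts_nonempty by (auto simp: L_def Q_def)
  have setL: "set L = insert [] Q" using xs conts_self[of c "[]" S] by (auto simp: L_def Q_def)
  have LN: "L ! N = []" by (simp add: L_def N_def nth_append)
  define code where "code ks = (THE i. i < length L \<and> L ! i = ks)" for ks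
  have code: "code (L ! i) = i" if "i < length L" for i
    unfolding code_def using that dL by (auto simp: nth_eq_iff_index_eq)
  have codeQ: "code ks < length L \<and> L ! code ks = ks" if "ks \<in> insert [] Q" for ks
    using that code unfolding setL[symmetric] in_set_conv_nth by auto
  have code_Nil: "code [] = N" using code[of N] lenL LN by simp
  have code_c: "code [c] = 0" using code[of 0] by (simp add: L_def)
  have actQ: "fst (act k S ks s) \<in> insert [] Q" if "ks \<in> insert [] Q" for ks s
    using that conts_act[of S ks c "[]" k s] S unfolding Q_def by auto
  define M where "M = \<lparr>tapes = Suc k, states = N, symbols = S,
    transition = (\<lambda>q s. (code (fst (act k S (L ! q) s)), snd (act k S (L ! q) s)))\<rparr>"
  have TM: "turing_machine M"
    unfolding turing_machine_def
  proof (intro conjI allI impI ballI)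
    show "1 \<le> tapes M" "3 \<le> symbols M" using S by (auto simp: M_def)
    fix q s assume q: "q < states M" and s: "s \<in> nlists (tapes M) {..<symbols M}"
    have Lq: "L ! q \<in> insert [] Q" using q lenL unfolding setL[symmetric] by (auto simp: M_def)
    show "fst (transition M q s) \<le> states M"
      using codeQ[OF actQ[OF Lq]] lenL by (auto simp: M_def less_Suc_eq_le)
    have "list_all (wf_com k S) (L ! q)"
      using Lq wf_conts[OF wf, of "[]"] by (auto simp: Q_def)
    then show "snd (transition M q s) \<in> nlists (tapes M) ({..<symbols M} \<times> {-1, 0, 1})"
      using act_valid[of k S "L ! q" s] s by (simp add: M_def)
  qed
  have sim: "step M (code ks, t, h) = (code ks', t', h')"
    if ks: "ks \<in> insert [] Q" and cs: "cstep k S (ks, t, h) = (ks', t', h')" for ks t h ks' t' h'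
  proof (cases "ks = []")
    case True
    have "cstep k S ([], t, h) = ([], t, h)" by (rule cstep_idle) simp
    then show ?thesis using True cs by (simp add: step_def M_def code_Nil)
  next
    case False
    then have "code ks \<noteq> N" using codeQ[OF ks] LN by auto
    then show ?thesis using cs codeQ[OF ks]
      by (simp add: step_def M_def cstep_def Let_def case_prod_unfold del: upt_Suc cong: if_cong)
  qed
  have sims: "ks \<in> insert [] Q \<Longrightarrow> (cstep k S ^^ m) (ks, t, h) = (ks', t', h') \<Longrightarrow>
    ks' \<in> insert [] Q \<and> (step M ^^ m) (code ks, t, h) = (code ks', t', h')" for m ks t h ks' t' h'
  proof (induction m arbitrary: ks' t' h')
    case (Suc m)
    obtain ks1 t1 h1 where 1: "(cstep k S ^^ m) (ks, t, h) = (ks1, t1, h1)" by (metis prod_cases3)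
    then have 2: "cstep k S (ks1, t1, h1) = (ks', t', h')" using Suc.prems by simp
    have 3: "ks1 \<in> insert [] Q" "(step M ^^ m) (code ks, t, h) = (code ks1, t1, h1)"
      using Suc.IH[OF Suc.prems(1) 1] by auto
    moreover have "ks' \<in> insert [] Q"
      using actQ[OF 3(1)] 2 by (auto simp: cstep_def Let_def case_prod_unfold)
    ultimately show ?case using sim[OF 3(1) 2] by simp
  qed simp
  have "\<exists>n\<le>poly p (length w). halts_with M ((step M ^^ n) (initial w)) (f w)" for w
  proof -
    let ?s = "((\<lambda>_. [])(0 := map bit_symbol w), [])"
    obtain t h where init: "initial w = (0, t, h)" by (auto simp: initial_def)
    have rep: "represents k S ?s t h"
      using init S k by (auto simp: initial_def represents_def bit_symbol_def)
    obtain s' where "runs k S c ?s (s', map bit_symbol (f w)) (poly p (length w))" using run by blast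
    then obtain n t' h' where n: "n \<le> poly p (length w)" "(cstep k S ^^ n) ([c], t, h) = ([], t', h')"
      and rep': "represents k S (s', map bit_symbol (f w)) t' h'"
      using rep unfolding runs_def by blast
    have "(step M ^^ n) (initial w) = (N, t', h')"
      using sims[OF _ n(2)] conts_self[of c "[]" S] by (simp add: Q_def init code_c code_Nil)
    then show ?thesis using n(1) rep' by (auto simp: halts_with_def M_def represents_def)
  qed
  then show ?thesis unfolding polytime_def using TM by blast
qed

section \<open>Stack rewriting systems and NP\<close>

type_synonym 'a stack_rule = "(nat \<times> 'a) list \<times> (nat \<times> 'a) list"

fun pop_all :: "(nat \<times> 'a) list \<Rightarrow> (nat \<Rightarrow> 'a list) \<Rightarrow> (nat \<Rightarrow> 'a list) option" where
  "pop_all [] s = Some s"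
| "pop_all ((r, a) # ps) s =
     (if s r \<noteq> [] \<and> hd (s r) = a then pop_all ps (s(r := tl (s r))) else None)"

fun push_all :: "(nat \<times> 'a) list \<Rightarrow> (nat \<Rightarrow> 'a list) \<Rightarrow> (nat \<Rightarrow> 'a list)" where
  "push_all [] s = s"
| "push_all ((r, a) # ps) s = push_all ps (s(r := a # s r))"

definition rewrite_step :: "'a stack_rule set \<Rightarrow> ((nat \<Rightarrow> 'a list) \<times> (nat \<Rightarrow> 'a list)) set" where
  "rewrite_step P = {(s, s'). \<exists>(po, pu) \<in> P. \<exists>s1. pop_all po s = Some s1 \<and> s' = push_all pu s1}"

section \<open>An interpreter for rewriting rules\<close>

context
  fixes k :: nat
begin

text \<open>Shifted by one, since 0 is the blank.\<close>

definition symbol_code :: "'a :: countable \<Rightarrow> nat" where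
  "symbol_code a = Suc (to_nat a)"

lemma symbol_code_inj [simp]: "symbol_code a = symbol_code b \<longleftrightarrow> a = b"
  by (simp add: symbol_code_def)

lemma symbol_code_pos [simp]: "0 < symbol_code a"
  by (simp add: symbol_code_def)

text \<open>Register 0 holds the unread part of the certificate. \<open>Tmp\<close> and
  \<open>Ctl\<close> serve to split the input, and a non-empty \<open>Err\<close> records that a
  rule could not be applied.\<close>

abbreviation (input) "Tmp \<equiv> k + 1"
abbreviation (input) "Ctl \<equiv> k + 2"
abbreviation (input) "Err \<equiv> k + 3"

definition fail :: "(nat \<Rightarrow> nat list) \<Rightarrow> (nat \<Rightarrow> nat list)" where
  "fail S = S(Err := 1 # S Err)"

primrec pushf :: "(nat \<times> 'a :: countable) list \<Rightarrow> (nat \<Rightarrow> nat list) \<Rightarrow> (nat \<Rightarrow> nat list)" where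
  "pushf [] S = S"
| "pushf (p # ps) S = pushf ps (S(Suc (fst p) := symbol_code (snd p) # S (Suc (fst p))))"

primrec popf :: "(nat \<times> 'a :: countable) list \<Rightarrow> (nat \<times> 'a) list \<Rightarrow> (nat \<Rightarrow> nat list) \<Rightarrow> (nat \<Rightarrow> nat list)" where
  "popf [] pu S = pushf pu S"
| "popf (p # ps) pu S =
     (if top (S (Suc (fst p))) = symbol_code (snd p) then popf ps pu (S(Suc (fst p) := tl (S (Suc (fst p)))))
      else fail S)"

text \<open>The rule at position \<open>i\<close> of the list, counted from 0, is selected by
  \<open>i\<close> symbols 2 and a symbol 1. A symbol is consumed even if this ends in an
  error.\<close>

primrec dispatchf :: "'a :: countable stack_rule list \<Rightarrow> (nat \<Rightarrow> nat list) \<Rightarrow> (nat \<Rightarrow> nat list)" where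
  "dispatchf [] S = fail (S(0 := tl (S 0)))"
| "dispatchf (\<rho> # \<rho>s) S =
     (if top (S 0) = 1 then popf (fst \<rho>) (snd \<rho>) (S(0 := tl (S 0)))
      else if top (S 0) = 2 then dispatchf \<rho>s (S(0 := tl (S 0)))
      else fail (S(0 := tl (S 0))))"

primrec push_com :: "(nat \<times> 'a :: countable) list \<Rightarrow> com" where
  "push_com [] = Skip"
| "push_com (p # ps) = Push (Suc (fst p)) (symbol_code (snd p)) ;; push_com ps"

primrec pop_com :: "(nat \<times> 'a :: countable) list \<Rightarrow> (nat \<times> 'a) list \<Rightarrow> com" where
  "pop_com [] pu = push_com pu"
| "pop_com (p # ps) pu = Case (Suc (fst p)) (\<lambda>x. if x = symbol_code (snd p)
     then Pop (Suc (fst p)) ;; pop_com ps pu else Push Err 1)"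

primrec dispatch_com :: "'a :: countable stack_rule list \<Rightarrow> com" where
  "dispatch_com [] = Pop 0 ;; Push Err 1"
| "dispatch_com (\<rho> # \<rho>s) = Case 0 (\<lambda>x. if x = 1 then Pop 0 ;; pop_com (fst \<rho>) (snd \<rho>)
     else if x = 2 then Pop 0 ;; dispatch_com \<rho>s else Pop 0 ;; Push Err 1)"

definition valid_list :: "nat \<Rightarrow> (nat \<times> 'a :: countable) list \<Rightarrow> bool" where
  "valid_list S ps \<longleftrightarrow> (\<forall>(r, a) \<in> set ps. r < k \<and> symbol_code a < S)"

lemma valid_list_simps [simp]:
  "valid_list S []"
  "valid_list S (p # ps) \<longleftrightarrow> fst p < k \<and> symbol_code (snd p) < S \<and> valid_list S ps"
  by (auto simp: valid_list_def)

definition valid_rules :: "nat \<Rightarrow> 'a :: countable stack_rule list \<Rightarrow> bool" where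
  "valid_rules S \<rho>s \<longleftrightarrow> 3 \<le> S \<and> (\<forall>(po, pu) \<in> set \<rho>s. valid_list S po \<and> valid_list S pu)"

lemma valid_rules_simps [simp]:
  "valid_rules S [] \<longleftrightarrow> 3 \<le> S"
  "valid_rules S (\<rho> # \<rho>s) \<longleftrightarrow> valid_list S (fst \<rho>) \<and> valid_list S (snd \<rho>) \<and> valid_rules S \<rho>s"
  by (auto simp: valid_rules_def)

lemma valid_rules_ge: "valid_rules S \<rho>s \<Longrightarrow> 3 \<le> S"
  by (simp add: valid_rules_def)

lemma wf_push_com: "valid_list S ps \<Longrightarrow> wf_com (k + 4) S (push_com ps)"
  by (induction ps) auto

lemma wf_pop_com: "3 \<le> S \<Longrightarrow> valid_list S ps \<Longrightarrow> valid_list S pu \<Longrightarrow> wf_com (k + 4) S (pop_com ps pu)"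
  by (induction ps) (auto simp: wf_push_com)

lemma wf_dispatch_com: "valid_rules S \<rho>s \<Longrightarrow> wf_com (k + 4) S (dispatch_com \<rho>s)"
  by (induction \<rho>s) (auto simp: wf_pop_com dest: valid_rules_ge)

lemma runs_push_com:
  "valid_list S ps \<Longrightarrow> runs (k + 4) S (push_com ps) (s, out) (pushf ps s, out) (3 * length ps + 1)"
proof (induction ps arbitrary: s)
  case Nil
  then show ?case using runs_Skip by simp
next
  case (Cons p ps)
  have "runs (k + 4) S (push_com (p # ps)) (s, out) (pushf (p # ps) s, out) (2 + (3 * length ps + 1) + 1)"
    unfolding push_com.simps pushf.simps
    by (rule runs_Seq[OF runs_Push Cons.IH]) (use Cons.prems in auto)
  then show ?case by (rule runs_mono) simp
qed

lemma runs_fail: "3 \<le> S \<Longrightarrow> runs (k + 4) S (Push Err 1) (s, out) (fail s, out) 2"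
  unfolding fail_def by (rule runs_Push) auto

lemma runs_pop_com:
  "3 \<le> S \<Longrightarrow> valid_list S ps \<Longrightarrow> valid_list S pu \<Longrightarrow>
   runs (k + 4) S (pop_com ps pu) (s, out) (popf ps pu s, out) (3 * length ps + 3 * length pu + 3)"
proof (induction ps arbitrary: s)
  case Nil
  then show ?case using runs_mono[OF runs_push_com[of S pu s out]] by simp
next
  case (Cons p ps)
  show ?case
  proof (cases "top (s (Suc (fst p))) = symbol_code (snd p)")
    case True
    have "runs (k + 4) S (Pop (Suc (fst p)) ;; pop_com ps pu) (s, out)
      (popf ps pu (s(Suc (fst p) := tl (s (Suc (fst p))))), out) (1 + (3 * length ps + 3 * length pu + 3) + 1)"
      by (rule runs_Seq[OF runs_Pop Cons.IH]) (use Cons.prems in auto)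
    then have "runs (k + 4) S (pop_com (p # ps) pu) (s, out) (popf (p # ps) pu s, out)
      ((1 + (3 * length ps + 3 * length pu + 3) + 1) + 1)"
      unfolding pop_com.simps by (intro runs_Case) (use Cons.prems True in auto)
    then show ?thesis by (rule runs_mono) simp
  next
    case False
    have "runs (k + 4) S (pop_com (p # ps) pu) (s, out) (popf (p # ps) pu s, out) (2 + 1)"
      unfolding pop_com.simps by (intro runs_Case) (use Cons.prems False runs_fail in auto)
    then show ?thesis by (rule runs_mono) simp
  qed
qed

lemma runs_dispatch_com:
  assumes "valid_rules S \<rho>s"
  shows "\<exists>B. \<forall>s out. runs (k + 4) S (dispatch_com \<rho>s) (s, out) (dispatchf \<rho>s s, out) B"
  using assms
proof (induction \<rho>s)
  case Nil
  have "runs (k + 4) S (dispatch_com []) (s, out) (dispatchf [] s, out) (1 + 2 + 1)" for s out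
    unfolding dispatch_com.simps dispatchf.simps
    by (rule runs_Seq[OF runs_Pop runs_fail]) (use Nil in auto)
  then show ?case by blast
next
  case (Cons \<rho> \<rho>s)
  have S: "3 \<le> S" using Cons.prems valid_rules_ge by auto
  obtain B where B: "runs (k + 4) S (dispatch_com \<rho>s) (s, out) (dispatchf \<rho>s s, out) B" for s out
    using Cons by auto
  define B1 where "B1 = 3 * length (fst \<rho>) + 3 * length (snd \<rho>) + 3"
  have B1: "runs (k + 4) S (pop_com (fst \<rho>) (snd \<rho>)) (s, out) (popf (fst \<rho>) (snd \<rho>) s, out) B1" for s out
    unfolding B1_def by (rule runs_pop_com) (use Cons.prems S in auto)
  have "runs (k + 4) S (dispatch_com (\<rho> # \<rho>s)) (s, out) (dispatchf (\<rho> # \<rho>s) s, out) (1 + (B + B1 + 2) + 1 + 1)"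
    for s out
    unfolding dispatch_com.simps
  proof (rule runs_Case)
    let ?s = "s(0 := tl (s 0))"
    have pop: "runs (k + 4) S (Pop 0) (s, out) (?s, out) 1" by (rule runs_Pop) simp
    have "runs (k + 4) S (Pop 0 ;; dispatch_com \<rho>s) (s, out) (dispatchf \<rho>s ?s, out) (1 + (B + B1 + 2) + 1)"
      by (rule runs_Seq[OF pop runs_mono[OF B]]) simp
    moreover have "runs (k + 4) S (Pop 0 ;; pop_com (fst \<rho>) (snd \<rho>)) (s, out)
        (popf (fst \<rho>) (snd \<rho>) ?s, out) (1 + (B + B1 + 2) + 1)"
      by (rule runs_Seq[OF pop runs_mono[OF B1]]) simp
    moreover have "runs (k + 4) S (Pop 0 ;; Push Err 1) (s, out) (fail ?s, out) (1 + (B + B1 + 2) + 1)"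
      by (rule runs_Seq[OF pop runs_mono[OF runs_fail[OF S]]]) simp
    ultimately show "runs (k + 4) S
        (if top (s 0) = 1 then Pop 0 ;; pop_com (fst \<rho>) (snd \<rho>)
         else if top (s 0) = 2 then Pop 0 ;; dispatch_com \<rho>s else Pop 0 ;; Push Err 1)
        (s, out) (dispatchf (\<rho> # \<rho>s) s, out) (1 + (B + B1 + 2) + 1)" by simp
  qed (use S in auto)
  then show ?case by blast
qed

lemma pushf_other: "j = 0 \<or> k < j \<Longrightarrow> valid_list S ps \<Longrightarrow> pushf ps s j = s j"
  by (induction ps arbitrary: s) auto

lemma popf_zero: "valid_list S ps \<Longrightarrow> valid_list S pu \<Longrightarrow> popf ps pu s 0 = s 0"
  by (induction ps arbitrary: s) (auto simp: fail_def pushf_other)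

text \<open>Errors are never erased, so looking at \<open>Err\<close> once, at the end, is enough to
  know that every selected rule was applicable.\<close>

lemma popf_Err:
  "valid_list S ps \<Longrightarrow> valid_list S pu \<Longrightarrow> popf ps pu s Err = [] \<Longrightarrow> s Err = []"
proof (induction ps arbitrary: s)
  case (Cons p ps)
  have "popf ps pu (s(Suc (fst p) := tl (s (Suc (fst p))))) Err = []"
    using Cons.prems(3) by (auto simp: fail_def split: if_splits)
  then have "(s(Suc (fst p) := tl (s (Suc (fst p))))) Err = []"
    by (rule Cons.IH[rotated 2]) (use Cons.prems in auto)
  then show ?case using Cons.prems(1) by simp
qed (auto simp: pushf_other)

lemma dispatchf_length:
  "valid_rules S \<rho>s \<Longrightarrow> s 0 \<noteq> [] \<Longrightarrow> length (dispatchf \<rho>s s 0) < length (s 0)"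
proof (induction \<rho>s arbitrary: s)
  case (Cons \<rho> \<rho>s)
  have 1: "length (dispatchf \<rho>s (s(0 := tl (s 0))) 0) \<le> length (tl (s 0))"
  proof (cases "tl (s 0) = []")
    case True
    then have "dispatchf \<rho>s (s(0 := tl (s 0))) 0 = []"
      by (cases \<rho>s) (auto simp: fail_def)
    then show ?thesis by simp
  next
    case False
    have "length (dispatchf \<rho>s (s(0 := tl (s 0))) 0) < length ((s(0 := tl (s 0))) 0)"
      by (rule Cons.IH) (use Cons.prems False in auto)
    then show ?thesis by simp
  qed
  have "popf (fst \<rho>) (snd \<rho>) (s(0 := tl (s 0))) 0 = tl (s 0)"
    using popf_zero[of S "fst \<rho>" "snd \<rho>" "s(0 := tl (s 0))"] Cons.prems by auto
  with 1 show ?case using Cons.prems(2) by (cases "s 0") (auto simp: fail_def)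
qed (auto simp: fail_def)

text \<open>The stacks of the rewriting system are the registers \<open>1, \<dots>, k\<close>.\<close>

definition stacks_rel :: "(nat \<Rightarrow> 'a :: countable list) \<Rightarrow> (nat \<Rightarrow> nat list) \<Rightarrow> bool" where
  "stacks_rel s S \<longleftrightarrow> (\<forall>r<k. S (Suc r) = map symbol_code (s r))"

lemma stacks_rel_push:
  "valid_list S pu \<Longrightarrow> stacks_rel s s' \<Longrightarrow> stacks_rel (push_all pu s) (pushf pu s')"
proof (induction pu arbitrary: s s')
  case (Cons p pu)
  obtain r a where p: "p = (r, a)" by force
  have "stacks_rel (s(r := a # s r)) (s'(Suc r := symbol_code a # s' (Suc r)))"
    using Cons.prems by (auto simp: stacks_rel_def p)
  then show ?case using Cons.IH Cons.prems by (simp add: p)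
qed simp

lemma popf_sound:
  assumes "valid_list S po" "valid_list S pu" "stacks_rel s s'" "popf po pu s' Err = []"
  shows "\<exists>s1. pop_all po s = Some s1 \<and> stacks_rel (push_all pu s1) (popf po pu s')"
  using assms
proof (induction po arbitrary: s s')
  case Nil
  then show ?case using stacks_rel_push by auto
next
  case (Cons p po)
  obtain r a where p: "p = (r, a)" by force
  have t: "top (s' (Suc r)) = symbol_code a" using Cons.prems(4) by (auto simp: p fail_def split: if_splits)
  then obtain xs where xs: "s r = a # xs" using Cons.prems by (cases "s r") (auto simp: stacks_rel_def p symbol_code_def)
  have "stacks_rel (s(r := xs)) (s'(Suc r := tl (s' (Suc r))))"
    using Cons.prems xs by (auto simp: stacks_rel_def p)
  moreover have "popf po pu (s'(Suc r := tl (s' (Suc r)))) Err = []"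
    using Cons.prems(4) t by (simp add: p)
  ultimately have "\<exists>s1. pop_all po (s(r := xs)) = Some s1 \<and>
      stacks_rel (push_all pu s1) (popf po pu (s'(Suc r := tl (s' (Suc r)))))"
    using Cons.IH[of "s(r := xs)" "s'(Suc r := tl (s' (Suc r)))"] Cons.prems(1,2) by (simp only: valid_list_simps)
  then show ?case using t xs by (simp add: p)
qed

lemma popf_complete:
  assumes "valid_list S po" "valid_list S pu" "stacks_rel s s'" "pop_all po s = Some s1"
  shows "stacks_rel (push_all pu s1) (popf po pu s') \<and> (\<forall>j. j = 0 \<or> k < j \<longrightarrow> popf po pu s' j = s' j)"
  using assms
proof (induction po arbitrary: s s')
  case Nil
  then show ?case using stacks_rel_push[of S pu] pushf_other[of _ S pu] by auto
next
  case (Cons p po)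
  obtain r a where p: "p = (r, a)" by force
  obtain xs where xs: "s r = a # xs" "pop_all po (s(r := xs)) = Some s1"
    using Cons.prems(4) by (cases "s r") (auto simp: p split: if_splits)
  have r: "r < k" and v: "valid_list S po" using Cons.prems by (simp_all add: p)
  have "stacks_rel (s(r := xs)) (s'(Suc r := tl (s' (Suc r))))"
    using Cons.prems(3) xs r by (auto simp: stacks_rel_def)
  moreover have "top (s' (Suc r)) = symbol_code a" using Cons.prems(3) xs r by (simp add: stacks_rel_def)
  moreover have "stacks_rel (push_all pu s1) (popf po pu (s'(Suc r := tl (s' (Suc r))))) \<and>
      (\<forall>j. j = 0 \<or> k < j \<longrightarrow> popf po pu (s'(Suc r := tl (s' (Suc r)))) j = (s'(Suc r := tl (s' (Suc r)))) j)"
    by (rule Cons.IH[OF v Cons.prems(2) calculation(1) xs(2)])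
  ultimately show ?case using r by (simp add: p)
qed

lemma stacks_rel_zero: "stacks_rel s (s'(0 := y)) \<longleftrightarrow> stacks_rel s s'"
  by (simp add: stacks_rel_def)

lemma dispatchf_sound:
  assumes "valid_rules S \<rho>s" "stacks_rel s s'" "dispatchf \<rho>s s' Err = []"
  shows "s' Err = [] \<and> (\<exists>s2. (s, s2) \<in> rewrite_step (set \<rho>s) \<and> stacks_rel s2 (dispatchf \<rho>s s'))"
  using assms
proof (induction \<rho>s arbitrary: s')
  case (Cons \<rho> \<rho>s)
  let ?s = "s'(0 := tl (s' 0))"
  from Cons.prems(3) consider "top (s' 0) = 1" | "top (s' 0) \<noteq> 1" "top (s' 0) = 2"
    by (auto simp: fail_def split: if_splits)
  then show ?case
  proof cases
    case 1
    then have e: "dispatchf (\<rho> # \<rho>s) s' = popf (fst \<rho>) (snd \<rho>) ?s" by simp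
    have "stacks_rel s ?s" using Cons.prems by (simp add: stacks_rel_zero)
    then obtain s1 where "pop_all (fst \<rho>) s = Some s1"
      "stacks_rel (push_all (snd \<rho>) s1) (popf (fst \<rho>) (snd \<rho>) ?s)"
      using popf_sound[of S "fst \<rho>" "snd \<rho>" s ?s] Cons.prems e by auto
    moreover have "s' Err = []" using popf_Err[of S "fst \<rho>" "snd \<rho>" ?s] Cons.prems e by auto
    moreover have "(s, push_all (snd \<rho>) s1) \<in> rewrite_step (set (\<rho> # \<rho>s))"
      using \<open>pop_all (fst \<rho>) s = Some s1\<close> by (cases \<rho>) (auto simp: rewrite_step_def)
    ultimately show ?thesis unfolding e by blast
  next
    case 2
    then have e: "dispatchf (\<rho> # \<rho>s) s' = dispatchf \<rho>s ?s" by simp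
    have sub: "rewrite_step (set \<rho>s) \<subseteq> rewrite_step (set (\<rho> # \<rho>s))"
      unfolding rewrite_step_def by auto
    have "?s Err = [] \<and> (\<exists>s2. (s, s2) \<in> rewrite_step (set \<rho>s) \<and> stacks_rel s2 (dispatchf \<rho>s ?s))"
    proof (rule Cons.IH)
      show "valid_rules S \<rho>s" using Cons.prems(1) by simp
      show "stacks_rel s ?s" using Cons.prems(2) by (simp only: stacks_rel_zero)
      show "dispatchf \<rho>s ?s Err = []" using Cons.prems(3) by (simp only: e)
    qed
    then show ?thesis unfolding e using sub by auto
  qed
qed (simp add: fail_def)

lemma dispatchf_Err:
  "valid_rules S \<rho>s \<Longrightarrow> dispatchf \<rho>s s Err = [] \<Longrightarrow> s Err = []"
proof (induction \<rho>s arbitrary: s)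
  case (Cons \<rho> \<rho>s)
  let ?s = "s(0 := tl (s 0))"
  from Cons.prems(2) have "popf (fst \<rho>) (snd \<rho>) ?s Err = [] \<or> dispatchf \<rho>s ?s Err = []"
    by (auto simp: fail_def split: if_splits)
  moreover have "?s Err = []" if "dispatchf \<rho>s ?s Err = []"
    by (rule Cons.IH[OF _ that]) (use Cons.prems in simp)
  moreover have "?s Err = []" if "popf (fst \<rho>) (snd \<rho>) ?s Err = []"
    by (rule popf_Err[OF _ _ that]) (use Cons.prems in auto)
  ultimately show ?case by auto
qed (simp add: fail_def)

text \<open>The code word \<open>y\<close> has to work in front of every rest \<open>z\<close>,
  because the certificate of a run is the concatenation of the code words of its steps.\<close>

lemma dispatchf_complete:
  assumes "valid_rules S \<rho>s" "stacks_rel s s'" "(s, s2) \<in> rewrite_step (set \<rho>s)"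
  shows "\<exists>y. length y \<le> length \<rho>s \<and> set y \<subseteq> {1, 2} \<and> y \<noteq> [] \<and>
    (\<forall>z. let s3 = dispatchf \<rho>s (s'(0 := y @ z)) in
       stacks_rel s2 s3 \<and> s3 0 = z \<and> (\<forall>j>k. s3 j = s' j))"
  using assms
proof (induction \<rho>s arbitrary: s')
  case (Cons \<rho> \<rho>s)
  show ?case
  proof (cases "\<exists>s1. pop_all (fst \<rho>) s = Some s1 \<and> s2 = push_all (snd \<rho>) s1")
    case True
    then obtain s1 where s1: "pop_all (fst \<rho>) s = Some s1" "s2 = push_all (snd \<rho>) s1" by blast
    have "stacks_rel s2 (popf (fst \<rho>) (snd \<rho>) (s'(0 := z))) \<and>
        (\<forall>j. j = 0 \<or> k < j \<longrightarrow> popf (fst \<rho>) (snd \<rho>) (s'(0 := z)) j = (s'(0 := z)) j)" for z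
      unfolding s1(2) using Cons.prems s1(1) by (intro popf_complete) (auto simp: stacks_rel_zero)
    moreover have "dispatchf (\<rho> # \<rho>s) (s'(0 := [1] @ z)) = popf (fst \<rho>) (snd \<rho>) (s'(0 := z))" for z
      by (simp only: dispatchf.simps fun_upd_same fun_upd_upd append.simps top_simps list.sel if_True simp_thms)
    ultimately show ?thesis
      by (intro exI[of _ "[1]"]) (simp only: Let_def, simp)
  next
    case False
    then have "(s, s2) \<in> rewrite_step (set \<rho>s)"
      using Cons.prems(3) by (auto simp: rewrite_step_def split: prod.splits)
    have v: "valid_rules S \<rho>s" using Cons.prems(1) by simp
    from Cons.IH[OF v Cons.prems(2) \<open>(s, s2) \<in> rewrite_step (set \<rho>s)\<close>]
    obtain y where "length y \<le> length \<rho>s \<and> set y \<subseteq> {1, 2} \<and> y \<noteq> [] \<and>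
      (\<forall>z. let s3 = dispatchf \<rho>s (s'(0 := y @ z)) in
         stacks_rel s2 s3 \<and> s3 0 = z \<and> (\<forall>j>k. s3 j = s' j))"
      by blast
    moreover have "dispatchf (\<rho> # \<rho>s) (s'(0 := (2 # y) @ z)) = dispatchf \<rho>s (s'(0 := y @ z))" for z
      by (simp only: dispatchf.simps fun_upd_same fun_upd_upd append.simps top_simps list.sel if_True
          simp_thms numeral_eq_one_iff num.simps if_False)
    ultimately show ?thesis by (intro exI[of _ "2 # y"]) (simp only: Let_def, simp)
  qed
qed (simp add: rewrite_step_def)

definition loop_com :: "'a :: countable stack_rule list \<Rightarrow> com" where
  "loop_com \<rho>s = While 0 (dispatch_com \<rho>s)"

text \<open>This holds for every content of register 0, meaningful or not, as
  \<open>polytime\<close> demands termination on all inputs. Each round shortens the register by at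
  least one symbol.\<close>

lemma loop_runs:
  assumes v: "valid_rules S \<rho>s"
    and B: "\<And>s out. runs (k + 4) S (dispatch_com \<rho>s) (s, out) (dispatchf \<rho>s s, out) B"
  shows "\<exists>n \<le> length (s 0). (dispatchf \<rho>s ^^ n) s 0 = [] \<and> (\<forall>i<n. (dispatchf \<rho>s ^^ i) s 0 \<noteq> []) \<and>
    runs (k + 4) S (loop_com \<rho>s) (s, out) ((dispatchf \<rho>s ^^ n) s, out) (length (s 0) * (B + 1) + 1)"
proof -
  let ?D = "\<lambda>i. (dispatchf \<rho>s ^^ i) s"
  have len: "i \<le> length (s 0) \<and> (\<forall>j<i. ?D j 0 \<noteq> []) \<Longrightarrow> length (?D i 0) + i \<le> length (s 0)" for i
  proof (induction i)
    case (Suc i)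
    then have "length (dispatchf \<rho>s (?D i) 0) < length (?D i 0)"
      by (intro dispatchf_length[OF v]) auto
    then show ?case using Suc by auto
  qed simp
  have "\<exists>n\<le>length (s 0). ?D n 0 = []"
  proof (rule ccontr)
    assume "\<not> ?thesis"
    then show False using len[of "length (s 0)"] by auto
  qed
  then obtain m where m: "m \<le> length (s 0)" "?D m 0 = []" by blast
  define n where "n = (LEAST n. ?D n 0 = [])"
  have n: "?D n 0 = []" "n \<le> length (s 0)" "\<forall>i<n. ?D i 0 \<noteq> []"
    unfolding n_def
    using LeastI[of "\<lambda>n. ?D n 0 = []", OF m(2)] Least_le[of "\<lambda>n. ?D n 0 = []", OF m(2)] m(1)
      not_less_Least[of _ "\<lambda>n. ?D n 0 = []"] by auto
  have "runs (k + 4) S (While 0 (dispatch_com \<rho>s)) (?D 0, out) (?D n, out) (n * (B + 1) + 1)"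
    by (rule runs_While[where st = "\<lambda>i. (?D i, out)", unfolded fst_conv]) (use n B in auto)
  moreover have "n * (B + 1) + 1 \<le> length (s 0) * (B + 1) + 1"
    using mult_le_mono1[OF n(2), of "B + 1"] by linarith
  ultimately have "runs (k + 4) S (loop_com \<rho>s) (?D 0, out) (?D n, out) (length (s 0) * (B + 1) + 1)"
    unfolding loop_com_def by (rule runs_mono)
  then show ?thesis using n by auto
qed

text \<open>Undoes \<open>pair_string\<close> on tape symbols, made total on malformed words. The
  first component comes out reversed, and \<open>move_com\<close> reverses it again.\<close>

fun splitf :: "nat list \<Rightarrow> nat list \<Rightarrow> nat list \<times> nat list" where
  "splitf (a # w) acc =
     (if a = 2 then (case w of [] \<Rightarrow> (acc, []) | b # w' \<Rightarrow> splitf w' (b # acc)) else (acc, w))"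
| "splitf [] acc = (acc, [])"

definition split_com :: com where
  "split_com = While Ctl (Case 0 (\<lambda>x. if x = 2
     then Pop 0 ;; Case 0 (\<lambda>b. if b = 0 then Pop Ctl else Push Tmp b ;; Pop 0)
     else Pop 0 ;; Pop Ctl))"

lemma runs_split_com:
  assumes S: "S = S' \<and> 3 \<le> S'"
  shows "0 \<notin> set w \<Longrightarrow> set w \<subseteq> {..<S'} \<Longrightarrow> s 0 = w \<Longrightarrow> s Tmp = acc \<Longrightarrow> s Ctl = [1] \<Longrightarrow>
    runs (k + 4) S' split_com (s, out)
      (s(0 := snd (splitf w acc), Tmp := fst (splitf w acc), Ctl := []), out) (10 * length w + 8)"
proof (induction w acc arbitrary: s rule: splitf.induct)
  case (1 a w acc)
  have S': "0 < S'" using S by simp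
  let ?B = "Case 0 (\<lambda>x. if x = 2
     then Pop 0 ;; Case 0 (\<lambda>b. if b = 0 then Pop Ctl else Push Tmp b ;; Pop 0)
     else Pop 0 ;; Pop Ctl)"
  let ?s1 = "s(0 := w)"
  have pop: "runs (k + 4) S' (Pop 0) (s, out) (?s1, out) 1"
    using runs_Pop[of 0 "k + 4" S' s out] 1 by simp
  have popc: "runs (k + 4) S' (Pop Ctl) (?s1, out) (?s1(Ctl := []), out) 1"
    using runs_Pop[of Ctl "k + 4" S' ?s1 out] 1 by simp
  have nil: "runs (k + 4) S' split_com (?s1(Ctl := []), out) (?s1(Ctl := []), out) 1"
    unfolding split_com_def by (rule runs_While_Nil) auto
  consider "a \<noteq> 2" | "a = 2" "w = []" | b w' where "a = 2" "w = b # w'" by (cases w) auto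
  then show ?case
  proof cases
    case 1
    have body: "runs (k + 4) S' ?B (s, out) (?s1(Ctl := []), out) (1 + 1 + 1 + 1)"
      by (rule runs_Case) (use 1 runs_Seq[OF pop popc] S' "1.prems" in auto)
    have R: "runs (k + 4) S' split_com (s, out) (?s1(Ctl := []), out) (1 + 1 + 1 + 1 + 1 + 1)"
      unfolding split_com_def
      by (rule runs_While_step[OF _ _ body nil[unfolded split_com_def]]) (use "1.prems" in auto)
    have eq: "?s1(Ctl := []) = s(0 := snd (splitf (a # w) acc), Tmp := fst (splitf (a # w) acc), Ctl := [])"
      using 1 "1.prems" by auto
    show ?thesis unfolding eq[symmetric] by (rule runs_mono[OF R]) simp
  next
    case 2
    have "runs (k + 4) S' (Case 0 (\<lambda>b. if b = 0 then Pop Ctl else Push Tmp b ;; Pop 0))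
        (?s1, out) (?s1(Ctl := []), out) (1 + 1)"
      by (rule runs_Case) (use 2 S' popc in auto)
    from runs_Seq[OF pop this]
    have body: "runs (k + 4) S' ?B (s, out) (?s1(Ctl := []), out) (1 + (1 + 1) + 1 + 1)"
      by (intro runs_Case) (use 2 S' "1.prems" in auto)
    have R: "runs (k + 4) S' split_com (s, out) (?s1(Ctl := []), out) (1 + (1 + 1) + 1 + 1 + 1 + 1)"
      unfolding split_com_def
      by (rule runs_While_step[OF _ _ body nil[unfolded split_com_def]]) (use "1.prems" in auto)
    have eq: "?s1(Ctl := []) = s(0 := snd (splitf (a # w) acc), Tmp := fst (splitf (a # w) acc), Ctl := [])"
      using 2 "1.prems" by auto
    show ?thesis unfolding eq[symmetric] by (rule runs_mono[OF R]) simp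
  next
    case 3
    let ?s2 = "s(0 := w', Tmp := b # acc)"
    have b: "0 < b" "b < S'" using 3 "1.prems" by auto
    have push: "runs (k + 4) S' (Push Tmp b) (?s1, out) (?s1(Tmp := b # acc), out) 2"
      using runs_Push[of b S' Tmp "k + 4" ?s1 out] b "1.prems" by simp
    have pop2: "runs (k + 4) S' (Pop 0) (?s1(Tmp := b # acc), out) (?s2, out) 1"
      using runs_Pop[of 0 "k + 4" S' "?s1(Tmp := b # acc)" out] 3 by (simp add: fun_upd_twist)
    have "runs (k + 4) S' (Case 0 (\<lambda>b. if b = 0 then Pop Ctl else Push Tmp b ;; Pop 0))
        (?s1, out) (?s2, out) ((2 + 1 + 1) + 1)"
      by (rule runs_Case) (use 3 S' b runs_Seq[OF push pop2] in auto)
    from runs_Seq[OF pop this]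
    have body: "runs (k + 4) S' ?B (s, out) (?s2, out) (1 + (2 + 1 + 1 + 1) + 1 + 1)"
      by (intro runs_Case) (use 3 S' "1.prems" in auto)
    have "runs (k + 4) S' split_com (?s2, out)
      (?s2(0 := snd (splitf w' (b # acc)), Tmp := fst (splitf w' (b # acc)), Ctl := []), out) (10 * length w' + 8)"
      by (rule "1.IH"[OF 3]) (use 3 "1.prems" in auto)
    note loop = this
    have R: "runs (k + 4) S' split_com (s, out)
      (?s2(0 := snd (splitf w' (b # acc)), Tmp := fst (splitf w' (b # acc)), Ctl := []), out) (1 + (2 + 1 + 1 + 1) + 1 + 1 + (10 * length w' + 8) + 1)"
      unfolding split_com_def
      by (rule runs_While_step[OF _ _ body loop[unfolded split_com_def]]) (use "1.prems" in auto)
    have eq: "?s2(0 := snd (splitf w' (b # acc)), Tmp := fst (splitf w' (b # acc)), Ctl := []) =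
      s(0 := snd (splitf (a # w) acc), Tmp := fst (splitf (a # w) acc), Ctl := [])"
      using 3 by (auto simp: fun_eq_iff)
    show ?thesis unfolding eq[symmetric] by (rule runs_mono[OF R]) (use 3 in simp)
  qed
next
  case (2 acc)
  let ?B = "Case 0 (\<lambda>x. if x = 2
     then Pop 0 ;; Case 0 (\<lambda>b. if b = 0 then Pop Ctl else Push Tmp b ;; Pop 0)
     else Pop 0 ;; Pop Ctl)"
  have pop: "runs (k + 4) S' (Pop 0) (s, out) (s, out) 1"
    using runs_Pop[of 0 "k + 4" S' s out] 2 by (simp add: fun_upd_idem)
  have popc: "runs (k + 4) S' (Pop Ctl) (s, out) (s(Ctl := []), out) 1"
    using runs_Pop[of Ctl "k + 4" S' s out] 2 by simp
  have nil: "runs (k + 4) S' split_com (s(Ctl := []), out) (s(Ctl := []), out) 1"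
    unfolding split_com_def by (rule runs_While_Nil) auto
  have body: "runs (k + 4) S' ?B (s, out) (s(Ctl := []), out) (1 + 1 + 1 + 1)"
    by (rule runs_Case) (use 2 runs_Seq[OF pop popc] S in auto)
  have R: "runs (k + 4) S' split_com (s, out) (s(Ctl := []), out) (1 + 1 + 1 + 1 + 1 + 1)"
    unfolding split_com_def
    by (rule runs_While_step[OF _ _ body nil[unfolded split_com_def]]) (use 2 in auto)
  have eq: "s(Ctl := []) = s(0 := snd (splitf [] acc), Tmp := fst (splitf [] acc), Ctl := [])"
    using 2 by auto
  show ?case unfolding eq[symmetric] by (rule runs_mono[OF R]) simp
qed

lemma splitf_pair:
  "splitf (map bit_symbol (pair_string x y)) acc = (rev (map bit_symbol x) @ acc, map bit_symbol y)"
proof (induction x arbitrary: acc)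
  case Nil
  show ?case by (simp add: pair_string_def bit_symbol_def)
next
  case (Cons b x)
  have "pair_string (b # x) y = True # b # pair_string x y" by (simp add: pair_string_def)
  then show ?case using Cons by (simp add: bit_symbol_def)
qed

lemma length_splitf: "length (fst (splitf w acc)) \<le> length w + length acc"
    "length (snd (splitf w acc)) \<le> length w"
  by (induction w acc rule: splitf.induct) (auto split: list.splits simp: le_SucI)

definition move_com :: "(bool \<Rightarrow> 'a :: countable) \<Rightarrow> com" where
  "move_com inp = While Tmp (Case Tmp (\<lambda>b. Pop Tmp ;; Push 1 (symbol_code (inp (b = 2)))))"

lemma runs_move_com:
  assumes S: "symbol_code (inp True) < S" "symbol_code (inp False) < S" and k: "0 < k"
  shows "s Tmp = w \<Longrightarrow> runs (k + 4) S (move_com inp) (s, out)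
    (s(Tmp := [], 1 := rev (map (\<lambda>b. symbol_code (inp (b = 2))) w) @ s 1), out) (6 * length w + 1)"
proof (induction w arbitrary: s)
  case Nil
  then have "s(Tmp := [], 1 := rev (map (\<lambda>b :: nat. symbol_code (inp (b = 2))) []) @ s 1) = s" by auto
  moreover have "runs (k + 4) S (move_com inp) (s, out) (s, out) (6 * length ([] :: nat list) + 1)"
    unfolding move_com_def using runs_While_Nil[of Tmp "k + 4" s S _ out] Nil by simp
  ultimately show ?case by (simp only:)
next
  case (Cons b w)
  let ?c = "symbol_code (inp (b = 2))"
  let ?s1 = "s(Tmp := w)" let ?s2 = "?s1(1 := ?c # s 1)"
  have c: "?c < S" using S by (cases "b = 2") auto
  have pop: "runs (k + 4) S (Pop Tmp) (s, out) (?s1, out) 1"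
    using runs_Pop[of Tmp "k + 4" S s out] Cons.prems by simp
  have push: "runs (k + 4) S (Push 1 ?c) (?s1, out) (?s2, out) 2"
    using runs_Push[of ?c S 1 "k + 4" ?s1 out] c k by simp
  have body: "runs (k + 4) S (Case Tmp (\<lambda>b. Pop Tmp ;; Push 1 (symbol_code (inp (b = 2))))) (s, out) (?s2, out) (1 + 2 + 1 + 1)"
    by (rule runs_Case) (use c Cons.prems runs_Seq[OF pop push] in auto)
  have "runs (k + 4) S (move_com inp) (?s2, out)
      (?s2(Tmp := [], 1 := rev (map (\<lambda>b. symbol_code (inp (b = 2))) w) @ ?s2 1), out) (6 * length w + 1)"
    by (rule Cons.IH) (use k in simp)
  note loop = this[unfolded move_com_def]
  have R: "runs (k + 4) S (move_com inp) (s, out)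
      (?s2(Tmp := [], 1 := rev (map (\<lambda>b. symbol_code (inp (b = 2))) w) @ ?s2 1), out)
      (1 + 2 + 1 + 1 + (6 * length w + 1) + 1)"
    unfolding move_com_def
    by (rule runs_While_step[OF _ _ body loop]) (use Cons.prems in auto)
  have eq: "?s2(Tmp := [], 1 := rev (map (\<lambda>b. symbol_code (inp (b = 2))) w) @ ?s2 1) =
      s(Tmp := [], 1 := rev (map (\<lambda>b. symbol_code (inp (b = 2))) (b # w)) @ s 1)"
    by (auto simp: fun_eq_iff)
  show ?case unfolding eq[symmetric] by (rule runs_mono[OF R]) simp
qed

definition verify_com :: "(bool \<Rightarrow> 'a :: countable) \<Rightarrow> 'a \<Rightarrow> 'a \<Rightarrow> 'a stack_rule list \<Rightarrow> com" where
  "verify_com inp e c \<rho>s = Push 1 (symbol_code e) ;; Push 2 (symbol_code c) ;; Push Ctl 1 ;;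
     split_com ;; move_com inp ;; loop_com \<rho>s ;;
     Case Err (\<lambda>x. if x = 0 then Case 2 (\<lambda>x. if x = 0 then Emit 2 else Skip) else Skip)"

lemma wf_verify_com:
  assumes "valid_rules S \<rho>s" "symbol_code (inp True) < S" "symbol_code (inp False) < S" "1 < k"
    and "symbol_code e < S" "symbol_code c < S"
  shows "wf_com (k + 4) S (verify_com inp e c \<rho>s)"
proof -
  have "3 \<le> S" using assms(1) by (rule valid_rules_ge)
  moreover have "symbol_code (inp b) < S" for b using assms by (cases b) auto
  ultimately show ?thesis
    using assms wf_dispatch_com[OF assms(1)]
    by (simp add: verify_com_def split_com_def move_com_def loop_com_def)
qed

lemma dispatchf_iterate_sound:
  assumes v: "valid_rules S \<rho>s"
  shows "stacks_rel s s' \<Longrightarrow> (dispatchf \<rho>s ^^ n) s' Err = [] \<Longrightarrow>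
    \<exists>t. (s, t) \<in> rewrite_step (set \<rho>s) ^^ n \<and> stacks_rel t ((dispatchf \<rho>s ^^ n) s')"
proof (induction n)
  case (Suc n)
  have "(dispatchf \<rho>s ^^ n) s' Err = []"
    using Suc.prems(2) dispatchf_Err[OF v, of "(dispatchf \<rho>s ^^ n) s'"] by simp
  then obtain t where t: "(s, t) \<in> rewrite_step (set \<rho>s) ^^ n" "stacks_rel t ((dispatchf \<rho>s ^^ n) s')"
    using Suc by blast
  have "dispatchf \<rho>s ((dispatchf \<rho>s ^^ n) s') Err = []" using Suc.prems(2) by simp
  from dispatchf_sound[OF v t(2) this] t(1) show ?case by auto
qed auto

lemma dispatchf_iterate_complete:
  assumes v: "valid_rules S \<rho>s"
  shows "stacks_rel s s' \<Longrightarrow> (s, t) \<in> rewrite_step (set \<rho>s) ^^ n \<Longrightarrow>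
    \<exists>y. length y \<le> n * length \<rho>s \<and> set y \<subseteq> {1, 2} \<and>
      (\<forall>i<n. (dispatchf \<rho>s ^^ i) (s'(0 := y)) 0 \<noteq> []) \<and>
      (dispatchf \<rho>s ^^ n) (s'(0 := y)) 0 = [] \<and>
      stacks_rel t ((dispatchf \<rho>s ^^ n) (s'(0 := y))) \<and>
      (\<forall>j>k. (dispatchf \<rho>s ^^ n) (s'(0 := y)) j = s' j)"
proof (induction n arbitrary: s s')
  case 0
  then have st: "s = t" by simp
  show ?case
  proof (intro exI conjI)
    show "stacks_rel t ((dispatchf \<rho>s ^^ 0) (s'(0 := [])))"
      using 0(1) by (simp only: st funpow_0 stacks_rel_zero)
  qed auto
next
  case (Suc n)
  let ?D = "dispatchf \<rho>s"
  obtain s1 where s1: "(s, s1) \<in> rewrite_step (set \<rho>s)" "(s1, t) \<in> rewrite_step (set \<rho>s) ^^ n"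
    using relpow_Suc_D2[OF Suc.prems(2)] by blast
  from dispatchf_complete[OF v Suc.prems(1) s1(1)] obtain y1 where
    y1: "length y1 \<le> length \<rho>s" "set y1 \<subseteq> {1, 2}" "y1 \<noteq> []" and
    st: "\<And>z. stacks_rel s1 (?D (s'(0 := y1 @ z)))" "\<And>z. ?D (s'(0 := y1 @ z)) 0 = z"
      "\<And>z j. j > k \<Longrightarrow> ?D (s'(0 := y1 @ z)) j = s' j"
    unfolding Let_def by blast
  define s1' where "s1' = ?D (s'(0 := y1 @ []))"
  have eq: "?D (s'(0 := y1 @ z)) = s1'(0 := z)" for z
  proof
    fix j
    consider "j = 0" | r where "j = Suc r" "r < k" | "j > k" by (cases j) force+
    then show "?D (s'(0 := y1 @ z)) j = (s1'(0 := z)) j"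
      by cases (use st(1,2)[of z] st(1,2)[of "[]"] st(3)[of j z] st(3)[of j "[]"] in \<open>auto simp: s1'_def stacks_rel_def\<close>)
  qed
  have "stacks_rel s1 s1'" using st(1)[of "[]"] by (simp only: s1'_def)
  from Suc.IH[OF this s1(2)] obtain y2 where
    y2: "length y2 \<le> n * length \<rho>s" "set y2 \<subseteq> {1, 2}"
    "\<forall>i<n. (?D ^^ i) (s1'(0 := y2)) 0 \<noteq> []" "(?D ^^ n) (s1'(0 := y2)) 0 = []"
    "stacks_rel t ((?D ^^ n) (s1'(0 := y2)))" "\<forall>j>k. (?D ^^ n) (s1'(0 := y2)) j = s1' j" by blast
  have shift: "(?D ^^ Suc i) (s'(0 := y1 @ y2)) = (?D ^^ i) (s1'(0 := y2))" for i
    by (simp only: funpow_Suc_right o_apply eq)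
  show ?case
  proof (intro exI[of _ "y1 @ y2"] conjI allI impI)
    show "length (y1 @ y2) \<le> Suc n * length \<rho>s" "set (y1 @ y2) \<subseteq> {1, 2}" using y1 y2 by auto
    show "(?D ^^ i) (s'(0 := y1 @ y2)) 0 \<noteq> []" if "i < Suc n" for i
      using that y1(3) y2(3) shift by (cases i) auto
    show "(?D ^^ Suc n) (s'(0 := y1 @ y2)) 0 = []"
      "stacks_rel t ((?D ^^ Suc n) (s'(0 := y1 @ y2)))" unfolding shift using y2 by auto
    show "(?D ^^ Suc n) (s'(0 := y1 @ y2)) j = s' j" if "k < j" for j
      unfolding shift using y2(6) st(3)[of j "[]"] that by (simp add: s1'_def)
  qed
qed

end

text \<open>\<open>represents\<close> admits no 0 inside a stack, so this may be assumed of all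
  registers. An empty register can then be recognised by its top symbol.\<close>

lemma runs_assuming:
  assumes "(\<And>r. r < k \<Longrightarrow> 0 \<notin> set (s r)) \<Longrightarrow> runs k S c (s, out) st n"
  shows "runs k S c (s, out) st n"
  unfolding runs_def
proof (intro allI impI)
  fix ks t h assume rep: "represents k S (s, out) t h"
  then have "set (s r) \<subseteq> {0<..<S}" if "r < k" for r using that by (simp add: represents_def)
  then have "0 \<notin> set (s r)" if "r < k" for r using that by fastforce
  then show "\<exists>m\<le>n. \<exists>t' h'. (cstep k S ^^ m) (c # ks, t, h) = (ks, t', h') \<and> represents k S st t' h'"
    using assms rep unfolding runs_def by blast
qed

text \<open>A certificate lists, in unary, the rules to be applied.\<close>

theorem NP_rewriting:
  fixes inp :: "bool \<Rightarrow> 'a :: countable" and \<rho>s :: "'a stack_rule list"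
  assumes k: "1 < k" and regs: "\<And>po pu r a. (po, pu) \<in> set \<rho>s \<Longrightarrow> (r, a) \<in> set po \<union> set pu \<Longrightarrow> r < k"
    and complete: "\<And>x. x \<in> L \<Longrightarrow> \<exists>n \<le> poly p (length x). \<exists>s.
      ((\<lambda>_. [])(0 := map inp x @ [e], 1 := [c]), s) \<in> rewrite_step (set \<rho>s) ^^ n \<and> s 1 = []"
    and sound: "\<And>x s. ((\<lambda>_. [])(0 := map inp x @ [e], 1 := [c]), s) \<in> (rewrite_step (set \<rho>s))\<^sup>* \<Longrightarrow> s 1 = [] \<Longrightarrow> x \<in> L"
  shows "L \<in> NP"
proof -
  let ?D = "dispatchf k \<rho>s"
  define A where "A = {inp True, inp False, e, c} \<union> (\<Union>(po, pu) \<in> set \<rho>s. snd ` (set po \<union> set pu))"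
  have finA: "finite A" unfolding A_def by auto
  \<comment> \<open>Exceeds the code of every symbol in use; the 3 is the least alphabet size that a
    machine may have.\<close>
  define S where "S = 3 + (\<Sum>a\<in>A. Suc (symbol_code a))"
  have S: "symbol_code a < S" if "a \<in> A" for a
    using member_le_sum[OF that _ finA, of "\<lambda>a. Suc (symbol_code a)"] by (simp add: S_def)
  have v: "valid_rules k S \<rho>s"
    unfolding valid_rules_def valid_list_def
  proof (intro conjI ballI)
    show "3 \<le> S" by (simp add: S_def)
    fix \<rho> assume \<rho>: "\<rho> \<in> set \<rho>s"
    obtain po pu where [simp]: "\<rho> = (po, pu)" by force
    have "r < k \<and> symbol_code a < S" if "(r, a) \<in> set po \<union> set pu" for r a
      using regs[OF _ that] S[of a] \<rho> that unfolding A_def by force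
    then show "case \<rho> of (po, pu) \<Rightarrow> (\<forall>(r, a)\<in>set po. r < k \<and> symbol_code a < S) \<and>
        (\<forall>(r, a)\<in>set pu. r < k \<and> symbol_code a < S)" by auto
  qed
  have S3: "3 \<le> S" using v by (rule valid_rules_ge)
  have Si: "symbol_code (inp True) < S" "symbol_code (inp False) < S" and Sc: "symbol_code e < S" "symbol_code c < S" using S by (auto simp: A_def)
  obtain B where B: "\<And>s out. runs (k + 4) S (dispatch_com k \<rho>s) (s, out) (?D s, out) B"
    using runs_dispatch_com[OF v] by auto
  define start where "start w = ((\<lambda>_. [])(0 := snd (splitf w []),
      1 := rev (map (\<lambda>b. symbol_code (inp (b = 2))) (fst (splitf w []))) @ [symbol_code e],
      2 := [symbol_code c]) :: nat \<Rightarrow> nat list)" for w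
  \<comment> \<open>The registers when the certificate is used up. The word is accepted if no error
    has occurred and stack 1, which is register 2, is empty.\<close>
  define res where "res w = (?D ^^ (LEAST n. (?D ^^ n) (start w) 0 = [])) (start w)" for w
  define f where "f w = (if res (map bit_symbol w) (k + 3) = [] \<and> res (map bit_symbol w) 2 = [] then [True] else [])"
    for w
  have res: "res w = (?D ^^ n) (start w)"
    if "(?D ^^ n) (start w) 0 = []" "\<forall>i<n. (?D ^^ i) (start w) 0 \<noteq> []" for w n
  proof -
    have "(LEAST n. (?D ^^ n) (start w) 0 = []) = n"
      by (rule Least_equality) (use that not_less in blast)+
    then show ?thesis by (simp add: res_def)
  qed
  have "polytime f"
  proof (rule polytimeI[OF wf_verify_com[OF v Si k Sc] _ S3])
    fix w
    let ?w = "map bit_symbol w"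
    let ?s0 = "(\<lambda>_. [])(0 := ?w) :: nat \<Rightarrow> nat list"
    let ?sa = "?s0(1 := [symbol_code e])" let ?sb = "?sa(2 := [symbol_code c])"
    let ?s1 = "?sb(k + 2 := [1])"
    let ?s2 = "?s1(0 := snd (splitf ?w []), k + 1 := fst (splitf ?w []), k + 2 := [])"
    have ra: "runs (k + 4) S (Push 1 (symbol_code e)) (?s0, []) (?sa, []) 2"
      using runs_Push[of "symbol_code e" S 1 "k + 4" ?s0 "[]"] Sc by simp
    have rb: "runs (k + 4) S (Push 2 (symbol_code c)) (?sa, []) (?sb, []) 2"
      using runs_Push[of "symbol_code c" S 2 "k + 4" ?sa "[]"] Sc by simp
    have r1: "runs (k + 4) S (Push (k + 2) 1) (?sb, []) (?s1, []) 2"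
      using runs_Push[of 1 S "k + 2" "k + 4" ?sb "[]"] S3 k by simp
    have r2: "runs (k + 4) S (split_com k) (?s1, []) (?s2, []) (10 * length ?w + 8)"
      by (rule runs_split_com) (use S3 k in \<open>auto simp: bit_symbol_def\<close>)
    have r3: "runs (k + 4) S (move_com k inp) (?s2, [])
      (?s2(k + 1 := [], 1 := rev (map (\<lambda>b. symbol_code (inp (b = 2))) (fst (splitf ?w []))) @ ?s2 1), [])
      (6 * length (fst (splitf ?w [])) + 1)"
      by (rule runs_move_com[OF Si]) (use k in simp_all)
    have eq: "?s2(k + 1 := [], 1 := rev (map (\<lambda>b. symbol_code (inp (b = 2))) (fst (splitf ?w []))) @ ?s2 1) =
      start ?w" using k by (auto simp: start_def fun_eq_iff)
    obtain n where n: "(?D ^^ n) (start ?w) 0 = []" "\<forall>i<n. (?D ^^ i) (start ?w) 0 \<noteq> []" and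
      r4: "runs (k + 4) S (loop_com k \<rho>s) (start ?w, []) ((?D ^^ n) (start ?w), []) (length (start ?w 0) * (B + 1) + 1)"
      using loop_runs[OF v B, of "start ?w" "[]"] by blast
    note r4 = r4[folded res[OF n]]
    have r5: "runs (k + 4) S (Case (k + 3) (\<lambda>x. if x = 0 then Case 2 (\<lambda>x. if x = 0 then Emit 2 else Skip) else Skip))
      (res ?w, []) (res ?w, map bit_symbol (f w)) (1 + 1 + 1)"
    proof (rule runs_Case)
      have e: "(top xs = 0) = (xs = [])" if "0 \<notin> set xs" for xs using that by (cases xs) auto
      show "runs (k + 4) S ((\<lambda>x. if x = 0 then Case 2 (\<lambda>x. if x = 0 then Emit 2 else Skip) else Skip) (top (res ?w (k + 3))))
        (res ?w, []) (res ?w, map bit_symbol (f w)) (1 + 1)"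
      proof (rule runs_assuming)
        assume "\<And>r. r < k + 4 \<Longrightarrow> 0 \<notin> set (res ?w r)"
        then have t: "top (res ?w (k + 3)) = 0 \<longleftrightarrow> res ?w (k + 3) = []" "top (res ?w 2) = 0 \<longleftrightarrow> res ?w 2 = []"
          using e by auto
        show ?thesis
        proof (cases "res ?w (k + 3) = []")
          case True
          have "runs (k + 4) S (if top (res ?w 2) = 0 then Emit 2 else Skip) (res ?w, [])
              (res ?w, map bit_symbol (f w)) 1"
            using runs_Emit[of 2 "k + 4" S "res ?w" "[]"] runs_Skip[of "k + 4" S "(res ?w, [])"] t True
            by (auto simp: f_def bit_symbol_def)
          from runs_Case[of 2 "k + 4" S "\<lambda>x. if x = 0 then Emit 2 else Skip" "res ?w", OF _ _ this]
          show ?thesis using True t S3 by simp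
        next
          case False
          then show ?thesis using t runs_mono[OF runs_Skip] by (simp add: f_def)
        qed
      qed
    qed (use S3 in auto)
    show "\<exists>s'. runs (k + 4) S (verify_com k inp e c \<rho>s) (?s0, []) (s', map bit_symbol (f w))
        (poly [:60, B + 20:] (length w))"
    proof (intro exI, rule runs_mono)
      show "runs (k + 4) S (verify_com k inp e c \<rho>s) (?s0, []) (res ?w, map bit_symbol (f w))
        (2 + (2 + (2 + ((10 * length ?w + 8) + ((6 * length (fst (splitf ?w [])) + 1) +
          ((length (start ?w 0) * (B + 1) + 1) + (1 + 1 + 1) + 1) + 1) + 1) + 1) + 1) + 1)"
        unfolding verify_com_def
        by (rule runs_Seq[OF ra runs_Seq[OF rb runs_Seq[OF r1 runs_Seq[OF r2 runs_Seq[OF r3[unfolded eq] runs_Seq[OF r4 r5]]]]]])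
      have "length (start ?w 0) \<le> length w" "length (fst (splitf ?w [])) \<le> length w"
        using length_splitf[of ?w "[]"] by (auto simp: start_def)
      moreover from this(1) have "length (start ?w 0) * (B + 1) \<le> length w * (B + 1)" by (rule mult_le_mono1)
      ultimately show "2 + (2 + (2 + ((10 * length ?w + 8) + ((6 * length (fst (splitf ?w [])) + 1) +
          ((length (start ?w 0) * (B + 1) + 1) + (1 + 1 + 1) + 1) + 1) + 1) + 1) + 1) + 1 \<le> poly [:60, B + 20:] (length w)"
        by (simp add: algebra_simps)
    qed
  qed simp
  \<comment> \<open>The factor \<open>length \<rho>s\<close> bounds the length of the unary code of
    one rule.\<close>
  moreover have "x \<in> L \<longleftrightarrow> (\<exists>y. length y \<le> poly (smult (length \<rho>s) p) (length x) \<and> f (pair_string x y) = [True])" for x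
  proof -
    define s0 where "s0 = ((\<lambda>_. [])(0 := map inp x @ [e], 1 := [c]) :: nat \<Rightarrow> 'a list)"
    define st where "st = ((\<lambda>_. [])(1 := map (\<lambda>b. symbol_code (inp b)) x @ [symbol_code e], 2 := [symbol_code c]) :: nat \<Rightarrow> nat list)"
    have start: "start (map bit_symbol (pair_string x y)) = st(0 := map bit_symbol y)" for y
      by (auto simp: start_def st_def splitf_pair bit_symbol_def rev_map fun_eq_iff)
    have rel: "stacks_rel k s0 st" by (auto simp: stacks_rel_def s0_def st_def numeral_2_eq_2)
    then have rel': "stacks_rel k s0 (st(0 := y))" for y by (simp only: stacks_rel_zero)
    have f: "f (pair_string x y) = [True] \<longleftrightarrow>
        (?D ^^ n) (st(0 := map bit_symbol y)) (k + 3) = [] \<and> (?D ^^ n) (st(0 := map bit_symbol y)) 2 = []"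
      if "(?D ^^ n) (st(0 := map bit_symbol y)) 0 = []"
        "\<forall>i<n. (?D ^^ i) (st(0 := map bit_symbol y)) 0 \<noteq> []" for n y
      using res[of n "map bit_symbol (pair_string x y)"] that by (simp add: f_def start)
    show ?thesis
    proof
      assume "x \<in> L"
      then obtain n s where n: "n \<le> poly p (length x)" "(s0, s) \<in> rewrite_step (set \<rho>s) ^^ n" "s 1 = []"
        using complete unfolding s0_def by blast
      from dispatchf_iterate_complete[OF v rel n(2)] obtain y where y: "length y \<le> n * length \<rho>s"
        "set y \<subseteq> {1, 2}" "\<forall>i<n. (?D ^^ i) (st(0 := y)) 0 \<noteq> []" "(?D ^^ n) (st(0 := y)) 0 = []"
        "stacks_rel k s ((?D ^^ n) (st(0 := y)))" "\<forall>j>k. (?D ^^ n) (st(0 := y)) j = st j" by blast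
      define z where "z = map (\<lambda>a. a = 2) y"
      have z: "map bit_symbol z = y"
        unfolding z_def map_map by (rule map_idI) (use y(2) in \<open>auto simp: bit_symbol_def\<close>)
      have "(?D ^^ n) (st(0 := y)) 2 = []" using y(5) n(3) k unfolding stacks_rel_def
        by (auto dest!: spec[of _ 1] simp: numeral_2_eq_2)
      moreover have "(?D ^^ n) (st(0 := y)) (k + 3) = []" using y(6) k by (simp add: st_def)
      ultimately have "f (pair_string x z) = [True]" using f[of n z] y(3,4) by (simp add: z)
      moreover have "length z \<le> poly (smult (length \<rho>s) p) (length x)"
        using le_trans[OF y(1) mult_le_mono1[OF n(1), of "length \<rho>s"]]
        by (simp only: z_def length_map poly_smult mult.commute)
      ultimately show "\<exists>y. length y \<le> poly (smult (length \<rho>s) p) (length x) \<and> f (pair_string x y) = [True]"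
        by blast
    next
      assume "\<exists>y. length y \<le> poly (smult (length \<rho>s) p) (length x) \<and> f (pair_string x y) = [True]"
      then obtain y where y: "f (pair_string x y) = [True]" by blast
      let ?s = "st(0 := map bit_symbol y)"
      obtain n where n: "(?D ^^ n) ?s 0 = []" "\<forall>i<n. (?D ^^ i) ?s 0 \<noteq> []"
        using loop_runs[OF v B, of ?s] by blast
      from f[OF n] y have e: "(?D ^^ n) ?s (k + 3) = []" "(?D ^^ n) ?s 2 = []" by auto
      from dispatchf_iterate_sound[OF v rel' e(1)] obtain t where
        t: "(s0, t) \<in> rewrite_step (set \<rho>s) ^^ n" "stacks_rel k t ((?D ^^ n) ?s)" by blast
      have "t 1 = []" using t(2) e(2) k unfolding stacks_rel_def
        by (auto dest!: spec[of _ 1] simp: numeral_2_eq_2)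
      then show "x \<in> L" using sound t(1) relpow_imp_rtrancl unfolding s0_def by blast
    qed
  qed
  ultimately show ?thesis unfolding NP_def by blast
qed

section \<open>Membership in NP\<close>

lemma binary_0 [simp]: "binary 0 = []"
  by (subst binary.simps) simp

lemma binary_pos: "0 < n \<Longrightarrow> binary n = odd n # binary (n div 2)"
  by (subst binary.simps) simp

fun number :: "bool list \<Rightarrow> nat" where
  "number [] = 0"
| "number (b # bs) = of_bool b + 2 * number bs"

definition canonical :: "bool list \<Rightarrow> bool" where
  "canonical bs \<longleftrightarrow> bs = [] \<or> last bs"

lemma number_binary [simp]: "number (binary n) = n"
proof (induction n rule: less_induct)
  case (less n)
  then show ?case by (cases "n = 0") (auto simp: binary_pos)
qed

lemma canonical_binary: "canonical (binary n)"
proof (induction n rule: less_induct)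
  case (less n)
  show ?case
  proof (cases "n = 0")
    case False
    then have "canonical (binary (n div 2))" using less by simp
    moreover have "odd n" if "binary (n div 2) = []"
    proof -
      have "n div 2 = 0" using that number_binary[of "n div 2"] by simp
      then show ?thesis using False by presburger
    qed
    ultimately show ?thesis using False by (auto simp: binary_pos canonical_def)
  qed (simp add: canonical_def)
qed

lemma binary_number: "canonical bs \<Longrightarrow> binary (number bs) = bs"
proof (induction bs)
  case (Cons b bs)
  have c: "canonical bs" using Cons.prems by (auto simp: canonical_def split: if_splits)
  have "0 < number (b # bs)"
  proof (rule ccontr)
    assume "\<not> ?thesis"
    then have "\<not> b" "number bs = 0" by (auto split: if_splits)
    then have "bs = []" using Cons.IH[OF c] by simp
    then show False using Cons.prems \<open>\<not> b\<close> by (simp add: canonical_def)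
  qed
  moreover have "number (b # bs) div 2 = number bs" "odd (number (b # bs)) = b" by (auto split: if_splits)
  ultimately show ?case using Cons.IH[OF c] by (simp add: binary_pos del: number.simps)
qed simp

lemma binary_inj: "binary u = binary v \<Longrightarrow> u = v"
  by (metis number_binary)

text \<open>\<open>Entry_Eq\<close> and \<open>Entry_Gt\<close> tell whether the name being guessed
  has so far agreed with the previous name or already exceeds it. \<open>Seek\<close> and
  \<open>Match\<close> carry \<open>None\<close> in the list of variables, and in a constraint the
  values of its earlier entries.\<close>

datatype control =
    Begin | Table | Entry_Eq | Entry_Gt | Rewind | Vars
  | Seek "nat list option" | Match "nat list option" | Constraints | Slots "nat list"

datatype sym = Bit bool | Mark | End | Free nat | Used nat | Ctrl control

instance control :: countable by countable_datatype
instance sym :: countable by countable_datatype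

definition rl :: "control \<Rightarrow> (nat \<times> sym) list \<Rightarrow> control \<Rightarrow> (nat \<times> sym) list \<Rightarrow> sym stack_rule" where
  "rl q po q' pu = ((1, Ctrl q) # po, (1, Ctrl q') # pu)"

context
  fixes m n :: nat and RI :: "nat list set"
begin

text \<open>The values read in the current constraint are kept in the control. Bounding their number
  keeps the set of rules finite.\<close>

definition short :: "nat list set" where
  "short = {is. set is \<subseteq> {..<m} \<and> length is < n}"

definition phases :: "nat list option set" where
  "phases = insert None (Some ` short)"

definition tabsyms :: "sym set" where
  "tabsyms = insert Mark (range Bit \<union> Free ` {..<m} \<union> Used ` {..<m})"

text \<open>Stack 0 holds the instance and stack 1 the control. First a table is guessed, which lists names
  in increasing order, each with a value. It is a tape with its head between the stacks 2 and 3; the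
  stacks 4 and 5 hold the last name, which must be exceeded by the next. The names in the list of
  variables are marked as used, and the constraints may refer only to used names.\<close>

definition csp_rules :: "sym stack_rule set" where
  "csp_rules =
     {rl Begin [] Table [(4, Mark), (5, Mark)]} \<union>
     (\<lambda>i. rl Begin [] Table [(4, Mark), (5, Mark), (2, Mark), (2, Free i)]) ` {..<m} \<union>
     {rl Table [] Entry_Eq [(2, Mark)]} \<union>
     (\<lambda>b. rl Entry_Eq [(4, Bit b)] Entry_Eq [(2, Bit b), (5, Bit b)]) ` UNIV \<union>
     {rl Entry_Eq [(4, Bit False)] Entry_Gt [(2, Bit True), (5, Bit True)]} \<union>
     (\<lambda>b. rl Entry_Eq [(4, Mark)] Entry_Gt [(4, Mark), (2, Bit b), (5, Bit b)]) ` UNIV \<union>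
     (\<lambda>b. rl Entry_Gt [(4, Bit b)] Entry_Gt []) ` UNIV \<union>
     (\<lambda>b. rl Entry_Gt [] Entry_Gt [(2, Bit b), (5, Bit b)]) ` UNIV \<union>
     (\<lambda>i. rl Entry_Gt [(4, Mark), (5, Bit True)] Rewind [(4, Mark), (5, Bit True), (2, Free i)]) ` {..<m} \<union>
     (\<lambda>b. rl Rewind [(5, Bit b)] Rewind [(4, Bit b)]) ` UNIV \<union>
     {rl Rewind [(5, Mark)] Table [(5, Mark)], rl Table [] Vars [],
      rl Vars [(0, Bit True)] (Seek None) [], rl Vars [(0, Bit False)] Constraints []} \<union>
     (\<lambda>(k, a). rl (Seek k) [(2, a)] (Seek k) [(3, a)]) ` (phases \<times> tabsyms) \<union>
     (\<lambda>(k, a). rl (Seek k) [(3, a)] (Seek k) [(2, a)]) ` (phases \<times> tabsyms) \<union>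
     (\<lambda>k. rl (Seek k) [(3, Mark)] (Match k) [(2, Mark)]) ` phases \<union>
     (\<lambda>(k, b). rl (Match k) [(0, Bit True), (0, Bit b), (3, Bit b)] (Match k) [(2, Bit b)]) ` (phases \<times> UNIV) \<union>
     (\<lambda>i. rl (Match None) [(0, Bit False), (3, Free i)] Vars [(2, Used i)]) ` {..<m} \<union>
     (\<lambda>i. rl (Match None) [(0, Bit False), (3, Used i)] Vars [(2, Used i)]) ` {..<m} \<union>
     {rl Constraints [(0, Bit True)] (Slots []) [], ([(1, Ctrl Constraints), (0, Bit False), (0, End)], [])} \<union>
     (\<lambda>v. rl (Slots v) [(0, Bit True)] (Seek (Some v)) []) ` short \<union>
     (\<lambda>v. rl (Slots v) [(0, Bit False)] Constraints []) ` RI \<union>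
     (\<lambda>(v, i). rl (Match (Some v)) [(0, Bit False), (3, Used i)] (Slots (v @ [i])) [(2, Used i)]) ` (short \<times> {..<m})"

lemma finite_nlists: "finite A \<Longrightarrow> finite (nlists k A)"
  unfolding nlists_def using finite_lists_length_eq[of A k] by (simp only: conj_commute)

lemma finite_short: "finite short"
proof -
  have "short \<subseteq> {is. set is \<subseteq> {..<m} \<and> length is \<le> n}" by (auto simp: short_def)
  then show ?thesis using finite_lists_length_le[of "{..<m}" n] finite_subset by blast
qed

lemma finite_RI: "RI \<subseteq> nlists n {..<m} \<Longrightarrow> finite RI"
  using finite_nlists[of "{..<m}" n] finite_subset by blast

lemma finite_csp_rules: "RI \<subseteq> nlists n {..<m} \<Longrightarrow> finite csp_rules"
  unfolding csp_rules_def phases_def tabsyms_def using finite_short finite_RI by simp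

lemma csp_rules_regs: "(po, pu) \<in> csp_rules \<Longrightarrow> (r, a) \<in> set po \<union> set pu \<Longrightarrow> r < 6"
proof -
  have *: "\<forall>\<rho> \<in> csp_rules. \<forall>x \<in> set (fst \<rho>) \<union> set (snd \<rho>). fst x < 6"
    unfolding csp_rules_def by (simp add: ball_Un rl_def split_beta)
  assume "(po, pu) \<in> csp_rules" "(r, a) \<in> set po \<union> set pu"
  then show "r < 6" using *[rule_format, of "(po, pu)" "(r, a)"] by simp
qed

section \<open>Soundness of the rewriting system: an invariant\<close>

definition cfg :: "sym list \<Rightarrow> sym list \<Rightarrow> sym list \<Rightarrow> sym list \<Rightarrow> sym list \<Rightarrow> sym list \<Rightarrow> nat \<Rightarrow> sym list" where
  "cfg W Q A B C D = (\<lambda>r. if r = 0 then W else if r = 1 then Q else if r = 2 then A else if r = 3 then B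
     else if r = 4 then C else if r = 5 then D else [])"

lemma cfg_simps [simp]:
  "cfg W Q A B C D 0 = W" "cfg W Q A B C D (Suc 0) = Q" "cfg W Q A B C D 2 = A"
  "cfg W Q A B C D 3 = B" "cfg W Q A B C D 4 = C" "cfg W Q A B C D 5 = D"
  "(cfg W Q A B C D)(0 := X) = cfg X Q A B C D" "(cfg W Q A B C D)(Suc 0 := X) = cfg W X A B C D"
  "(cfg W Q A B C D)(2 := X) = cfg W Q X B C D" "(cfg W Q A B C D)(3 := X) = cfg W Q A X C D"
  "(cfg W Q A B C D)(4 := X) = cfg W Q A B X D" "(cfg W Q A B C D)(5 := X) = cfg W Q A B C X"
  by (auto simp: cfg_def fun_eq_iff)

lemma pop_all_Cons: "pop_all ((r, a) # ps) s = Some s1 \<longleftrightarrow> (\<exists>xs. s r = a # xs \<and> pop_all ps (s(r := xs)) = Some s1)"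
  by (cases "s r") auto

declare pop_all.simps(2) [simp del]

definition tab :: "(bool list \<times> sym) list \<Rightarrow> sym list" where
  "tab es = concat (map (\<lambda>(bs, v). Mark # map Bit bs @ [v]) es)"

lemma tab_simps [simp]: "tab [] = []" "tab ((bs, v) # es) = Mark # map Bit bs @ v # tab es"
  "tab (es @ fs) = tab es @ tab fs"
  by (auto simp: tab_def)

definition vals :: "sym set" where
  "vals = Free ` {..<m} \<union> Used ` {..<m}"

text \<open>A guessed assignment must not give two values to one variable. Strictly increasing names
  exclude this, and the order can be checked against the last name alone.\<close>

definition good :: "(bool list \<times> sym) list \<Rightarrow> bool" where
  "good es \<longleftrightarrow> sorted_wrt (<) (map fst es) \<and> (\<forall>(bs, v) \<in> set es. canonical bs \<and> v \<in> vals)"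

definition bits :: "bool list \<Rightarrow> bool list" where
  "bits d = concat (map (\<lambda>b. [True, b]) d)"

lemma bits_simps [simp]: "bits [] = []" "bits (b # d) = True # b # bits d" "bits (d @ e) = bits d @ bits e"
  by (auto simp: bits_def)

lemma encode_var_bits: "encode_var u = bits (binary u) @ [False]"
  by (simp add: encode_var_def encode_list_def bits_def)

definition items :: "nat list \<Rightarrow> bool list" where
  "items us = concat (map (\<lambda>v. True # encode_var v) us)"

definition citems :: "nat list list \<Rightarrow> bool list" where
  "citems cs = concat (map (\<lambda>c. True # items c @ [False]) cs)"

lemma items_simps [simp]: "items [] = []" "items (us @ [u]) = items us @ True # bits (binary u) @ [False]"
  "items (u # us) = True # bits (binary u) @ False # items us"
  by (auto simp: items_def encode_var_bits)

lemma citems_simps [simp]: "citems [] = []" "citems (cs @ [c]) = citems cs @ True # items c @ [False]"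
  "citems (c # cs) = True # items c @ False # citems cs"
  by (auto simp: citems_def)

lemma encode_list_items: "encode_list encode_var us = items us @ [False]"
  by (simp add: encode_list_def items_def)

lemma encode_list_citems: "encode_list (encode_list encode_var) cs = citems cs @ [False]"
  by (simp add: encode_list_def citems_def items_def)

definition marked :: "nat list \<Rightarrow> (bool list \<times> sym) list \<Rightarrow> bool" where
  "marked xs es \<longleftrightarrow> (\<forall>bs i. (bs, Used i) \<in> set es \<longrightarrow> bs \<in> binary ` set xs) \<and>
     (\<forall>u \<in> set xs. \<exists>i. (binary u, Used i) \<in> set es)"

definition slots :: "(bool list \<times> sym) list \<Rightarrow> nat list \<Rightarrow> nat list \<Rightarrow> bool" where
  "slots es = list_all2 (\<lambda>u i. (binary u, Used i) \<in> set es)"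

definition okc :: "(bool list \<times> sym) list \<Rightarrow> nat list list \<Rightarrow> bool" where
  "okc es cs \<longleftrightarrow> (\<forall>c \<in> set cs. \<exists>v \<in> RI. slots es c v)"

text \<open>\<open>read_so_far k xs cs us\<close> is the part of the instance that has been read when a variable is about
  to be looked up, where \<open>k\<close> tells whether this variable occurs in a constraint.\<close>

definition read_so_far :: "nat list option \<Rightarrow> nat list \<Rightarrow> nat list list \<Rightarrow> nat list \<Rightarrow> bool list" where
  "read_so_far k xs cs us = (case k of None \<Rightarrow> items xs @ [True]
     | Some v \<Rightarrow> items xs @ [False] @ citems cs @ [True] @ items us @ [True])"

definition lookup_inv :: "nat list option \<Rightarrow> (bool list \<times> sym) list \<Rightarrow> nat list \<Rightarrow> nat list list \<Rightarrow> nat list \<Rightarrow> bool" where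
  "lookup_inv k es xs cs us \<longleftrightarrow> good es \<and> marked xs es \<and>
     (case k of None \<Rightarrow> True | Some v \<Rightarrow> okc es cs \<and> slots es us v \<and> v \<in> short)"

text \<open>\<open>w\<close> is the unread part of the instance. In \<open>Entry_Gt\<close> nothing
  is demanded of the rest \<open>c\<close> of the previous name: \<open>d\<close> already exceeds
  all names in the table, and appending bits keeps it so.\<close>

fun run_inv :: "bool list \<Rightarrow> control \<Rightarrow> bool list \<Rightarrow> sym list \<Rightarrow> sym list \<Rightarrow> sym list \<Rightarrow> sym list \<Rightarrow> bool" where
  "run_inv x Begin w A B C D \<longleftrightarrow> w = x \<and> A = [] \<and> B = [] \<and> C = [] \<and> D = []"
| "run_inv x Table w A B C D \<longleftrightarrow> w = x \<and> (\<exists>es p. A = rev (tab es) \<and> B = [] \<and> C = map Bit p @ [Mark] \<and> D = [Mark] \<and>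
     good es \<and> snd ` set es \<subseteq> range Free \<and> (\<forall>bs \<in> fst ` set es. bs \<le> p))"
| "run_inv x Entry_Eq w A B C D \<longleftrightarrow> w = x \<and> (\<exists>es c d. A = map Bit (rev d) @ [Mark] @ rev (tab es) \<and> B = [] \<and>
     C = map Bit c @ [Mark] \<and> D = map Bit (rev d) @ [Mark] \<and>
     good es \<and> snd ` set es \<subseteq> range Free \<and> (\<forall>bs \<in> fst ` set es. bs \<le> d @ c))"
| "run_inv x Entry_Gt w A B C D \<longleftrightarrow> w = x \<and> (\<exists>es c d. A = map Bit (rev d) @ [Mark] @ rev (tab es) \<and> B = [] \<and>
     C = map Bit c @ [Mark] \<and> D = map Bit (rev d) @ [Mark] \<and>
     good es \<and> snd ` set es \<subseteq> range Free \<and> (\<forall>bs \<in> fst ` set es. bs < d))"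
| "run_inv x Rewind w A B C D \<longleftrightarrow> w = x \<and> (\<exists>es c d. A = rev (tab es) \<and> B = [] \<and>
     C = map Bit c @ [Mark] \<and> D = map Bit (rev d) @ [Mark] \<and>
     good es \<and> snd ` set es \<subseteq> range Free \<and> (\<forall>bs \<in> fst ` set es. bs \<le> d @ c))"
| "run_inv x Vars w A B C D \<longleftrightarrow> (\<exists>es xs. x = items xs @ w \<and> rev A @ B = tab es \<and> good es \<and> marked xs es)"
| "run_inv x (Seek k) w A B C D \<longleftrightarrow> (\<exists>es xs cs us. x = read_so_far k xs cs us @ w \<and>
     rev A @ B = tab es \<and> lookup_inv k es xs cs us)"
| "run_inv x (Match k) w A B C D \<longleftrightarrow> (\<exists>es xs cs us d A'. x = read_so_far k xs cs us @ bits d @ w \<and>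
     A = map Bit (rev d) @ [Mark] @ A' \<and> rev A @ B = tab es \<and> lookup_inv k es xs cs us)"
| "run_inv x Constraints w A B C D \<longleftrightarrow> (\<exists>es xs cs. x = items xs @ [False] @ citems cs @ w \<and>
     rev A @ B = tab es \<and> good es \<and> marked xs es \<and> okc es cs)"
| "run_inv x (Slots v) w A B C D \<longleftrightarrow> (\<exists>es xs cs us. x = items xs @ [False] @ citems cs @ [True] @ items us @ w \<and>
     rev A @ B = tab es \<and> good es \<and> marked xs es \<and> okc es cs \<and> slots es us v)"

definition accepted :: "bool list \<Rightarrow> bool" where
  "accepted x \<longleftrightarrow> (\<exists>es xs cs. x = items xs @ [False] @ citems cs @ [False] \<and> good es \<and> marked xs es \<and> okc es cs)"

definition run_invs :: "bool list \<Rightarrow> (nat \<Rightarrow> sym list) \<Rightarrow> bool" where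
  "run_invs x s \<longleftrightarrow> (\<exists>q w A B C D. s = cfg (map Bit w @ [End]) [Ctrl q] A B C D \<and> run_inv x q w A B C D) \<or>
     (s 1 = [] \<and> accepted x)"

text \<open>Between a \<open>Mark\<close> and the next value there are only \<open>Bit\<close>
  symbols, so what has been matched around the head is exactly one entry and not a part of
  one.\<close>

lemma tab_split:
  assumes "tab es = p @ [Mark] @ map Bit d @ [v] @ q" "v \<in> vals" "snd ` set es \<subseteq> vals"
  shows "\<exists>es1 es2. es = es1 @ (d, v) # es2 \<and> tab es1 = p \<and> tab es2 = q"
  using assms(1,3)
proof (induction es arbitrary: p)
  case Nil
  then show ?case by simp
next
  case (Cons e es)
  obtain bs u where e: "e = (bs, u)" by force
  have u: "u \<in> vals" using Cons.prems e by auto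
  have key: "bs = d \<and> u = v \<and> r = q" if "map Bit bs @ u # r = map Bit d @ v # q" for r q
    using that
  proof (induction bs arbitrary: d)
    case Nil
    then show ?case using u by (cases d) (auto simp: vals_def)
  next
    case (Cons b bs)
    then show ?case using assms(2) by (cases d) (auto simp: vals_def)
  qed
  show ?case
  proof (cases p)
    case Nil
    then have "map Bit bs @ u # tab es = map Bit d @ v # q" using Cons.prems e by simp
    from key[OF this] show ?thesis using e Nil by (intro exI[of _ "[]"] exI[of _ es]) auto
  next
    case (Cons a p')
    have eq: "map Bit bs @ u # tab es = p' @ Mark # map Bit d @ v # q" and "a = Mark"
      using Cons.prems(1) e Cons by auto
    moreover have "\<exists>p''. p' = map Bit bs @ u # p''"
      using eq u
    proof (induction bs arbitrary: p')
      case Nil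
      then show ?case by (cases p') (auto simp: vals_def)
    next
      case (Cons b bs)
      then show ?case by (cases p') auto
    qed
    ultimately obtain p'' where p'': "p' = map Bit bs @ u # p''" "tab es = p'' @ [Mark] @ map Bit d @ [v] @ q"
      by auto
    from Cons.IH[OF p''(2)] obtain es1 es2 where "es = es1 @ (d, v) # es2" "tab es1 = p''" "tab es2 = q"
      using Cons.prems(2) by auto
    then show ?thesis using e Cons p'' \<open>a = Mark\<close> by (intro exI[of _ "e # es1"] exI[of _ es2]) auto
  qed
qed

lemma map_Bit_Cons: "Bit b # xs = map Bit w @ [End] \<longleftrightarrow> (\<exists>w'. w = b # w' \<and> xs = map Bit w' @ [End])"
  "map Bit w @ [End] = Bit b # xs \<longleftrightarrow> (\<exists>w'. w = b # w' \<and> xs = map Bit w' @ [End])"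
  "map Bit w @ [End] = End # xs \<longleftrightarrow> w = [] \<and> xs = []"
  by (cases w; auto)+

lemma map_Bit_Mark: "map Bit w @ [Mark] = Bit b # xs \<longleftrightarrow> (\<exists>w'. w = b # w' \<and> xs = map Bit w' @ [Mark])"
  "map Bit w @ [Mark] = Mark # xs \<longleftrightarrow> w = [] \<and> xs = []"
  by (cases w; auto)+

lemma good_snoc:
  assumes "good es" "\<forall>bs \<in> fst ` set es. bs < d" "canonical d" "i < m"
  shows "good (es @ [(d, Free i)])"
  using assms by (auto simp: good_def sorted_wrt_append vals_def)

lemma rewrite_step_iff:
  "(s, s') \<in> rewrite_step P \<longleftrightarrow>
     (\<exists>\<rho> \<in> P. \<exists>s1. pop_all (fst \<rho>) s = Some s1 \<and> s' = push_all (snd \<rho>) s1)"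
  by (simp add: rewrite_step_def split_beta)

lemmas rule_simps = rewrite_step_iff csp_rules_def bex_Un rl_def pop_all_Cons split_beta

lemma invsI: "run_inv x q w A B C D \<Longrightarrow> run_invs x (cfg (map Bit w @ [End]) [Ctrl q] A B C D)"
  unfolding run_invs_def by blast

lemma inv_step:
  assumes i: "run_inv x q w A B C D" and st: "(cfg (map Bit w @ [End]) [Ctrl q] A B C D, s) \<in> rewrite_step csp_rules"
  shows "run_invs x s"
proof (cases q)
  case Begin
  let ?W = "map Bit w @ [End]"
  have e: "w = x" "A = []" "B = []" "C = []" "D = []" using i Begin by auto
  consider "s = cfg ?W [Ctrl Table] A B (Mark # C) (Mark # D)"
    | j where "j < m" "s = cfg ?W [Ctrl Table] (Free j # Mark # A) B (Mark # C) (Mark # D)"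
    using st unfolding Begin by (auto simp: rule_simps)
  then show ?thesis
  proof cases
    case 1
    have "run_inv x Table w [] [] [Mark] [Mark]"
      using e by (auto simp: good_def intro!: exI[of _ "[] :: (bool list \<times> sym) list"] exI[of _ "[] :: bool list"])
    then show ?thesis using invsI 1 e by simp
  next
    case (2 j)
    have "run_inv x Table w [Free j, Mark] [] [Mark] [Mark]"
      using e 2 by (auto simp: good_def canonical_def vals_def intro!: exI[of _ "[([], Free j)]"] exI[of _ "[] :: bool list"])
    then show ?thesis using invsI 2 e by simp
  qed
next
  case Table
  let ?W = "map Bit w @ [End]"
  obtain es p where e: "w = x" "A = rev (tab es)" "B = []" "C = map Bit p @ [Mark]" "D = [Mark]"
    "good es" "snd ` set es \<subseteq> range Free" "\<forall>bs \<in> fst ` set es. bs \<le> p" using i Table by auto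
  consider "s = cfg ?W [Ctrl Entry_Eq] (Mark # A) B C D" | "s = cfg ?W [Ctrl Vars] A B C D"
    using st unfolding Table by (auto simp: rule_simps)
  then show ?thesis
  proof cases
    case 1
    have "run_inv x Entry_Eq w (Mark # A) B C D"
      unfolding run_inv.simps
      by (intro conjI, rule e(1), rule exI[of _ es], rule exI[of _ p], rule exI[of _ "[]"]) (use e in auto)
    then show ?thesis using invsI 1 by simp
  next
    case 2
    have "marked [] es" using e(7) by (force simp: marked_def)
    then have "run_inv x Vars w A B C D"
      using e by (auto intro!: exI[of _ es] exI[of _ "[] :: nat list"])
    then show ?thesis using invsI 2 by simp
  qed
next
  case Entry_Eq
  let ?W = "map Bit w @ [End]"
  obtain es c d where e: "w = x" "A = map Bit (rev d) @ [Mark] @ rev (tab es)" "B = []" "C = map Bit c @ [Mark]"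
    "D = map Bit (rev d) @ [Mark]"
    "good es" "snd ` set es \<subseteq> range Free" "\<forall>bs \<in> fst ` set es. bs \<le> d @ c" using i Entry_Eq by auto
  consider b C' where "C = Bit b # C'" "s = cfg ?W [Ctrl Entry_Eq] (Bit b # A) B C' (Bit b # D)"
    | C' where "C = Bit False # C'" "s = cfg ?W [Ctrl Entry_Gt] (Bit True # A) B C' (Bit True # D)"
    | b C' where "C = Mark # C'" "s = cfg ?W [Ctrl Entry_Gt] (Bit b # A) B C (Bit b # D)"
    using st unfolding Entry_Eq by (auto simp: rule_simps)
  then show ?thesis
  proof cases
    case (1 b C')
    then obtain c' where c': "c = b # c'" "C' = map Bit c' @ [Mark]" using e by (auto simp: map_Bit_Mark)
    have "run_inv x Entry_Eq w (Bit b # A) B C' (Bit b # D)"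
      unfolding run_inv.simps
      by (intro conjI, rule e(1), rule exI[of _ es], rule exI[of _ c'], rule exI[of _ "d @ [b]"]) (use e c' in auto)
    then show ?thesis using invsI 1 by simp
  next
    case (2 C')
    then obtain c' where c': "c = False # c'" "C' = map Bit c' @ [Mark]" using e by (auto simp: map_Bit_Mark)
    have "d @ False # c' < d @ [True]" by (induction d) auto
    then have "d @ c < d @ [True]" using c' by simp
    then have lt: "\<forall>bs \<in> fst ` set es. bs < d @ [True]" using e(8) by (meson le_less_trans)
    have "run_inv x Entry_Gt w (Bit True # A) B C' (Bit True # D)"
      unfolding run_inv.simps
      by (intro conjI, rule e(1), rule exI[of _ es], rule exI[of _ c'], rule exI[of _ "d @ [True]"]) (use e c' lt in auto)
    then show ?thesis using invsI 2 by simp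
  next
    case (3 b C')
    then have c: "c = []" using e by (auto simp: map_Bit_Mark)
    have "d < d @ [b]" by (induction d) auto
    then have "d @ c < d @ [b]" using c by simp
    then have lt: "\<forall>bs \<in> fst ` set es. bs < d @ [b]" using e(8) by (meson le_less_trans)
    have "run_inv x Entry_Gt w (Bit b # A) B C (Bit b # D)"
      unfolding run_inv.simps
      by (intro conjI, rule e(1), rule exI[of _ es], rule exI[of _ c], rule exI[of _ "d @ [b]"]) (use e lt in auto)
    then show ?thesis using invsI 3 by simp
  qed
next
  case Entry_Gt
  let ?W = "map Bit w @ [End]"
  obtain es c d where e: "w = x" "A = map Bit (rev d) @ [Mark] @ rev (tab es)" "B = []" "C = map Bit c @ [Mark]"
    "D = map Bit (rev d) @ [Mark]"
    "good es" "snd ` set es \<subseteq> range Free" "\<forall>bs \<in> fst ` set es. bs < d" using i Entry_Gt by auto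
  consider b C' where "C = Bit b # C'" "s = cfg ?W [Ctrl Entry_Gt] A B C' D"
    | b where "s = cfg ?W [Ctrl Entry_Gt] (Bit b # A) B C (Bit b # D)"
    | j C' D' where "j < m" "C = Mark # C'" "D = Bit True # D'" "s = cfg ?W [Ctrl Rewind] (Free j # A) B C D"
    using st unfolding Entry_Gt by (auto simp: rule_simps)
  then show ?thesis
  proof cases
    case (1 b C')
    then obtain c' where c': "c = b # c'" "C' = map Bit c' @ [Mark]" using e by (auto simp: map_Bit_Mark)
    have "run_inv x Entry_Gt w A B C' D"
      unfolding run_inv.simps
      by (intro conjI, rule e(1), rule exI[of _ es], rule exI[of _ c'], rule exI[of _ d]) (use e c' in auto)
    then show ?thesis using invsI 1 by simp
  next
    case (2 b)
    have "d < d @ [b]" by (induction d) auto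
    then have lt: "\<forall>bs \<in> fst ` set es. bs < d @ [b]" using e(8) by (meson less_trans)
    have "run_inv x Entry_Gt w (Bit b # A) B C (Bit b # D)"
      unfolding run_inv.simps
      by (intro conjI, rule e(1), rule exI[of _ es], rule exI[of _ c], rule exI[of _ "d @ [b]"]) (use e lt in auto)
    then show ?thesis using invsI 2 by simp
  next
    case (3 j C' D')
    then have c: "c = []" using e by (auto simp: map_Bit_Mark)
    have "canonical d" using e(5) 3 by (cases d rule: rev_cases) (auto simp: canonical_def)
    then have g: "good (es @ [(d, Free j)])" using good_snoc e 3 by blast
    have f: "snd ` set (es @ [(d, Free j)]) \<subseteq> range Free" using e(7) by simp
    have le: "\<forall>bs \<in> fst ` set (es @ [(d, Free j)]). bs \<le> d @ []" using e(8) by (simp add: less_imp_le)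
    have "run_inv x Rewind w (Free j # A) B C D"
      unfolding run_inv.simps
      by (intro conjI, rule e(1), rule exI[of _ "es @ [(d, Free j)]"], rule exI[of _ "[]"], rule exI[of _ d])
        (intro conjI g f le; use e c in \<open>simp add: rev_map\<close>)
    then show ?thesis using invsI 3 by simp
  qed
next
  case Rewind
  let ?W = "map Bit w @ [End]"
  obtain es c d where e: "w = x" "A = rev (tab es)" "B = []" "C = map Bit c @ [Mark]"
    "D = map Bit (rev d) @ [Mark]"
    "good es" "snd ` set es \<subseteq> range Free" "\<forall>bs \<in> fst ` set es. bs \<le> d @ c" using i Rewind by auto
  consider b D' where "D = Bit b # D'" "s = cfg ?W [Ctrl Rewind] A B (Bit b # C) D'"
    | D' where "D = Mark # D'" "s = cfg ?W [Ctrl Table] A B C D"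
    using st unfolding Rewind by (auto simp: rule_simps)
  then show ?thesis
  proof cases
    case (1 b D')
    then obtain d' where d': "d = d' @ [b]" "D' = map Bit (rev d') @ [Mark]"
      using e by (cases d rule: rev_cases) auto
    have "run_inv x Rewind w A B (Bit b # C) D'"
      unfolding run_inv.simps
      by (intro conjI, rule e(1), rule exI[of _ es], rule exI[of _ "b # c"], rule exI[of _ d']) (use e d' in auto)
    then show ?thesis using invsI 1 by simp
  next
    case (2 D')
    then have d: "d = []" using e by (cases d rule: rev_cases) auto
    have "run_inv x Table w A B C D"
      unfolding run_inv.simps
      by (intro conjI, rule e(1), rule exI[of _ es], rule exI[of _ c]) (use e d in auto)
    then show ?thesis using invsI 2 by simp
  qed
next
  case Vars
  obtain es xs where e: "x = items xs @ w" "rev A @ B = tab es" "good es" "marked xs es" using i Vars by auto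
  consider w' where "w = True # w'" "s = cfg (map Bit w' @ [End]) [Ctrl (Seek None)] A B C D"
    | w' where "w = False # w'" "s = cfg (map Bit w' @ [End]) [Ctrl Constraints] A B C D"
    using st unfolding Vars by (auto simp: rule_simps map_Bit_Cons)
  then show ?thesis
  proof cases
    case (1 w')
    then have "run_inv x (Seek None) w' A B C D"
      using e by (auto simp: read_so_far_def lookup_inv_def)
    then show ?thesis using invsI 1 by simp
  next
    case (2 w')
    then have "run_inv x Constraints w' A B C D"
      using e by (auto simp: okc_def intro!: exI[of _ es] exI[of _ xs] exI[of _ "[] :: nat list list"])
    then show ?thesis using invsI 2 by simp
  qed
next
  case (Seek k)
  let ?W = "map Bit w @ [End]"
  obtain es xs cs us where e: "x = read_so_far k xs cs us @ w" "rev A @ B = tab es" "lookup_inv k es xs cs us"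
    using i Seek by auto
  consider a A' where "A = a # A'" "s = cfg ?W [Ctrl (Seek k)] A' (a # B) C D"
    | a B' where "B = a # B'" "s = cfg ?W [Ctrl (Seek k)] (a # A) B' C D"
    | B' where "B = Mark # B'" "s = cfg ?W [Ctrl (Match k)] (Mark # A) B' C D"
    using st unfolding Seek by (auto simp: rule_simps)
  then show ?thesis
  proof cases
    case (1 a A')
    then have "run_inv x (Seek k) w A' (a # B) C D" using e by auto
    then show ?thesis using invsI 1 by simp
  next
    case (2 a B')
    then have "run_inv x (Seek k) w (a # A) B' C D" using e by auto
    then show ?thesis using invsI 2 by simp
  next
    case (3 B')
    have "run_inv x (Match k) w (Mark # A) B' C D"
      unfolding run_inv.simps
      by (rule exI[of _ es], rule exI[of _ xs], rule exI[of _ cs], rule exI[of _ us], rule exI[of _ "[]"], rule exI[of _ A])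
        (use e 3 in auto)
    then show ?thesis using invsI 3 by simp
  qed
next
  case (Match k)
  obtain es xs cs us d A' where e: "x = read_so_far k xs cs us @ bits d @ w"
    "A = map Bit (rev d) @ [Mark] @ A'" "rev A @ B = tab es" "lookup_inv k es xs cs us"
    using i Match by auto
  have g: "good es" "marked xs es" using e(4) by (auto simp: lookup_inv_def)
  have split: "\<exists>es1 es2. es = es1 @ (d, v) # es2 \<and> tab es1 = rev A' \<and> tab es2 = B'"
    if "B = v # B'" "v \<in> vals" for v B'
    by (rule tab_split) (use e that g in \<open>auto simp: rev_map good_def\<close>)
  consider b w' B' where "w = True # b # w'" "B = Bit b # B'"
      "s = cfg (map Bit w' @ [End]) [Ctrl (Match k)] (Bit b # A) B' C D"
    | w' j B' where "k = None" "j < m" "w = False # w'" "B = Free j # B'"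
      "s = cfg (map Bit w' @ [End]) [Ctrl Vars] (Used j # A) B' C D"
    | w' j B' where "k = None" "j < m" "w = False # w'" "B = Used j # B'"
      "s = cfg (map Bit w' @ [End]) [Ctrl Vars] (Used j # A) B' C D"
    | w' v j B' where "k = Some v" "v \<in> short" "j < m" "w = False # w'" "B = Used j # B'"
      "s = cfg (map Bit w' @ [End]) [Ctrl (Slots (v @ [j]))] (Used j # A) B' C D"
    using st unfolding Match by (auto simp: rule_simps map_Bit_Cons)
  then consider b w' B' where "w = True # b # w'" "B = Bit b # B'"
      "s = cfg (map Bit w' @ [End]) [Ctrl (Match k)] (Bit b # A) B' C D"
    | w' v j B' where "k = None" "j < m" "v = Free j \<or> v = Used j" "w = False # w'" "B = v # B'"
      "s = cfg (map Bit w' @ [End]) [Ctrl Vars] (Used j # A) B' C D"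
    | w' v j B' where "k = Some v" "v \<in> short" "j < m" "w = False # w'" "B = Used j # B'"
      "s = cfg (map Bit w' @ [End]) [Ctrl (Slots (v @ [j]))] (Used j # A) B' C D"
    by cases blast+
  then show ?thesis
  proof cases
    case (1 b w' B')
    have "run_inv x (Match k) w' (Bit b # A) B' C D"
      unfolding run_inv.simps
      by (rule exI[of _ es], rule exI[of _ xs], rule exI[of _ cs], rule exI[of _ us],
          rule exI[of _ "d @ [b]"], rule exI[of _ A']) (use e 1 in auto)
    then show ?thesis using invsI 1 by simp
  next
    case (2 w' v j B')
    then have "v \<in> vals" by (auto simp: vals_def)
    from split[OF 2(5) this] obtain es1 es2 where es: "es = es1 @ (d, v) # es2" "tab es1 = rev A'" "tab es2 = B'"
      by blast
    \<comment> \<open>Marking the entry adds its name to the variables read so far. If it was marked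
      before, the name is repeated in the list, which an encoding allows.\<close>
    let ?es = "es1 @ (d, Used j) # es2"
    have d: "binary (number d) = d" using g(1) es by (intro binary_number) (auto simp: good_def)
    have "good ?es" using g(1) es 2 by (auto simp: good_def vals_def)
    moreover have "marked (xs @ [number d]) ?es"
      unfolding marked_def
    proof (intro conjI allI impI ballI)
      fix bs i assume "(bs, Used i) \<in> set ?es"
      then have "(bs, Used i) \<in> set es \<or> bs = d" using es by auto
      then show "bs \<in> binary ` set (xs @ [number d])" using g(2) d by (auto simp: marked_def)
    next
      fix u assume "u \<in> set (xs @ [number d])"
      then consider "binary u = d" | i where "(binary u, Used i) \<in> set es"
        using g(2) d by (auto simp: marked_def)
      then show "\<exists>i. (binary u, Used i) \<in> set ?es" using es by cases auto
    qed
    moreover have "x = items (xs @ [number d]) @ w'" using e(1) 2 d by (simp add: read_so_far_def)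
    moreover have "rev (Used j # A) @ B' = tab ?es" using e es by (simp add: rev_map)
    ultimately have "run_inv x Vars w' (Used j # A) B' C D" unfolding run_inv.simps by blast
    then show ?thesis using invsI 2 by simp
  next
    case (3 w' v j B')
    then have "Used j \<in> vals" by (auto simp: vals_def)
    from split[OF 3(5) this] have dj: "(d, Used j) \<in> set es" by auto
    have d: "binary (number d) = d" using g(1) dj by (intro binary_number) (auto simp: good_def)
    have l: "okc es cs" "slots es us v" using e(4) 3 by (auto simp: lookup_inv_def)
    have "slots es (us @ [number d]) (v @ [j])" using l dj d unfolding slots_def by (intro list_all2_appendI) auto
    moreover have "x = items xs @ [False] @ citems cs @ [True] @ items (us @ [number d]) @ w'"
      using e(1) 3 d by (simp add: read_so_far_def)
    moreover have "rev (Used j # A) @ B' = tab es" using e 3 by simp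
    ultimately have "run_inv x (Slots (v @ [j])) w' (Used j # A) B' C D" unfolding run_inv.simps using g l by blast
    then show ?thesis using invsI 3 by simp
  qed
next
  case Constraints
  obtain es xs cs where e: "x = items xs @ [False] @ citems cs @ w" "rev A @ B = tab es" "good es" "marked xs es"
    "okc es cs" using i Constraints by auto
  consider w' where "w = True # w'" "s = cfg (map Bit w' @ [End]) [Ctrl (Slots [])] A B C D"
    | "w = [False]" "s 1 = []"
    using st unfolding Constraints by (auto simp: rule_simps map_Bit_Cons)
  then show ?thesis
  proof cases
    case (1 w')
    have "run_inv x (Slots []) w' A B C D"
      unfolding run_inv.simps
      by (rule exI[of _ es], rule exI[of _ xs], rule exI[of _ cs], rule exI[of _ "[]"])
        (use e 1 in \<open>auto simp: slots_def\<close>)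
    then show ?thesis using invsI 1 by simp
  next
    case 2
    then have "accepted x" using e unfolding accepted_def by auto
    then show ?thesis using 2 by (simp add: run_invs_def)
  qed
next
  case (Slots v)
  obtain es xs cs us where e: "x = items xs @ [False] @ citems cs @ [True] @ items us @ w" "rev A @ B = tab es"
    "good es" "marked xs es" "okc es cs" "slots es us v" using i Slots by auto
  consider w' where "w = True # w'" "v \<in> short" "s = cfg (map Bit w' @ [End]) [Ctrl (Seek (Some v))] A B C D"
    | w' where "w = False # w'" "v \<in> RI" "s = cfg (map Bit w' @ [End]) [Ctrl Constraints] A B C D"
    using st unfolding Slots by (auto simp: rule_simps map_Bit_Cons)
  then show ?thesis
  proof cases
    case (1 w')
    have "run_inv x (Seek (Some v)) w' A B C D"
      unfolding run_inv.simps
      by (rule exI[of _ es], rule exI[of _ xs], rule exI[of _ cs], rule exI[of _ us])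
        (use e 1 in \<open>auto simp: read_so_far_def lookup_inv_def\<close>)
    then show ?thesis using invsI 1 by simp
  next
    case (2 w')
    have "okc es (cs @ [us])" using e 2 by (auto simp: okc_def)
    then have "run_inv x Constraints w' A B C D"
      unfolding run_inv.simps
      by (intro exI[of _ es] exI[of _ xs] exI[of _ "cs @ [us]"]) (use e 2 in auto)
    then show ?thesis using invsI 2 by simp
  qed
qed

lemma invs_star:
  assumes "(cfg (map Bit x @ [End]) [Ctrl Begin] [] [] [] [], s) \<in> (rewrite_step csp_rules)\<^sup>*"
  shows "run_invs x s"
  using assms
proof (induction rule: rtrancl_induct)
  case base
  show ?case by (rule invsI) simp
next
  case (step s t)
  from step.IH[unfolded run_invs_def] show ?case
  proof
    assume "\<exists>q w A B C D. s = cfg (map Bit w @ [End]) [Ctrl q] A B C D \<and> run_inv x q w A B C D"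
    then show ?thesis using inv_step step.hyps(2) by blast
  next
    assume "s 1 = [] \<and> accepted x"
    then have "(s, t) \<notin> rewrite_step csp_rules" by (auto simp: rule_simps)
    then show ?thesis using step.hyps(2) by simp
  qed
qed

section \<open>Completeness of the rewriting system: short accepting runs\<close>

definition reach :: "nat \<Rightarrow> (nat \<Rightarrow> sym list) \<Rightarrow> (nat \<Rightarrow> sym list) \<Rightarrow> bool" where
  "reach N s s' \<longleftrightarrow> (\<exists>k\<le>N. (s, s') \<in> rewrite_step csp_rules ^^ k)"

lemma reach_refl: "reach N s s"
  unfolding reach_def by (intro exI[of _ 0]) simp

lemma reach_step: "(s, s') \<in> rewrite_step csp_rules \<Longrightarrow> reach 1 s s'"
  unfolding reach_def by (intro exI[of _ 1]) simp

lemma reach_trans: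
  assumes "reach N1 s s'" "reach N2 s' s''" "N1 + N2 \<le> N"
  shows "reach N s s''"
proof -
  obtain k1 k2 where k: "k1 \<le> N1" "(s, s') \<in> rewrite_step csp_rules ^^ k1"
    "k2 \<le> N2" "(s', s'') \<in> rewrite_step csp_rules ^^ k2"
    using assms(1,2) unfolding reach_def by blast
  have "(s, s'') \<in> rewrite_step csp_rules ^^ (k1 + k2)" using k by (auto simp: relpow_add)
  then show ?thesis unfolding reach_def using k(1,3) assms(3) by (intro exI[of _ "k1 + k2"]) auto
qed

lemma reach_gt_clear:
  "reach (length c) (cfg W [Ctrl Entry_Gt] A B (map Bit c @ [Mark]) D) (cfg W [Ctrl Entry_Gt] A B [Mark] D)"
proof (induction c)
  case (Cons b c)
  have "reach 1 (cfg W [Ctrl Entry_Gt] A B (map Bit (b # c) @ [Mark]) D)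
      (cfg W [Ctrl Entry_Gt] A B (map Bit c @ [Mark]) D)"
    by (rule reach_step) (auto simp: rule_simps)
  from reach_trans[OF this Cons] show ?case by simp
qed (simp add: reach_refl)

lemma reach_gt_push:
  "reach (length r) (cfg W [Ctrl Entry_Gt] A B C D)
     (cfg W [Ctrl Entry_Gt] (map Bit (rev r) @ A) B C (map Bit (rev r) @ D))"
proof (induction r arbitrary: A D)
  case (Cons b r)
  have "reach 1 (cfg W [Ctrl Entry_Gt] A B C D) (cfg W [Ctrl Entry_Gt] (Bit b # A) B C (Bit b # D))"
    by (rule reach_step) (auto simp: rule_simps)
  from reach_trans[OF this Cons] show ?case by simp
qed (simp add: reach_refl)

text \<open>The run follows the common prefix of both names. At the first difference the old name
  has \<open>False\<close> and the new one \<open>True\<close>, or else the old name has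
  ended.\<close>

lemma reach_eq:
  "c < r \<Longrightarrow> reach (length c + length r) (cfg W [Ctrl Entry_Eq] A B (map Bit c @ [Mark]) D)
     (cfg W [Ctrl Entry_Gt] (map Bit (rev r) @ A) B [Mark] (map Bit (rev r) @ D))"
proof (induction c arbitrary: r A D)
  case Nil
  then obtain b r' where r: "r = b # r'" by (cases r) auto
  have "reach 1 (cfg W [Ctrl Entry_Eq] A B (map Bit [] @ [Mark]) D)
      (cfg W [Ctrl Entry_Gt] (Bit b # A) B [Mark] (Bit b # D))"
    by (rule reach_step) (auto simp: rule_simps)
  from reach_trans[OF this reach_gt_push[of r']] show ?case by (simp add: r)
next
  case (Cons a c)
  then obtain b r' where r: "r = b # r'" by (cases r) auto
  show ?case
  proof (cases "a = b")
    case True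
    then have "c < r'" using Cons.prems r by simp
    have "reach 1 (cfg W [Ctrl Entry_Eq] A B (map Bit (a # c) @ [Mark]) D)
      (cfg W [Ctrl Entry_Eq] (Bit b # A) B (map Bit c @ [Mark]) (Bit b # D))"
      using True by (intro reach_step) (auto simp: rule_simps)
    from reach_trans[OF this Cons.IH[OF \<open>c < r'\<close>]] show ?thesis by (simp add: r)
  next
    case False
    then have ab: "a = False" "b = True" using Cons.prems r by auto
    have "reach 1 (cfg W [Ctrl Entry_Eq] A B (map Bit (a # c) @ [Mark]) D)
      (cfg W [Ctrl Entry_Gt] (Bit b # A) B (map Bit c @ [Mark]) (Bit b # D))"
      using ab by (intro reach_step) (auto simp: rule_simps)
    from reach_trans[OF reach_trans[OF this reach_gt_clear order_refl] reach_gt_push[of r']]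
    show ?thesis by (simp add: r)
  qed
qed

lemma reach_rewind:
  "reach (length d) (cfg W [Ctrl Rewind] A B C (map Bit (rev d) @ [Mark])) (cfg W [Ctrl Rewind] A B (map Bit d @ C) [Mark])"
proof (induction d arbitrary: C rule: rev_induct)
  case (snoc b d)
  have "reach 1 (cfg W [Ctrl Rewind] A B C (map Bit (rev (d @ [b])) @ [Mark]))
      (cfg W [Ctrl Rewind] A B (Bit b # C) (map Bit (rev d) @ [Mark]))"
    by (rule reach_step) (auto simp: rule_simps)
  from reach_trans[OF this snoc] show ?case by simp
qed (simp add: reach_refl)

lemma reach_entry:
  assumes "p < d" "canonical d" "j < m"
  shows "reach (length p + 2 * length d + 3) (cfg W [Ctrl Table] A B (map Bit p @ [Mark]) [Mark])
     (cfg W [Ctrl Table] (Free j # map Bit (rev d) @ Mark # A) B (map Bit d @ [Mark]) [Mark])"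
proof -
  have 1: "reach 1 (cfg W [Ctrl Table] A B (map Bit p @ [Mark]) [Mark])
      (cfg W [Ctrl Entry_Eq] (Mark # A) B (map Bit p @ [Mark]) [Mark])"
    by (rule reach_step) (auto simp: rule_simps)
  obtain d' where d: "d = d' @ [True]" using assms(1,2) by (cases d rule: rev_cases) (auto simp: canonical_def)
  have 3: "reach 1 (cfg W [Ctrl Entry_Gt] (map Bit (rev d) @ Mark # A) B [Mark] (map Bit (rev d) @ [Mark]))
      (cfg W [Ctrl Rewind] (Free j # map Bit (rev d) @ Mark # A) B [Mark] (map Bit (rev d) @ [Mark]))"
    by (rule reach_step) (use assms(3) d in \<open>auto simp: rule_simps\<close>)
  have 5: "reach 1 (cfg W [Ctrl Rewind] (Free j # map Bit (rev d) @ Mark # A) B (map Bit d @ [Mark]) [Mark])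
      (cfg W [Ctrl Table] (Free j # map Bit (rev d) @ Mark # A) B (map Bit d @ [Mark]) [Mark])"
    by (rule reach_step) (auto simp: rule_simps)
  show ?thesis
    by (rule reach_trans[OF reach_trans[OF reach_trans[OF reach_trans[OF 1 reach_eq[OF assms(1)] order_refl]
              3 order_refl] reach_rewind order_refl] 5]) simp
qed

lemma reach_table:
  assumes "\<And>d. d \<in> set ds \<Longrightarrow> canonical d \<and> ix d < m \<and> length d \<le> L"
  shows "sorted_wrt (<) (p # ds) \<Longrightarrow> length p \<le> L \<Longrightarrow> \<exists>C. reach (length ds * (3 * L + 3))
     (cfg W [Ctrl Table] A B (map Bit p @ [Mark]) [Mark])
     (cfg W [Ctrl Table] (rev (tab (map (\<lambda>d. (d, Free (ix d))) ds)) @ A) B C [Mark])"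
  using assms
proof (induction ds arbitrary: p A)
  case Nil
  then show ?case using reach_refl by auto
next
  case (Cons d ds)
  let ?A = "Free (ix d) # map Bit (rev d) @ Mark # A"
  have "\<exists>C. reach (length ds * (3 * L + 3)) (cfg W [Ctrl Table] ?A B (map Bit d @ [Mark]) [Mark])
     (cfg W [Ctrl Table] (rev (tab (map (\<lambda>d. (d, Free (ix d))) ds)) @ ?A) B C [Mark])"
    by (rule Cons.IH) (use Cons.prems in auto)
  then obtain C where C: "reach (length ds * (3 * L + 3)) (cfg W [Ctrl Table] ?A B (map Bit d @ [Mark]) [Mark])
     (cfg W [Ctrl Table] (rev (tab (map (\<lambda>d. (d, Free (ix d))) ds)) @ ?A) B C [Mark])" by blast
  have d: "p < d" "canonical d" "ix d < m" "length d \<le> L" using Cons.prems by auto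
  have "reach (length (d # ds) * (3 * L + 3)) (cfg W [Ctrl Table] A B (map Bit p @ [Mark]) [Mark])
     (cfg W [Ctrl Table] (rev (tab (map (\<lambda>d. (d, Free (ix d))) ds)) @ ?A) B C [Mark])"
    by (rule reach_trans[OF reach_entry[OF d(1-3)] C]) (use d(4) Cons.prems(2) in simp)
  then show ?case by (auto simp: rev_map)
qed

text \<open>The name of variable 0 is the empty string. It lacks the final bit \<open>True\<close>
  that completes an entry, so only the second rule for \<open>Begin\<close> can write it, as the
  first entry.\<close>

lemma reach_begin:
  assumes "\<And>d. d \<in> set ds \<Longrightarrow> canonical d \<and> ix d < m \<and> length d \<le> L" and "sorted_wrt (<) ds"
  shows "\<exists>C. reach (2 + length ds * (3 * L + 3)) (cfg W [Ctrl Begin] [] [] [] [])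
     (cfg W [Ctrl Vars] (rev (tab (map (\<lambda>d. (d, Free (ix d))) ds))) [] C [Mark])"
proof -
  have "\<exists>C. reach (1 + length ds * (3 * L + 3)) (cfg W [Ctrl Begin] [] [] [] [])
     (cfg W [Ctrl Table] (rev (tab (map (\<lambda>d. (d, Free (ix d))) ds))) [] C [Mark])"
  proof (cases "\<exists>ds'. ds = [] # ds'")
    case True
    then obtain ds' where ds: "ds = [] # ds'" by blast
    have 1: "reach 1 (cfg W [Ctrl Begin] [] [] [] []) (cfg W [Ctrl Table] [Free (ix []), Mark] [] [Mark] [Mark])"
      by (rule reach_step) (use assms(1)[of "[]"] ds in \<open>auto simp: rule_simps\<close>)
    have "\<exists>C. reach (length ds' * (3 * L + 3)) (cfg W [Ctrl Table] [Free (ix []), Mark] [] (map Bit [] @ [Mark]) [Mark])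
     (cfg W [Ctrl Table] (rev (tab (map (\<lambda>d. (d, Free (ix d))) ds')) @ [Free (ix []), Mark]) [] C [Mark])"
      by (rule reach_table) (use assms ds in auto)
    then obtain C where C: "reach (length ds' * (3 * L + 3)) (cfg W [Ctrl Table] [Free (ix []), Mark] [] [Mark] [Mark])
     (cfg W [Ctrl Table] (rev (tab (map (\<lambda>d. (d, Free (ix d))) ds')) @ [Free (ix []), Mark]) [] C [Mark])" by auto
    from reach_trans[OF 1 C, of "1 + length ds * (3 * L + 3)"] show ?thesis by (auto simp: ds)
  next
    case False
    have 1: "reach 1 (cfg W [Ctrl Begin] [] [] [] []) (cfg W [Ctrl Table] [] [] [Mark] [Mark])"
      by (rule reach_step) (auto simp: rule_simps)
    have "[] < d" if dd: "d \<in> set ds" for d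
    proof -
      have "d \<noteq> []"
      proof
        assume "d = []"
        then obtain ds1 ds2 where ds: "ds = ds1 @ [] # ds2" using split_list[of "[]" ds] dd by blast
        then have "ds1 \<noteq> []" using False by (cases ds1) auto
        then show False using assms(2) ds by (cases ds1) (auto simp: sorted_wrt_append)
      qed
      then show ?thesis by (cases d) auto
    qed
    then have "\<exists>C. reach (length ds * (3 * L + 3)) (cfg W [Ctrl Table] [] [] (map Bit [] @ [Mark]) [Mark])
     (cfg W [Ctrl Table] (rev (tab (map (\<lambda>d. (d, Free (ix d))) ds)) @ []) [] C [Mark])"
      by (intro reach_table) (use assms in auto)
    then obtain C where C: "reach (length ds * (3 * L + 3)) (cfg W [Ctrl Table] [] [] [Mark] [Mark])
     (cfg W [Ctrl Table] (rev (tab (map (\<lambda>d. (d, Free (ix d))) ds))) [] C [Mark])" by auto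
    from reach_trans[OF 1 C, of "1 + length ds * (3 * L + 3)"] show ?thesis by auto
  qed
  then obtain C where C: "reach (1 + length ds * (3 * L + 3)) (cfg W [Ctrl Begin] [] [] [] [])
     (cfg W [Ctrl Table] (rev (tab (map (\<lambda>d. (d, Free (ix d))) ds))) [] C [Mark])" by blast
  have 2: "reach 1 (cfg W [Ctrl Table] (rev (tab (map (\<lambda>d. (d, Free (ix d))) ds))) [] C [Mark])
     (cfg W [Ctrl Vars] (rev (tab (map (\<lambda>d. (d, Free (ix d))) ds))) [] C [Mark])"
    by (rule reach_step) (auto simp: rule_simps)
  from reach_trans[OF C 2, of "2 + length ds * (3 * L + 3)"] show ?thesis by auto
qed

lemma reach_left:
  assumes "k \<in> phases" shows "set A1 \<subseteq> tabsyms \<Longrightarrow>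
    reach (length A1) (cfg W [Ctrl (Seek k)] (A1 @ A) B C D) (cfg W [Ctrl (Seek k)] A (rev A1 @ B) C D)"
proof (induction A1 arbitrary: B)
  case (Cons a A1)
  have "reach 1 (cfg W [Ctrl (Seek k)] ((a # A1) @ A) B C D) (cfg W [Ctrl (Seek k)] (A1 @ A) (a # B) C D)"
    by (rule reach_step) (use assms Cons.prems in \<open>auto simp: rule_simps\<close>)
  moreover have "reach (length A1) (cfg W [Ctrl (Seek k)] (A1 @ A) (a # B) C D)
      (cfg W [Ctrl (Seek k)] A (rev A1 @ a # B) C D)" using Cons by simp
  ultimately have "reach (length (a # A1)) (cfg W [Ctrl (Seek k)] ((a # A1) @ A) B C D)
      (cfg W [Ctrl (Seek k)] A (rev A1 @ a # B) C D)" by (rule reach_trans) simp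
  then show ?case by simp
qed (simp add: reach_refl)

lemma reach_right:
  assumes "k \<in> phases" shows "set B1 \<subseteq> tabsyms \<Longrightarrow>
    reach (length B1) (cfg W [Ctrl (Seek k)] A (B1 @ B) C D) (cfg W [Ctrl (Seek k)] (rev B1 @ A) B C D)"
proof (induction B1 arbitrary: A)
  case (Cons a B1)
  have "reach 1 (cfg W [Ctrl (Seek k)] A ((a # B1) @ B) C D) (cfg W [Ctrl (Seek k)] (a # A) (B1 @ B) C D)"
    by (rule reach_step) (use assms Cons.prems in \<open>auto simp: rule_simps\<close>)
  moreover have "reach (length B1) (cfg W [Ctrl (Seek k)] (a # A) (B1 @ B) C D)
      (cfg W [Ctrl (Seek k)] (rev B1 @ a # A) B C D)" using Cons by simp
  ultimately have "reach (length (a # B1)) (cfg W [Ctrl (Seek k)] A ((a # B1) @ B) C D)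
      (cfg W [Ctrl (Seek k)] (rev B1 @ a # A) B C D)" by (rule reach_trans) simp
  then show ?case by simp
qed (simp add: reach_refl)

lemma reach_match:
  assumes "k \<in> phases"
  shows "reach (length d) (cfg (map Bit (bits d @ w) @ [End]) [Ctrl (Match k)] A (map Bit d @ B) C D)
     (cfg (map Bit w @ [End]) [Ctrl (Match k)] (map Bit (rev d) @ A) B C D)"
proof (induction d arbitrary: A)
  case (Cons b d)
  have "reach 1 (cfg (map Bit (bits (b # d) @ w) @ [End]) [Ctrl (Match k)] A (map Bit (b # d) @ B) C D)
     (cfg (map Bit (bits d @ w) @ [End]) [Ctrl (Match k)] (Bit b # A) (map Bit d @ B) C D)"
    by (rule reach_step) (use assms in \<open>auto simp: rule_simps\<close>)
  from reach_trans[OF this Cons] show ?case by simp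
qed (simp add: reach_refl)

text \<open>The previous lookup may have left the head on either side of the wanted entry. In both
  cases the length of the table bounds the movement.\<close>

lemma reach_lookup:
  assumes k: "k \<in> phases" and t: "rev A @ B = tab (es1 @ (d, v) # es2)" and
    sy: "snd ` set (es1 @ (d, v) # es2) \<subseteq> vals"
  shows "reach (length (tab (es1 @ (d, v) # es2)) + length d + 1)
     (cfg (map Bit (bits d @ w) @ [End]) [Ctrl (Seek k)] A B C D)
     (cfg (map Bit w @ [End]) [Ctrl (Match k)] (map Bit (rev d) @ Mark # rev (tab es1)) (v # tab es2) C D)"
proof -
  let ?W = "map Bit (bits d @ w) @ [End]"
  let ?R = "Mark # map Bit d @ v # tab es2"
  have tabs: "set (tab es) \<subseteq> tabsyms" if "snd ` set es \<subseteq> vals" for es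
    using that by (induction es) (auto simp: tabsyms_def vals_def)
  have AB: "set A \<subseteq> tabsyms" "set B \<subseteq> tabsyms"
  proof -
    have "set A \<union> set B = set (tab (es1 @ (d, v) # es2))"
      using arg_cong[OF t, of set] by (simp only: set_append set_rev)
    then show "set A \<subseteq> tabsyms" "set B \<subseteq> tabsyms" using tabs[OF sy] by blast+
  qed
  have len: "length A + length B = length (tab (es1 @ (d, v) # es2))"
    using arg_cong[OF t, of length] by simp
  have "rev A @ B = tab es1 @ ?R" using t by simp
  then consider us where "rev A = tab es1 @ us" "us @ B = ?R" | us where "tab es1 = rev A @ us" "B = us @ ?R"
    unfolding append_eq_append_conv2 by metis
  then have 1: "reach (length (tab (es1 @ (d, v) # es2)))
      (cfg ?W [Ctrl (Seek k)] A B C D) (cfg ?W [Ctrl (Seek k)] (rev (tab es1)) ?R C D)"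
  proof cases
    case 1
    then have A: "A = rev us @ rev (tab es1)" by (metis rev_append rev_rev_ident)
    have "reach (length (rev us)) (cfg ?W [Ctrl (Seek k)] (rev us @ rev (tab es1)) B C D)
        (cfg ?W [Ctrl (Seek k)] (rev (tab es1)) (rev (rev us) @ B) C D)"
      by (rule reach_left[OF k]) (use A AB in auto)
    then have "reach (length us) (cfg ?W [Ctrl (Seek k)] A B C D) (cfg ?W [Ctrl (Seek k)] (rev (tab es1)) ?R C D)"
      using A 1(2) by simp
    then show ?thesis by (rule reach_trans[OF _ reach_refl[of 0]]) (use len A in simp)
  next
    case 2
    have "reach (length us) (cfg ?W [Ctrl (Seek k)] A (us @ ?R) C D)
        (cfg ?W [Ctrl (Seek k)] (rev us @ A) ?R C D)"
      by (rule reach_right[OF k]) (use 2 AB in auto)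
    moreover have "rev us @ A = rev (tab es1)" using 2(1) by simp
    ultimately have "reach (length us) (cfg ?W [Ctrl (Seek k)] A B C D) (cfg ?W [Ctrl (Seek k)] (rev (tab es1)) ?R C D)"
      using 2(2) by simp
    then show ?thesis by (rule reach_trans[OF _ reach_refl[of 0]]) (use len 2 in simp)
  qed
  have 2: "reach 1 (cfg ?W [Ctrl (Seek k)] (rev (tab es1)) ?R C D)
      (cfg ?W [Ctrl (Match k)] (Mark # rev (tab es1)) (map Bit d @ v # tab es2) C D)"
    by (rule reach_step) (use k in \<open>auto simp: rule_simps\<close>)
  show ?thesis
    by (rule reach_trans[OF reach_trans[OF 1 2 order_refl] reach_match[OF k]]) simp
qed

definition table :: "(nat \<Rightarrow> nat) \<Rightarrow> bool list list \<Rightarrow> bool list set \<Rightarrow> (bool list \<times> sym) list" where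
  "table ix ds X = map (\<lambda>d. (d, (if d \<in> X then Used else Free) (ix (number d)))) ds"

lemma table_split:
  assumes "d \<in> set ds" "distinct ds"
  shows "\<exists>es1 es2. table ix ds X = es1 @ (d, (if d \<in> X then Used else Free) (ix (number d))) # es2 \<and>
    table ix ds (insert d X) = es1 @ (d, Used (ix (number d))) # es2"
proof -
  obtain ds1 ds2 where ds: "ds = ds1 @ d # ds2" using split_list[OF assms(1)] by blast
  then have "d \<notin> set ds1" "d \<notin> set ds2" using assms(2) by auto
  then show ?thesis
    by (intro exI[of _ "table ix ds1 X"] exI[of _ "table ix ds2 X"]) (auto simp: table_def ds)
qed

lemma length_tab_table:
  "length (tab (table ix ds X)) = (\<Sum>d\<leftarrow>ds. length d + 2)"
  by (induction ds) (auto simp: table_def)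

lemma table_vals: "(\<And>d. d \<in> set ds \<Longrightarrow> ix (number d) < m) \<Longrightarrow> snd ` set (table ix ds X) \<subseteq> vals"
  by (auto simp: table_def vals_def)

context
  fixes ix :: "nat \<Rightarrow> nat" and ds :: "bool list list" and L K :: nat
  assumes dist: "distinct ds" and ix: "\<And>d. d \<in> set ds \<Longrightarrow> ix (number d) < m"
    and L: "\<And>d. d \<in> set ds \<Longrightarrow> length d \<le> L" and K: "(\<Sum>d\<leftarrow>ds. length d + 2) \<le> K"
begin

lemma reach_vars:
  "binary ` set us \<subseteq> set ds \<Longrightarrow> rev A @ B = tab (table ix ds X) \<Longrightarrow>
   \<exists>A' B'. rev A' @ B' = tab (table ix ds (X \<union> binary ` set us)) \<and>
     reach (length us * (K + L + 3)) (cfg (map Bit (items us @ w) @ [End]) [Ctrl Vars] A B C D)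
       (cfg (map Bit w @ [End]) [Ctrl Vars] A' B' C D)"
proof (induction us arbitrary: A B X)
  case Nil
  then show ?case by (intro exI[of _ A] exI[of _ B]) (simp add: reach_refl)
next
  case (Cons u us)
  let ?d = "binary u" let ?w = "items us @ w"
  define v where "v = (if ?d \<in> X then Used else Free) (ix u)"
  have d: "?d \<in> set ds" using Cons.prems by simp
  obtain es1 es2 where es: "table ix ds X = es1 @ (?d, v) # es2"
    "table ix ds (insert ?d X) = es1 @ (?d, Used (ix u)) # es2"
    using table_split[OF d dist, of ix X] by (auto simp: v_def)
  have j: "ix u < m" using ix[OF d] by simp
  have 1: "reach 1 (cfg (map Bit (items (u # us) @ w) @ [End]) [Ctrl Vars] A B C D)
      (cfg (map Bit (bits ?d @ False # ?w) @ [End]) [Ctrl (Seek None)] A B C D)"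
    by (rule reach_step) (auto simp: rule_simps)
  have 2: "reach (length (tab (es1 @ (?d, v) # es2)) + length ?d + 1)
     (cfg (map Bit (bits ?d @ False # ?w) @ [End]) [Ctrl (Seek None)] A B C D)
     (cfg (map Bit (False # ?w) @ [End]) [Ctrl (Match None)] (map Bit (rev ?d) @ Mark # rev (tab es1)) (v # tab es2) C D)"
    by (rule reach_lookup)
      (use Cons.prems(2) es(1) table_vals[of ds ix X, OF ix] in \<open>auto simp: phases_def\<close>)
  let ?A = "Used (ix u) # map Bit (rev ?d) @ Mark # rev (tab es1)"
  have 3: "reach 1
     (cfg (map Bit (False # ?w) @ [End]) [Ctrl (Match None)] (map Bit (rev ?d) @ Mark # rev (tab es1)) (v # tab es2) C D)
     (cfg (map Bit ?w @ [End]) [Ctrl Vars] ?A (tab es2) C D)"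
    by (rule reach_step) (use j in \<open>auto simp: rule_simps v_def\<close>)
  have bound: "length (tab (es1 @ (?d, v) # es2)) \<le> K" "length ?d \<le> L"
    using K L[OF d] length_tab_table[of ix ds X] es(1) by auto
  have 4: "reach (K + L + 3) (cfg (map Bit (items (u # us) @ w) @ [End]) [Ctrl Vars] A B C D)
     (cfg (map Bit ?w @ [End]) [Ctrl Vars] ?A (tab es2) C D)"
    by (rule reach_trans[OF reach_trans[OF 1 2 order_refl] 3]) (use bound in linarith)
  have "rev ?A @ tab es2 = tab (table ix ds (insert ?d X))" by (simp add: es(2) rev_map)
  from Cons.IH[OF _ this] Cons.prems(1) obtain A' B' where
    AB: "rev A' @ B' = tab (table ix ds (insert ?d X \<union> binary ` set us))" and
    5: "reach (length us * (K + L + 3)) (cfg (map Bit ?w @ [End]) [Ctrl Vars] ?A (tab es2) C D)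
       (cfg (map Bit w @ [End]) [Ctrl Vars] A' B' C D)" by auto
  have "reach (length (u # us) * (K + L + 3)) (cfg (map Bit (items (u # us) @ w) @ [End]) [Ctrl Vars] A B C D)
       (cfg (map Bit w @ [End]) [Ctrl Vars] A' B' C D)"
    by (rule reach_trans[OF 4 5]) simp
  then show ?case using AB by (intro exI[of _ A'] exI[of _ B']) simp
qed

lemma reach_slots:
  "binary ` set us \<subseteq> set ds \<inter> X \<Longrightarrow> rev A @ B = tab (table ix ds X) \<Longrightarrow>
   length v + length us \<le> n \<Longrightarrow> set v \<subseteq> {..<m} \<Longrightarrow>
   \<exists>A' B'. rev A' @ B' = tab (table ix ds X) \<and>
     reach (length us * (K + L + 3)) (cfg (map Bit (items us @ w) @ [End]) [Ctrl (Slots v)] A B C D)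
       (cfg (map Bit w @ [End]) [Ctrl (Slots (v @ map ix us))] A' B' C D)"
proof (induction us arbitrary: A B v)
  case Nil
  then show ?case by (intro exI[of _ A] exI[of _ B]) (simp add: reach_refl)
next
  case (Cons u us)
  let ?d = "binary u" let ?w = "items us @ w" let ?v = "Used (ix u)"
  have d: "?d \<in> set ds" "?d \<in> X" using Cons.prems by auto
  obtain es1 es2 where es: "table ix ds X = es1 @ (?d, ?v) # es2"
    using table_split[OF d(1) dist, of ix X] d(2) by auto
  have j: "ix u < m" using ix[OF d(1)] by simp
  have sh: "v \<in> short" using Cons.prems by (auto simp: short_def)
  have 1: "reach 1 (cfg (map Bit (items (u # us) @ w) @ [End]) [Ctrl (Slots v)] A B C D)
      (cfg (map Bit (bits ?d @ False # ?w) @ [End]) [Ctrl (Seek (Some v))] A B C D)"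
    by (rule reach_step) (use sh in \<open>auto simp: rule_simps\<close>)
  have 2: "reach (length (tab (es1 @ (?d, ?v) # es2)) + length ?d + 1)
     (cfg (map Bit (bits ?d @ False # ?w) @ [End]) [Ctrl (Seek (Some v))] A B C D)
     (cfg (map Bit (False # ?w) @ [End]) [Ctrl (Match (Some v))] (map Bit (rev ?d) @ Mark # rev (tab es1)) (?v # tab es2) C D)"
    by (rule reach_lookup)
      (use Cons.prems(2) es sh table_vals[of ds ix X, OF ix] in \<open>auto simp: phases_def\<close>)
  let ?A = "?v # map Bit (rev ?d) @ Mark # rev (tab es1)"
  have 3: "reach 1
     (cfg (map Bit (False # ?w) @ [End]) [Ctrl (Match (Some v))] (map Bit (rev ?d) @ Mark # rev (tab es1)) (?v # tab es2) C D)
     (cfg (map Bit ?w @ [End]) [Ctrl (Slots (v @ [ix u]))] ?A (tab es2) C D)"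
    by (rule reach_step) (use j sh in \<open>auto simp: rule_simps\<close>)
  have bound: "length (tab (es1 @ (?d, ?v) # es2)) \<le> K" "length ?d \<le> L"
    using K L[OF d(1)] length_tab_table[of ix ds X] es by auto
  have 4: "reach (K + L + 3) (cfg (map Bit (items (u # us) @ w) @ [End]) [Ctrl (Slots v)] A B C D)
     (cfg (map Bit ?w @ [End]) [Ctrl (Slots (v @ [ix u]))] ?A (tab es2) C D)"
    by (rule reach_trans[OF reach_trans[OF 1 2 order_refl] 3]) (use bound in linarith)
  have t: "rev ?A @ tab es2 = tab (table ix ds X)" by (simp add: es rev_map)
  have "length (v @ [ix u]) + length us \<le> n" "set (v @ [ix u]) \<subseteq> {..<m}"
    "binary ` set us \<subseteq> set ds \<inter> X" using Cons.prems j by auto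
  from Cons.IH[OF this(3) t this(1,2)] obtain A' B' where
    AB: "rev A' @ B' = tab (table ix ds X)" and
    5: "reach (length us * (K + L + 3)) (cfg (map Bit ?w @ [End]) [Ctrl (Slots (v @ [ix u]))] ?A (tab es2) C D)
       (cfg (map Bit w @ [End]) [Ctrl (Slots ((v @ [ix u]) @ map ix us))] A' B' C D)" by auto
  have "reach (length (u # us) * (K + L + 3)) (cfg (map Bit (items (u # us) @ w) @ [End]) [Ctrl (Slots v)] A B C D)
       (cfg (map Bit w @ [End]) [Ctrl (Slots ((v @ [ix u]) @ map ix us))] A' B' C D)"
    by (rule reach_trans[OF 4 5]) simp
  then show ?case using AB by (intro exI[of _ A'] exI[of _ B']) simp
qed

lemma reach_constraints:
  assumes RI: "RI \<subseteq> nlists n {..<m}"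
  shows "(\<And>c. c \<in> set cs \<Longrightarrow> binary ` set c \<subseteq> set ds \<inter> X \<and> map ix c \<in> RI) \<Longrightarrow> rev A @ B = tab (table ix ds X) \<Longrightarrow>
   \<exists>A' B'. rev A' @ B' = tab (table ix ds X) \<and>
     reach (length cs * (n * (K + L + 3) + 2)) (cfg (map Bit (citems cs @ w) @ [End]) [Ctrl Constraints] A B C D)
       (cfg (map Bit w @ [End]) [Ctrl Constraints] A' B' C D)"
proof (induction cs arbitrary: A B)
  case Nil
  then show ?case by (intro exI[of _ A] exI[of _ B]) (simp add: reach_refl)
next
  case (Cons c cs)
  let ?w = "False # citems cs @ w"
  have c: "binary ` set c \<subseteq> set ds \<inter> X" "map ix c \<in> RI" using Cons.prems(1)[of c] by auto
  then have "map ix c \<in> nlists n {..<m}" using RI by blast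
  then have n: "length c = n" using nlistsE_length by fastforce
  have 1: "reach 1 (cfg (map Bit (citems (c # cs) @ w) @ [End]) [Ctrl Constraints] A B C D)
      (cfg (map Bit (items c @ ?w) @ [End]) [Ctrl (Slots [])] A B C D)"
    by (rule reach_step) (auto simp: rule_simps)
  obtain A1 B1 where t: "rev A1 @ B1 = tab (table ix ds X)" and
    2: "reach (length c * (K + L + 3)) (cfg (map Bit (items c @ ?w) @ [End]) [Ctrl (Slots [])] A B C D)
      (cfg (map Bit ?w @ [End]) [Ctrl (Slots ([] @ map ix c))] A1 B1 C D)"
    using reach_slots[OF c(1) Cons.prems(2), of "[]" ?w C D] n by auto
  have 3: "reach 1 (cfg (map Bit ?w @ [End]) [Ctrl (Slots ([] @ map ix c))] A1 B1 C D)
     (cfg (map Bit (citems cs @ w) @ [End]) [Ctrl Constraints] A1 B1 C D)"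
    by (rule reach_step) (use c in \<open>auto simp: rule_simps\<close>)
  have "binary ` set c' \<subseteq> set ds \<inter> X \<and> map ix c' \<in> RI" if "c' \<in> set cs" for c'
    by (rule Cons.prems(1)) (use that in simp)
  from Cons.IH[OF this t] obtain A' B' where AB: "rev A' @ B' = tab (table ix ds X)" and
    4: "reach (length cs * (n * (K + L + 3) + 2)) (cfg (map Bit (citems cs @ w) @ [End]) [Ctrl Constraints] A1 B1 C D)
       (cfg (map Bit w @ [End]) [Ctrl Constraints] A' B' C D)" by blast
  have "reach (length (c # cs) * (n * (K + L + 3) + 2))
      (cfg (map Bit (citems (c # cs) @ w) @ [End]) [Ctrl Constraints] A B C D)
      (cfg (map Bit w @ [End]) [Ctrl Constraints] A' B' C D)"
    by (rule reach_trans[OF reach_trans[OF reach_trans[OF 1 2 order_refl] 3 order_refl] 4]) (simp add: n)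
  then show ?case using AB by blast
qed

end

lemma length_items: "length us \<le> length (items us)" "u \<in> set us \<Longrightarrow> length (binary u) \<le> length (items us)"
proof -
  show "length us \<le> length (items us)" by (induction us) auto
  have "length (bits d) = 2 * length d" for d by (induction d) auto
  then show "u \<in> set us \<Longrightarrow> length (binary u) \<le> length (items us)" by (induction us) auto
qed

lemma length_citems: "length cs \<le> length (citems cs)"
  by (induction cs) auto

text \<open>With \<open>l\<close> the length of the instance, \<open>[:3, 3, 1:]\<close> is
  \<open>l * (l + 2) + l + 3\<close>, the cost of one lookup: moving over the table, matching a
  name, and three further steps. The products with \<open>[:0, 1:]\<close> account for writing the
  table, reading the variables, and checking the constraints.\<close>

lemma reach_accept:
  assumes RI: "RI \<subseteq> nlists n {..<m}" and x: "x = items xs @ [False] @ citems cs @ [False]"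
    and ix: "\<And>u. u \<in> set xs \<Longrightarrow> ix u < m" and cs: "\<And>c. c \<in> set cs \<Longrightarrow> set c \<subseteq> set xs \<and> map ix c \<in> RI"
  shows "\<exists>s. s 1 = [] \<and> reach (poly ([:5:] + [:0, 1:] * [:3, 3:] + [:0, 1:] * [:3, 3, 1:] +
    [:0, 1:] * ([:2:] + smult n [:3, 3, 1:])) (length x)) (cfg (map Bit x @ [End]) [Ctrl Begin] [] [] [] []) s"
proof -
  \<comment> \<open>The table to be guessed contains just the names of the variables of the
    instance.\<close>
  define ds where "ds = sorted_list_of_set (binary ` set xs)"
  define l where "l = length x"
  have ds: "sorted_wrt (<) ds" "set ds = binary ` set xs" "distinct ds"
    by (simp_all add: ds_def strict_sorted_list_of_set)
  have ixd: "ix (number d) < m" if "d \<in> set ds" for d using that ds(2) ix by auto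
  have Ld: "length d \<le> l" if "d \<in> set ds" for d
  proof -
    obtain u where "u \<in> set xs" "d = binary u" using \<open>d \<in> set ds\<close> ds(2) by auto
    then show ?thesis using length_items(2)[of u xs] by (simp add: l_def x)
  qed
  have lx: "length xs \<le> l" "length cs \<le> l" using length_items(1)[of xs] length_citems[of cs] by (simp_all add: l_def x)
  have "length ds = card (binary ` set xs)" using ds(2,3) by (metis distinct_card)
  also have "\<dots> \<le> card (set xs)" by (rule card_image_le) simp
  also have "\<dots> \<le> length xs" by (rule card_length)
  finally have lds: "length ds \<le> l" using lx by simp
  have "\<forall>d \<in> set ds'. length d \<le> l \<Longrightarrow> (\<Sum>d\<leftarrow>ds'. length d + 2) \<le> length ds' * (l + 2)" for ds' :: "bool list list"
    by (induction ds') (auto simp: algebra_simps)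
  then have "(\<Sum>d\<leftarrow>ds. length d + 2) \<le> length ds * (l + 2)" using Ld by blast
  also have "\<dots> \<le> l * (l + 2)" using lds by (rule mult_le_mono1)
  finally have K: "(\<Sum>d\<leftarrow>ds. length d + 2) \<le> l * (l + 2)" .
  let ?q = "l * (l + 2) + l + 3"
  let ?W = "map Bit x @ [End]"
  have "canonical d \<and> ix (number d) < m \<and> length d \<le> l" if "d \<in> set ds" for d
    using that ixd Ld ds(2) canonical_binary by auto
  from reach_begin[OF this ds(1)] obtain C where
    1: "reach (2 + length ds * (3 * l + 3)) (cfg ?W [Ctrl Begin] [] [] [] [])
      (cfg ?W [Ctrl Vars] (rev (tab (table ix ds {}))) [] C [Mark])"
    by (auto simp: table_def)
  obtain A2 B2 where t2: "rev A2 @ B2 = tab (table ix ds (set ds))" and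
    2: "reach (length xs * ?q) (cfg ?W [Ctrl Vars] (rev (tab (table ix ds {}))) [] C [Mark])
      (cfg (map Bit (False # citems cs @ [False]) @ [End]) [Ctrl Vars] A2 B2 C [Mark])"
    using reach_vars[where ix = ix and ds = ds and L = l and K = "l * (l + 2)", OF ds(3) ixd Ld K, of xs "rev (tab (table ix ds {}))" "[]" "{}" "False # citems cs @ [False]" C "[Mark]"]
      ds(2) by (auto simp: x)
  have 3: "reach 1 (cfg (map Bit (False # citems cs @ [False]) @ [End]) [Ctrl Vars] A2 B2 C [Mark])
      (cfg (map Bit (citems cs @ [False]) @ [End]) [Ctrl Constraints] A2 B2 C [Mark])"
    by (rule reach_step) (auto simp: rule_simps)
  have "binary ` set c \<subseteq> set ds \<inter> set ds \<and> map ix c \<in> RI" if "c \<in> set cs" for c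
    using cs[OF that] ds(2) by auto
  from reach_constraints[where ix = ix and ds = ds and L = l and K = "l * (l + 2)" and w = "[False]" and C = C and D = "[Mark]", OF ds(3) ixd Ld K RI this t2] obtain A3 B3 where
    4: "reach (length cs * (n * ?q + 2)) (cfg (map Bit (citems cs @ [False]) @ [End]) [Ctrl Constraints] A2 B2 C [Mark])
      (cfg (map Bit [False] @ [End]) [Ctrl Constraints] A3 B3 C [Mark])" by blast
  have 5: "reach 1 (cfg (map Bit [False] @ [End]) [Ctrl Constraints] A3 B3 C [Mark]) (cfg [] [] A3 B3 C [Mark])"
    by (rule reach_step) (auto simp: rule_simps)
  have "reach (poly ([:5:] + [:0, 1:] * [:3, 3:] + [:0, 1:] * [:3, 3, 1:] +
    [:0, 1:] * ([:2:] + smult n [:3, 3, 1:])) l) (cfg ?W [Ctrl Begin] [] [] [] []) (cfg [] [] A3 B3 C [Mark])"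
  proof (rule reach_trans[OF reach_trans[OF reach_trans[OF reach_trans[OF 1 2 order_refl] 3 order_refl] 4 order_refl] 5])
    have "length ds * (3 * l + 3) \<le> l * (3 * l + 3)" "length xs * ?q \<le> l * ?q"
      "length cs * (n * ?q + 2) \<le> l * (n * ?q + 2)" using lds lx by (intro mult_le_mono1; simp)+
    then have "2 + length ds * (3 * l + 3) + length xs * ?q + 1 + length cs * (n * ?q + 2) + 1 \<le>
      5 + l * (3 * l + 3) + l * ?q + l * (n * ?q + 2)" by linarith
    also have "\<dots> = poly ([:5:] + [:0, 1:] * [:3, 3:] + [:0, 1:] * [:3, 3, 1:] +
      [:0, 1:] * ([:2:] + smult n [:3, 3, 1:])) l" by (simp add: algebra_simps)
    finally show "2 + length ds * (3 * l + 3) + length xs * ?q + 1 + length cs * (n * ?q + 2) + 1 \<le>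
      poly ([:5:] + [:0, 1:] * [:3, 3:] + [:0, 1:] * [:3, 3, 1:] + [:0, 1:] * ([:2:] + smult n [:3, 3, 1:])) l" .
  qed
  then show ?thesis unfolding l_def by (intro exI[of _ "cfg [] [] A3 B3 C [Mark]"]) simp
qed

end

theorem CSP_in_NP:
  assumes V: "finite V" and R: "R \<subseteq> nlists n V"
  shows "fst (CSP V n R) \<in> NP"
proof -
  obtain vs where vs: "set vs = V" "distinct vs" using finite_distinct_list[OF V] by auto
  define m where "m = length vs"
  \<comment> \<open>Stack symbols must come from a countable type, which the vertex type need not
    be; positions in \<open>vs\<close> stand for the vertices.\<close>
  define RI where "RI = {is \<in> nlists n {..<m}. map ((!) vs) is \<in> R}"
  have RI: "RI \<subseteq> nlists n {..<m}" by (auto simp: RI_def)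
  obtain \<rho>s where \<rho>s: "set \<rho>s = csp_rules m n RI" using finite_list[OF finite_csp_rules[OF RI]] by auto
  have init: "(\<lambda>_. [])(0 := map Bit x @ [End], 1 := [Ctrl Begin]) = cfg (map Bit x @ [End]) [Ctrl Begin] [] [] [] []" for x
    by (auto simp: cfg_def fun_eq_iff)
  show ?thesis
  proof (rule NP_rewriting[where inp = Bit and e = End and c = "Ctrl Begin" and \<rho>s = \<rho>s and k = 6])
    show "r < 6" if "(po, pu) \<in> set \<rho>s" "(r, a) \<in> set po \<union> set pu" for po pu r a
      using csp_rules_regs that unfolding \<rho>s by blast
  next
    fix x assume "x \<in> fst (CSP V n R)"
    then obtain X C where I: "(X, C) \<in> csp_instances n" "csp_satisfiable V R (X, C)" "x \<in> csp_encodings (X, C)"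
      by (auto simp: CSP_def)
    obtain xs cs where x: "x = encode_list encode_var xs @ encode_list (encode_list encode_var) cs"
      "set xs = X" "set cs = C" using I(3) by (auto simp: csp_encodings_def)
    obtain a where a: "a ` X \<subseteq> V" "\<forall>c \<in> C. map a c \<in> R" using I(2) by (auto simp: csp_satisfiable_def)
    have "\<forall>u \<in> X. \<exists>i<m. vs ! i = a u" using a(1) vs(1) by (auto simp: m_def in_set_conv_nth)
    then obtain ix where ix: "\<forall>u \<in> X. ix u < m \<and> vs ! ix u = a u" by metis
    have C: "set c \<subseteq> X" "length c = n" if "c \<in> C" for c
    proof -
      have "c \<in> nlists n X" using I(1) that by (auto simp: csp_instances_def)
      then show "set c \<subseteq> X" "length c = n" by auto
    qed
    have "map ix c \<in> RI" if "c \<in> C" for c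
    proof -
      have "map ((!) vs) (map ix c) = map a c" using C(1)[OF that] ix by auto
      moreover have "map ix c \<in> nlists n {..<m}" by (rule nlistsI) (use C[OF that] ix in auto)
      ultimately show ?thesis using a(2) that by (simp add: RI_def del: map_map)
    qed
    then have "\<exists>s. s 1 = [] \<and> reach m n RI (poly ([:5:] + [:0, 1:] * [:3, 3:] + [:0, 1:] * [:3, 3, 1:] +
      [:0, 1:] * ([:2:] + smult n [:3, 3, 1:])) (length x)) (cfg (map Bit x @ [End]) [Ctrl Begin] [] [] [] []) s"
      by (intro reach_accept[OF RI, of x xs cs ix])
        (use x ix C in \<open>auto simp: encode_list_items encode_list_citems\<close>)
    then show "\<exists>k\<le>poly ([:5:] + [:0, 1:] * [:3, 3:] + [:0, 1:] * [:3, 3, 1:] +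
      [:0, 1:] * ([:2:] + smult n [:3, 3, 1:])) (length x). \<exists>s.
      ((\<lambda>_. [])(0 := map Bit x @ [End], 1 := [Ctrl Begin]), s) \<in> rewrite_step (set \<rho>s) ^^ k \<and> s 1 = []"
      unfolding init \<rho>s reach_def by blast
  next
    fix x s assume st: "((\<lambda>_. [])(0 := map Bit x @ [End], 1 := [Ctrl Begin]), s) \<in> (rewrite_step (set \<rho>s))\<^sup>*"
      and s: "s 1 = []"
    have "run_invs m n RI x s" using invs_star st unfolding init \<rho>s by blast
    then have "accepted m RI x" using s by (auto simp: run_invs_def)
    then obtain es xs cs where e: "x = items xs @ [False] @ citems cs @ [False]" "good m es" "marked xs es" "okc RI es cs"
      by (auto simp: accepted_def)
    have "sorted_wrt (<) (map fst es)" using e(2) by (simp add: good_def)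
    then have dist: "distinct (map fst es)" by (simp add: strict_sorted_iff)
    define a where "a u = vs ! (SOME i. (binary u, Used i) \<in> set es)" for u
    have a: "a u = vs ! i" if "(binary u, Used i) \<in> set es" for u i
    proof -
      have "(SOME i. (binary u, Used i) \<in> set es) = i"
      proof (rule some_equality[of "\<lambda>i. (binary u, Used i) \<in> set es", OF that])
        fix j assume "(binary u, Used j) \<in> set es"
        then have "Used j = Used i" by (rule eq_key_imp_eq_value[OF dist _ that])
        then show "j = i" by simp
      qed
      then show ?thesis by (simp add: a_def)
    qed
    have m: "i < m" if "(binary u, Used i) \<in> set es" for u i
      using e(2) that by (auto simp: good_def vals_def)
    have aX: "a ` set xs \<subseteq> V"
    proof (rule image_subsetI)
      fix u assume "u \<in> set xs"
      then obtain i where i: "(binary u, Used i) \<in> set es" using e(3) by (auto simp: marked_def)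
      then show "a u \<in> V" using a[OF i] m[OF i] vs(1) by (auto simp: m_def)
    qed
    have cs: "c \<in> nlists n (set xs) \<and> map a c \<in> R" if c: "c \<in> set cs" for c
    proof -
      obtain v where v: "v \<in> RI" "list_all2 (\<lambda>u i. (binary u, Used i) \<in> set es) c v"
        using e(4) c by (auto simp: okc_def slots_def)
      have len: "length c = length v" using v(2) by (rule list_all2_lengthD)
      have "length v = n" using v(1) RI by auto
      have nth: "(binary (c ! i), Used (v ! i)) \<in> set es" if "i < length c" for i
        using v(2) that by (rule list_all2_nthD)
      have "u \<in> set xs" if uc: "u \<in> set c" for u
      proof -
        obtain i where "i < length c" "u = c ! i" using uc by (auto simp: in_set_conv_nth)
        then have "binary u \<in> binary ` set xs" using nth e(3) by (auto simp: marked_def)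
        then show ?thesis using binary_inj by auto
      qed
      moreover have "map a c = map ((!) vs) v"
        by (rule nth_equalityI) (use len nth a in auto)
      ultimately show ?thesis using v(1) len \<open>length v = n\<close> by (auto simp: RI_def intro!: nlistsI)
    qed
    have "(set xs, set cs) \<in> csp_instances n" using cs by (auto simp: csp_instances_def)
    moreover have "csp_satisfiable V R (set xs, set cs)" using aX cs by (auto simp: csp_satisfiable_def)
    moreover have "x \<in> csp_encodings (set xs, set cs)"
      unfolding csp_encodings_def e(1) by (auto simp: encode_list_items encode_list_citems)
    ultimately show "x \<in> fst (CSP V n R)" unfolding CSP_def by auto
  qed simp
qed

section \<open>Printing a grid of constraints\<close>

lemma runs_cong:
  "runs k S c st st1 n1 \<Longrightarrow> st1 = st' \<Longrightarrow> n1 \<le> n \<Longrightarrow> runs k S c st st' n"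
  using runs_mono by blast

abbreviation "un a \<equiv> replicate a (1 :: nat)"

text \<open>In all programs below, register 0 holds the input, 2 its length, 3 to 5 the numbers
  \<open>P\<close>, \<open>T\<close>, \<open>Z\<close>, 6 and 7 the current row and column, 11 and
  12 the evaluation of polynomials; the others are scratch. Numbers are unary, and copying restores
  its source from register 8.\<close>

definition copy_com :: "nat \<Rightarrow> nat \<Rightarrow> com" where
  "copy_com q d = While q (Pop q ;; Push 8 1 ;; Push d 1) ;; While 8 (Pop 8 ;; Push q 1)"

definition copy_time :: "nat \<Rightarrow> nat" where
  "copy_time a = 20 * a + 5"

lemma runs_copy:
  assumes r: "q < 13" "d < 13" "q \<noteq> 8" "d \<noteq> 8" "q \<noteq> d" and s: "s q = un a" "s 8 = []"
  shows "runs 13 3 (copy_com q d) (s, out) (s(d := un a @ s d), out) (copy_time a)"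
proof -
  define st1 where "st1 i = (s(q := un (a - i), 8 := un i, d := un i @ s d), out)" for i
  define st2 where "st2 i = (s(q := un i, 8 := un (a - i), d := un a @ s d), out)" for i
  have body1: "runs 13 3 (Pop q ;; Push 8 1 ;; Push d 1) (st1 i) (st1 (Suc i)) 7" if "i < a" for i
    unfolding st1_def
    by (rule runs_cong, rule runs_Seq, rule runs_Pop, use r in simp, rule runs_Seq, rule runs_Push, simp, simp, simp,
        rule runs_Push, simp, simp, use r in simp)
      (use r that in \<open>auto simp: fun_eq_iff tl_replicate\<close>)
  have body2: "runs 13 3 (Pop 8 ;; Push q 1) (st2 i) (st2 (Suc i)) 4" if "i < a" for i
    unfolding st2_def
    by (rule runs_cong, rule runs_Seq, rule runs_Pop, simp, rule runs_Push, simp, simp, use r in simp)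
      (use r that in \<open>auto simp: fun_eq_iff tl_replicate\<close>)
  have "runs 13 3 (While q (Pop q ;; Push 8 1 ;; Push d 1)) (st1 0) (st1 a) (a * (7 + 1) + 1)"
    by (rule runs_While) (use r body1 in \<open>auto simp: st1_def\<close>)
  moreover have "st1 0 = (s, out)" using r s by (auto simp: st1_def fun_eq_iff)
  moreover have "st1 a = st2 0" using r by (auto simp: st1_def st2_def fun_eq_iff)
  ultimately have 1: "runs 13 3 (While q (Pop q ;; Push 8 1 ;; Push d 1)) (s, out) (st2 0) (a * (7 + 1) + 1)" by simp
  have "runs 13 3 (While 8 (Pop 8 ;; Push q 1)) (st2 0) (st2 a) (a * (4 + 1) + 1)"
    by (rule runs_While) (use r body2 in \<open>auto simp: st2_def\<close>)
  moreover have "st2 a = (s(d := un a @ s d), out)" using r s by (auto simp: st2_def fun_eq_iff)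
  ultimately have 2: "runs 13 3 (While 8 (Pop 8 ;; Push q 1)) (st2 0) (s(d := un a @ s d), out) (a * (4 + 1) + 1)"
    by simp
  show ?thesis unfolding copy_com_def
    by (rule runs_cong[OF runs_Seq[OF 1 2]]) (simp_all add: copy_time_def)
qed

definition clear_com :: "nat \<Rightarrow> com" where
  "clear_com r = While r (Pop r)"

lemma runs_clear:
  assumes r: "r < 13" and s: "s r = un a"
  shows "runs 13 3 (clear_com r) (s, out) (s(r := []), out) (2 * a + 1)"
proof -
  define st where "st i = (s(r := un (a - i)), out)" for i
  have body: "runs 13 3 (Pop r) (st i) (st (Suc i)) 1" if "i < a" for i
    unfolding st_def
    by (rule runs_cong, rule runs_Pop, use r in simp) (use r that in \<open>auto simp: fun_eq_iff tl_replicate\<close>)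
  have "runs 13 3 (While r (Pop r)) (st 0) (st a) (a * (1 + 1) + 1)"
    by (rule runs_While) (use r body in \<open>auto simp: st_def\<close>)
  moreover have "st 0 = (s, out)" "st a = (s(r := []), out)" using s by (auto simp: st_def)
  ultimately have "runs 13 3 (clear_com r) (s, out) (s(r := []), out) (a * (1 + 1) + 1)" by (simp add: clear_com_def)
  then show ?thesis by (rule runs_mono) simp
qed

text \<open>A template is a text with holes for the unary coordinates of its place. The holes are
  filled by \<open>bits\<close>, as they stand inside an encoded variable name.\<close>

datatype token = Lit bool | Row_Unary | Col_Unary

primrec token_string :: "nat \<Rightarrow> nat \<Rightarrow> token \<Rightarrow> bool list" where
  "token_string t j (Lit b) = [b]"
| "token_string t j Row_Unary = bits (replicate t True)"
| "token_string t j Col_Unary = bits (replicate j True)"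

definition tokens_string :: "nat \<Rightarrow> nat \<Rightarrow> token list \<Rightarrow> bool list" where
  "tokens_string t j ts = concat (map (token_string t j) ts)"

definition emit_unary :: "nat \<Rightarrow> com" where
  "emit_unary q = While q (Pop q ;; Push 8 1 ;; Emit 2 ;; Emit 2) ;; While 8 (Pop 8 ;; Push q 1)"

lemma runs_emit_unary:
  assumes r: "q < 13" "q \<noteq> 8" and s: "s q = un a" "s 8 = []"
  shows "runs 13 3 (emit_unary q) (s, out) (s, out @ map bit_symbol (bits (replicate a True))) (20 * a + 5)"
proof -
  define st1 where "st1 i = (s(q := un (a - i), 8 := un i), out @ map bit_symbol (bits (replicate i True)))" for i
  define st2 where "st2 i = (s(q := un i, 8 := un (a - i)), out @ map bit_symbol (bits (replicate a True)))" for i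
  have "bits (replicate i True) @ [True, True] = True # True # bits (replicate i True)" for i
    by (induction i) auto
  from arg_cong[OF this, of "map bit_symbol"]
  have app: "map bit_symbol (bits (replicate i True)) @ [2, 2] = 2 # 2 # map bit_symbol (bits (replicate i True))" for i
    by (simp add: bit_symbol_def)
  have body1: "runs 13 3 (Pop q ;; Push 8 1 ;; Emit 2 ;; Emit 2) (st1 i) (st1 (Suc i)) 8" if "i < a" for i
    unfolding st1_def
    by (rule runs_cong, rule runs_Seq, rule runs_Pop, use r in simp, rule runs_Seq, rule runs_Push, simp, simp, simp,
        rule runs_Seq, rule runs_Emit, simp, rule runs_Emit, simp)
      (use r that in \<open>auto simp: fun_eq_iff tl_replicate app bit_symbol_def\<close>)
  have body2: "runs 13 3 (Pop 8 ;; Push q 1) (st2 i) (st2 (Suc i)) 4" if "i < a" for i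
    unfolding st2_def
    by (rule runs_cong, rule runs_Seq, rule runs_Pop, simp, rule runs_Push, simp, simp, use r in simp)
      (use r that in \<open>auto simp: fun_eq_iff tl_replicate\<close>)
  have "runs 13 3 (While q (Pop q ;; Push 8 1 ;; Emit 2 ;; Emit 2)) (st1 0) (st1 a) (a * (8 + 1) + 1)"
    by (rule runs_While) (use r body1 in \<open>auto simp: st1_def\<close>)
  moreover have "st1 0 = (s, out)" using r s by (auto simp: st1_def fun_eq_iff)
  moreover have "st1 a = st2 0" using r by (auto simp: st1_def st2_def fun_eq_iff)
  ultimately have 1: "runs 13 3 (While q (Pop q ;; Push 8 1 ;; Emit 2 ;; Emit 2)) (s, out) (st2 0) (a * (8 + 1) + 1)" by simp
  have "runs 13 3 (While 8 (Pop 8 ;; Push q 1)) (st2 0) (st2 a) (a * (4 + 1) + 1)"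
    by (rule runs_While) (use r body2 in \<open>auto simp: st2_def\<close>)
  moreover have "st2 a = (s, out @ map bit_symbol (bits (replicate a True)))"
    using r s by (auto simp: st2_def fun_eq_iff)
  ultimately have 2: "runs 13 3 (While 8 (Pop 8 ;; Push q 1)) (st2 0)
      (s, out @ map bit_symbol (bits (replicate a True))) (a * (4 + 1) + 1)" by simp
  show ?thesis unfolding emit_unary_def
    by (rule runs_cong[OF runs_Seq[OF 1 2]]) simp_all
qed

primrec token_com :: "token \<Rightarrow> com" where
  "token_com (Lit b) = Emit (bit_symbol b)"
| "token_com Row_Unary = emit_unary 6"
| "token_com Col_Unary = emit_unary 7"

primrec tokens_com :: "token list \<Rightarrow> com" where
  "tokens_com [] = Skip"
| "tokens_com (x # xs) = token_com x ;; tokens_com xs"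

lemma runs_tokens:
  assumes s: "s 6 = un t" "s 7 = un j" "s 8 = []"
  shows "runs 13 3 (tokens_com ts) (s, out) (s, out @ map bit_symbol (tokens_string t j ts))
    ((length ts + 1) * (20 * (t + j) + 6))"
proof (induction ts arbitrary: out)
  case Nil
  show ?case by (rule runs_cong) (use runs_Skip in \<open>auto simp: tokens_string_def\<close>)
next
  case (Cons x ts)
  have "runs 13 3 (token_com x) (s, out) (s, out @ map bit_symbol (token_string t j x)) (20 * (t + j) + 5)"
  proof (cases x)
    case (Lit b)
    then show ?thesis using runs_mono[OF runs_Emit[of "bit_symbol b" 13 3 s out]] by (simp add: bit_symbol_def)
  next
    case Row_Unary
    then show ?thesis using runs_mono[OF runs_emit_unary[of 6 s t out]] s by simp
  next
    case Col_Unary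
    then show ?thesis using runs_mono[OF runs_emit_unary[of 7 s j out]] s by simp
  qed
  from runs_Seq[OF this Cons.IH] show ?case
    unfolding tokens_com.simps by (rule runs_cong) (simp_all add: tokens_string_def algebra_simps)
qed

lemma wf_tokens: "wf_com 13 3 (tokens_com ts)"
proof (induction ts)
  case (Cons x ts)
  then show ?case by (cases x) (auto simp: emit_unary_def bit_symbol_def)
qed simp

text \<open>The column counter is left behind the last printed column, so that consecutive calls
  continue the row.\<close>

definition row_com :: "token list \<Rightarrow> nat \<Rightarrow> com" where
  "row_com ts q = copy_com q 10 ;; While 10 (Pop 10 ;; tokens_com ts ;; Push 7 1)"

definition row_time :: "nat \<Rightarrow> nat \<Rightarrow> nat \<Rightarrow> nat \<Rightarrow> nat" where
  "row_time l t j m = copy_time m + (m * ((l + 1) * (20 * (t + j + m) + 6) + 6) + 1) + 1"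

lemma runs_row:
  assumes q: "q < 13" "q \<noteq> 10" "q \<noteq> 8" "q \<noteq> 7" and s: "s 6 = un t" "s 7 = un j" "s 8 = []" "s q = un m" "s 10 = []"
  shows "runs 13 3 (row_com ts q) (s, out) (s(7 := un (j + m)),
     out @ map bit_symbol (concat (map (\<lambda>i. tokens_string t (j + i) ts) [0..<m]))) (row_time (length ts) t j m)"
proof -
  define st where "st i = (s(7 := un (j + i), 10 := un (m - i)),
     out @ map bit_symbol (concat (map (\<lambda>i. tokens_string t (j + i) ts) [0..<i])))" for i
  let ?B = "(length ts + 1) * (20 * (t + j + m) + 6)"
  have 1: "runs 13 3 (copy_com q 10) (s, out) (st 0) (copy_time m)"
    by (rule runs_cong[OF runs_copy]) (use q s in \<open>auto simp: st_def fun_eq_iff\<close>)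
  have body: "runs 13 3 (Pop 10 ;; tokens_com ts ;; Push 7 1) (st i) (st (Suc i)) (?B + 5)" if i: "i < m" for i
  proof -
    define s1 where "s1 = s(7 := un (j + i), 10 := un (m - Suc i))"
    let ?o = "out @ map bit_symbol (concat (map (\<lambda>i. tokens_string t (j + i) ts) [0..<i]))"
    let ?o' = "out @ map bit_symbol (concat (map (\<lambda>i. tokens_string t (j + i) ts) [0..<Suc i]))"
    have a: "runs 13 3 (Pop 10) (st i) (s1, ?o) 1"
      unfolding st_def by (rule runs_cong[OF runs_Pop]) (use i in \<open>auto simp: s1_def fun_eq_iff tl_replicate\<close>)
    have "runs 13 3 (tokens_com ts) (s1, ?o) (s1, ?o @ map bit_symbol (tokens_string t (j + i) ts))
        ((length ts + 1) * (20 * (t + (j + i)) + 6))"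
      by (rule runs_tokens) (use s in \<open>auto simp: s1_def\<close>)
    then have b: "runs 13 3 (tokens_com ts) (s1, ?o) (s1, ?o') ?B"
    proof (rule runs_cong)
      show "(length ts + 1) * (20 * (t + (j + i)) + 6) \<le> ?B" by (rule mult_le_mono2) (use i in simp)
    qed simp
    have c: "runs 13 3 (Push 7 1) (s1, ?o') (st (Suc i)) 2"
      unfolding st_def by (rule runs_cong[OF runs_Push]) (auto simp: s1_def fun_eq_iff)
    show ?thesis by (rule runs_cong[OF runs_Seq[OF a runs_Seq[OF b c]]]) simp_all
  qed
  have 2: "runs 13 3 (While 10 (Pop 10 ;; tokens_com ts ;; Push 7 1)) (st 0) (st m) (m * (?B + 5 + 1) + 1)"
    by (rule runs_While) (use body in \<open>auto simp: st_def\<close>)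
  show ?thesis unfolding row_com_def
    by (rule runs_cong[OF runs_Seq[OF 1 2]]) (use s in \<open>auto simp: st_def fun_eq_iff row_time_def\<close>)
qed

lemma wf_row: "q < 13 \<Longrightarrow> wf_com 13 3 (row_com ts q)"
  by (simp add: row_com_def copy_com_def wf_tokens)

lemma wf_copy: "q < 13 \<Longrightarrow> d < 13 \<Longrightarrow> wf_com 13 3 (copy_com q d)"
  by (simp add: copy_com_def)

lemma wf_clear: "q < 13 \<Longrightarrow> wf_com 13 3 (clear_com q)"
  by (simp add: clear_com_def)

text \<open>The letters of \<open>pair_string x []\<close> are generated while \<open>x\<close> is
  read: a \<open>True\<close> before each bit and a \<open>False\<close> at the end. Register 1
  saves \<open>x\<close> and gives it back, since the grid is printed twice.\<close>

definition letters_com :: "(bool \<Rightarrow> token list) \<Rightarrow> com" where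
  "letters_com ts =
     While 0 (Case 0 (\<lambda>b. Pop 0 ;; tokens_com (ts True) ;; Push 7 1 ;;
       tokens_com (ts (b = 2)) ;; Push 7 1 ;; Push 1 (if b = 2 then 2 else 1))) ;;
     tokens_com (ts False) ;; Push 7 1 ;;
     While 1 (Case 1 (\<lambda>b. Pop 1 ;; Push 0 (if b = 2 then 2 else 1)))"

definition letters_string :: "(bool \<Rightarrow> token list) \<Rightarrow> nat \<Rightarrow> bool list \<Rightarrow> bool list" where
  "letters_string ts j w = concat (map (\<lambda>i. tokens_string 0 (j + i) (ts (w ! i))) [0..<length w])"

lemma letters_string_Nil: "letters_string ts j [] = []"
  by (simp add: letters_string_def)

lemma letters_string_Cons:
  "letters_string ts j (b # w) = tokens_string 0 j (ts b) @ letters_string ts (Suc j) w"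
proof -
  have "[0..<Suc (length w)] = 0 # map Suc [0..<length w]" by (simp add: map_Suc_upt upt_conv_Cons del: upt_Suc)
  then show ?thesis by (simp add: letters_string_def comp_def del: upt_Suc)
qed

lemma letters_string_append:
  "letters_string ts j (v @ w) = letters_string ts j v @ letters_string ts (j + length v) w"
  by (induction v arbitrary: j) (simp_all add: letters_string_Nil letters_string_Cons)

definition letters_time :: "nat \<Rightarrow> nat \<Rightarrow> nat \<Rightarrow> nat" where
  "letters_time l n j = n * (2 * ((l + 1) * (20 * (j + 2 * n) + 6)) + 16) +
     (l + 1) * (20 * (j + 2 * n) + 6) + 10 * n + 20"

lemma runs_letters:
  assumes s: "s 0 = map bit_symbol x" "s 1 = []" "s 6 = []" "s 7 = un j" "s 8 = []"
    and l: "length (ts True) \<le> l" "length (ts False) \<le> l"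
  shows "runs 13 3 (letters_com ts) (s, out) (s(7 := un (j + 2 * length x + 1)),
     out @ map bit_symbol (letters_string ts j (pair_string x []))) (letters_time l (length x) j)"
proof -
  let ?n = "length x"
  define pre where "pre i = concat (map (\<lambda>b. [True, b]) (take i x))" for i
  have len_pre: "length (pre i) = 2 * i" if "i \<le> ?n" for i
    using that by (simp add: pre_def length_concat comp_def sum_list_triv)
  define st where "st i = (s(0 := map bit_symbol (drop i x), 1 := map bit_symbol (rev (take i x)), 7 := un (j + 2 * i)),
     out @ map bit_symbol (letters_string ts j (pre i)))" for i
  define st2 where "st2 i = (s(0 := map bit_symbol (drop (?n - i) x), 1 := map bit_symbol (rev (take (?n - i) x)),
      7 := un (j + 2 * ?n + 1)), out @ map bit_symbol (letters_string ts j (pair_string x [])))" for i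
  let ?B = "(l + 1) * (20 * (j + 2 * ?n) + 6)"
  have tok: "runs 13 3 (tokens_com (ts b)) (s', o') (s', o' @ map bit_symbol (tokens_string 0 j' (ts b))) ?B"
    if "s' 6 = []" "s' 7 = un j'" "s' 8 = []" "j' \<le> j + 2 * ?n" for s' o' b j'
  proof -
    have "(length (ts b) + 1) * (20 * (0 + j') + 6) \<le> ?B"
      by (rule mult_le_mono) (use that l in \<open>cases b; auto\<close>)+
    then show ?thesis using runs_mono[OF runs_tokens[of s' 0 j' "ts b" o']] that by simp
  qed
  have body: "runs 13 3 (Case 0 (\<lambda>b. Pop 0 ;; tokens_com (ts True) ;; Push 7 1 ;;
       tokens_com (ts (b = 2)) ;; Push 7 1 ;; Push 1 (if b = 2 then 2 else 1))) (st i) (st (Suc i)) (2 * ?B + 13)"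
    if i: "i < ?n" for i
  proof -
    let ?b = "x ! i" let ?o = "out @ map bit_symbol (letters_string ts j (pre i))"
    have d: "drop i x = ?b # drop (Suc i) x" using i by (rule Cons_nth_drop_Suc[symmetric])
    have tk: "take (Suc i) x = take i x @ [?b]" using i by (rule take_Suc_conv_app_nth)
    have pre: "pre (Suc i) = pre i @ [True, ?b]" by (simp add: pre_def tk)
    define s1 where "s1 = s(0 := map bit_symbol (drop (Suc i) x), 1 := map bit_symbol (rev (take i x)), 7 := un (j + 2 * i))"
    let ?o1 = "?o @ map bit_symbol (tokens_string 0 (j + 2 * i) (ts True))"
    let ?o2 = "?o1 @ map bit_symbol (tokens_string 0 (j + 2 * i + 1) (ts ?b))"
    have a: "runs 13 3 (Pop 0) (fst (st i), snd (st i)) (s1, ?o) 1"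
      unfolding st_def fst_conv snd_conv by (rule runs_cong[OF runs_Pop]) (auto simp: s1_def fun_eq_iff d)
    have b: "runs 13 3 (tokens_com (ts True)) (s1, ?o) (s1, ?o1) ?B"
      by (rule tok) (use s i in \<open>auto simp: s1_def\<close>)
    have c: "runs 13 3 (Push 7 1) (s1, ?o1) (s1(7 := un (j + 2 * i + 1)), ?o1) 2"
      by (rule runs_cong[OF runs_Push]) (auto simp: s1_def fun_eq_iff)
    have e: "runs 13 3 (tokens_com (ts ?b)) (s1(7 := un (j + 2 * i + 1)), ?o1) (s1(7 := un (j + 2 * i + 1)), ?o2) ?B"
      by (rule tok) (use s i in \<open>auto simp: s1_def\<close>)
    have f: "runs 13 3 (Push 7 1) (s1(7 := un (j + 2 * i + 1)), ?o2) (s1(7 := un (j + 2 * i + 2)), ?o2) 2"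
      by (rule runs_cong[OF runs_Push]) (auto simp: fun_eq_iff)
    have g: "runs 13 3 (Push 1 (bit_symbol ?b)) (s1(7 := un (j + 2 * i + 2)), ?o2) (st (Suc i)) 2"
      unfolding st_def
      by (rule runs_cong[OF runs_Push])
        (auto simp: s1_def fun_eq_iff tk pre letters_string_append letters_string_Cons letters_string_Nil
          len_pre less_imp_le[OF i] bit_symbol_def algebra_simps)
    have h: "top (fst (st i) 0) = bit_symbol ?b" by (simp add: st_def d)
    have sym: "(bit_symbol ?b = 2) = ?b" "(if ?b then 2 else 1) = bit_symbol ?b" by (auto simp: bit_symbol_def)
    have "runs 13 3 (Case 0 (\<lambda>b. Pop 0 ;; tokens_com (ts True) ;; Push 7 1 ;;
       tokens_com (ts (b = 2)) ;; Push 7 1 ;; Push 1 (if b = 2 then 2 else 1))) (fst (st i), snd (st i)) (st (Suc i))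
       ((1 + (?B + (2 + (?B + (2 + 2 + 1) + 1) + 1) + 1) + 1) + 1)"
      by (rule runs_Case, simp, simp, unfold h sym)
        (rule runs_Seq[OF a runs_Seq[OF b runs_Seq[OF c runs_Seq[OF e runs_Seq[OF f g]]]]])
    then show ?thesis by (auto elim: runs_mono)
  qed
  have "runs 13 3 (While 0 (Case 0 (\<lambda>b. Pop 0 ;; tokens_com (ts True) ;; Push 7 1 ;;
       tokens_com (ts (b = 2)) ;; Push 7 1 ;; Push 1 (if b = 2 then 2 else 1)))) (st 0) (st ?n) (?n * (2 * ?B + 13 + 1) + 1)"
    by (rule runs_While[where st = st and N = ?n, OF _ _ body]) (auto simp: st_def)
  moreover have "st 0 = (s, out)" using s by (auto simp: st_def fun_eq_iff pre_def letters_string_Nil)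
  ultimately have 1: "runs 13 3 (While 0 (Case 0 (\<lambda>b. Pop 0 ;; tokens_com (ts True) ;; Push 7 1 ;;
       tokens_com (ts (b = 2)) ;; Push 7 1 ;; Push 1 (if b = 2 then 2 else 1)))) (s, out) (fst (st ?n), snd (st ?n)) (?n * (2 * ?B + 13 + 1) + 1)"
    by simp
  have pair: "pair_string x [] = pre ?n @ [False]" by (simp add: pair_string_def pre_def)
  have 2: "runs 13 3 (tokens_com (ts False)) (fst (st ?n), snd (st ?n))
      (fst (st ?n), snd (st ?n) @ map bit_symbol (tokens_string 0 (j + 2 * ?n) (ts False))) ?B"
    by (rule tok) (use s in \<open>auto simp: st_def\<close>)
  have 3: "runs 13 3 (Push 7 1) (fst (st ?n), snd (st ?n) @ map bit_symbol (tokens_string 0 (j + 2 * ?n) (ts False))) (st2 0) 2"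
    by (rule runs_cong[OF runs_Push])
      (auto simp: st_def st2_def fun_eq_iff pair letters_string_append letters_string_Cons letters_string_Nil len_pre)
  have body2: "runs 13 3 (Case 1 (\<lambda>b. Pop 1 ;; Push 0 (if b = 2 then 2 else 1))) (st2 i) (st2 (Suc i)) 5"
    if i: "i < ?n" for i
  proof -
    let ?m = "?n - Suc i" let ?b = "x ! ?m"
    have m: "?n - i = Suc ?m" "?m < ?n" using i by auto
    have tk: "take (?n - i) x = take ?m x @ [?b]" unfolding m(1) using m(2) by (rule take_Suc_conv_app_nth)
    have d: "drop ?m x = ?b # drop (?n - i) x" unfolding m(1) using m(2) by (rule Cons_nth_drop_Suc[symmetric])
    define s1 where "s1 = s(0 := map bit_symbol (drop (?n - i) x), 1 := map bit_symbol (rev (take ?m x)),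
      7 := un (j + 2 * ?n + 1))"
    have a: "runs 13 3 (Pop 1) (fst (st2 i), snd (st2 i)) (s1, snd (st2 i)) 1"
      by (rule runs_cong[OF runs_Pop]) (auto simp: st2_def s1_def fun_eq_iff tk)
    have b: "runs 13 3 (Push 0 (bit_symbol ?b)) (s1, snd (st2 i)) (st2 (Suc i)) 2"
      by (rule runs_cong[OF runs_Push]) (auto simp: st2_def s1_def fun_eq_iff d bit_symbol_def)
    have h: "top (fst (st2 i) 1) = bit_symbol ?b" by (simp add: st2_def tk)
    have sym: "(if bit_symbol ?b = 2 then 2 else 1) = bit_symbol ?b" by (auto simp: bit_symbol_def)
    have "runs 13 3 (Case 1 (\<lambda>b. Pop 1 ;; Push 0 (if b = 2 then 2 else 1))) (fst (st2 i), snd (st2 i)) (st2 (Suc i)) (1 + 2 + 1 + 1)"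
      by (rule runs_Case, simp, simp, unfold h sym) (rule runs_Seq[OF a b])
    then show ?thesis by (auto elim: runs_mono)
  qed
  have 4: "runs 13 3 (While 1 (Case 1 (\<lambda>b. Pop 1 ;; Push 0 (if b = 2 then 2 else 1)))) (st2 0) (st2 ?n) (?n * (5 + 1) + 1)"
    by (rule runs_While[where st = st2 and N = ?n, OF _ _ body2]) (auto simp: st2_def)
  have fin: "st2 ?n = (s(7 := un (j + 2 * ?n + 1)), out @ map bit_symbol (letters_string ts j (pair_string x [])))"
    using s by (auto simp: st2_def fun_eq_iff)
  show ?thesis
    unfolding letters_com_def
    by (rule runs_cong[OF runs_Seq[OF 1 runs_Seq[OF 2 runs_Seq[OF 3 4]]]])
      (simp_all add: fin letters_time_def algebra_simps)
qed

lemma wf_letters: "wf_com 13 3 (letters_com ts)"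
  by (simp add: letters_com_def wf_tokens)

text \<open>\<open>(k, t, j)\<close> puts the \<open>k\<close>-th template at time \<open>t\<close> in column \<open>j\<close>, where cell \<open>0\<close> of the tapes is in
  column \<open>Z\<close>.\<close>

definition placements :: "bool list \<Rightarrow> nat \<Rightarrow> nat \<Rightarrow> nat \<Rightarrow> (nat \<times> nat \<times> nat) list" where
  "placements x P T Z =
     map (\<lambda>i. (0, 0, i)) [0..<Z] @ [(1, 0, Z)] @
     map (\<lambda>i. (7 + of_bool (pair_string x [] ! i), 0, Z + i)) [0..<length (pair_string x [])] @
     map (\<lambda>i. (2, 0, Z + 2 * length x + 1 + i)) [0..<P] @
     map (\<lambda>i. (3, 0, Z + 2 * length x + 1 + P + i)) [0..<Z] @
     map (\<lambda>i. (4, 0, Suc Z + i)) [0..<Z] @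
     concat (map (\<lambda>t. map (\<lambda>i. (5, t, i)) [0..<Z] @ map (\<lambda>i. (5, t, Z + i)) [0..<Z]) [0..<T]) @
     [(6, T, Z)]"

definition grid_string :: "(nat \<Rightarrow> token list) \<Rightarrow> (nat \<times> nat \<times> nat) list \<Rightarrow> bool list" where
  "grid_string tm pl = concat (map (\<lambda>(k, t, j). tokens_string t j (tm k)) pl)"

lemma grid_string_simps [simp]:
  "grid_string tm [] = []" "grid_string tm (p # pl) = tokens_string (fst (snd p)) (snd (snd p)) (tm (fst p)) @ grid_string tm pl"
  "grid_string tm (pl @ ql) = grid_string tm pl @ grid_string tm ql"
  by (auto simp: grid_string_def split_beta)

lemma grid_string_map: "grid_string tm (map (\<lambda>i. (k, t, f i)) [0..<m]) = concat (map (\<lambda>i. tokens_string t (f i) (tm k)) [0..<m])"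
  by (simp add: grid_string_def comp_def)

lemma grid_string_letters:
  "grid_string tm (map (\<lambda>i. (7 + of_bool (w ! i), 0, j + i)) [0..<length w]) = letters_string (\<lambda>b. tm (7 + of_bool b)) j w"
  by (simp add: grid_string_def letters_string_def comp_def)

text \<open>Follows the summands of \<open>placements\<close>. The \<open>2 * Z\<close> columns of a
  step are printed as two stretches of length \<open>Z\<close>, for which the counter
  exists.\<close>

definition grid_com :: "(nat \<Rightarrow> token list) \<Rightarrow> com" where
  "grid_com tm =
     row_com (tm 0) 5 ;; tokens_com (tm 1) ;; letters_com (\<lambda>b. tm (7 + of_bool b)) ;;
     row_com (tm 2) 3 ;; row_com (tm 3) 5 ;; clear_com 7 ;;
     copy_com 5 7 ;; Push 7 1 ;; row_com (tm 4) 5 ;; clear_com 7 ;;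
     copy_com 4 9 ;; While 9 (Pop 9 ;; row_com (tm 5) 5 ;; row_com (tm 5) 5 ;; clear_com 7 ;; Push 6 1) ;;
     copy_com 5 7 ;; tokens_com (tm 6) ;; clear_com 7 ;; clear_com 6"

lemma wf_grid: "wf_com 13 3 (grid_com tm)"
  by (simp add: grid_com_def wf_row wf_tokens wf_letters wf_copy wf_clear)

definition grid_time :: "nat \<Rightarrow> nat \<Rightarrow> nat \<Rightarrow> nat \<Rightarrow> nat \<Rightarrow> nat" where
  "grid_time l n P T Z =
     row_time l 0 0 Z + ((l + 1) * (20 * Z + 6) + (letters_time l n Z + (row_time l 0 (Z + 2 * n + 1) P +
     (row_time l 0 (Z + 2 * n + 1 + P) Z + ((2 * (Z + 2 * n + 1 + P + Z) + 1) + (copy_time Z + (2 +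
     (row_time l 0 (Suc Z) Z + ((2 * (Suc Z + Z) + 1) + (copy_time T +
     ((T * ((row_time l T 0 Z + row_time l T Z Z + 2 * (Z + Z) + 10) + 1) + 1) + (copy_time Z +
     ((l + 1) * (20 * (T + Z) + 6) + ((2 * Z + 1) + (2 * T + 1) + 1) + 1) + 1) + 1) + 1) + 1) + 1) + 1) + 1) + 1) + 1) + 1) + 1) + 1) + 1"

lemma row_time_mono: "l \<le> l' \<Longrightarrow> t \<le> t' \<Longrightarrow> row_time l t j m \<le> row_time l' t' j m"
  unfolding row_time_def by (intro add_le_mono mult_le_mono order_refl) auto

lemma runs_grid:
  assumes s: "s 0 = map bit_symbol x" "s 1 = []" "s 3 = un P" "s 4 = un T" "s 5 = un Z" "s 6 = []" "s 7 = []"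
      "s 8 = []" "s 9 = []" "s 10 = []"
    and l: "\<And>k. k < 9 \<Longrightarrow> length (tm k) \<le> l"
  shows "runs 13 3 (grid_com tm) (s, out) (s, out @ map bit_symbol (grid_string tm (placements x P T Z)))
    (grid_time l (length x) P T Z)"
proof -
  let ?n = "length x"
  let ?p1 = "map (\<lambda>i. (0, 0, i)) [0..<Z]" let ?p2 = "[(1, 0, Z)]"
  let ?p3 = "map (\<lambda>i. (7 + of_bool (pair_string x [] ! i), 0, Z + i)) [0..<length (pair_string x [])]"
  let ?p4 = "map (\<lambda>i. (2, 0, Z + 2 * length x + 1 + i)) [0..<P]"
  let ?p5 = "map (\<lambda>i. (3, 0, Z + 2 * length x + 1 + P + i)) [0..<Z]"
  let ?p6 = "map (\<lambda>i. (4, 0, Suc Z + i)) [0..<Z]"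
  let ?q = "\<lambda>t. map (\<lambda>i. (5, t, i)) [0..<Z] @ map (\<lambda>i. (5, t, Z + i)) [0..<Z]"
  let ?p7 = "\<lambda>m. concat (map ?q [0..<m])" let ?p8 = "[(6, T, Z)]"
  let ?o = "\<lambda>pl. out @ map bit_symbol (grid_string tm pl)"
  have row: "runs 13 3 (row_com (tm k) q) (s', ?o pl) (s'(7 := un (j + m)), ?o (pl @ map (\<lambda>i. (k, t, j + i)) [0..<m])) (row_time l t' j m)"
    if "q \<in> {3, 5}" "k < 9" "s' 6 = un t" "s' 7 = un j" "s' 8 = []" "s' q = un m" "s' 10 = []" "t \<le> t'" for k q s' pl j m t t'
    by (rule runs_cong[OF runs_row[of q s' t j m "tm k"]])
      (use that l row_time_mono[of "length (tm k)" l t t' j m] in \<open>auto simp: grid_string_map\<close>)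
  have tok: "runs 13 3 (tokens_com (tm k)) (s', ?o pl) (s', ?o (pl @ [(k, t, j)])) ((l + 1) * (20 * (t + j) + 6))"
    if "k < 9" "s' 6 = un t" "s' 7 = un j" "s' 8 = []" for k s' pl t j
    by (rule runs_cong[OF runs_tokens[of s' t j "tm k"]])
      (use that l in \<open>auto intro!: mult_le_mono1\<close>)
  have a1: "runs 13 3 (row_com (tm 0) 5) (s, out) (s(7 := un Z), ?o ?p1) (row_time l 0 0 Z)"
    using row[of 5 0 s 0 0 Z 0 "[]"] s by simp
  have a2: "runs 13 3 (tokens_com (tm 1)) (s(7 := un Z), ?o ?p1) (s(7 := un Z), ?o (?p1 @ ?p2)) ((l + 1) * (20 * Z + 6))"
    using tok[of 1 "s(7 := un Z)" 0 Z ?p1] s by simp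
  have a3: "runs 13 3 (letters_com (\<lambda>b. tm (7 + of_bool b))) (s(7 := un Z), ?o (?p1 @ ?p2))
      (s(7 := un (Z + 2 * ?n + 1)), ?o (?p1 @ ?p2 @ ?p3)) (letters_time l ?n Z)"
    by (rule runs_cong[OF runs_letters[of _ x Z _ l]])
      (use s l in \<open>auto simp: grid_string_letters[of tm "pair_string x []" Z, simplified]\<close>)
  have a4: "runs 13 3 (row_com (tm 2) 3) (s(7 := un (Z + 2 * ?n + 1)), ?o (?p1 @ ?p2 @ ?p3))
      (s(7 := un (Z + 2 * ?n + 1 + P)), ?o (?p1 @ ?p2 @ ?p3 @ ?p4)) (row_time l 0 (Z + 2 * ?n + 1) P)"
    by (rule runs_cong[OF row[of 3 2 _ 0 "Z + 2 * ?n + 1" P 0]]) (use s in simp_all)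
  have a5: "runs 13 3 (row_com (tm 3) 5) (s(7 := un (Z + 2 * ?n + 1 + P)), ?o (?p1 @ ?p2 @ ?p3 @ ?p4))
      (s(7 := un (Z + 2 * ?n + 1 + P + Z)), ?o (?p1 @ ?p2 @ ?p3 @ ?p4 @ ?p5)) (row_time l 0 (Z + 2 * ?n + 1 + P) Z)"
    by (rule runs_cong[OF row[of 5 3 _ 0 "Z + 2 * ?n + 1 + P" Z 0]]) (use s in simp_all)
  have a6: "runs 13 3 (clear_com 7) (s(7 := un (Z + 2 * ?n + 1 + P + Z)), ?o (?p1 @ ?p2 @ ?p3 @ ?p4 @ ?p5))
      (s, ?o (?p1 @ ?p2 @ ?p3 @ ?p4 @ ?p5)) (2 * (Z + 2 * ?n + 1 + P + Z) + 1)"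
    by (rule runs_cong[OF runs_clear[of 7 _ "Z + 2 * ?n + 1 + P + Z"]]) (use s in \<open>auto simp: fun_eq_iff\<close>)
  let ?p15 = "?p1 @ ?p2 @ ?p3 @ ?p4 @ ?p5"
  have a7: "runs 13 3 (copy_com 5 7) (s, ?o ?p15) (s(7 := un Z), ?o ?p15) (copy_time Z)"
    by (rule runs_cong[OF runs_copy[of 5 7 _ Z]]) (use s in auto)
  have a8: "runs 13 3 (Push 7 1) (s(7 := un Z), ?o ?p15) (s(7 := un (Suc Z)), ?o ?p15) 2"
    by (rule runs_cong[OF runs_Push]) auto
  have a9: "runs 13 3 (row_com (tm 4) 5) (s(7 := un (Suc Z)), ?o ?p15) (s(7 := un (Suc Z + Z)), ?o (?p15 @ ?p6)) (row_time l 0 (Suc Z) Z)"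
    by (rule runs_cong[OF row[of 5 4 _ 0 "Suc Z" Z 0]]) (use s in \<open>simp_all del: replicate_Suc\<close>)
  have a10: "runs 13 3 (clear_com 7) (s(7 := un (Suc Z + Z)), ?o (?p15 @ ?p6)) (s, ?o (?p15 @ ?p6)) (2 * (Suc Z + Z) + 1)"
    by (rule runs_cong[OF runs_clear[of 7 _ "Suc Z + Z"]]) (use s in \<open>auto simp: fun_eq_iff\<close>)
  let ?p16 = "?p15 @ ?p6"
  define st where "st i = (s(9 := un (T - i), 6 := un i), ?o (?p16 @ ?p7 i))" for i
  have a11: "runs 13 3 (copy_com 4 9) (s, ?o ?p16) (st 0) (copy_time T)"
    unfolding st_def by (rule runs_cong[OF runs_copy[of 4 9 _ T]]) (use s in \<open>auto simp: fun_eq_iff\<close>)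
  have body: "runs 13 3 (Pop 9 ;; row_com (tm 5) 5 ;; row_com (tm 5) 5 ;; clear_com 7 ;; Push 6 1) (st i) (st (Suc i))
      (row_time l T 0 Z + row_time l T Z Z + 2 * (Z + Z) + 10)" if i: "i < T" for i
  proof -
    define s1 where "s1 = s(9 := un (T - Suc i), 6 := un i)"
    let ?pl = "?p16 @ ?p7 i"
    let ?pl1 = "?pl @ map (\<lambda>j. (5, i, j)) [0..<Z]" let ?pl2 = "?pl1 @ map (\<lambda>j. (5, i, Z + j)) [0..<Z]"
    have b1: "runs 13 3 (Pop 9) (st i) (s1, ?o ?pl) 1"
      unfolding st_def by (rule runs_cong[OF runs_Pop]) (use i in \<open>auto simp: s1_def fun_eq_iff tl_replicate\<close>)
    have b2: "runs 13 3 (row_com (tm 5) 5) (s1, ?o ?pl) (s1(7 := un Z), ?o ?pl1) (row_time l T 0 Z)"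
      by (rule runs_cong[OF row[of 5 5 _ i 0 Z T]]) (use s i in \<open>simp_all add: s1_def\<close>)
    have b3: "runs 13 3 (row_com (tm 5) 5) (s1(7 := un Z), ?o ?pl1) (s1(7 := un (Z + Z)), ?o ?pl2) (row_time l T Z Z)"
      by (rule runs_cong[OF row[of 5 5 _ i Z Z T]]) (use s i in \<open>simp_all add: s1_def\<close>)
    have b4: "runs 13 3 (clear_com 7) (s1(7 := un (Z + Z)), ?o ?pl2) (s1, ?o ?pl2) (2 * (Z + Z) + 1)"
      by (rule runs_cong[OF runs_clear[of 7 _ "Z + Z"]]) (use s in \<open>auto simp: s1_def fun_eq_iff\<close>)
    have b5: "runs 13 3 (Push 6 1) (s1, ?o ?pl2) (st (Suc i)) 2"
      unfolding st_def by (rule runs_cong[OF runs_Push]) (auto simp: s1_def fun_eq_iff)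
    show ?thesis by (rule runs_cong[OF runs_Seq[OF b1 runs_Seq[OF b2 runs_Seq[OF b3 runs_Seq[OF b4 b5]]]]]) simp_all
  qed
  have a12: "runs 13 3 (While 9 (Pop 9 ;; row_com (tm 5) 5 ;; row_com (tm 5) 5 ;; clear_com 7 ;; Push 6 1)) (st 0) (st T)
      (T * ((row_time l T 0 Z + row_time l T Z Z + 2 * (Z + Z) + 10) + 1) + 1)"
    by (rule runs_While[where st = st and N = T, OF _ _ body]) (auto simp: st_def)
  let ?p17 = "?p16 @ ?p7 T"
  have a13: "runs 13 3 (copy_com 5 7) (st T) (s(6 := un T, 7 := un Z), ?o ?p17) (copy_time Z)"
    unfolding st_def by (rule runs_cong[OF runs_copy[of 5 7 _ Z]]) (use s in \<open>auto simp: fun_eq_iff\<close>)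
  have a14: "runs 13 3 (tokens_com (tm 6)) (s(6 := un T, 7 := un Z), ?o ?p17) (s(6 := un T, 7 := un Z), ?o (?p17 @ ?p8))
      ((l + 1) * (20 * (T + Z) + 6))"
    by (rule tok) (use s in auto)
  have a15: "runs 13 3 (clear_com 7) (s(6 := un T, 7 := un Z), ?o (?p17 @ ?p8)) (s(6 := un T), ?o (?p17 @ ?p8)) (2 * Z + 1)"
    by (rule runs_cong[OF runs_clear[of 7 _ Z]]) (use s in \<open>auto simp: fun_eq_iff\<close>)
  have a16: "runs 13 3 (clear_com 6) (s(6 := un T), ?o (?p17 @ ?p8)) (s, ?o (?p17 @ ?p8)) (2 * T + 1)"
    by (rule runs_cong[OF runs_clear[of 6 _ T]]) (use s in \<open>auto simp: fun_eq_iff\<close>)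
  have "?p17 @ ?p8 = placements x P T Z" by (simp add: placements_def)
  note a16 = a16[unfolded this]
  show ?thesis
    unfolding grid_com_def
    by (rule runs_cong[OF runs_Seq[OF a1 runs_Seq[OF a2 runs_Seq[OF a3 runs_Seq[OF a4 runs_Seq[OF a5 runs_Seq[OF a6
      runs_Seq[OF a7 runs_Seq[OF a8 runs_Seq[OF a9 runs_Seq[OF a10 runs_Seq[OF a11 runs_Seq[OF a12 runs_Seq[OF a13
      runs_Seq[OF a14[unfolded \<open>?p17 @ ?p8 = placements x P T Z\<close>] runs_Seq[OF a15[unfolded \<open>?p17 @ ?p8 = placements x P T Z\<close>] a16]]]]]]]]]]]]]]]])
      (simp_all add: grid_time_def)
qed

section \<open>Evaluating polynomials in unary\<close>

primrec push_units :: "nat \<Rightarrow> com" where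
  "push_units 0 = Skip"
| "push_units (Suc c) = Push 11 1 ;; push_units c"

lemma runs_push_units: "runs 13 3 (push_units c) (s, out) (s(11 := un c @ s 11), out) (3 * c + 1)"
proof (induction c arbitrary: s)
  case 0
  show ?case unfolding push_units.simps by (rule runs_cong[OF runs_Skip]) auto
next
  case (Suc c)
  have a: "runs 13 3 (Push 11 1) (s, out) (s(11 := 1 # s 11), out) 2" by (rule runs_Push) auto
  show ?case unfolding push_units.simps
    by (rule runs_cong[OF runs_Seq[OF a Suc]]) (auto simp: replicate_app_Cons_same)
qed

text \<open>Horner's scheme, with the constant coefficient at the head of the list as in
  \<open>Poly\<close>. The product with the argument is formed by repeatedly copying register
  2.\<close>

primrec horner_com :: "nat list \<Rightarrow> com" where
  "horner_com [] = Skip"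
| "horner_com (c # cs) = horner_com cs ;; copy_com 11 12 ;; clear_com 11 ;;
     While 12 (Pop 12 ;; copy_com 2 11) ;; push_units c"

primrec horner_time :: "nat list \<Rightarrow> nat \<Rightarrow> nat" where
  "horner_time [] n = 1"
| "horner_time (c # cs) n = horner_time cs n + (copy_time (poly (Poly cs) n) + ((2 * poly (Poly cs) n + 1) +
     ((poly (Poly cs) n * ((1 + copy_time n + 1) + 1) + 1) + (3 * c + 1) + 1) + 1) + 1) + 1"

lemma runs_horner:
  assumes s: "s 2 = un n" "s 8 = []" "s 11 = []" "s 12 = []"
  shows "runs 13 3 (horner_com cs) (s, out) (s(11 := un (poly (Poly cs) n)), out) (horner_time cs n)"
proof (induction cs)
  case Nil
  show ?case unfolding horner_com.simps by (rule runs_cong[OF runs_Skip]) (use s in \<open>auto simp: fun_eq_iff\<close>)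
next
  case (Cons c cs)
  let ?m = "poly (Poly cs) n"
  have a: "runs 13 3 (copy_com 11 12) (s(11 := un ?m), out) (s(11 := un ?m, 12 := un ?m), out) (copy_time ?m)"
    by (rule runs_cong[OF runs_copy[of 11 12 _ ?m]]) (use s in auto)
  define st where "st i = (s(11 := un (i * n), 12 := un (?m - i)), out)" for i
  have b: "runs 13 3 (clear_com 11) (s(11 := un ?m, 12 := un ?m), out) (st 0) (2 * ?m + 1)"
    unfolding st_def by (rule runs_cong[OF runs_clear[of 11 _ ?m]]) (auto simp: fun_eq_iff)
  have body: "runs 13 3 (Pop 12 ;; copy_com 2 11) (st i) (st (Suc i)) (1 + copy_time n + 1)" if i: "i < ?m" for i
  proof -
    have p: "runs 13 3 (Pop 12) (st i) (s(11 := un (i * n), 12 := un (?m - Suc i)), out) 1"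
      unfolding st_def by (rule runs_cong[OF runs_Pop]) (use i in \<open>auto simp: fun_eq_iff tl_replicate\<close>)
    have q: "runs 13 3 (copy_com 2 11) (s(11 := un (i * n), 12 := un (?m - Suc i)), out) (st (Suc i)) (copy_time n)"
      unfolding st_def by (rule runs_cong[OF runs_copy[of 2 11 _ n]]) (use s in \<open>auto simp: fun_eq_iff replicate_add\<close>)
    show ?thesis by (rule runs_Seq[OF p q])
  qed
  have w: "runs 13 3 (While 12 (Pop 12 ;; copy_com 2 11)) (st 0) (st ?m) (?m * ((1 + copy_time n + 1) + 1) + 1)"
    by (rule runs_While[where st = st and N = ?m, OF _ _ body]) (auto simp: st_def)
  have u: "runs 13 3 (push_units c) (st ?m) (s(11 := un (poly (Poly (c # cs)) n)), out) (3 * c + 1)"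
    unfolding st_def by (rule runs_cong[OF runs_push_units])
      (use s in \<open>auto simp: fun_eq_iff replicate_add mult.commute\<close>)
  show ?case unfolding horner_com.simps horner_time.simps
    by (rule runs_Seq[OF Cons runs_Seq[OF a runs_Seq[OF b runs_Seq[OF w u]]]])
qed

lemma wf_horner: "wf_com 13 3 (horner_com cs)"
proof (induction cs)
  case (Cons c cs)
  have "wf_com 13 3 (push_units c)" by (induction c) auto
  then show ?case using Cons by (simp add: wf_copy wf_clear)
qed simp

text \<open>The running times are deeply nested sums and products; the closure rules replace an
  explicit bounding polynomial.\<close>

definition polynomially_bounded :: "(nat \<Rightarrow> nat) \<Rightarrow> bool" where
  "polynomially_bounded f \<longleftrightarrow> (\<exists>p. \<forall>n. f n \<le> poly p n)"

lemma polynomially_bounded_const: "polynomially_bounded (\<lambda>_. c)"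
  unfolding polynomially_bounded_def by (intro exI[of _ "[:c:]"]) simp

lemma polynomially_bounded_id: "polynomially_bounded (\<lambda>n. n)"
  unfolding polynomially_bounded_def by (intro exI[of _ "[:0, 1:]"]) simp

lemma polynomially_bounded_poly: "polynomially_bounded (\<lambda>n. poly p n)"
  unfolding polynomially_bounded_def by blast

lemma polynomially_bounded_add:
  assumes "polynomially_bounded f" "polynomially_bounded g"
  shows "polynomially_bounded (\<lambda>n. f n + g n)"
proof -
  obtain p q where "\<forall>n. f n \<le> poly p n" "\<forall>n. g n \<le> poly q n"
    using assms by (auto simp: polynomially_bounded_def)
  then show ?thesis unfolding polynomially_bounded_def by (intro exI[of _ "p + q"]) (simp add: add_le_mono)
qed

lemma polynomially_bounded_mult:
  assumes "polynomially_bounded f" "polynomially_bounded g"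
  shows "polynomially_bounded (\<lambda>n. f n * g n)"
proof -
  obtain p q where "\<forall>n. f n \<le> poly p n" "\<forall>n. g n \<le> poly q n"
    using assms by (auto simp: polynomially_bounded_def)
  then show ?thesis unfolding polynomially_bounded_def by (intro exI[of _ "p * q"]) (simp add: mult_le_mono)
qed

lemma polynomially_bounded_Suc:
  "polynomially_bounded f \<Longrightarrow> polynomially_bounded (\<lambda>n. Suc (f n))"
  using polynomially_bounded_add[OF _ polynomially_bounded_const[of 1], of f] by simp

lemmas polynomially_bounded_intros = polynomially_bounded_const polynomially_bounded_id polynomially_bounded_poly
  polynomially_bounded_add polynomially_bounded_mult polynomially_bounded_Suc

lemma polynomially_bounded_horner: "polynomially_bounded (\<lambda>n. horner_time cs n)"
proof (induction cs)
  case (Cons c cs)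
  then show ?case unfolding horner_time.simps copy_time_def by (intro polynomially_bounded_intros)
qed (simp add: polynomially_bounded_const)

definition count_com :: com where
  "count_com = While 0 (Case 0 (\<lambda>b. Pop 0 ;; Push 2 1 ;; Push 1 (if b = 2 then 2 else 1))) ;;
     While 1 (Case 1 (\<lambda>b. Pop 1 ;; Push 0 (if b = 2 then 2 else 1)))"

lemma runs_count:
  assumes s: "s 0 = map bit_symbol x" "s 1 = []" "s 2 = []"
  shows "runs 13 3 count_com (s, out) (s(2 := un (length x)), out) (20 * length x + 5)"
proof -
  let ?n = "length x"
  define st where "st i = (s(0 := map bit_symbol (drop i x), 1 := map bit_symbol (rev (take i x)), 2 := un i), out)" for i
  define st2 where "st2 i = (s(0 := map bit_symbol (drop (?n - i) x), 1 := map bit_symbol (rev (take (?n - i) x)), 2 := un ?n), out)" for i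
  have body: "runs 13 3 (Case 0 (\<lambda>b. Pop 0 ;; Push 2 1 ;; Push 1 (if b = 2 then 2 else 1))) (st i) (st (Suc i)) 8"
    if i: "i < ?n" for i
  proof -
    let ?b = "x ! i"
    have d: "drop i x = ?b # drop (Suc i) x" using i by (rule Cons_nth_drop_Suc[symmetric])
    have tk: "take (Suc i) x = take i x @ [?b]" using i by (rule take_Suc_conv_app_nth)
    define s1 where "s1 = s(0 := map bit_symbol (drop (Suc i) x), 1 := map bit_symbol (rev (take i x)), 2 := un i)"
    have a: "runs 13 3 (Pop 0) (fst (st i), snd (st i)) (s1, out) 1"
      by (rule runs_cong[OF runs_Pop]) (auto simp: st_def s1_def fun_eq_iff d)
    have b: "runs 13 3 (Push 2 1) (s1, out) (s1(2 := un (Suc i)), out) 2"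
      by (rule runs_cong[OF runs_Push]) (auto simp: s1_def)
    have c: "runs 13 3 (Push 1 (bit_symbol ?b)) (s1(2 := un (Suc i)), out) (st (Suc i)) 2"
      by (rule runs_cong[OF runs_Push]) (auto simp: st_def s1_def fun_eq_iff tk bit_symbol_def)
    have h: "top (fst (st i) 0) = bit_symbol ?b" by (simp add: st_def d)
    have sym: "(if bit_symbol ?b = 2 then 2 else 1) = bit_symbol ?b" by (auto simp: bit_symbol_def)
    have "runs 13 3 (Case 0 (\<lambda>b. Pop 0 ;; Push 2 1 ;; Push 1 (if b = 2 then 2 else 1))) (fst (st i), snd (st i)) (st (Suc i)) (1 + (2 + 2 + 1) + 1 + 1)"
      by (rule runs_Case, simp, simp, unfold h sym) (rule runs_Seq[OF a runs_Seq[OF b c]])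
    then show ?thesis by (auto elim: runs_mono)
  qed
  have body2: "runs 13 3 (Case 1 (\<lambda>b. Pop 1 ;; Push 0 (if b = 2 then 2 else 1))) (st2 i) (st2 (Suc i)) 5"
    if i: "i < ?n" for i
  proof -
    let ?m = "?n - Suc i" let ?b = "x ! ?m"
    have m: "?n - i = Suc ?m" "?m < ?n" using i by auto
    have tk: "take (?n - i) x = take ?m x @ [?b]" unfolding m(1) using m(2) by (rule take_Suc_conv_app_nth)
    have d: "drop ?m x = ?b # drop (?n - i) x" unfolding m(1) using m(2) by (rule Cons_nth_drop_Suc[symmetric])
    define s1 where "s1 = s(0 := map bit_symbol (drop (?n - i) x), 1 := map bit_symbol (rev (take ?m x)), 2 := un ?n)"
    have a: "runs 13 3 (Pop 1) (fst (st2 i), snd (st2 i)) (s1, snd (st2 i)) 1"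
      by (rule runs_cong[OF runs_Pop]) (auto simp: st2_def s1_def fun_eq_iff tk)
    have b: "runs 13 3 (Push 0 (bit_symbol ?b)) (s1, snd (st2 i)) (st2 (Suc i)) 2"
      by (rule runs_cong[OF runs_Push]) (auto simp: st2_def s1_def fun_eq_iff d bit_symbol_def)
    have h: "top (fst (st2 i) 1) = bit_symbol ?b" by (simp add: st2_def tk)
    have sym: "(if bit_symbol ?b = 2 then 2 else 1) = bit_symbol ?b" by (auto simp: bit_symbol_def)
    have "runs 13 3 (Case 1 (\<lambda>b. Pop 1 ;; Push 0 (if b = 2 then 2 else 1))) (fst (st2 i), snd (st2 i)) (st2 (Suc i)) (1 + 2 + 1 + 1)"
      by (rule runs_Case, simp, simp, unfold h sym) (rule runs_Seq[OF a b])
    then show ?thesis by (auto elim: runs_mono)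
  qed
  have 1: "runs 13 3 (While 0 (Case 0 (\<lambda>b. Pop 0 ;; Push 2 1 ;; Push 1 (if b = 2 then 2 else 1)))) (st 0) (st ?n) (?n * (8 + 1) + 1)"
    by (rule runs_While[where st = st and N = ?n, OF _ _ body]) (auto simp: st_def)
  have 2: "runs 13 3 (While 1 (Case 1 (\<lambda>b. Pop 1 ;; Push 0 (if b = 2 then 2 else 1)))) (st2 0) (st2 ?n) (?n * (5 + 1) + 1)"
    by (rule runs_While[where st = st2 and N = ?n, OF _ _ body2]) (auto simp: st2_def)
  have e: "st ?n = st2 0" "st 0 = (s, out)" "st2 ?n = (s(2 := un ?n), out)"
    using s by (auto simp: st_def st2_def fun_eq_iff)
  show ?thesis unfolding count_com_def
    by (rule runs_cong[OF runs_Seq[OF 1[unfolded e] 2]]) (simp_all add: e)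
qed

text \<open>The two passes have the shape of an encoded instance: the list of variables, then that
  of constraints, each ended by \<open>False\<close>.\<close>

lemma polytime_grid:
  "polytime (\<lambda>x. let pl = placements x (poly pP (length x)) (poly pT (length x)) (poly pZ (length x))
     in grid_string tm1 pl @ [False] @ grid_string tm2 pl @ [False])"
proof -
  define c where "c = count_com ;; horner_com (coeffs pP) ;; copy_com 11 3 ;; clear_com 11 ;;
    horner_com (coeffs pT) ;; copy_com 11 4 ;; clear_com 11 ;; horner_com (coeffs pZ) ;; copy_com 11 5 ;; clear_com 11 ;;
    grid_com tm1 ;; Emit 1 ;; grid_com tm2 ;; Emit 1"
  have wf: "wf_com 13 3 c"
    by (simp add: c_def count_com_def wf_horner wf_copy wf_clear wf_grid)
  define l where "l = (\<Sum>k<9. length (tm1 k) + length (tm2 k))"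
  have l: "length (tm1 k) \<le> l" "length (tm2 k) \<le> l" if "k < 9" for k
  proof -
    have "length (tm1 k) + length (tm2 k) \<le> l" unfolding l_def by (rule member_le_sum) (use that in auto)
    then show "length (tm1 k) \<le> l" "length (tm2 k) \<le> l" by auto
  qed
  define P T Z where "P = poly pP" and "T = poly pT" and "Z = poly pZ"
  define time where "time n = (20 * n + 5) + (horner_time (coeffs pP) n + (copy_time (P n) + ((2 * P n + 1) +
    (horner_time (coeffs pT) n + (copy_time (T n) + ((2 * T n + 1) + (horner_time (coeffs pZ) n + (copy_time (Z n) +
    ((2 * Z n + 1) + (grid_time l n (P n) (T n) (Z n) + (1 + (grid_time l n (P n) (T n) (Z n) + 1 + 1) + 1) + 1) + 1) + 1) + 1) + 1) + 1) + 1) + 1) + 1) + 1) + 1"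
    for n
  have "polynomially_bounded time"
    unfolding time_def grid_time_def row_time_def copy_time_def letters_time_def P_def T_def Z_def
    by (intro polynomially_bounded_intros polynomially_bounded_horner)
  then obtain p where p: "time n \<le> poly p n" for n by (auto simp: polynomially_bounded_def)
  show ?thesis
  proof (rule polytimeI[OF wf])
    fix x :: "bool list"
    let ?n = "length x"
    let ?pl = "placements x (P ?n) (T ?n) (Z ?n)"
    define s0 where "s0 = ((\<lambda>_. [])(0 := map bit_symbol x) :: nat \<Rightarrow> nat list)"
    define s1 where "s1 = s0(2 := un ?n)"
    define s2 where "s2 = s1(3 := un (P ?n))"
    define s3 where "s3 = s2(4 := un (T ?n))"
    define s4 where "s4 = s3(5 := un (Z ?n))"
    have z1: "s1 r = []" if "r \<notin> {0, 2}" for r using that by (simp add: s1_def s0_def)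
    have z2: "s2 r = []" if "r \<notin> {0, 2, 3}" for r using that z1 by (simp add: s2_def)
    have z3: "s3 r = []" if "r \<notin> {0, 2, 3, 4}" for r using that z2 by (simp add: s3_def)
    have z4: "s4 r = []" if "r \<notin> {0, 2, 3, 4, 5}" for r using that z3 by (simp add: s4_def)
    have n: "s1 2 = un ?n" "s2 2 = un ?n" "s3 2 = un ?n" by (simp_all add: s1_def s2_def s3_def)
    have a1: "runs 13 3 count_com (s0, []) (s1, []) (20 * ?n + 5)"
      unfolding s1_def by (rule runs_count) (simp_all add: s0_def)
    have horner: "runs 13 3 (horner_com (coeffs q)) (s, []) (s(11 := un (poly q ?n)), []) (horner_time (coeffs q) ?n)"
      if "s 2 = un ?n" "s 8 = []" "s 11 = []" "s 12 = []" for s and q :: "nat poly"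
      using runs_horner[of s ?n "coeffs q" "[]"] that by simp
    have cp: "runs 13 3 (copy_com 11 d) (s(11 := un a), []) (s(11 := un a, d := un a), []) (copy_time a)"
      if "d \<in> {3, 4, 5}" "s 8 = []" "s d = []" for d s a
      by (rule runs_cong[OF runs_copy[of 11 d _ a]]) (use that in auto)
    have cl: "runs 13 3 (clear_com 11) (s(11 := un a, d := un a), []) (s(d := un a), []) (2 * a + 1)"
      if "d \<in> {3, 4, 5}" "s 11 = []" for d s a
      by (rule runs_cong[OF runs_clear[of 11 _ a]]) (use that in \<open>auto simp: fun_eq_iff\<close>)
    have a2: "runs 13 3 (horner_com (coeffs pP)) (s1, []) (s1(11 := un (P ?n)), []) (horner_time (coeffs pP) ?n)"
      unfolding P_def by (rule horner) (use n z1 in auto)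
    have a3: "runs 13 3 (copy_com 11 3) (s1(11 := un (P ?n)), []) (s1(11 := un (P ?n), 3 := un (P ?n)), []) (copy_time (P ?n))"
      by (rule cp) (use z1 in auto)
    have a4: "runs 13 3 (clear_com 11) (s1(11 := un (P ?n), 3 := un (P ?n)), []) (s2, []) (2 * P ?n + 1)"
      unfolding s2_def by (rule cl) (use z1 in auto)
    have a5: "runs 13 3 (horner_com (coeffs pT)) (s2, []) (s2(11 := un (T ?n)), []) (horner_time (coeffs pT) ?n)"
      unfolding T_def by (rule horner) (use n z2 in auto)
    have a6: "runs 13 3 (copy_com 11 4) (s2(11 := un (T ?n)), []) (s2(11 := un (T ?n), 4 := un (T ?n)), []) (copy_time (T ?n))"
      by (rule cp) (use z2 in auto)
    have a7: "runs 13 3 (clear_com 11) (s2(11 := un (T ?n), 4 := un (T ?n)), []) (s3, []) (2 * T ?n + 1)"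
      unfolding s3_def by (rule cl) (use z2 in auto)
    have a8: "runs 13 3 (horner_com (coeffs pZ)) (s3, []) (s3(11 := un (Z ?n)), []) (horner_time (coeffs pZ) ?n)"
      unfolding Z_def by (rule horner) (use n z3 in auto)
    have a9: "runs 13 3 (copy_com 11 5) (s3(11 := un (Z ?n)), []) (s3(11 := un (Z ?n), 5 := un (Z ?n)), []) (copy_time (Z ?n))"
      by (rule cp) (use z3 in auto)
    have a10: "runs 13 3 (clear_com 11) (s3(11 := un (Z ?n), 5 := un (Z ?n)), []) (s4, []) (2 * Z ?n + 1)"
      unfolding s4_def by (rule cl) (use z3 in auto)
    have r4: "s4 0 = map bit_symbol x" "s4 3 = un (P ?n)" "s4 4 = un (T ?n)" "s4 5 = un (Z ?n)"
      by (simp_all add: s4_def s3_def s2_def s1_def s0_def)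
    have grid: "runs 13 3 (grid_com tm) (s4, out) (s4, out @ map bit_symbol (grid_string tm ?pl))
        (grid_time l ?n (P ?n) (T ?n) (Z ?n))" if "\<And>k. k < 9 \<Longrightarrow> length (tm k) \<le> l" for tm out
      by (rule runs_grid) (use r4 z4 that in auto)
    let ?o1 = "[] @ map bit_symbol (grid_string tm1 ?pl)" let ?o2 = "?o1 @ [1]"
    let ?o3 = "?o2 @ map bit_symbol (grid_string tm2 ?pl)"
    have a11: "runs 13 3 (grid_com tm1) (s4, []) (s4, ?o1) (grid_time l ?n (P ?n) (T ?n) (Z ?n))"
      by (rule grid) (rule l)
    have a12: "runs 13 3 (Emit 1) (s4, ?o1) (s4, ?o2) 1" by (rule runs_Emit) simp
    have a13: "runs 13 3 (grid_com tm2) (s4, ?o2) (s4, ?o3) (grid_time l ?n (P ?n) (T ?n) (Z ?n))"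
      by (rule grid) (rule l)
    have a14: "runs 13 3 (Emit 1) (s4, ?o3) (s4, ?o3 @ [1]) 1" by (rule runs_Emit) simp
    have "runs 13 3 c (s0, []) (s4, ?o3 @ [1]) (time ?n)"
      unfolding c_def time_def
      by (rule runs_Seq[OF a1 runs_Seq[OF a2 runs_Seq[OF a3 runs_Seq[OF a4 runs_Seq[OF a5 runs_Seq[OF a6 runs_Seq[OF a7
        runs_Seq[OF a8 runs_Seq[OF a9 runs_Seq[OF a10 runs_Seq[OF a11 runs_Seq[OF a12 runs_Seq[OF a13 a14]]]]]]]]]]]]])
    then have "runs 13 3 c (s0, []) (s4, ?o3 @ [1]) (poly p ?n)" by (rule runs_mono) (rule p)
    then show "\<exists>s'. runs 13 3 c ((\<lambda>_. [])(0 := map bit_symbol x), []) (s', map bit_symbol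
        (let pl = placements x (poly pP ?n) (poly pT ?n) (poly pZ ?n)
         in grid_string tm1 pl @ [False] @ grid_string tm2 pl @ [False])) (poly p ?n)"
      by (intro exI[of _ s4]) (simp add: s0_def P_def T_def Z_def Let_def bit_symbol_def)
  qed simp_all
qed

section \<open>Gadgets\<close>

text \<open>\<open>Cell xs\<close> is the value at \<open>xs\<close> of the polymorphism for the tile at a position, \<open>Rel k xs\<close> that of the
  polymorphism for the block of type \<open>k\<close>, and \<open>Aux\<close> fills the tuples of \<open>R\<close> beyond two coordinates. In
  place of an identity between two polymorphisms, the constraints say that they are adjacent.\<close>

datatype 'v gadget_var = Cell "'v list" | Rel nat "'v list" | Aux nat nat nat

text \<open>The window through which a machine step is seen: three neighbouring cells of a row, and
  as number 3 the cell at the next time under the middle one.\<close>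

definition cell_row :: "nat \<Rightarrow> nat" where "cell_row p = (if p = 3 then 1 else 0)"
definition cell_col :: "nat \<Rightarrow> nat" where "cell_col p = (if p = 3 then 1 else p)"

definition block :: "(nat \<Rightarrow> nat \<Rightarrow> 'g) \<Rightarrow> nat \<Rightarrow> nat \<Rightarrow> 'g list" where
  "block \<tau> t j = map (\<lambda>p. \<tau> (t + cell_row p) (j + cell_col p)) [0..<4]"

lemma block_eq: "block \<tau> t j = [\<tau> t j, \<tau> t (j + 1), \<tau> t (j + 2), \<tau> (t + 1) (j + 1)]"
  by (simp add: block_def cell_row_def cell_col_def upt_rec numeral_eq_Suc)

lemma ball_edges:
  assumes "\<And>k t j r c u r' c' v. (k, t, j) \<in> Q \<Longrightarrow> ((r, c, u), (r', c', v)) \<in> es k \<Longrightarrow> P t j r c u r' c' v"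
  shows "\<forall>(k, t, j) \<in> Q. \<forall>((r, c, u), (r', c', v)) \<in> es k. P t j r c u r' c' v"
  using assms by auto

text \<open>The templates \<open>es\<close> do not depend on \<open>Q\<close>, which is what permits
  to print them over grids of any size. From tiles to values, all operations are projections. From
  values to tiles, the coordinates chosen for a cell and for a block are linked by
  \<open>\<pi>\<close>, because the cell operation is adjacent to a minor of the block
  operation.\<close>

lemma gadget_symbolic:
  fixes E :: "('v \<times> 'v) set" and G :: "'g set" and B :: "nat \<Rightarrow> 'g list set"
  assumes E: "nonbipartite_graph E" and G: "finite G" "G \<noteq> {}" and B: "\<And>k. k < N \<Longrightarrow> B k \<subseteq> nlists 4 G"
  shows "\<exists>es :: nat \<Rightarrow> ((nat \<times> nat \<times> 'v gadget_var) \<times> (nat \<times> nat \<times> 'v gadget_var)) set.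
     (\<forall>k. finite (es k)) \<and> (\<forall>k. \<forall>((_, _, u), (_, _, v)) \<in> es k. u \<notin> range (\<lambda>(a, b, c). Aux a b c) \<and> v \<notin> range (\<lambda>(a, b, c). Aux a b c)) \<and>
     (\<forall>Q. (\<forall>(k, t, j) \<in> Q. k < N) \<longrightarrow>
       ((\<exists>\<tau>. (\<forall>t j. \<tau> t j \<in> G) \<and> (\<forall>(k, t, j) \<in> Q. block \<tau> t j \<in> B k)) \<longleftrightarrow>
        (\<exists>\<sigma>. \<forall>(k, t, j) \<in> Q. \<forall>((r, c, u), (r', c', v)) \<in> es k. (\<sigma> (t + r) (j + c) u, \<sigma> (t + r') (j + c') v) \<in> E)))"
proof -
  have finE: "finite E" "finite (Field E)" and irr: "irrefl E"
    using E finite_Field_nonbipartite by (auto simp: nonbipartite_graph_def)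
  have finB: "finite (B k)" if "k < N" for k
    using B[OF that] finite_nlists[OF G(1)] finite_subset by blast
  \<comment> \<open>One arity that suffices to enumerate the tiles and every set of blocks; the
    enumerations may have repetitions.\<close>
  define K where "K = card G + (\<Sum>k<N. card (B k))"
  have K: "card G \<le> K" "\<And>k. k < N \<Longrightarrow> card (B k) \<le> K"
  proof -
    show "card G \<le> K" by (simp add: K_def)
    fix k assume "k < N"
    then have "card (B k) \<le> (\<Sum>k<N. card (B k))" by (intro member_le_sum) auto
    then show "card (B k) \<le> K" by (simp add: K_def)
  qed
  have enum: "\<exists>f :: nat \<Rightarrow> 'x. range f = A \<and> f ` {..<K} = A" if A: "finite A" "A \<noteq> {}" "card A \<le> K" for A :: "'x set"
  proof -
    obtain g where g: "bij_betw g {0..<card A} A" using ex_bij_betw_nat_finite[OF A(1)] by blast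
    have pos: "0 < card A" using A by (simp add: card_gt_0_iff)
    define f where "f i = g (if i < card A then i else 0)" for i
    have im: "g ` {0..<card A} = A" using g by (simp add: bij_betw_def)
    have "range f \<subseteq> A" using im pos by (auto simp: f_def)
    moreover have "A \<subseteq> f ` {..<K}"
    proof
      fix a assume "a \<in> A"
      then have "a \<in> g ` {0..<card A}" by (simp only: im)
      then obtain i where "i < card A" "a = g i" by auto
      then show "a \<in> f ` {..<K}" using A(3) by (auto simp: f_def image_iff intro!: bexI[of _ i])
    qed
    ultimately show ?thesis by (intro exI[of _ f]) blast
  qed
  obtain gi :: "nat \<Rightarrow> 'g" where gi: "range gi = G" "gi ` {..<K} = G" using enum[OF G K(1)] by blast
  have "\<forall>a. \<exists>i. a \<in> G \<longrightarrow> i < K \<and> gi i = a" using gi(2) by (auto simp: image_iff)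
  then obtain idx where idx: "\<And>a. a \<in> G \<Longrightarrow> idx a < K \<and> gi (idx a) = a" by metis
  have "\<forall>k. \<exists>f :: nat \<Rightarrow> 'g list. k < N \<longrightarrow> B k \<noteq> {} \<longrightarrow> range f = B k \<and> f ` {..<K} = B k"
    using enum[OF finB] K(2) by metis
  then obtain bi where bi: "\<And>k. k < N \<Longrightarrow> B k \<noteq> {} \<Longrightarrow> range (bi k) = B k \<and> bi k ` {..<K} = B k" by metis
  \<comment> \<open>Coordinate \<open>m\<close> of a block operation stands for the block
    \<open>bi k m\<close>, and \<open>\<pi> k p\<close> sends it to the coordinate of the tile at
    position \<open>p\<close> of that block.\<close>
  define \<pi> where "\<pi> k p m = idx (bi k m ! p)" for k p m
  have biG: "bi k m ! p \<in> G" if "k < N" "B k \<noteq> {}" "p < 4" for k m p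
  proof -
    have "bi k m \<in> nlists 4 G" using bi[OF that(1,2)] B[OF that(1)] by auto
    then show ?thesis using that(3) by (rule nlistsE_nth_in)
  qed
  have \<pi>: "\<pi> k p m < K" if "k < N" "B k \<noteq> {}" "p < 4" for k p m
    unfolding \<pi>_def using idx[OF biG[OF that]] by blast
  define adj where "adj = {(xs, ys). xs \<in> nlists K (Field E) \<and> ys \<in> nlists K (Field E) \<and> (\<forall>i<K. (xs ! i, ys ! i) \<in> E)}"
  have "adj \<subseteq> nlists K (Field E) \<times> nlists K (Field E)" by (auto simp: adj_def)
  then have finadj: "finite adj" using finite_nlists[OF finE(2)] finite_subset by (metis finite_cartesian_product)
  \<comment> \<open>If no block is allowed, a loop makes the template unsatisfiable. Otherwise the
    three sets of edges say that the cell operations are polymorphisms, that they are adjacent to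
    the minors of the block operation along \<open>\<pi>\<close>, and that the block operation is a
    polymorphism.\<close>
  define es where "es k =
    (if B k = {} then {((0 :: nat, 0 :: nat, Cell []), (0 :: nat, 0 :: nat, Cell []))}
     else (\<lambda>(p, xs, ys). ((cell_row p, cell_col p, Cell xs), (cell_row p, cell_col p, Cell ys))) ` ({..<4} \<times> adj) \<union>
          (\<lambda>(p, xs, ys). ((cell_row p, cell_col p, Cell xs), (0, 0, Rel k (map (\<lambda>i. ys ! \<pi> k p i) [0..<K])))) ` ({..<4} \<times> adj) \<union>
          (\<lambda>(xs, ys). ((0, 0, Rel k xs), (0, 0, Rel k ys))) ` adj)" for k
  obtain \<xi> where \<xi>: "chooses K (pols K E) E \<xi>" using nonbipartite_chooses[OF E] by blast
  have adjI: "(map x [0..<K], map y [0..<K]) \<in> adj" if "\<forall>i. (x i, y i) \<in> E" for x y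
  proof -
    have "x i \<in> Field E" "y i \<in> Field E" for i using that by (auto simp: Field_def)
    then show ?thesis using that by (auto simp: adj_def intro!: nlistsI)
  qed
  show ?thesis
  proof (intro exI[of _ es] conjI allI impI)
    show "finite (es k)" for k using finadj by (simp add: es_def)
    show "\<forall>((_, _, u), (_, _, v)) \<in> es k. u \<notin> range (\<lambda>(a, b, c). Aux a b c) \<and> v \<notin> range (\<lambda>(a, b, c). Aux a b c)" for k
      by (auto simp: es_def)
  next
    fix Q :: "(nat \<times> nat \<times> nat) set" assume Q: "\<forall>(k, t, j) \<in> Q. k < N"
    show "(\<exists>\<tau>. (\<forall>t j. \<tau> t j \<in> G) \<and> (\<forall>(k, t, j) \<in> Q. block \<tau> t j \<in> B k)) \<longleftrightarrow>
        (\<exists>\<sigma>. \<forall>(k, t, j) \<in> Q. \<forall>((r, c, u), (r', c', v)) \<in> es k. (\<sigma> (t + r) (j + c) u, \<sigma> (t + r') (j + c') v) \<in> E)"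
    proof
      assume "\<exists>\<tau>. (\<forall>t j. \<tau> t j \<in> G) \<and> (\<forall>(k, t, j) \<in> Q. block \<tau> t j \<in> B k)"
      then obtain \<tau> where \<tau>: "\<And>t j. \<tau> t j \<in> G" "\<And>k t j. (k, t, j) \<in> Q \<Longrightarrow> block \<tau> t j \<in> B k" by blast
      define m where "m k t j = (SOME m. m < K \<and> bi k m = block \<tau> t j)" for k t j
      have m: "m k t j < K \<and> bi k (m k t j) = block \<tau> t j" if q: "(k, t, j) \<in> Q" for k t j
      proof -
        have "k < N" using Q q by blast
        moreover have "B k \<noteq> {}" using \<tau>(2)[OF q] by blast
        ultimately have "block \<tau> t j \<in> bi k ` {..<K}" using bi \<tau>(2)[OF q] by blast
        then have "\<exists>m. m < K \<and> bi k m = block \<tau> t j" by auto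
        then show ?thesis unfolding m_def by (rule someI_ex)
      qed
      define \<sigma> :: "nat \<Rightarrow> nat \<Rightarrow> 'v gadget_var \<Rightarrow> 'v"
        where "\<sigma> t j u = (case u of Cell xs \<Rightarrow> xs ! idx (\<tau> t j) | Rel k xs \<Rightarrow> xs ! m k t j | Aux _ _ _ \<Rightarrow> undefined)" for t j u
      have "(\<sigma> (t + r) (j + c) u, \<sigma> (t + r') (j + c') v) \<in> E"
        if q: "(k, t, j) \<in> Q" and e: "((r, c, u), (r', c', v)) \<in> es k" for k t j r c u r' c' v
      proof -
        have ne: "B k \<noteq> {}" using \<tau>(2)[OF q] by blast
        from e ne consider
            "((r, c, u), (r', c', v)) \<in> (\<lambda>(p, xs, ys). ((cell_row p, cell_col p, Cell xs), (cell_row p, cell_col p, Cell ys))) ` ({..<4} \<times> adj)"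
          | "((r, c, u), (r', c', v)) \<in> (\<lambda>(p, xs, ys). ((cell_row p, cell_col p, Cell xs), (0, 0, Rel k (map (\<lambda>i. ys ! \<pi> k p i) [0..<K])))) ` ({..<4} \<times> adj)"
          | "((r, c, u), (r', c', v)) \<in> (\<lambda>(xs, ys). ((0, 0, Rel k xs), (0, 0, Rel k ys))) ` adj"
          unfolding es_def by (simp only: if_False Un_iff) (elim disjE; assumption)
        then show ?thesis
        proof cases
          case 1
          then obtain p xs ys where "(xs, ys) \<in> adj" "r = cell_row p" "c = cell_col p" "r' = r" "c' = c" "u = Cell xs" "v = Cell ys"
            by (elim imageE) (auto simp: split_beta)
          then show ?thesis using idx[OF \<tau>(1)] by (simp add: \<sigma>_def adj_def)
        next
          case 2
          then obtain p xs ys where 2: "p < 4" "(xs, ys) \<in> adj" "r = cell_row p" "c = cell_col p" "r' = 0" "c' = 0" "u = Cell xs"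
              "v = Rel k (map (\<lambda>i. ys ! \<pi> k p i) [0..<K])"
          proof (elim imageE)
            fix z assume z: "((r, c, u), (r', c', v)) = (case z of (p, xs, ys) \<Rightarrow> ((cell_row p, cell_col p, Cell xs), (0, 0, Rel k (map (\<lambda>i. ys ! \<pi> k p i) [0..<K]))))"
              "z \<in> {..<4} \<times> adj"
            obtain p xs ys where "z = (p, xs, ys)" by (metis prod_cases3)
            with z show thesis using that[of p xs ys] by simp
          qed
          have "bi k (m k t j) ! p = \<tau> (t + r) (j + c)" using m[OF q] 2 by (simp add: block_def)
          then have "\<pi> k p (m k t j) = idx (\<tau> (t + r) (j + c))" by (simp add: \<pi>_def)
          then show ?thesis using 2 m[OF q] idx[OF \<tau>(1)] by (simp add: \<sigma>_def adj_def)
        next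
          case 3
          then obtain xs ys where "(xs, ys) \<in> adj" "r = 0" "c = 0" "r' = 0" "c' = 0" "u = Rel k xs" "v = Rel k ys"
            by (elim imageE) (auto simp: split_beta)
          then show ?thesis using m[OF q] by (simp add: \<sigma>_def adj_def)
        qed
      qed
      then show "\<exists>\<sigma>. \<forall>(k, t, j) \<in> Q. \<forall>((r, c, u), (r', c', v)) \<in> es k. (\<sigma> (t + r) (j + c) u, \<sigma> (t + r') (j + c') v) \<in> E"
        by (intro exI[of _ \<sigma>]) auto
    next
      assume "\<exists>\<sigma>. \<forall>(k, t, j) \<in> Q. \<forall>((r, c, u), (r', c', v)) \<in> es k. (\<sigma> (t + r) (j + c) u, \<sigma> (t + r') (j + c') v) \<in> E"
      then obtain \<sigma> where \<sigma>': "\<forall>(k, t, j) \<in> Q. \<forall>((r, c, u), (r', c', v)) \<in> es k. (\<sigma> (t + r) (j + c) u, \<sigma> (t + r') (j + c') v) \<in> E"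
        by blast
      have \<sigma>: "(\<sigma> (t + r) (j + c) u, \<sigma> (t + r') (j + c') v) \<in> E"
        if "(k, t, j) \<in> Q" "((r, c, u), (r', c', v)) \<in> es k" for k t j r c u r' c' v
        using \<sigma>' that by fastforce
      define F where "F t j = (\<lambda>x. \<sigma> t j (Cell (map x [0..<K])))" for t j
      define H where "H k t j = (\<lambda>x. \<sigma> t j (Rel k (map x [0..<K])))" for k t j
      have depF: "dep K (F t j)" and depH: "dep K (H k t j)" for k t j
        by (auto simp: dep_def F_def H_def intro!: arg_cong[where f = "\<sigma> t j"] cong: map_cong)
      define \<tau> where "\<tau> t j = gi (\<xi> (F t j))" for t j
      have "block \<tau> t j \<in> B k" if q: "(k, t, j) \<in> Q" for k t j
      proof -
        have kN: "k < N" using Q q by blast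
        have ne: "B k \<noteq> {}"
        proof
          assume "B k = {}"
          then have "(\<sigma> (t + 0) (j + 0) (Cell []), \<sigma> (t + 0) (j + 0) (Cell [])) \<in> E"
            by (intro \<sigma>[OF q]) (simp add: es_def)
          then show False using irr by (simp add: irrefl_def)
        qed
        have FF: "padj E (F (t + cell_row p) (j + cell_col p)) (F (t + cell_row p) (j + cell_col p))" if p: "p < 4" for p
          unfolding padj_def F_def
        proof (intro allI impI \<sigma>[OF q])
          fix x y :: "nat \<Rightarrow> 'v" assume "\<forall>i. (x i, y i) \<in> E"
          from adjI[OF this] show "((cell_row p, cell_col p, Cell (map x [0..<K])), (cell_row p, cell_col p, Cell (map y [0..<K]))) \<in> es k"
            using ne p unfolding es_def by (auto intro!: image_eqI[where x = "(p, map x [0..<K], map y [0..<K])"])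
        qed
        have HH: "padj E (H k t j) (H k t j)"
          unfolding padj_def
        proof (intro allI impI)
          fix x y :: "nat \<Rightarrow> 'v" assume "\<forall>i. (x i, y i) \<in> E"
          from adjI[OF this] have "((0, 0, Rel k (map x [0..<K])), (0, 0, Rel k (map y [0..<K]))) \<in> es k"
            using ne unfolding es_def by auto
          from \<sigma>[OF q this] show "(H k t j x, H k t j y) \<in> E" by (simp add: H_def)
        qed
        have FH: "padj E (F (t + cell_row p) (j + cell_col p)) (\<lambda>x. H k t j (x \<circ> \<pi> k p))" if p: "p < 4" for p
          unfolding padj_def
        proof (intro allI impI)
          fix x y :: "nat \<Rightarrow> 'v" assume "\<forall>i. (x i, y i) \<in> E"
          from adjI[OF this] have "((cell_row p, cell_col p, Cell (map x [0..<K])), (0, 0, Rel k (map (\<lambda>i. map y [0..<K] ! \<pi> k p i) [0..<K]))) \<in> es k"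
            using ne p unfolding es_def by (auto intro!: image_eqI[where x = "(p, map x [0..<K], map y [0..<K])"])
          moreover have "map (\<lambda>i. map y [0..<K] ! \<pi> k p i) [0..<K] = map (y \<circ> \<pi> k p) [0..<K]"
            using \<pi>[OF kN ne p] by simp
          ultimately have "((cell_row p, cell_col p, Cell (map x [0..<K])), (0, 0, Rel k (map (y \<circ> \<pi> k p) [0..<K]))) \<in> es k" by (simp only:)
          from \<sigma>[OF q this] show "(F (t + cell_row p) (j + cell_col p) x, H k t j (y \<circ> \<pi> k p)) \<in> E"
            by (simp add: H_def F_def)
        qed
        have Fp: "F (t + cell_row p) (j + cell_col p) \<in> pols K E" if "p < 4" for p
          using FF[OF that] depF by (simp add: pols_def)
        have Hp: "H k t j \<in> pols K E" using HH depH by (simp add: pols_def)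
        have \<pi>K: "\<forall>i<K. \<pi> k p i < K" if "p < 4" for p using \<pi>[OF kN ne that] by blast
        let ?m = "\<xi> (H k t j)"
        have mK: "?m < K" using \<xi> Hp by (auto simp: chooses_def)
        have "\<xi> (F (t + cell_row p) (j + cell_col p)) = \<pi> k p ?m" if p: "p < 4" for p
        proof -
          have "\<xi> (F (t + cell_row p) (j + cell_col p)) = \<xi> (\<lambda>x. H k t j (x \<circ> \<pi> k p))"
            using \<xi> Fp[OF p] pols_minor[OF Hp \<pi>K[OF p]] FH[OF p] unfolding chooses_def by blast
          also have "\<dots> = \<pi> k p ?m" using \<xi> Hp \<pi>K[OF p] unfolding chooses_def by blast
          finally show ?thesis .
        qed
        then have \<tau>p: "\<tau> (t + cell_row p) (j + cell_col p) = bi k ?m ! p" if "p < 4" for p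
          using that idx[OF biG[OF kN ne that]] by (simp add: \<tau>_def \<pi>_def)
        have bB: "bi k ?m \<in> B k" using bi[OF kN ne] by blast
        then have "length (bi k ?m) = 4" using B[OF kN] by auto
        then have "block \<tau> t j = bi k ?m" by (intro nth_equalityI) (auto simp: block_def \<tau>p)
        then show ?thesis using bB by simp
      qed
      moreover have "\<tau> t j \<in> G" for t j unfolding \<tau>_def using gi(1) by blast
      ultimately show "\<exists>\<tau>. (\<forall>t j. \<tau> t j \<in> G) \<and> (\<forall>(k, t, j) \<in> Q. block \<tau> t j \<in> B k)" by blast
    qed
  qed
qed

definition instantiate :: "(nat \<Rightarrow> nat \<Rightarrow> 'a \<Rightarrow> 'v) \<Rightarrow> nat \<Rightarrow> nat \<Rightarrow> (nat \<times> nat \<times> 'a) list \<Rightarrow> 'v list" where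
  "instantiate \<sigma> t j c = map (\<lambda>(r, d, a). \<sigma> (t + r) (j + d) a) c"

text \<open>An edge of the projection extends to a tuple of \<open>R\<close>. Its other entries are
  taken by auxiliary variables that belong to one edge of one template at one place, so these
  extensions never interfere. The finitely many symbolic variables are then numbered.\<close>

theorem gadget:
  fixes R :: "'v list set" and G :: "'g set" and B :: "nat \<Rightarrow> 'g list set"
  assumes R: "R \<subseteq> nlists n V" and n: "2 \<le> n" and E: "nonbipartite_graph ((\<lambda>r. (r ! 0, r ! 1)) ` R)"
    and G: "finite G" "G \<noteq> {}" and B: "\<And>k. k < N \<Longrightarrow> B k \<subseteq> nlists 4 G"
  shows "\<exists>tm :: nat \<Rightarrow> (nat \<times> nat \<times> nat) list list. (\<forall>k. \<forall>c \<in> set (tm k). length c = n) \<and>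
     (\<forall>Q. (\<forall>(k, t, j) \<in> Q. k < N) \<longrightarrow>
       ((\<exists>\<tau>. (\<forall>t j. \<tau> t j \<in> G) \<and> (\<forall>(k, t, j) \<in> Q. block \<tau> t j \<in> B k)) \<longleftrightarrow>
        (\<exists>\<sigma>. \<forall>(k, t, j) \<in> Q. \<forall>c \<in> set (tm k). instantiate \<sigma> t j c \<in> R)))"
proof -
  let ?E = "(\<lambda>r. (r ! 0, r ! 1)) ` R"
  from gadget_symbolic[OF E G B, of N "\<lambda>k. k"] obtain es :: "nat \<Rightarrow> ((nat \<times> nat \<times> 'v gadget_var) \<times> (nat \<times> nat \<times> 'v gadget_var)) set"
    where es: "\<And>k. finite (es k)"
      and na: "\<And>k. \<forall>((_, _, u), (_, _, v)) \<in> es k. u \<notin> range (\<lambda>(a, b, c). Aux a b c) \<and> v \<notin> range (\<lambda>(a, b, c). Aux a b c)"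
      and eq: "\<And>Q. \<forall>(k, t, j) \<in> Q. k < N \<Longrightarrow>
       (\<exists>\<tau>. (\<forall>t j. \<tau> t j \<in> G) \<and> (\<forall>(k, t, j) \<in> Q. block \<tau> t j \<in> B k)) \<longleftrightarrow>
        (\<exists>\<sigma>. \<forall>(k, t, j) \<in> Q. \<forall>((r, c, u), (r', c', v)) \<in> es k. (\<sigma> (t + r) (j + c) u, \<sigma> (t + r') (j + c') v) \<in> ?E)"
    by blast
  have "\<forall>k. \<exists>xs. set xs = es k" using es finite_list by blast
  then obtain el where el: "\<And>k. set (el k) = es k" by metis
  define con where "con k i = fst (el k ! i) # snd (el k ! i) # map (\<lambda>a. (0 :: nat, 0 :: nat, Aux k i a)) [2..<n]" for k i
  define tv where "tv k = map (con k) [0..<length (el k)]" for k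
  define U where "U = (\<Union>k<N. \<Union>c \<in> set (tv k). (\<lambda>(r, d, u). u) ` set c)"
  have "finite U" unfolding U_def by auto
  from finite_imp_inj_to_nat_seg[OF this] obtain code :: "'v gadget_var \<Rightarrow> nat" and b :: nat
    where "code ` U = {i. i < b} \<and> inj_on code U" by (elim exE) (rule that)
  then have code: "inj_on code U" by (rule conjunct2)
  define tm where "tm k = (if k < N then map (map (\<lambda>(r, d, u). (r, d, code u))) (tv k) else [])" for k
  have len: "length c = n" if "c \<in> set (tm k)" for k c
    using that n by (auto simp: tm_def tv_def con_def split: if_splits)
  have "(\<exists>\<tau>. (\<forall>t j. \<tau> t j \<in> G) \<and> (\<forall>(k, t, j) \<in> Q. block \<tau> t j \<in> B k)) \<longleftrightarrow>
        (\<exists>\<sigma>. \<forall>(k, t, j) \<in> Q. \<forall>c \<in> set (tm k). instantiate \<sigma> t j c \<in> R)"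
    if Q: "\<forall>(k, t, j) \<in> Q. k < N" for Q
    unfolding eq[OF Q]
  proof
    assume "\<exists>\<sigma>. \<forall>(k, t, j) \<in> Q. \<forall>((r, c, u), (r', c', v)) \<in> es k. (\<sigma> (t + r) (j + c) u, \<sigma> (t + r') (j + c') v) \<in> ?E"
    then obtain \<sigma> where "\<forall>(k, t, j) \<in> Q. \<forall>((r, c, u), (r', c', v)) \<in> es k. (\<sigma> (t + r) (j + c) u, \<sigma> (t + r') (j + c') v) \<in> ?E"
      by blast
    note all = this
    have \<sigma>: "(\<sigma> (t + r) (j + c) u, \<sigma> (t + r') (j + c') v) \<in> ?E"
      if "(k, t, j) \<in> Q" "((r, c, u), (r', c', v)) \<in> es k" for k t j r c u r' c' v
      using bspec[OF bspec[OF all that(1), unfolded prod.case] that(2)] by (simp only: prod.case)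
    define val where "val t j p = (case p of (r, c, u) \<Rightarrow> \<sigma> (t + r) (j + c) u)" for t j p
    have ex: "\<exists>r \<in> R. r ! 0 = val t j (fst (el k ! i)) \<and> r ! 1 = val t j (snd (el k ! i))"
      if q: "(k, t, j) \<in> Q" "i < length (el k)" for k t j i
    proof -
      obtain r c u r' c' v where e: "el k ! i = ((r, c, u), (r', c', v))" by (metis prod.exhaust)
      then have "((r, c, u), (r', c', v)) \<in> es k" using el[of k] nth_mem[OF q(2)] by metis
      from \<sigma>[OF q(1) this] show ?thesis unfolding e val_def by auto
    qed
    define tup where "tup k t j i = (SOME r. r \<in> R \<and> r ! 0 = val t j (fst (el k ! i)) \<and> r ! 1 = val t j (snd (el k ! i)))" for k t j i
    have tup: "tup k t j i \<in> R \<and> tup k t j i ! 0 = val t j (fst (el k ! i)) \<and> tup k t j i ! 1 = val t j (snd (el k ! i))"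
      if q: "(k, t, j) \<in> Q" "i < length (el k)" for k t j i
      unfolding tup_def by (rule someI_ex) (use ex[OF q] in blast)
    define \<sigma>1 :: "nat \<Rightarrow> nat \<Rightarrow> 'v gadget_var \<Rightarrow> 'v" where "\<sigma>1 t j u = (case u of Aux k i a \<Rightarrow> tup k t j i ! a | _ \<Rightarrow> \<sigma> t j u)" for t j u
    define \<sigma>2 where "\<sigma>2 t j a = \<sigma>1 t j (inv_into U code a)" for t j a
    have "instantiate \<sigma>2 t j c \<in> R" if q: "(k, t, j) \<in> Q" and c: "c \<in> set (tm k)" for k t j c
    proof -
      have kN: "k < N" using Q q by blast
      then obtain i where i: "i < length (el k)" and ci: "c = map (\<lambda>(r, d, u). (r, d, code u)) (con k i)"
        using c by (auto simp: tm_def tv_def)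
      have inv: "inv_into U code (code u) = u" if "(r, d, u) \<in> set (con k i)" for r d u
      proof (rule inv_into_f_f[OF code])
        have "con k i \<in> set (tv k)" using i by (auto simp: tv_def)
        then show "u \<in> U" unfolding U_def using kN that by force
      qed
      have "instantiate \<sigma>2 t j c = instantiate \<sigma>1 t j (con k i)"
        unfolding ci instantiate_def map_map using inv by (auto simp: \<sigma>2_def)
      also have "\<dots> = tup k t j i"
      proof (rule nth_equalityI)
        have "tup k t j i \<in> nlists n V" using tup[OF q i] R by blast
        then show l: "length (instantiate \<sigma>1 t j (con k i)) = length (tup k t j i)"
          using n by (simp add: instantiate_def con_def)
        have ln: "length (tup k t j i) = n" using \<open>tup k t j i \<in> nlists n V\<close> by simp
        fix a assume "a < length (instantiate \<sigma>1 t j (con k i))"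
        then have a: "a < n" using l ln by simp
        obtain r c u r' c' v where e: "el k ! i = ((r, c, u), (r', c', v))" by (metis prod.exhaust)
        then have "((r, c, u), (r', c', v)) \<in> es k" using el[of k] nth_mem[OF i] by metis
        note mem = this
        have nau: "u \<notin> range (\<lambda>(a, b, c). Aux a b c)" "v \<notin> range (\<lambda>(a, b, c). Aux a b c)" 
          using bspec[OF na[of k] mem] by simp_all
        have \<sigma>1u: "\<sigma>1 t' j' w = \<sigma> t' j' w" if "w \<notin> range (\<lambda>(a, b, c). Aux a b c)" for t' j' w
          using that by (cases w) (auto simp: \<sigma>1_def image_iff)
        consider "a = 0" | "a = 1" | b where "a = Suc (Suc b)" by (metis One_nat_def not0_implies_Suc)
        then show "instantiate \<sigma>1 t j (con k i) ! a = tup k t j i ! a"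
        proof cases
          case 1
          then show ?thesis using tup[OF q i] nau by (simp add: instantiate_def con_def e val_def \<sigma>1u)
        next
          case 2
          then show ?thesis using tup[OF q i] nau by (simp add: instantiate_def con_def e val_def \<sigma>1u)
        next
          case 3
          then show ?thesis using a by (simp add: instantiate_def con_def \<sigma>1_def)
        qed
      qed
      also have "\<dots> \<in> R" using tup[OF q i] by blast
      finally show ?thesis .
    qed
    then show "\<exists>\<sigma>. \<forall>(k, t, j) \<in> Q. \<forall>c \<in> set (tm k). instantiate \<sigma> t j c \<in> R" by blast
  next
    assume prems: "\<exists>\<sigma>. \<forall>(k, t, j) \<in> Q. \<forall>c \<in> set (tm k). instantiate \<sigma> t j c \<in> R"
    define E0 where "E0 = ?E"
    from prems obtain \<sigma> where \<sigma>: "\<And>k t j c. (k, t, j) \<in> Q \<Longrightarrow> c \<in> set (tm k) \<Longrightarrow> instantiate \<sigma> t j c \<in> R" by blast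
    have key: "(\<sigma> (t + r) (j + c) (code u), \<sigma> (t + r') (j + c') (code v)) \<in> E0"
      if q: "(k, t, j) \<in> Q" and e: "((r, c, u), (r', c', v)) \<in> es k" for k t j r c u r' c' v
    proof -
      have kN: "k < N" using Q q by blast
      obtain i where i: "i < length (el k)" "el k ! i = ((r, c, u), (r', c', v))"
        using e el[of k] by (metis in_set_conv_nth)
      define d where "d = map (\<lambda>(r, d, u). (r, d, code u)) (con k i)"
      have "d \<in> set (tm k)" using i kN by (auto simp: tm_def tv_def d_def)
      then have rR: "instantiate \<sigma> t j d \<in> R" by (rule \<sigma>[OF q])
      have "instantiate \<sigma> t j d ! 0 = \<sigma> (t + r) (j + c) (code u)" "instantiate \<sigma> t j d ! 1 = \<sigma> (t + r') (j + c') (code v)"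
        using i by (simp_all add: instantiate_def d_def con_def)
      then have "(\<sigma> (t + r) (j + c) (code u), \<sigma> (t + r') (j + c') (code v)) =
          (\<lambda>r. (r ! 0, r ! 1)) (instantiate \<sigma> t j d)" by simp
      then show ?thesis unfolding E0_def using rR by (rule image_eqI)
    qed
    then show "\<exists>\<sigma>. \<forall>(k, t, j) \<in> Q. \<forall>((r, c, u), (r', c', v)) \<in> es k. (\<sigma> (t + r) (j + c) u, \<sigma> (t + r') (j + c') v) \<in> ?E"
      unfolding E0_def[symmetric]
      by (intro exI[of _ "\<lambda>t j u. \<sigma> t j (code u)"]) (rule ball_edges, rule key)
  qed
  note main = this
  show ?thesis
  proof (intro exI[of _ tm] conjI allI ballI impI)
    show "length c = n" if "c \<in> set (tm k)" for k c using len[OF that] .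
  qed (rule main)
qed

section \<open>Tableaux of Turing machines\<close>

lemma poly_mono_nat: "a \<le> b \<Longrightarrow> poly p a \<le> poly p b" for p :: "nat poly"
  by (induction p) (auto intro!: add_le_mono mult_le_mono)

text \<open>State, scanned symbols, contents of one cell on all tapes, and which heads stand there.
  State and scanned symbols are repeated along the whole row, so that a window of three cells
  suffices although the heads of different tapes may be far apart.\<close>

type_synonym tile = "nat \<times> nat list \<times> nat list \<times> bool list"

abbreviation (input) tile_state :: "tile \<Rightarrow> nat" where "tile_state A \<equiv> fst A"
abbreviation (input) tile_scanned :: "tile \<Rightarrow> nat list" where "tile_scanned A \<equiv> fst (snd A)"
abbreviation (input) tile_cells :: "tile \<Rightarrow> nat list" where "tile_cells A \<equiv> fst (snd (snd A))"
abbreviation (input) tile_heads :: "tile \<Rightarrow> bool list" where "tile_heads A \<equiv> snd (snd (snd A))"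

text \<open>A halted machine idles, so the result can be inspected in the last row whenever the
  machine stopped.\<close>

definition next_action :: "turing_machine \<Rightarrow> nat \<Rightarrow> nat list \<Rightarrow> nat \<times> (nat \<times> int) list" where
  "next_action M q s = (if q = states M then (q, map (\<lambda>a. (a, 0)) s) else transition M q s)"

definition scanned :: "turing_machine \<Rightarrow> configuration \<Rightarrow> nat list" where
  "scanned M = (\<lambda>(q, t, h). map (\<lambda>j. t j (h j)) [0..<tapes M])"

lemma step_next_action:
  "step M (q, t, h) = (fst (next_action M q (scanned M (q, t, h))),
     \<lambda>j. if j < tapes M then (t j)(h j := fst (snd (next_action M q (scanned M (q, t, h))) ! j)) else t j,
     \<lambda>j. if j < tapes M then h j + snd (snd (next_action M q (scanned M (q, t, h))) ! j) else h j)"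
  by (auto simp: step_def next_action_def scanned_def fun_eq_iff Let_def split_beta)

context
  fixes M :: turing_machine
  assumes TM: "turing_machine M"
begin

definition tiles :: "tile set" where
  "tiles = {..states M} \<times> nlists (tapes M) {..<symbols M} \<times> nlists (tapes M) {..<symbols M} \<times> nlists (tapes M) UNIV"

lemma finite_tiles: "finite tiles"
  unfolding tiles_def by (intro finite_cartesian_product finite_nlists) auto

definition first_cell :: "nat \<Rightarrow> nat list" where
  "first_cell a = a # replicate (tapes M - 1) 0"

text \<open>The scanned symbols are compared with the cells only where a head stands; their equality
  along the row does the rest. A head moving by 1 comes from \<open>A\<close>, one moving by -1 from
  \<open>C\<close>.\<close>

definition local_step :: "tile \<Rightarrow> tile \<Rightarrow> tile \<Rightarrow> tile \<Rightarrow> bool" where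
  "local_step A B C D \<longleftrightarrow>
     tile_state A = tile_state B \<and> tile_state C = tile_state B \<and>
     tile_scanned A = tile_scanned B \<and> tile_scanned C = tile_scanned B \<and>
     (\<forall>i<tapes M. tile_heads B ! i \<longrightarrow> tile_cells B ! i = tile_scanned B ! i) \<and>
     (let (q, acts) = next_action M (tile_state B) (tile_scanned B) in
        tile_state D = q \<and>
        (\<forall>i<tapes M. tile_cells D ! i = (if tile_heads B ! i then fst (acts ! i) else tile_cells B ! i) \<and>
           tile_heads D ! i = (if snd (acts ! i) = 1 then tile_heads A ! i
             else if snd (acts ! i) = -1 then tile_heads C ! i else tile_heads B ! i)))"

text \<open>The conditions 0 to 4, 7 and 8 describe the initial configuration, where 2 leaves the certificate
  open but lets no letter follow a blank, and 6 says that the output is \<open>[True]\<close>.\<close>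

definition tile_condition :: "nat \<Rightarrow> tile \<Rightarrow> tile \<Rightarrow> tile \<Rightarrow> tile \<Rightarrow> bool" where
  "tile_condition r A B C D \<longleftrightarrow>
     (if r = 0 then tile_cells A = replicate (tapes M) 0 \<and> tile_heads A = replicate (tapes M) False
      else if r = 1 then tile_state A = 0 \<and> tile_heads A = replicate (tapes M) True
      else if r = 2 then (\<exists>a<3. tile_cells A = first_cell a \<and> (a = 0 \<longrightarrow> tile_cells B ! 0 = 0))
      else if r = 3 then tile_cells A = replicate (tapes M) 0
      else if r = 4 then tile_heads A = replicate (tapes M) False
      else if r = 5 then local_step A B C D
      else if r = 6 then tile_state A = states M \<and> tile_cells A ! (tapes M - 1) = 2 \<and> tile_cells B ! (tapes M - 1) = 0
      else tile_cells A = first_cell (bit_symbol (r = 8)))"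

definition tile_relation :: "nat \<Rightarrow> tile list set" where
  "tile_relation r = {[A, B, C, D] | A B C D. A \<in> tiles \<and> B \<in> tiles \<and> C \<in> tiles \<and> D \<in> tiles \<and> tile_condition r A B C D}"

definition tiling :: "(nat \<Rightarrow> nat \<Rightarrow> tile) \<Rightarrow> bool list \<Rightarrow> nat \<Rightarrow> nat \<Rightarrow> nat \<Rightarrow> bool" where
  "tiling \<tau> x P T Z \<longleftrightarrow> (\<forall>t j. \<tau> t j \<in> tiles) \<and>
     (\<forall>(r, t, j) \<in> set (placements x P T Z).
        tile_condition r (\<tau> t j) (\<tau> t (j + 1)) (\<tau> t (j + 2)) (\<tau> (t + 1) (j + 1)))"

lemma tapes_pos: "1 \<le> tapes M" and symbols_ge: "3 \<le> symbols M"
  using TM by (auto simp: turing_machine_def)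

definition conf :: "bool list \<Rightarrow> nat \<Rightarrow> configuration" where
  "conf w t = (step M ^^ t) (initial w)"

definition valid :: "configuration \<Rightarrow> bool" where
  "valid = (\<lambda>(q, t, h). q \<le> states M \<and> (\<forall>j p. t j p < symbols M))"

lemma scanned_valid: "valid c \<Longrightarrow> scanned M c \<in> nlists (tapes M) {..<symbols M}"
  by (auto simp: valid_def scanned_def split: prod.splits intro!: nlistsI)

lemma next_action_valid:
  assumes "q \<le> states M" "s \<in> nlists (tapes M) {..<symbols M}"
  shows "fst (next_action M q s) \<le> states M"
    "i < tapes M \<Longrightarrow> fst (snd (next_action M q s) ! i) < symbols M"
    "i < tapes M \<Longrightarrow> snd (snd (next_action M q s) ! i) \<in> {-1, 0, 1}"
proof -
  have "fst (next_action M q s) \<le> states M \<and>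
    (i < tapes M \<longrightarrow> snd (next_action M q s) ! i \<in> {..<symbols M} \<times> {-1, 0, 1})"
  proof (cases "q = states M")
    case True
    then show ?thesis using nlistsE_nth_in[OF assms(2)] assms(2) by (auto simp: next_action_def)
  next
    case False
    then have "q < states M" using assms(1) by simp
    then have "fst (transition M q s) \<le> states M \<and> snd (transition M q s) \<in> nlists (tapes M) ({..<symbols M} \<times> {-1, 0, 1})"
      using TM assms(2) unfolding turing_machine_def by blast
    then show ?thesis using False nlistsE_nth_in by (auto simp: next_action_def)
  qed
  then show "fst (next_action M q s) \<le> states M"
    "i < tapes M \<Longrightarrow> fst (snd (next_action M q s) ! i) < symbols M"
    "i < tapes M \<Longrightarrow> snd (snd (next_action M q s) ! i) \<in> {-1, 0, 1}" by (auto simp: mem_Times_iff)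
qed

lemma valid_step: "valid c \<Longrightarrow> valid (step M c)"
proof -
  assume v: "valid c"
  obtain q t h where c: "c = (q, t, h)" by (metis prod_cases3)
  have s: "scanned M (q, t, h) \<in> nlists (tapes M) {..<symbols M}" using scanned_valid v c by simp
  have q: "q \<le> states M" using v c by (simp add: valid_def)
  show ?thesis using v next_action_valid[OF q s] unfolding c step_next_action by (auto simp: valid_def)
qed

lemma valid_conf: "valid (conf w t)"
proof (induction t)
  case 0
  show ?case using symbols_ge by (auto simp: conf_def initial_def valid_def bit_symbol_def)
next
  case (Suc t)
  then show ?case using valid_step by (simp add: conf_def)
qed

lemma conf_Suc: "conf w (Suc t) = step M (conf w t)"
  by (simp add: conf_def)

lemma step_halted: "fst c = states M \<Longrightarrow> step M c = c"
  by (cases c) (simp add: step_def)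

lemma halted:
  assumes "fst (conf w m) = states M" "m \<le> t" shows "conf w t = conf w m"
  using assms(2)
proof (induction t rule: dec_induct)
  case (step t)
  then show ?case using assms(1) step_halted by (simp add: conf_Suc)
qed simp

section \<open>From computations to tilings and back\<close>

definition real_tile :: "bool list \<Rightarrow> nat \<Rightarrow> nat \<Rightarrow> nat \<Rightarrow> tile" where
  "real_tile w Z t j = (case conf w t of (q, tp, h) \<Rightarrow>
     (q, scanned M (q, tp, h), map (\<lambda>i. tp i (int j - int Z)) [0..<tapes M], map (\<lambda>i. h i = int j - int Z) [0..<tapes M]))"

lemma real_tile_in: "real_tile w Z t j \<in> tiles"
  using valid_conf[of w t] scanned_valid[OF valid_conf[of w t]]
  by (auto simp: real_tile_def tiles_def valid_def split: prod.splits intro!: nlistsI)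

lemma real_local_step:
  "local_step (real_tile w Z t j) (real_tile w Z t (j + 1)) (real_tile w Z t (j + 2)) (real_tile w Z (t + 1) (j + 1))"
proof -
  obtain q tp h where c: "conf w t = (q, tp, h)" by (metis prod_cases3)
  have v: "valid (q, tp, h)" using valid_conf[of w t] c by simp
  let ?s = "scanned M (q, tp, h)"
  have q: "q \<le> states M" using v by (simp add: valid_def)
  note na = next_action_valid[OF q scanned_valid[OF v]]
  have c': "conf w (t + 1) = step M (q, tp, h)" using c by (simp add: conf_def)
  have s: "?s ! i = tp i (h i)" if "i < tapes M" for i using that by (simp add: scanned_def)
  have dir: "(h i + d = int j + 1 - int Z) = (if d = 1 then h i = int j - int Z
      else if d = -1 then h i = int j + 2 - int Z else h i = int j + 1 - int Z)"
    if "d \<in> {-1, 0, 1}" for d i using that by auto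
  have cell: "tp i (1 + int j - int Z) = tp i (h i)" if "int Z + h i = 1 + int j" for i
  proof -
    have "1 + int j - int Z = h i" using that by simp
    then show ?thesis by simp
  qed
  show ?thesis
    unfolding local_step_def real_tile_def c c' step_next_action
    using s dir[OF na(3)] cell by (auto simp: split_beta Let_def algebra_simps)
qed

lemma head_bound: "conf w t = (q, tp, h) \<Longrightarrow> i < tapes M \<Longrightarrow> \<bar>h i\<bar> \<le> int t"
proof (induction t arbitrary: q tp h)
  case 0
  then show ?case by (auto simp: conf_def initial_def)
next
  case (Suc t)
  obtain q1 tp1 h1 where c: "conf w t = (q1, tp1, h1)" by (metis prod_cases3)
  have v: "valid (q1, tp1, h1)" using valid_conf[of w t] c by simp
  then have "q1 \<le> states M" by (simp add: valid_def)
  note na = next_action_valid(3)[OF this scanned_valid[OF v] Suc.prems(2)]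
  have "h i = h1 i + snd (snd (next_action M q1 (scanned M (q1, tp1, h1))) ! i)"
    using Suc.prems by (auto simp: conf_Suc c step_next_action)
  then show ?case using Suc.IH[OF c Suc.prems(2)] na by auto
qed

text \<open>The scanned symbols of \<open>D\<close> are absent from the conclusion: they concern the
  next step and are recovered from the heads in their own row.\<close>

lemma local_step_deterministic:
  assumes "local_step A B C D" "local_step A' B' C' D'" and "D \<in> tiles" "D' \<in> tiles"
    and "tile_state B = tile_state B'" "tile_scanned B = tile_scanned B'" "tile_cells B = tile_cells B'"
    and "tile_heads A = tile_heads A'" "tile_heads B = tile_heads B'" "tile_heads C = tile_heads C'"
  shows "tile_state D = tile_state D' \<and> tile_cells D = tile_cells D' \<and> tile_heads D = tile_heads D'"
proof -
  have len: "length (tile_cells D) = tapes M" "length (tile_cells D') = tapes M" "length (tile_heads D) = tapes M" "length (tile_heads D') = tapes M"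
    using assms(3,4) by (auto simp: tiles_def)
  have "\<forall>i<tapes M. tile_cells D ! i = tile_cells D' ! i \<and> tile_heads D ! i = tile_heads D' ! i"
    using assms(1,2,5-) unfolding local_step_def by (auto simp: split_beta Let_def)
  then have "tile_cells D = tile_cells D'" "tile_heads D = tile_heads D'"
    using len by (auto intro!: nth_equalityI)
  moreover have "tile_state D = tile_state D'"
    using assms(1,2,5,6) unfolding local_step_def by (auto simp: split_beta Let_def)
  ultimately show ?thesis by blast
qed

lemma placements_mem:
  "j < Z \<Longrightarrow> (0, 0, j) \<in> set (placements x P T Z)"
  "(1, 0, Z) \<in> set (placements x P T Z)"
  "i < length (pair_string x []) \<Longrightarrow> (7 + of_bool (pair_string x [] ! i), 0, Z + i) \<in> set (placements x P T Z)"
  "i < P \<Longrightarrow> (2, 0, Z + 2 * length x + 1 + i) \<in> set (placements x P T Z)"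
  "i < Z \<Longrightarrow> (3, 0, Z + 2 * length x + 1 + P + i) \<in> set (placements x P T Z)"
  "i < Z \<Longrightarrow> (4, 0, Suc Z + i) \<in> set (placements x P T Z)"
  "(6, T, Z) \<in> set (placements x P T Z)"
  by (simp_all add: placements_def)

lemma placements_mem_step:
  assumes "t < T" "j < 2 * Z" shows "(5, t, j) \<in> set (placements x P T Z)"
proof (cases "j < Z")
  case True
  then have "(5, t, j) \<in> (\<lambda>j. (5, t, j)) ` {0..<Z}" by simp
  then show ?thesis using assms(1) unfolding placements_def by auto
next
  case False
  then have "(5, t, j) \<in> (\<lambda>i. (5, t, Z + i)) ` {0..<Z}" using assms(2) by (auto intro!: image_eqI[of _ _ "j - Z"])
  then show ?thesis using assms(1) unfolding placements_def by auto
qed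

lemma tilingD:
  assumes "tiling \<tau> x P T Z" "(r, t, j) \<in> set (placements x P T Z)"
  shows "tile_condition r (\<tau> t j) (\<tau> t (j + 1)) (\<tau> t (j + 2)) (\<tau> (t + 1) (j + 1))"
  using assms unfolding tiling_def by blast

text \<open>In a tiling, row \<open>t\<close> is determined only within distance \<open>Z - t\<close> of the origin, as the
  track of the heads is not constrained at the border of the grid.\<close>

lemma tiling_sound:
  assumes tau: "tiling \<tau> x P T Z" and Z: "2 * T + 2 \<le> Z" and T: "1 \<le> T"
    and row0: "\<And>j. j \<le> 2 * Z \<Longrightarrow> tile_cells (\<tau> 0 j) = tile_cells (real_tile w Z 0 j)"
  shows "t \<le> T \<Longrightarrow> t \<le> j \<Longrightarrow> j + t \<le> 2 * Z \<Longrightarrow>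
     tile_state (\<tau> t j) = tile_state (real_tile w Z t j) \<and> tile_cells (\<tau> t j) = tile_cells (real_tile w Z t j) \<and>
     tile_heads (\<tau> t j) = tile_heads (real_tile w Z t j)"
proof -
  have tin: "\<tau> t j \<in> tiles" for t j using tau by (simp add: tiling_def)
  have ls: "local_step (\<tau> t j) (\<tau> t (j + 1)) (\<tau> t (j + 2)) (\<tau> (t + 1) (j + 1))" if "t < T" "j < 2 * Z" for t j
    using tilingD[OF tau placements_mem_step[OF that]] by (simp add: tile_condition_def)
  \<comment> \<open>Only rows before \<open>T\<close> carry the step condition. With
    \<open>1 \<le> T\<close>, row 0 is among them, which spreads the initial state from column
    \<open>Z\<close> over the row.\<close>
  have hor: "tile_state (\<tau> t j) = tile_state (\<tau> t Z) \<and> tile_scanned (\<tau> t j) = tile_scanned (\<tau> t Z)"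
    if t: "t < T" and j: "j \<le> 2 * Z" for t j
  proof -
    have "j \<le> 2 * Z \<Longrightarrow> tile_state (\<tau> t j) = tile_state (\<tau> t 0) \<and> tile_scanned (\<tau> t j) = tile_scanned (\<tau> t 0)" for j
    proof (induction j)
      case (Suc j)
      then have j: "j < 2 * Z" by simp
      note l = ls[OF t j, unfolded local_step_def]
      have "tile_state (\<tau> t j) = tile_state (\<tau> t 0) \<and> tile_scanned (\<tau> t j) = tile_scanned (\<tau> t 0)"
        by (rule Suc.IH) (use j in simp)
      then show ?case using conjunct1[OF l] conjunct1[OF conjunct2[OF conjunct2[OF l]]] by simp
    qed simp
    from this[OF j] this[of Z] show ?thesis by simp
  qed
  show "t \<le> T \<Longrightarrow> t \<le> j \<Longrightarrow> j + t \<le> 2 * Z \<Longrightarrow>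
     tile_state (\<tau> t j) = tile_state (real_tile w Z t j) \<and> tile_cells (\<tau> t j) = tile_cells (real_tile w Z t j) \<and>
     tile_heads (\<tau> t j) = tile_heads (real_tile w Z t j)"
  proof (induction t arbitrary: j)
    case 0
    then have j: "j \<le> 2 * Z" by simp
    have c: "tile_condition 1 (\<tau> 0 Z) (\<tau> 0 (Z + 1)) (\<tau> 0 (Z + 2)) (\<tau> (0 + 1) (Z + 1))"
      by (rule tilingD[OF tau]) (rule placements_mem)
    have st: "tile_state (\<tau> 0 j) = 0" using c hor[of 0 j] T j by (simp add: tile_condition_def)
    have hd: "tile_heads (\<tau> 0 j) = map (\<lambda>_. j = Z) [0..<tapes M]"
    proof -
      consider "j < Z" | "j = Z" | i where "j = Suc Z + i" "i < Z"
      proof (cases "j \<le> Z")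
        case True
        then show thesis using that(1,2) by linarith
      next
        case False
        then show thesis using that(3)[of "j - Suc Z"] j by linarith
      qed
      then show ?thesis
      proof cases
        case 1
        then show ?thesis using tilingD[OF tau placements_mem(1)[OF 1]]
          by (simp add: tile_condition_def map_replicate_const)
      next
        case 2
        then show ?thesis using c by (simp add: tile_condition_def map_replicate_const)
      next
        case 3
        then show ?thesis using tilingD[OF tau placements_mem(6)[OF 3(2)]]
          by (simp add: tile_condition_def map_replicate_const)
      qed
    qed
    show ?case using st hd row0[OF j] by (auto simp: real_tile_def conf_def initial_def)
  next
    case (Suc t)
    have tT: "t < T" using Suc.prems by simp
    obtain q tp h where c: "conf w t = (q, tp, h)" by (metis prod_cases3)
    have sc: "tile_scanned (\<tau> t j) = scanned M (q, tp, h)" if "j \<le> 2 * Z" for j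
    proof (rule nth_equalityI)
      show l: "length (tile_scanned (\<tau> t j)) = length (scanned M (q, tp, h))"
        using tin[of t j] by (auto simp: tiles_def scanned_def)
      fix i assume "i < length (tile_scanned (\<tau> t j))"
      then have i: "i < tapes M" using l by (simp add: scanned_def)
      define p where "p = nat (h i + int Z)"
      have hb: "\<bar>h i\<bar> \<le> int t" by (rule head_bound[OF c i])
      then have p: "int p = h i + int Z" using Suc.prems(1) Z by (simp add: p_def)
      \<comment> \<open>A head is at most \<open>t\<close> cells away from the origin, so its column
        lies in the part of the row that is already determined; this is where about
        \<open>2 * T\<close> columns are needed on either side of the origin.\<close>
      then have pr: "t \<le> p" "p + t \<le> 2 * Z" "1 \<le> p" using hb Suc.prems(1) Z by linarith+
      have IH: "tile_cells (\<tau> t p) = tile_cells (real_tile w Z t p)" "tile_heads (\<tau> t p) = tile_heads (real_tile w Z t p)"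
        using Suc.IH[of p] pr tT by auto
      have "tile_heads (\<tau> t p) ! i" using IH(2) i p by (simp add: real_tile_def c)
      moreover have "tile_cells (\<tau> t p) ! i = tp i (h i)" using IH(1) i p by (simp add: real_tile_def c)
      moreover have "local_step (\<tau> t (p - 1)) (\<tau> t p) (\<tau> t (p + 1)) (\<tau> (t + 1) p)"
        using ls[OF tT, of "p - 1"] pr by (simp add: numeral_2_eq_2)
      ultimately have "tile_scanned (\<tau> t p) ! i = tp i (h i)" using i by (simp add: local_step_def)
      moreover have "tile_scanned (\<tau> t p) = tile_scanned (\<tau> t j)" using hor[OF tT, of p] hor[OF tT that] pr by simp
      ultimately show "tile_scanned (\<tau> t j) ! i = scanned M (q, tp, h) ! i" using i by (simp add: scanned_def)
    qed
    obtain j' where j': "j = j' + 1" using Suc.prems(2) by (cases j) auto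
    have 1: "local_step (\<tau> t j') (\<tau> t (j' + 1)) (\<tau> t (j' + 2)) (\<tau> (t + 1) (j' + 1))"
      by (rule ls[OF tT]) (use Suc.prems j' in simp)
    have rs: "tile_scanned (real_tile w Z t (j' + 1)) = scanned M (q, tp, h)" by (simp add: real_tile_def c)
    have "tile_state (\<tau> (t + 1) (j' + 1)) = tile_state (real_tile w Z (t + 1) (j' + 1)) \<and>
      tile_cells (\<tau> (t + 1) (j' + 1)) = tile_cells (real_tile w Z (t + 1) (j' + 1)) \<and>
      tile_heads (\<tau> (t + 1) (j' + 1)) = tile_heads (real_tile w Z (t + 1) (j' + 1))"
      by (rule local_step_deterministic[OF 1 real_local_step])
        (use tin real_tile_in Suc.IH[of j'] Suc.IH[of "j' + 1"] Suc.IH[of "j' + 2"] Suc.prems j' sc[of "j' + 1"] rs in auto)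
    then show ?case by (simp add: j')
  qed
qed

lemma real_tiling:
  assumes w: "w = pair_string x y" and y: "length y \<le> P" and halt: "halts_with M (conf w m) [True]" and m: "m \<le> T"
  shows "tiling (real_tile w Z) x P T Z"
  unfolding tiling_def
proof (intro conjI allI ballI)
  show "real_tile w Z t j \<in> tiles" for t j by (rule real_tile_in)
  have w': "w = pair_string x [] @ y" by (simp add: w pair_string_def)
  have lx: "length (pair_string x []) = 2 * length x + 1"
    by (simp add: pair_string_def length_concat comp_def sum_list_triv)
  have row0: "tile_cells (real_tile w Z 0 (Z + i)) = first_cell (if i < length w then bit_symbol (w ! i) else 0)" for i
  proof -
    have "tile_cells (real_tile w Z 0 (Z + i)) = map (\<lambda>j. if j = 0 \<and> i < length w then bit_symbol (w ! i) else 0) [0..<tapes M]"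
      by (auto simp: real_tile_def conf_def initial_def)
    also have "\<dots> = first_cell (if i < length w then bit_symbol (w ! i) else 0)"
      by (rule nth_equalityI) (use tapes_pos in \<open>auto simp: first_cell_def nth_Cons'\<close>)
    finally show ?thesis .
  qed
  have cond: "tile_condition r (real_tile w Z t j) (real_tile w Z t (j + 1)) (real_tile w Z t (j + 2)) (real_tile w Z (t + 1) (j + 1))"
    if "(r, t, j) \<in> set (placements x P T Z)" for r t j
  proof -
    from that consider (l) "r = 0" "t = 0" "j < Z" | (h) "r = 1" "t = 0" "j = Z"
      | (w) i where "r = 7 + of_bool (pair_string x [] ! i)" "t = 0" "j = Z + i" "i < length (pair_string x [])"
      | (f) i where "r = 2" "t = 0" "j = Z + (2 * length x + 1 + i)" "i < P"
      | (b) i where "r = 3" "t = 0" "j = Z + (2 * length x + 1 + P + i)"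
      | (n) i where "r = 4" "t = 0" "j = Suc Z + i" | (s) "r = 5" | (a) "r = 6" "t = T" "j = Z"
      unfolding placements_def by auto
    then show ?thesis
    proof cases
      case l
      have "tile_cells (real_tile w Z 0 j) = replicate (tapes M) 0 \<and> tile_heads (real_tile w Z 0 j) = replicate (tapes M) False"
        using l by (auto simp: real_tile_def conf_def initial_def map_replicate_const intro!: nth_equalityI)
      then show ?thesis using l by (simp add: tile_condition_def)
    next
      case h
      then show ?thesis
        by (auto simp: tile_condition_def real_tile_def conf_def initial_def map_replicate_const intro!: nth_equalityI)
    next
      case (w i)
      have "w ! i = pair_string x [] ! i" "i < length w" using w(4) by (simp_all add: w' nth_append)
      then have "tile_cells (real_tile w Z 0 (Z + i)) = first_cell (bit_symbol (pair_string x [] ! i))" using row0[of i] by simp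
      then show ?thesis using w by (cases "pair_string x [] ! i") (auto simp: tile_condition_def)
    next
      case (f i)
      let ?i = "2 * length x + 1 + i"
      let ?a = "if ?i < length w then bit_symbol (w ! ?i) else 0"
      have "?a < 3" by (simp add: bit_symbol_def)
      moreover have "tile_cells (real_tile w Z 0 (Z + Suc ?i)) ! 0 = 0" if "?a = 0"
      proof -
        have "\<not> ?i < length w" using that by (auto simp: bit_symbol_def split: if_splits)
        then show ?thesis by (simp only: row0) (simp add: first_cell_def)
      qed
      ultimately show ?thesis using f row0[of ?i] by (auto simp: tile_condition_def intro!: exI[of _ ?a])
    next
      case (b i)
      have "\<not> 2 * length x + 1 + P + i < length w" using y lx by (simp add: w')
      then have "tile_cells (real_tile w Z 0 j) = first_cell 0" unfolding b(3) row0 by simp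
      moreover have "first_cell 0 = replicate (tapes M) 0" using tapes_pos by (cases "tapes M") (auto simp: first_cell_def)
      ultimately show ?thesis using b by (simp add: tile_condition_def)
    next
      case (n i)
      have "tile_heads (real_tile w Z 0 j) = replicate (tapes M) False"
        using n by (auto simp: real_tile_def conf_def initial_def map_replicate_const intro!: nth_equalityI)
      then show ?thesis using n by (simp add: tile_condition_def)
    next
      case s
      then show ?thesis using real_local_step by (simp add: tile_condition_def)
    next
      case a
      obtain q tp h where c: "conf w m = (q, tp, h)" by (metis prod_cases3)
      have hw: "q = states M" "tp (tapes M - 1) 0 = 2" "tp (tapes M - 1) 1 = 0"
        using halt by (auto simp: halts_with_def c bit_symbol_def)
      have "conf w T = (q, tp, h)" using halted[OF _ m] hw(1) c by simp
      then show ?thesis using a hw tapes_pos by (simp add: tile_condition_def real_tile_def)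
    qed
  qed
  show "case p of (r, t, j) \<Rightarrow> tile_condition r (real_tile w Z t j) (real_tile w Z t (j + 1)) (real_tile w Z t (j + 2))
      (real_tile w Z (t + 1) (j + 1))" if "p \<in> set (placements x P T Z)" for p
    using that cond by (cases p) auto
qed

text \<open>The certificate consists of the letters before the first blank in the free columns.
  Condition 2 passes blanks on to the right, so no further letter is on the tape.\<close>

lemma tiling_certificate:
  assumes tau: "tiling \<tau> x P T Z"
  shows "\<exists>y. length y \<le> P \<and> (\<forall>j \<le> 2 * Z. tile_cells (\<tau> 0 j) = tile_cells (real_tile (pair_string x y) Z 0 j))"
proof -
  let ?c = "2 * length x + 1"
  have lx: "length (pair_string x []) = ?c"
    by (simp add: pair_string_def length_concat comp_def sum_list_triv)
  have len: "length (tile_cells (\<tau> t j)) = tapes M" for t j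
  proof -
    have "\<tau> t j \<in> tiles" using tau unfolding tiling_def by blast
    then show ?thesis by (auto simp: tiles_def)
  qed
  have free: "\<exists>a<3. tile_cells (\<tau> 0 (Z + ?c + i)) = first_cell a \<and> (a = 0 \<longrightarrow> tile_cells (\<tau> 0 (Z + ?c + Suc i)) ! 0 = 0)"
    if "i < P" for i
    using tilingD[OF tau placements_mem(4)[OF that]] by (simp add: tile_condition_def)
  have blank: "tile_cells (\<tau> 0 (Z + ?c + P + i)) = replicate (tapes M) 0" if "i < Z" for i
    using tilingD[OF tau placements_mem(5)[OF that]] by (simp add: tile_condition_def)
  define a where "a i = tile_cells (\<tau> 0 (Z + ?c + i)) ! 0" for i
  \<comment> \<open>The alternative \<open>i = P\<close> makes the minimum exist when all free
    columns carry letters.\<close>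
  define l where "l = (LEAST i. i = P \<or> a i = 0)"
  have l: "l = P \<or> a l = 0" unfolding l_def by (rule LeastI[of _ P]) simp
  have lP: "l \<le> P" unfolding l_def by (rule Least_le) simp
  have before: "a i \<noteq> 0" if "i < l" for i using that not_less_Least[of i "\<lambda>i. i = P \<or> a i = 0"] unfolding l_def by blast
  have after: "l \<le> i \<Longrightarrow> i < P \<Longrightarrow> a i = 0" for i
  proof (induction i rule: dec_induct)
    case base
    then show ?case using l by simp
  next
    case (step i)
    then have "a i = 0" by simp
    moreover obtain b where b: "tile_cells (\<tau> 0 (Z + ?c + i)) = first_cell b" "b = 0 \<longrightarrow> tile_cells (\<tau> 0 (Z + ?c + Suc i)) ! 0 = 0"
      using free[of i] step.prems by auto
    ultimately show ?case by (simp add: a_def first_cell_def)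
  qed
  define y where "y = map (\<lambda>i. a i = 2) [0..<l]"
  have ly: "length y = l" by (simp add: y_def)
  let ?w = "pair_string x y"
  have w': "?w = pair_string x [] @ y" by (simp add: pair_string_def)
  have real: "tile_cells (real_tile ?w Z 0 (Z + i)) = first_cell (if i < length ?w then bit_symbol (?w ! i) else 0)" for i
  proof -
    have "tile_cells (real_tile ?w Z 0 (Z + i)) = map (\<lambda>j. if j = 0 \<and> i < length ?w then bit_symbol (?w ! i) else 0) [0..<tapes M]"
      by (auto simp: real_tile_def conf_def initial_def)
    also have "\<dots> = first_cell (if i < length ?w then bit_symbol (?w ! i) else 0)"
      by (rule nth_equalityI) (use tapes_pos in \<open>auto simp: first_cell_def nth_Cons'\<close>)
    finally show ?thesis .
  qed
  have "tile_cells (\<tau> 0 j) = tile_cells (real_tile ?w Z 0 j)" if j: "j \<le> 2 * Z" for j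
  proof -
    consider (l) "j < Z" | (w) i where "j = Z + i" "i < ?c" | (f) i where "j = Z + ?c + i" "i < P"
      | (b) i where "j = Z + ?c + P + i" "i < Z"
    proof -
      assume h: "j < Z \<Longrightarrow> thesis" "\<And>i. j = Z + i \<Longrightarrow> i < ?c \<Longrightarrow> thesis" "\<And>i. j = Z + ?c + i \<Longrightarrow> i < P \<Longrightarrow> thesis"
        "\<And>i. j = Z + ?c + P + i \<Longrightarrow> i < Z \<Longrightarrow> thesis"
      show thesis
        using h(1) h(2)[of "j - Z"] h(3)[of "j - Z - ?c"] h(4)[of "j - Z - ?c - P"] j by linarith
    qed
    then show ?thesis
    proof cases
      case l
      have "tile_cells (\<tau> 0 j) = replicate (tapes M) 0"
        using tilingD[OF tau placements_mem(1)[OF l]] by (simp add: tile_condition_def)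
      moreover have "tile_cells (real_tile ?w Z 0 j) = replicate (tapes M) 0"
        using l by (auto simp: real_tile_def conf_def initial_def map_replicate_const intro!: nth_equalityI)
      ultimately show ?thesis by simp
    next
      case (w i)
      have "tile_cells (\<tau> 0 (Z + i)) = first_cell (bit_symbol (pair_string x [] ! i))"
        using tilingD[OF tau placements_mem(3)[of i]] w lx
        by (cases "pair_string x [] ! i") (auto simp: tile_condition_def)
      moreover have "i < length ?w" "?w ! i = pair_string x [] ! i" using w lx by (simp_all add: w' nth_append)
      ultimately show ?thesis using real[of i] w by simp
    next
      case (f i)
      obtain b where b: "b < 3" "tile_cells (\<tau> 0 j) = first_cell b" using free[OF f(2)] f(1) by auto
      then have ai: "a i = b" by (simp add: a_def f first_cell_def)
      have "real_tile ?w Z 0 j = real_tile ?w Z 0 (Z + (?c + i))" by (simp add: f add.assoc)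
      moreover have "(if ?c + i < length ?w then bit_symbol (?w ! (?c + i)) else 0) = b"
      proof (cases "i < l")
        case True
        then have "b = 1 \<or> b = 2" using before[OF True] ai b(1) by auto
        moreover have "y ! i = (b = 2)" "length y = l" using True ai by (simp_all add: y_def)
        ultimately show ?thesis using True lx by (auto simp: w' nth_append bit_symbol_def)
      next
        case False
        then show ?thesis using ly after[of i] f(2) ai lx by (simp add: w')
      qed
      ultimately show ?thesis using real[of "?c + i"] b(2) by simp
    next
      case (b i)
      have "real_tile ?w Z 0 j = real_tile ?w Z 0 (Z + (?c + P + i))" by (simp add: b add.assoc)
      moreover have "\<not> ?c + P + i < length ?w" using lx lP ly by (simp add: w')
      moreover have "first_cell 0 = replicate (tapes M) 0" using tapes_pos by (cases "tapes M") (auto simp: first_cell_def)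
      ultimately show ?thesis using real[of "?c + P + i"] blank[OF b(2)] b(1) by simp
    qed
  qed
  then show ?thesis using lP by (intro exI[of _ y]) (auto simp: y_def)
qed

text \<open>The machine has halted by time \<open>T\<close> on every certificate of the allowed
  length, so row \<open>T\<close> shows its output, and a symbol 2 followed by a blank can only be
  \<open>[True]\<close>.\<close>

lemma tiling_accepts:
  assumes tau: "tiling \<tau> x P T Z" and Z: "2 * T + 2 \<le> Z" and T: "1 \<le> T"
    and halts: "\<And>y. length y \<le> P \<Longrightarrow> \<exists>m\<le>T. halts_with M (conf (pair_string x y) m) (f (pair_string x y))"
  shows "\<exists>y. length y \<le> P \<and> f (pair_string x y) = [True]"
proof -
  obtain y where y: "length y \<le> P" "\<And>j. j \<le> 2 * Z \<Longrightarrow> tile_cells (\<tau> 0 j) = tile_cells (real_tile (pair_string x y) Z 0 j)"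
    using tiling_certificate[OF tau] by blast
  let ?w = "pair_string x y"
  obtain m where m: "m \<le> T" "halts_with M (conf ?w m) (f ?w)" using halts[OF y(1)] by blast
  obtain q tp h where c: "conf ?w m = (q, tp, h)" by (metis prod_cases3)
  have q: "q = states M" using m(2) by (simp add: halts_with_def c)
  then have cT: "conf ?w T = (q, tp, h)" using halted[of ?w m T] m(1) c by simp
  have acc: "tile_cells (\<tau> T Z) ! (tapes M - 1) = 2" "tile_cells (\<tau> T (Z + 1)) ! (tapes M - 1) = 0"
    using tilingD[OF tau placements_mem(7)] by (simp_all add: tile_condition_def)
  have "tile_cells (\<tau> T Z) = tile_cells (real_tile ?w Z T Z)"
    "tile_cells (\<tau> T (Z + 1)) = tile_cells (real_tile ?w Z T (Z + 1))"
    using tiling_sound[OF tau Z T y(2), of T Z] tiling_sound[OF tau Z T y(2), of T "Z + 1"] Z by simp_all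
  then have tp: "tp (tapes M - 1) 0 = 2" "tp (tapes M - 1) 1 = 0" using acc tapes_pos by (simp_all add: real_tile_def cT)
  have out: "\<forall>i<length (f ?w). tp (tapes M - 1) (int i) = bit_symbol (f ?w ! i)" "tp (tapes M - 1) (int (length (f ?w))) = 0"
    using m(2) by (simp_all add: halts_with_def c)
  have "f ?w = [True]"
  proof (cases "f ?w")
    case Nil
    then show ?thesis using out(2) tp by simp
  next
    case (Cons b bs)
    have "bit_symbol b = 2" using out(1)[rule_format, of 0] tp Cons by simp
    then have b by (cases b) (auto simp: bit_symbol_def)
    moreover have "bs = []"
    proof (cases bs)
      case (Cons b' bs')
      then have "bit_symbol b' = 0" using out(1)[rule_format, of 1] tp \<open>f ?w = b # bs\<close> by simp
      then show ?thesis by (simp add: bit_symbol_def split: if_splits)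
    qed
    ultimately show ?thesis using Cons by simp
  qed
  then show ?thesis using y(1) by blast
qed

end

theorem NP_tiling:
  assumes "L \<in> NP"
  shows "\<exists>(G :: tile set) B pP pT pZ. finite G \<and> G \<noteq> {} \<and> (\<forall>r. B r \<subseteq> nlists 4 G) \<and>
    (\<forall>x. x \<in> L \<longleftrightarrow> (\<exists>\<tau>. (\<forall>t j. \<tau> t j \<in> G) \<and>
      (\<forall>(r, t, j) \<in> set (placements x (poly pP (length x)) (poly pT (length x)) (poly pZ (length x))).
        [\<tau> t j, \<tau> t (j + 1), \<tau> t (j + 2), \<tau> (t + 1) (j + 1)] \<in> B r)))"
proof -
  obtain f pP where f: "polytime f"
    and L: "\<And>x. x \<in> L \<longleftrightarrow> (\<exists>y. length y \<le> poly pP (length x) \<and> f (pair_string x y) = [True])"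
    using assms unfolding NP_def by blast
  obtain M p where M: "turing_machine M" and p: "\<And>w. \<exists>m \<le> poly p (length w). halts_with M ((step M ^^ m) (initial w)) (f w)"
    using f unfolding polytime_def by blast
  \<comment> \<open>\<open>[:1, 2:] + pP\<close> bounds the length of
    \<open>pair_string x y\<close>. The additional 1 and the form of \<open>pZ\<close> provide the
    hypotheses \<open>1 \<le> T\<close> and \<open>2 * T + 2 \<le> Z\<close> of
    \<open>tiling_accepts\<close>.\<close>
  define pT where "pT = pcompose p ([:1, 2:] + pP) + [:1:]"
  define pZ where "pZ = [:2:] * pT + [:2:]"
  have halts: "\<exists>m\<le>poly pT (length x). halts_with M (conf M (pair_string x y) m) (f (pair_string x y))"
    if "length y \<le> poly pP (length x)" for x y
  proof -
    obtain m where m: "m \<le> poly p (length (pair_string x y))" "halts_with M (conf M (pair_string x y) m) (f (pair_string x y))"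
      using p conf_def[OF M] by metis
    have "length (pair_string x y) = 2 * length x + 1 + length y"
      by (simp add: pair_string_def length_concat comp_def sum_list_triv)
    then have "poly p (length (pair_string x y)) \<le> poly p (1 + 2 * length x + poly pP (length x))"
      using that by (intro poly_mono_nat) simp
    also have "\<dots> \<le> poly pT (length x)" by (simp add: pT_def poly_pcompose mult_2 mult_2_right add.assoc)
    finally show ?thesis using m by (intro exI[of _ m]) auto
  qed
  have Z: "2 * poly pT n + 2 \<le> poly pZ n" and T: "1 \<le> poly pT n" for n by (simp_all add: pZ_def pT_def)
  have "x \<in> L \<longleftrightarrow> (\<exists>\<tau>. tiling M \<tau> x (poly pP (length x)) (poly pT (length x)) (poly pZ (length x)))" for x
  proof
    assume "x \<in> L"
    then obtain y where y: "length y \<le> poly pP (length x)" "f (pair_string x y) = [True]" using L by blast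
    then obtain m where "m \<le> poly pT (length x)" "halts_with M (conf M (pair_string x y) m) [True]"
      using halts by metis
    from real_tiling[OF M refl y(1) this(2,1)] show "\<exists>\<tau>. tiling M \<tau> x (poly pP (length x)) (poly pT (length x)) (poly pZ (length x))"
      by blast
  next
    assume "\<exists>\<tau>. tiling M \<tau> x (poly pP (length x)) (poly pT (length x)) (poly pZ (length x))"
    then show "x \<in> L" using tiling_accepts[OF M _ Z T halts] L by blast
  qed
  moreover have mem: "[A, B, C, D] \<in> tile_relation M r \<longleftrightarrow> A \<in> tiles M \<and> B \<in> tiles M \<and> C \<in> tiles M \<and> D \<in> tiles M \<and> tile_condition M r A B C D"
    for A B C D r unfolding tile_relation_def[OF M] by blast
  moreover have "tiling M \<tau> x P T Z \<longleftrightarrow> (\<forall>t j. \<tau> t j \<in> tiles M) \<and>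
      (\<forall>(r, t, j) \<in> set (placements x P T Z). [\<tau> t j, \<tau> t (j + 1), \<tau> t (j + 2), \<tau> (t + 1) (j + 1)] \<in> tile_relation M r)"
    for \<tau> x P T Z
    unfolding tiling_def[OF M] mem by blast
  moreover have "finite (tiles M)" by (rule finite_tiles[OF M])
  moreover have "tiles M \<noteq> {}" using real_tile_in[OF M, of "[]" 0 0 0] by auto
  moreover have "tile_relation M r \<subseteq> nlists 4 (tiles M)" for r
    by (auto simp: tile_relation_def[OF M] intro!: nlistsI)
  ultimately show ?thesis
    by (intro exI[of _ "tiles M"] exI[of _ "tile_relation M"] exI[of _ pP] exI[of _ pT] exI[of _ pZ]) simp
qed

section \<open>Hardness\<close>

text \<open>In unary, the offset of a cell inside a template is added by writing it next to the hole
  for the row or column. The last run of \<open>True\<close> is non-empty, so that the string is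
  canonical and thus the binary form of its number.\<close>

definition cell_var :: "nat \<Rightarrow> nat \<Rightarrow> nat \<Rightarrow> nat" where
  "cell_var t j a = number (replicate t True @ False # replicate j True @ False # replicate (Suc a) True)"

lemma binary_cell_var:
  "binary (cell_var t j a) = replicate t True @ False # replicate j True @ False # replicate (Suc a) True"
  unfolding cell_var_def by (rule binary_number) (simp add: canonical_def)

lemma replicate_True_eq:
  "replicate m True @ False # xs = replicate m' True @ False # ys \<Longrightarrow> m = m' \<and> xs = ys"
proof (induction m arbitrary: m')
  case 0
  then show ?case by (cases m') auto
next
  case (Suc m)
  then show ?case by (cases m') auto
qed

lemma cell_var_inject:
  assumes "cell_var t j a = cell_var t' j' a'" shows "t = t' \<and> j = j' \<and> a = a'"
proof -
  have "binary (cell_var t j a) = binary (cell_var t' j' a')" using assms by simp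
  note this[unfolded binary_cell_var]
  from replicate_True_eq[OF this] have t: "t = t'"
    "replicate j True @ False # replicate (Suc a) True = replicate j' True @ False # replicate (Suc a') True" by blast+
  from replicate_True_eq[OF t(2)] have j: "j = j'" "replicate (Suc a) True = replicate (Suc a') True" by blast+
  have "length (replicate (Suc a) True) = length (replicate (Suc a') True)" by (simp only: j(2))
  then show ?thesis using t j by simp
qed

lemma tokens_string_simps [simp]:
  "tokens_string t j [] = []" "tokens_string t j (x # xs) = token_string t j x @ tokens_string t j xs"
  "tokens_string t j (xs @ ys) = tokens_string t j xs @ tokens_string t j ys"
  "tokens_string t j (map Lit bs) = bs"
  by (induction bs) (auto simp: tokens_string_def)

lemma tokens_string_concat:
  "tokens_string t j (concat (map f xs)) = concat (map (\<lambda>x. tokens_string t j (f x)) xs)"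
  by (induction xs) auto

fun var_tokens :: "nat \<times> nat \<times> nat \<Rightarrow> token list" where
  "var_tokens (r, d, a) =
     Row_Unary # map Lit (bits (replicate r True @ [False])) @
     Col_Unary # map Lit (bits (replicate d True @ False # replicate (Suc a) True) @ [False])"

lemma tokens_string_var:
  "tokens_string t j (var_tokens (r, d, a)) = encode_var (cell_var (t + r) (j + d) a)"
  unfolding encode_var_bits binary_cell_var
  by (simp add: replicate_add del: map_append map_replicate)

definition item_tokens :: "(nat \<times> nat \<times> nat) list \<Rightarrow> token list" where
  "item_tokens c = concat (map (\<lambda>v. Lit True # var_tokens v) c)"

lemma tokens_string_items: "tokens_string t j (item_tokens c) = items (instantiate cell_var t j c)"
  unfolding item_tokens_def tokens_string_concat items_def instantiate_def
  by (induction c) (auto simp: tokens_string_var simp del: var_tokens.simps)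

definition constraint_tokens :: "(nat \<times> nat \<times> nat) list list \<Rightarrow> token list" where
  "constraint_tokens cs = concat (map (\<lambda>c. Lit True # item_tokens c @ [Lit False]) cs)"

lemma tokens_string_constraints:
  "tokens_string t j (constraint_tokens cs) = citems (map (instantiate cell_var t j) cs)"
  unfolding constraint_tokens_def tokens_string_concat citems_def
  by (induction cs) (auto simp: tokens_string_items)

lemma items_concat: "items (concat xss) = concat (map items xss)"
  by (induction xss) (auto simp: items_def)

lemma citems_concat: "citems (concat xss) = concat (map citems xss)"
  by (induction xss) (auto simp: citems_def)

lemma instantiate_map: "map a (instantiate \<sigma> t j c) = instantiate (\<lambda>t j x. a (\<sigma> t j x)) t j c"
  by (simp add: instantiate_def split_beta)

lemma placements_range:
  assumes "(k, t, j) \<in> set (placements x P T Z)" shows "k < 9"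
  using assms unfolding placements_def
  by (simp only: set_append set_map set_concat Un_iff) (elim disjE; auto simp: of_bool_def)

theorem CSP_NP_hard:
  assumes L: "L \<in> NP" and R: "R \<subseteq> nlists n V" and n: "2 \<le> n"
    and E: "nonbipartite_graph ((\<lambda>r. (r ! 0, r ! 1)) ` R)"
  shows "polytime_reducible L (CSP V n R)"
proof -
  obtain G :: "tile set" and B pP pT pZ where G: "finite G" "G \<noteq> {}" and B: "\<And>r. B r \<subseteq> nlists 4 G"
    and L: "\<And>x. x \<in> L \<longleftrightarrow> (\<exists>\<tau>. (\<forall>t j. \<tau> t j \<in> G) \<and>
      (\<forall>(r, t, j) \<in> set (placements x (poly pP (length x)) (poly pT (length x)) (poly pZ (length x))).
        [\<tau> t j, \<tau> t (j + 1), \<tau> t (j + 2), \<tau> (t + 1) (j + 1)] \<in> B r))"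
    using NP_tiling[OF L] by (elim exE conjE) (rule that, assumption, assumption, erule spec, erule spec)
  \<comment> \<open>The bound 9 is the number of kinds of templates in
    \<open>placements\<close>.\<close>
  obtain tm :: "nat \<Rightarrow> (nat \<times> nat \<times> nat) list list"
    where tm: "\<And>k c. c \<in> set (tm k) \<Longrightarrow> length c = n"
      and eq: "\<And>Q. \<forall>(k, t, j) \<in> Q. k < 9 \<Longrightarrow>
       (\<exists>\<tau>. (\<forall>t j. \<tau> t j \<in> G) \<and> (\<forall>(k, t, j) \<in> Q. block \<tau> t j \<in> B k)) \<longleftrightarrow>
        (\<exists>\<sigma>. \<forall>(k, t, j) \<in> Q. \<forall>c \<in> set (tm k). instantiate \<sigma> t j c \<in> R)"
    using gadget[OF R n E G, of 9 B, OF B]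
    by (elim exE conjE) (rule that, drule spec, drule (1) bspec, assumption, drule spec, drule (1) mp, assumption)
  define pl where "pl x = placements x (poly pP (length x)) (poly pT (length x)) (poly pZ (length x))" for x
  have Q: "\<forall>(k, t, j) \<in> set (pl x). k < 9" for x using placements_range unfolding pl_def by blast
  have L': "x \<in> L \<longleftrightarrow> (\<exists>\<sigma>. \<forall>(k, t, j) \<in> set (pl x). \<forall>c \<in> set (tm k). instantiate \<sigma> t j c \<in> R)" for x
    using trans[OF L eq[OF Q[of x, unfolded pl_def], unfolded block_eq]] unfolding pl_def .
  \<comment> \<open>Lists exactly the variables that occur in the constraints, with repetitions.
    Hence an assignment that satisfies the constraints automatically maps all of them into
    \<open>V\<close>.\<close>
  define us where "us x = concat (map (\<lambda>(k, t, j). instantiate cell_var t j (concat (tm k))) (pl x))" for x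
  define cs where "cs x = concat (map (\<lambda>(k, t, j). map (instantiate cell_var t j) (tm k)) (pl x))" for x
  define f where "f x = encode_list encode_var (us x) @ encode_list (encode_list encode_var) (cs x)" for x
  have "items (us x) = grid_string (\<lambda>k. item_tokens (concat (tm k))) (pl x)" for x
    unfolding us_def items_concat grid_string_def by (auto simp: tokens_string_items intro!: arg_cong[where f = concat])
  moreover have "citems (cs x) = grid_string (\<lambda>k. constraint_tokens (tm k)) (pl x)" for x
    unfolding cs_def citems_concat grid_string_def by (auto simp: tokens_string_constraints intro!: arg_cong[where f = concat])
  ultimately have "f x = grid_string (\<lambda>k. item_tokens (concat (tm k))) (pl x) @ [False] @
      grid_string (\<lambda>k. constraint_tokens (tm k)) (pl x) @ [False]" for x
    by (simp add: f_def encode_list_items encode_list_citems)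
  then have feq: "f = (\<lambda>x. let pl = placements x (poly pP (length x)) (poly pT (length x)) (poly pZ (length x))
     in grid_string (\<lambda>k. item_tokens (concat (tm k))) pl @ [False] @ grid_string (\<lambda>k. constraint_tokens (tm k)) pl @ [False])"
    unfolding Let_def pl_def by (rule ext)
  have f: "polytime f" unfolding feq by (rule polytime_grid)
  have mem: "v \<in> set (us x) \<longleftrightarrow> (\<exists>c \<in> set (cs x). v \<in> set c)" for x v
    unfolding us_def cs_def by (auto simp: instantiate_def split_beta)
  have csI: "c \<in> set (cs x) \<longleftrightarrow> (\<exists>(k, t, j) \<in> set (pl x). \<exists>d \<in> set (tm k). c = instantiate cell_var t j d)" for c x
    unfolding cs_def by (auto simp: split_beta)
  have inst: "(set (us x), set (cs x)) \<in> csp_instances n" for x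
  proof -
    have "c \<in> nlists n (set (us x))" if "c \<in> set (cs x)" for c
    proof (rule nlistsI)
      show "length c = n" using that tm unfolding csI by (auto simp: instantiate_def)
      show "set c \<subseteq> set (us x)" using that by (auto simp: mem)
    qed
    then show ?thesis by (auto simp: csp_instances_def)
  qed
  have sat: "csp_satisfiable V R (set (us x), set (cs x)) \<longleftrightarrow> x \<in> L" for x
  proof
    assume "csp_satisfiable V R (set (us x), set (cs x))"
    then obtain a where a: "\<And>c. c \<in> set (cs x) \<Longrightarrow> map a c \<in> R" by (auto simp: csp_satisfiable_def)
    have "instantiate (\<lambda>t j v. a (cell_var t j v)) t j c \<in> R" if "(k, t, j) \<in> set (pl x)" "c \<in> set (tm k)" for k t j c
    proof -
      have "instantiate cell_var t j c \<in> set (cs x)" unfolding csI using that by blast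
      from a[OF this] show ?thesis by (simp only: instantiate_map)
    qed
    then show "x \<in> L" unfolding L' by (intro exI[of _ "\<lambda>t j v. a (cell_var t j v)"]) blast
  next
    assume "x \<in> L"
    then obtain \<sigma> where \<sigma>: "\<And>k t j c. (k, t, j) \<in> set (pl x) \<Longrightarrow> c \<in> set (tm k) \<Longrightarrow> instantiate \<sigma> t j c \<in> R"
      unfolding L' by blast
    define cv where "cv = (\<lambda>(t, j, a). cell_var t j a)"
    have "inj cv" unfolding cv_def by (rule injI) (auto dest!: cell_var_inject)
    define a where "a v = (case the_inv cv v of (t, j, v) \<Rightarrow> \<sigma> t j v)" for v
    have a: "a (cell_var t j v) = \<sigma> t j v" for t j v
    proof -
      have "the_inv cv (cv (t, j, v)) = (t, j, v)" by (rule the_inv_f_f[OF \<open>inj cv\<close>])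
      then show ?thesis by (simp add: a_def cv_def)
    qed
    have m: "map a c \<in> R" if cc: "c \<in> set (cs x)" for c
    proof -
      obtain k t j d where "(k, t, j) \<in> set (pl x)" "d \<in> set (tm k)" "c = instantiate cell_var t j d"
        using cc unfolding csI by blast
      then show ?thesis using \<sigma> by (simp add: instantiate_map a)
    qed
    have "a v \<in> V" if vv: "v \<in> set (us x)" for v
    proof -
      obtain c where c: "c \<in> set (cs x)" "v \<in> set c" using vv unfolding mem by blast
      have "map a c \<in> nlists n V" using m[OF c(1)] R by (rule rev_subsetD)
      then have "set (map a c) \<subseteq> V" by (rule nlistsE_set)
      then show ?thesis using c(2) by auto
    qed
    then show "csp_satisfiable V R (set (us x), set (cs x))"
      using m by (auto simp: csp_satisfiable_def)
  qed
  have enc: "f x \<in> csp_encodings (set (us x), set (cs x))" for x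
    unfolding csp_encodings_def f_def by blast
  show ?thesis
    unfolding polytime_reducible_def CSP_def prod.case
  proof (intro exI[of _ f] conjI allI impI f)
    fix x assume "x \<in> L"
    then show "f x \<in> (\<Union>I \<in> {I \<in> csp_instances n. csp_satisfiable V R I}. csp_encodings I)"
      using inst[of x] sat[of x] enc[of x] by blast
  next
    fix x assume "x \<notin> L"
    then show "f x \<in> (\<Union>I \<in> {I \<in> csp_instances n. \<not> csp_satisfiable V R I}. csp_encodings I)"
      using inst[of x] sat[of x] enc[of x] by blast
  qed
qed

section \<open>The dichotomy\<close>

theorem theorem3p8:
  fixes H :: "'v pair_pre_digraph" and n :: nat
  assumes "pair_graph H" and "n \<ge> 1"
  shows "((\<exists>R. R \<subseteq> nlists n (pverts H) \<and> R \<noteq> {} \<and>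
              pPol (pverts H) 2 (edge_relation H) \<subset> pPol (pverts H) n R \<and>
              NP_complete (CSP (pverts H) n R))
            \<longleftrightarrow> odd_girth H \<le> enat n)
         \<and> (odd_girth H > enat n \<longrightarrow>
             (\<forall>R. R \<subseteq> nlists n (pverts H) \<and> R \<noteq> {} \<and>
                  pPol (pverts H) 2 (edge_relation H) \<subset> pPol (pverts H) n R
               \<longrightarrow> csp_trivial (pverts H) n R))"
proof (intro conjI iffI impI allI)
  show "csp_trivial (pverts H) n R"
    if "odd_girth H > enat n" "R \<subseteq> nlists n (pverts H) \<and> R \<noteq> {} \<and>
      pPol (pverts H) 2 (edge_relation H) \<subset> pPol (pverts H) n R" for R
    using that by (intro large_odd_girth_trivial[OF assms]) simp_all
  \<comment> \<open>By contraposition: if the odd girth exceeds \<open>n\<close>, the problem is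
    trivial and so not NP-complete.\<close>
  then show "odd_girth H \<le> enat n"
    if "\<exists>R. R \<subseteq> nlists n (pverts H) \<and> R \<noteq> {} \<and> pPol (pverts H) 2 (edge_relation H) \<subset> pPol (pverts H) n R \<and>
      NP_complete (CSP (pverts H) n R)"
    using that trivial_not_NP_complete by (meson not_le)
next
  assume "odd_girth H \<le> enat n"
  then obtain c where c: "induced_cycle H c" "odd (length c)" "length c \<le> n"
    using odd_girth_le[OF assms(1)] by blast
  let ?k = "length c"
  let ?R = "closed_walks H n ?k"
  have k: "3 \<le> ?k" using c(1) by (simp add: induced_cycle_def)
  note ne = closed_walks_nonempty[OF c(1,3)]
  have R: "?R \<subseteq> nlists n (pverts H)" by (auto simp: closed_walks_def)
  have lt: "0 < ?k" "1 < ?k" "1 = Suc 0 mod ?k" using k by auto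
  then have "(c ! 0, c ! 1) \<in> parcs H" using c(1) unfolding induced_cycle_def by blast
  then have "pPol (pverts H) 2 (edge_relation H) \<subset> pPol (pverts H) n ?R"
    using closed_walks_pPol[OF lt(1) c(3)] closed_walks_pPol_strict[OF assms(1) c(2,3)] by blast
  moreover have "NP_complete (CSP (pverts H) n ?R)"
    unfolding NP_complete_def
    using CSP_in_NP[OF pair_graph_facts(1)[OF assms(1)] R]
      CSP_NP_hard[OF _ R _ closed_walks_nonbipartite[OF assms(1) c(2) k c(3) ne]] k c(3) by simp
  ultimately show "\<exists>R. R \<subseteq> nlists n (pverts H) \<and> R \<noteq> {} \<and>
      pPol (pverts H) 2 (edge_relation H) \<subset> pPol (pverts H) n R \<and> NP_complete (CSP (pverts H) n R)"
    using R ne by (intro exI[of _ ?R] conjI) auto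
qed

end
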